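(* Let $\gamma>0$, let $$X=\Big\{u:\mathbb{R}^2\to\mathbb{C}:\ \int_{\mathbb{R}^2}\big(|\nabla u|^2+|u|^2+\ln(1+|x|)\,|u|^2\big)\,dx<\infty\Big\},$$ and for $u\in X$ let $$E(u)=\int_{\mathbb{R}^2}|\nabla u|^2\,dx+\frac{\gamma}{4\pi}\int_{\mathbb{R}^2}\int_{\mathbb{R}^2}\ln(|x-y|)\,|u(x)|^2|u(y)|^2\,dx\,dy,\qquad N(u)=\int_{\mathbb{R}^2}|u|^2\,dx,$$ and $e_0(\lambda)=\inf\{E(u):u\in X,\ N(u)=\lambda\}$. Then for every $\lambda>0$ there exists a spherically symmetric decreasing function $u_\lambda\in X$ such that $N(u_\lambda)=\lambda$ and $E(u_\lambda)=e_0(\lambda)$.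
   Context: $\gamma>0$ is a fixed coupling constant. *)

theory Defs
  imports "HOL-Analysis.Analysis"
begin

text \<open>Smooth (C-infinity) real functions on the plane: all iterated partial derivatives
  exist everywhere and are continuous.\<close>
definition smooth_fun :: "(real^2 \<Rightarrow> real) \<Rightarrow> bool" where
  "smooth_fun \<phi> \<longleftrightarrow>
     (\<exists>S. \<phi> \<in> S \<and>
        (\<forall>g\<in>S. continuous_on UNIV g \<and>
           (\<forall>i::2. \<exists>h\<in>S. \<forall>x. ((\<lambda>t. g (x + t *\<^sub>R axis i 1)) has_real_derivative h x) (at 0))))"

definition test_fun :: "(real^2 \<Rightarrow> real) \<Rightarrow> bool" where
  "test_fun \<phi> \<longleftrightarrow> smooth_fun \<phi> \<and> compact (closure {x. \<phi> x \<noteq> 0})"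

definition weak_partial :: "(real^2 \<Rightarrow> complex) \<Rightarrow> 2 \<Rightarrow> (real^2 \<Rightarrow> complex) \<Rightarrow> bool" where
  "weak_partial u i g \<longleftrightarrow>
     (\<forall>\<phi> d\<phi>. test_fun \<phi> \<and>
        (\<forall>x. ((\<lambda>t. \<phi> (x + t *\<^sub>R axis i 1)) has_real_derivative d\<phi> x) (at 0)) \<longrightarrow>
        (\<integral>x. complex_of_real (d\<phi> x) * u x \<partial>lborel) = - (\<integral>x. complex_of_real (\<phi> x) * g x \<partial>lborel))"

definition X_space :: "(real^2 \<Rightarrow> complex) set" where
  "X_space = {u. u \<in> borel_measurable lborel \<and>
     (\<exists>g1 g2. g1 \<in> borel_measurable lborel \<and> g2 \<in> borel_measurable lborel \<and>
        weak_partial u 1 g1 \<and> weak_partial u 2 g2 \<and>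
        (\<integral>\<^sup>+x. ennreal ((cmod (g1 x))\<^sup>2 + (cmod (g2 x))\<^sup>2 + (cmod (u x))\<^sup>2
                 + ln (1 + norm x) * (cmod (u x))\<^sup>2) \<partial>lborel) < \<infinity>)}"

text \<open>Dirichlet energy: integral of |grad u|^2 for the (a.e. unique) weak gradient.\<close>
definition dirichlet :: "(real^2 \<Rightarrow> complex) \<Rightarrow> real" where
  "dirichlet u = (SOME D. \<exists>g1 g2. g1 \<in> borel_measurable lborel \<and> g2 \<in> borel_measurable lborel \<and>
        weak_partial u 1 g1 \<and> weak_partial u 2 g2 \<and>
        D = (\<integral>x. (cmod (g1 x))\<^sup>2 + (cmod (g2 x))\<^sup>2 \<partial>lborel))"

definition mass :: "(real^2 \<Rightarrow> complex) \<Rightarrow> real" where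
  "mass u = (\<integral>x. (cmod (u x))\<^sup>2 \<partial>lborel)"

definition energy :: "real \<Rightarrow> (real^2 \<Rightarrow> complex) \<Rightarrow> real" where
  "energy \<gamma> u = dirichlet u + \<gamma> / (4 * pi) *
     (\<integral>y. (\<integral>x. ln (dist x y) * (cmod (u x))\<^sup>2 * (cmod (u y))\<^sup>2 \<partial>lborel) \<partial>lborel)"

definition e0 :: "real \<Rightarrow> real \<Rightarrow> ereal" where
  "e0 \<gamma> lam = (INF u \<in> {u \<in> X_space. mass u = lam}. ereal (energy \<gamma> u))"

definition sym_decreasing :: "(real^2 \<Rightarrow> complex) \<Rightarrow> bool" where
  "sym_decreasing u \<longleftrightarrow>
     (\<exists>f :: real \<Rightarrow> real. (\<forall>x. u x = complex_of_real (f (norm x))) \<and>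
        (\<forall>r s. 0 \<le> r \<and> r \<le> s \<longrightarrow> f s \<le> f r))"

end

theory Submission
  imports Defs "HOL-Complex_Analysis.Great_Picard"
begin

text \<open>
  The Dirichlet energy of \<open>u\<close> is the limit of the normalised difference energies, the integrals of
  \<open>|u(x + h) - u(x)|\<^sup>2\<close> over all \<open>x\<close> and over \<open>h\<close> in a small disc. Hence passing to \<open>|u|\<close>, to limits,
  to truncations and to polarisations is controlled by pointwise inequalities between differences.

  Existence: after translation, the growth of the logarithm makes a minimising sequence tight, disc
  averages make it compact in \<open>L\<^sup>2\<close>, and the energy is lower semicontinuous.

  Symmetry: polarising a nonnegative minimiser \<open>v\<close> in a line does not raise the Dirichlet energy, and
  it strictly lowers the logarithmic energy unless \<open>v\<close> dominates its reflection on one side of the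
  line, because \<open>ln\<close> is strictly increasing. The lines bisecting the mass in two orthogonal
  directions meet in a centre; with respect to it \<open>v\<close> is almost everywhere a decreasing
  function \<open>f\<close> of the radius.

  The value at the centre must be finite. Comparing \<open>v\<close> with its truncation at height \<open>f(R)\<close> gives
  \<open>f(R/2) \<le> (1 + C R\<^sup>2) f(R)\<close> for small \<open>R\<close>, and iterating this along \<open>R, R/2, R/4, \<dots>\<close> bounds \<open>f\<close>.
\<close>

subsection \<open>Square-integrable functions\<close>

definition L2 :: "'a measure \<Rightarrow> ('a \<Rightarrow> 'b::euclidean_space) \<Rightarrow> bool" where
  "L2 M f \<longleftrightarrow> f \<in> borel_measurable M \<and> integrable M (\<lambda>x. (norm (f x))\<^sup>2)"

definition sqnorm :: "'a measure \<Rightarrow> ('a \<Rightarrow> 'b::euclidean_space) \<Rightarrow> real" where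
  "sqnorm M f = (\<integral>x. (norm (f x))\<^sup>2 \<partial>M)"

lemma L2_measurable [measurable_dest]: "L2 M f \<Longrightarrow> f \<in> borel_measurable M"
  by (simp add: L2_def)

lemma L2_integrable: "L2 M f \<Longrightarrow> integrable M (\<lambda>x. (norm (f x))\<^sup>2)"
  by (simp add: L2_def)

lemma sqnorm_nonneg: "0 \<le> sqnorm M f"
  by (simp add: sqnorm_def)

lemma nn_integral_norm_sq: "L2 M f \<Longrightarrow> (\<integral>\<^sup>+x. ennreal ((norm (f x))\<^sup>2) \<partial>M) = ennreal (sqnorm M f)"
  unfolding sqnorm_def by (intro nn_integral_eq_integral) (auto simp: L2_def)

lemma L2_nn_integralI:
  assumes "f \<in> borel_measurable M" "(\<integral>\<^sup>+x. ennreal ((norm (f x))\<^sup>2) \<partial>M) \<le> ennreal C" "0 \<le> C"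
  shows "L2 M f" "sqnorm M f \<le> C"
proof -
  have "(\<integral>\<^sup>+x. ennreal ((norm (f x))\<^sup>2) \<partial>M) < \<infinity>"
    using assms(2) by (simp add: le_less_trans)
  then show "L2 M f"
    using assms(1) unfolding L2_def by (auto intro!: integrableI_bounded)
  from nn_integral_norm_sq[OF this] assms show "sqnorm M f \<le> C"
    by (simp add: sqnorm_nonneg)
qed

lemma norm_add_sq_le: "(norm (x + y))\<^sup>2 \<le> 2 * (norm x)\<^sup>2 + 2 * (norm (y::'b::real_inner))\<^sup>2"
proof -
  have "0 \<le> (norm (x - y))\<^sup>2" by simp
  then show ?thesis by (simp add: power2_norm_eq_inner inner_simps inner_commute)
qed

lemma L2_bound:
  assumes "L2 M g" "f \<in> borel_measurable M" "AE x in M. norm (f x) \<le> norm (g x)"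
  shows "L2 M f"
  unfolding L2_def
proof (intro conjI assms(2) Bochner_Integration.integrable_bound[OF L2_integrable[OF assms(1)]])
  show "AE x in M. norm ((norm (f x))\<^sup>2) \<le> norm ((norm (g x))\<^sup>2)"
    using assms(3) by eventually_elim (simp add: power_mono)
qed (use assms(2) in measurable)

lemma L2_add: assumes "L2 M f" "L2 M g" shows "L2 M (\<lambda>x. f x + g x)"
proof -
  have "integrable M (\<lambda>x. (norm (f x + g x))\<^sup>2)"
  proof (rule Bochner_Integration.integrable_bound)
    show "integrable M (\<lambda>x. 2 * (norm (f x))\<^sup>2 + 2 * (norm (g x))\<^sup>2)"
      using assms by (simp add: L2_def)
    show "(\<lambda>x. (norm (f x + g x))\<^sup>2) \<in> borel_measurable M"
      using assms[THEN L2_measurable] by measurable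
    show "AE x in M. norm ((norm (f x + g x))\<^sup>2) \<le> norm (2 * (norm (f x))\<^sup>2 + 2 * (norm (g x))\<^sup>2)"
      using norm_add_sq_le[of "f _" "g _"] by (intro AE_I2) (simp add: abs_of_nonneg)
  qed
  then show ?thesis using assms unfolding L2_def by auto
qed

lemma L2_scaleR: "L2 M f \<Longrightarrow> L2 M (\<lambda>x. c *\<^sub>R f x)"
  by (auto simp: L2_def power_mult_distrib)

lemma sqnorm_scaleR: "sqnorm M (\<lambda>x. c *\<^sub>R f x) = c\<^sup>2 * sqnorm M f"
  by (simp add: sqnorm_def power_mult_distrib)

lemma L2_diff: "L2 M f \<Longrightarrow> L2 M g \<Longrightarrow> L2 M (\<lambda>x. f x - g x)"
  using L2_add[of M f "\<lambda>x. -1 *\<^sub>R g x"] L2_scaleR[of M g "-1"] by simp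

lemma sqnorm_minus_commute: "sqnorm M (\<lambda>x. f x - g x) = sqnorm M (\<lambda>x. g x - f x)"
  by (simp add: sqnorm_def norm_minus_commute)

lemma sqnorm_add_le:
  assumes "L2 M f" "L2 M g" shows "sqnorm M (\<lambda>x. f x + g x) \<le> 2 * sqnorm M f + 2 * sqnorm M g"
proof -
  have "sqnorm M (\<lambda>x. f x + g x) \<le> (\<integral>x. 2 * (norm (f x))\<^sup>2 + 2 * (norm (g x))\<^sup>2 \<partial>M)"
    unfolding sqnorm_def using assms L2_add[OF assms] norm_add_sq_le
    by (intro integral_mono) (auto simp: L2_def)
  also have "\<dots> = 2 * sqnorm M f + 2 * sqnorm M g"
    using assms by (simp add: sqnorm_def L2_def)
  finally show ?thesis .
qed

lemma sqnorm_cong_AE: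
  assumes "f \<in> borel_measurable M" "g \<in> borel_measurable M" "AE x in M. f x = g x"
  shows "sqnorm M f = sqnorm M g"
  unfolding sqnorm_def using assms by (intro integral_cong_AE) auto

lemma sqnorm_eq_0_iff:
  assumes "L2 M f" shows "sqnorm M f = 0 \<longleftrightarrow> (AE x in M. f x = 0)"
  using integral_nonneg_eq_0_iff_AE[OF L2_integrable[OF assms]] by (simp add: sqnorm_def)

lemma L2_of_real: "L2 M v \<Longrightarrow> L2 M (\<lambda>x. complex_of_real (v x))"
  by (auto simp: L2_def)

lemma sqnorm_of_real: "sqnorm M (\<lambda>x. complex_of_real (v x)) = sqnorm M v"
  by (simp add: sqnorm_def)

lemma L2_vec_nth:
  fixes g :: "'a \<Rightarrow> real ^ 'n"
  assumes "L2 M g" shows "L2 M (\<lambda>x. g x $ i)"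
proof (rule L2_bound[OF assms])
  show "(\<lambda>x. g x $ i) \<in> borel_measurable M"
    by (rule measurable_compose[OF L2_measurable[OF assms] borel_measurable_continuous_onI])
      (intro continuous_intros)
  show "AE x in M. norm (g x $ i) \<le> norm (g x)"
    by (intro AE_I2 Finite_Cartesian_Product.norm_nth_le)
qed

lemma sqnorm_vec_eq_sum:
  fixes g :: "'a \<Rightarrow> real ^ 'n"
  assumes "L2 M g" shows "sqnorm M g = (\<Sum>i\<in>UNIV. sqnorm M (\<lambda>x. g x $ i))"
proof -
  have "(norm z)\<^sup>2 = (\<Sum>i\<in>UNIV. (norm (z $ i))\<^sup>2)" for z :: "real ^ 'n"
    by (simp add: norm_vec_def L2_set_def sum_nonneg)
  then show ?thesis
    unfolding sqnorm_def using L2_integrable[OF L2_vec_nth[OF assms]]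
    by (simp add: Bochner_Integration.integral_sum)
qed

lemma L2_inner_integrable:
  assumes "L2 M f" "L2 M g" shows "integrable M (\<lambda>x. f x \<bullet> g x)"
proof (rule Bochner_Integration.integrable_bound)
  show "integrable M (\<lambda>x. (norm (f x))\<^sup>2 + (norm (g x))\<^sup>2)"
    using assms by (simp add: L2_def)
  show "(\<lambda>x. f x \<bullet> g x) \<in> borel_measurable M"
    using assms[THEN L2_measurable] by measurable
  show "AE x in M. norm (f x \<bullet> g x) \<le> norm ((norm (f x))\<^sup>2 + (norm (g x))\<^sup>2)"
  proof (intro AE_I2)
    fix x
    have "\<bar>f x \<bullet> g x\<bar> \<le> norm (f x) * norm (g x)" by (rule Cauchy_Schwarz_ineq2)
    also have "\<dots> \<le> (norm (f x))\<^sup>2 + (norm (g x))\<^sup>2"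
      using sum_squares_bound[of "norm (f x)" "norm (g x)"]
        mult_nonneg_nonneg[OF norm_ge_zero[of "f x"] norm_ge_zero[of "g x"]] by linarith
    finally show "norm (f x \<bullet> g x) \<le> norm ((norm (f x))\<^sup>2 + (norm (g x))\<^sup>2)" by simp
  qed
qed

lemma sqnorm_add:
  assumes "L2 M f" "L2 M g"
  shows "sqnorm M (\<lambda>x. f x + g x) = sqnorm M f + 2 * (\<integral>x. f x \<bullet> g x \<partial>M) + sqnorm M g"
proof -
  have "sqnorm M (\<lambda>x. f x + g x) = (\<integral>x. (norm (f x))\<^sup>2 + 2 * (f x \<bullet> g x) + (norm (g x))\<^sup>2 \<partial>M)"
    unfolding sqnorm_def
    by (intro Bochner_Integration.integral_cong) (auto simp: power2_norm_eq_inner inner_simps inner_commute)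
  then show ?thesis
    using assms L2_inner_integrable[OF assms] by (simp add: sqnorm_def L2_def)
qed

lemma sqnorm_diff:
  assumes "L2 M f" "L2 M g"
  shows "sqnorm M (\<lambda>x. f x - g x) = sqnorm M f - 2 * (\<integral>x. f x \<bullet> g x \<partial>M) + sqnorm M g"
  using sqnorm_add[OF assms(1) L2_scaleR[OF assms(2), of "-1"]] sqnorm_scaleR[of M "-1" g] by simp

lemma norm_integral_product_sq_le:
  fixes f :: "'a \<Rightarrow> 'b::real_normed_vector" and g :: "'a \<Rightarrow> 'c::real_normed_vector"
    and h :: "'a \<Rightarrow> 'd::{banach,second_countable_topology}"
  assumes [measurable]: "(\<lambda>x. norm (f x)) \<in> borel_measurable M" "(\<lambda>x. norm (g x)) \<in> borel_measurable M"
    and product_bound: "\<And>x. norm (h x) \<le> norm (f x) * norm (g x)"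
  shows "ennreal ((norm (\<integral>x. h x \<partial>M))\<^sup>2)
    \<le> (\<integral>\<^sup>+x. ennreal ((norm (f x))\<^sup>2) \<partial>M) * (\<integral>\<^sup>+x. ennreal ((norm (g x))\<^sup>2) \<partial>M)"
proof (cases "integrable M h")
  case True
  have "ennreal ((norm (\<integral>x. h x \<partial>M))\<^sup>2) = (ennreal (norm (\<integral>x. h x \<partial>M)))\<^sup>2"
    by (simp add: ennreal_power)
  also have "\<dots> \<le> (\<integral>\<^sup>+x. ennreal (norm (h x)) \<partial>M)\<^sup>2"
    by (intro power_mono integral_norm_bound_ennreal True) simp
  also have "\<dots> \<le> (\<integral>\<^sup>+x. ennreal (norm (f x)) * ennreal (norm (g x)) \<partial>M)\<^sup>2"
    using product_bound by (intro power_mono nn_integral_mono) (auto simp flip: ennreal_mult)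
  also have "\<dots> \<le> (\<integral>\<^sup>+x. (ennreal (norm (f x)))\<^sup>2 \<partial>M) * (\<integral>\<^sup>+x. (ennreal (norm (g x)))\<^sup>2 \<partial>M)"
    by (rule Cauchy_Schwarz_nn_integral) measurable
  finally show ?thesis by (simp add: ennreal_power)
qed (simp add: not_integrable_integral_eq)

lemma L2_Cauchy_Schwarz:
  assumes "L2 M f" "L2 M g"
  shows "\<bar>\<integral>x. f x \<bullet> g x \<partial>M\<bar> \<le> sqrt (sqnorm M f) * sqrt (sqnorm M g)"
proof -
  have "ennreal ((norm (\<integral>x. f x \<bullet> g x \<partial>M))\<^sup>2)
      \<le> (\<integral>\<^sup>+x. ennreal ((norm (f x))\<^sup>2) \<partial>M) * (\<integral>\<^sup>+x. ennreal ((norm (g x))\<^sup>2) \<partial>M)"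
    using assms Cauchy_Schwarz_ineq2 by (intro norm_integral_product_sq_le) auto
  then have "(\<integral>x. f x \<bullet> g x \<partial>M)\<^sup>2 \<le> sqnorm M f * sqnorm M g"
    by (simp add: nn_integral_norm_sq assms sqnorm_nonneg flip: ennreal_mult)
  then have "sqrt ((\<integral>x. f x \<bullet> g x \<partial>M)\<^sup>2) \<le> sqrt (sqnorm M f * sqnorm M g)"
    by (rule real_sqrt_le_mono)
  then show ?thesis by (simp add: real_sqrt_mult)
qed

lemma L2_nn_integral_mult_le:
  assumes "L2 M f" "L2 M g"
  shows "(\<integral>\<^sup>+x. ennreal (norm (f x) * norm (g x)) \<partial>M) \<le> ennreal (sqrt (sqnorm M f) * sqrt (sqnorm M g))"
proof -
  have L: "L2 M (\<lambda>x. norm (f x))" "L2 M (\<lambda>x. norm (g x))" using assms by (auto simp: L2_def)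
  have "(\<integral>\<^sup>+x. ennreal (norm (f x) * norm (g x)) \<partial>M) = ennreal (\<integral>x. norm (f x) \<bullet> norm (g x) \<partial>M)"
    using L2_inner_integrable[OF L] by (subst nn_integral_eq_integral) auto
  also have "\<dots> \<le> ennreal (sqrt (sqnorm M f) * sqrt (sqnorm M g))"
    using L2_Cauchy_Schwarz[OF L] by (intro ennreal_leI) (simp add: sqnorm_def)
  finally show ?thesis .
qed

lemma sqnorm_parallelogram:
  assumes "L2 M f" "L2 M g"
  shows "sqnorm M (\<lambda>x. f x - g x)
     = 2 * sqnorm M f + 2 * sqnorm M g - 4 * sqnorm M (\<lambda>x. (1/2) *\<^sub>R (f x + g x))"
  unfolding sqnorm_scaleR sqnorm_diff[OF assms] sqnorm_add[OF assms]
  by (simp add: power2_eq_square field_simps)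

lemma nn_integral_le_liminf_AE:
  assumes [measurable]: "\<And>n. f n \<in> borel_measurable M"
    and lim: "AE x in M. (\<lambda>n. f n x) \<longlonglongrightarrow> (g x :: ennreal)"
  shows "(\<integral>\<^sup>+x. g x \<partial>M) \<le> liminf (\<lambda>n. \<integral>\<^sup>+x. f n x \<partial>M)"
proof -
  have "(\<integral>\<^sup>+x. g x \<partial>M) = (\<integral>\<^sup>+x. liminf (\<lambda>n. f n x) \<partial>M)"
    by (rule nn_integral_cong_AE, use lim in eventually_elim) (metis lim_imp_Liminf sequentially_bot)
  also have "\<dots> \<le> liminf (\<lambda>n. \<integral>\<^sup>+x. f n x \<partial>M)" by (rule nn_integral_liminf) measurable
  finally show ?thesis .
qed

lemma L2_AE_limit:
  fixes f :: "nat \<Rightarrow> 'a \<Rightarrow> 'b::euclidean_space"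
  assumes f: "\<And>n. L2 M (f n)" and g [measurable]: "g \<in> borel_measurable M"
    and lim: "AE x in M. (\<lambda>n. f n x) \<longlonglongrightarrow> g x"
    and C: "\<forall>\<^sub>F n in sequentially. sqnorm M (f n) \<le> C" "0 \<le> C"
  shows "L2 M g" "sqnorm M g \<le> C"
proof -
  have [measurable]: "f n \<in> borel_measurable M" for n using f by (rule L2_measurable)
  have "(\<integral>\<^sup>+x. ennreal ((norm (g x))\<^sup>2) \<partial>M) \<le> liminf (\<lambda>n. \<integral>\<^sup>+x. ennreal ((norm (f n x))\<^sup>2) \<partial>M)"
  proof (rule nn_integral_le_liminf_AE)
    show "AE x in M. (\<lambda>n. ennreal ((norm (f n x))\<^sup>2)) \<longlonglongrightarrow> ennreal ((norm (g x))\<^sup>2)"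
      using lim by eventually_elim (intro tendsto_ennrealI tendsto_intros)
  qed measurable
  also have "\<dots> = liminf (\<lambda>n. ennreal (sqnorm M (f n)))" by (simp add: nn_integral_norm_sq[OF f])
  also have "\<dots> \<le> ennreal C"
    by (rule Liminf_le) (use C(1) in \<open>auto elim!: eventually_mono intro: ennreal_leI\<close>)
  finally show "L2 M g" "sqnorm M g \<le> C"
    using C(2) by (auto intro!: L2_nn_integralI)
qed

lemma L2_AE_subseq:
  assumes "\<And>n. L2 M (h n)" "L2 M f" "(\<lambda>n. sqnorm M (\<lambda>x. h n x - f x)) \<longlonglongrightarrow> 0"
  shows "\<exists>r. strict_mono r \<and> (AE x in M. (\<lambda>n. h (r n) x) \<longlonglongrightarrow> f x)"
proof -
  have "\<exists>r::nat\<Rightarrow>nat. strict_mono r \<and> (AE x in M. (\<lambda>n. (norm (h (r n) x - f x))\<^sup>2) \<longlonglongrightarrow> 0)"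
  proof (rule tendsto_L1_AE_subseq)
    show "integrable M (\<lambda>x. (norm (h n x - f x))\<^sup>2)" for n
      using L2_diff[OF assms(1,2)] by (simp add: L2_def)
    show "(\<lambda>n. \<integral>x. norm ((norm (h n x - f x))\<^sup>2) \<partial>M) \<longlonglongrightarrow> 0"
      using assms(3) by (simp add: sqnorm_def)
  qed
  then obtain r :: "nat \<Rightarrow> nat" where r: "strict_mono r"
    "AE x in M. (\<lambda>n. (norm (h (r n) x - f x))\<^sup>2) \<longlonglongrightarrow> 0" by blast
  from r(2) have "AE x in M. (\<lambda>n. h (r n) x) \<longlonglongrightarrow> f x"
  proof eventually_elim
    case (elim x)
    from tendsto_real_sqrt[OF this] have "(\<lambda>n. norm (h (r n) x - f x)) \<longlonglongrightarrow> 0" by simp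
    then show ?case by (simp add: LIM_zero_cancel tendsto_norm_zero_iff)
  qed
  with r(1) show ?thesis by blast
qed

subsection \<open>Completeness and weak compactness of \<open>L\<^sup>2\<close>\<close>

definition L2_Cauchy :: "'a measure \<Rightarrow> (nat \<Rightarrow> 'a \<Rightarrow> 'b::euclidean_space) \<Rightarrow> bool" where
  "L2_Cauchy M h \<longleftrightarrow> (\<forall>e>0. \<exists>N. \<forall>m\<ge>N. \<forall>n\<ge>N. sqnorm M (\<lambda>x. h m x - h n x) < e)"

lemma L2_CauchyI:
  assumes increment_le: "\<And>m n. n \<le> m \<Longrightarrow> sqnorm M (\<lambda>x. h n x - h m x) \<le> \<epsilon> n" and "\<epsilon> \<longlonglongrightarrow> 0"
  shows "L2_Cauchy M h"
  unfolding L2_Cauchy_def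
proof (intro allI impI)
  fix e :: real assume "e > 0"
  with assms(2) obtain N where N: "\<And>n. n \<ge> N \<Longrightarrow> \<epsilon> n < e"
    using order_tendstoD(2)[of \<epsilon> 0 sequentially e] unfolding eventually_sequentially by blast
  have "sqnorm M (\<lambda>x. h m x - h n x) < e" if "N \<le> m" "N \<le> n" for m n
  proof (cases "n \<le> m")
    case True
    then show ?thesis
      using increment_le[OF True] N[OF that(2)] by (simp add: sqnorm_minus_commute[of M "h m"])
  next
    case False
    then show ?thesis using increment_le[of m n] N[OF that(1)] by simp
  qed
  then show "\<exists>N. \<forall>m\<ge>N. \<forall>n\<ge>N. sqnorm M (\<lambda>x. h m x - h n x) < e" by blast
qed

lemma summable_if_weighted_squares_finite:
  fixes d :: "nat \<Rightarrow> 'b::banach"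
  assumes "(\<Sum>k. ennreal (2^k * (norm (d k))\<^sup>2)) \<noteq> \<infinity>"
  shows "summable d"
proof -
  define S where "S = enn2real (\<Sum>k. ennreal (2^k * (norm (d k))\<^sup>2))"
  have term_le: "f k \<le> suminf f" for f :: "nat \<Rightarrow> ennreal" and k
    using sum_le_suminf[OF summableI, of "{k}" f] by simp
  have "norm (d k) \<le> sqrt S * (1 / sqrt 2)^k" for k
  proof -
    have "ennreal (2^k * (norm (d k))\<^sup>2) \<le> (\<Sum>k. ennreal (2^k * (norm (d k))\<^sup>2))"
      by (rule term_le)
    also have "\<dots> = ennreal S" using assms by (simp add: S_def top.not_eq_extremum)
    finally have "2^k * (norm (d k))\<^sup>2 \<le> S" by (simp add: S_def)
    then have "(norm (d k))\<^sup>2 \<le> S / 2^k" by (simp add: field_simps)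
    then have "sqrt ((norm (d k))\<^sup>2) \<le> sqrt (S / 2^k)" by (rule real_sqrt_le_mono)
    then show ?thesis by (simp add: real_sqrt_divide real_sqrt_power power_divide)
  qed
  moreover have "summable (\<lambda>k. sqrt S * (1 / sqrt 2)^k)"
    by (intro summable_mult summable_geometric) simp
  ultimately show ?thesis by (metis summable_comparison_test')
qed

lemma L2_geometric_AE_convergent:
  fixes h :: "nat \<Rightarrow> 'a \<Rightarrow> 'b::euclidean_space"
  assumes h: "\<And>n. L2 M (h n)" and small: "\<And>k. sqnorm M (\<lambda>x. h (Suc k) x - h k x) \<le> (1/8)^k"
  shows "AE x in M. convergent (\<lambda>k. h k x)"
proof -
  define d where "d k x = h (Suc k) x - h k x" for k x
  have d_L2: "L2 M (d k)" for k unfolding d_def by (intro L2_diff h)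
  have [measurable]: "d k \<in> borel_measurable M" for k by (rule L2_measurable[OF d_L2])
  have "(\<integral>\<^sup>+x. (\<Sum>k. ennreal (2^k * (norm (d k x))\<^sup>2)) \<partial>M) = (\<Sum>k. \<integral>\<^sup>+x. ennreal (2^k * (norm (d k x))\<^sup>2) \<partial>M)"
    by (rule nn_integral_suminf) measurable
  also have "\<dots> = (\<Sum>k. ennreal (2^k * sqnorm M (d k)))"
    by (intro suminf_cong) (simp add: ennreal_mult nn_integral_cmult nn_integral_norm_sq[OF d_L2] sqnorm_nonneg)
  also have "\<dots> \<le> (\<Sum>k. ennreal ((1/4)^k))"
  proof (intro suminf_le summableI ennreal_leI)
    fix k
    have "2^k * sqnorm M (d k) \<le> 2^k * (1/8)^k" using small by (simp add: d_def[abs_def])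
    also have "\<dots> = (1/4::real)^k" by (simp flip: power_mult_distrib)
    finally show "2^k * sqnorm M (d k) \<le> (1/4)^k" .
  qed
  also have "\<dots> < \<infinity>"
    by (subst suminf_ennreal2) (auto simp: summable_geometric)
  finally have "AE x in M. (\<Sum>k. ennreal (2^k * (norm (d k x))\<^sup>2)) \<noteq> \<infinity>"
    by (intro nn_integral_PInf_AE) auto
  then show ?thesis
  proof eventually_elim
    case (elim x)
    then have "convergent (\<lambda>k. h 0 x + (\<Sum>j<k. d j x))"
      by (intro convergent_add convergent_const)
        (simp add: summable_if_weighted_squares_finite flip: summable_iff_convergent)
    moreover have "h 0 x + (\<Sum>j<k. d j x) = h k x" for k
      using sum_lessThan_telescope[of "\<lambda>j. h j x" k] by (simp add: d_def)
    ultimately show ?case by simp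
  qed
qed

lemma L2_Cauchy_geometric_subseq:
  assumes "L2_Cauchy M h"
  obtains r where "strict_mono r" "\<And>k. sqnorm M (\<lambda>x. h (r (Suc k)) x - h (r k) x) \<le> (1/8)^k"
proof -
  have "\<forall>k. \<exists>N. \<forall>m\<ge>N. \<forall>n\<ge>N. sqnorm M (\<lambda>x. h m x - h n x) < (1/8)^k"
    using assms by (simp add: L2_Cauchy_def)
  then obtain N where N: "\<And>k m n. m \<ge> N k \<Longrightarrow> n \<ge> N k \<Longrightarrow> sqnorm M (\<lambda>x. h m x - h n x) < (1/8)^k"
    by metis
  define r where "r k = (\<Sum>j\<le>k. N j) + k" for k
  have "r k \<ge> N k" for k
    unfolding r_def by (simp add: member_le_sum trans_le_add1)
  moreover have "strict_mono r" by (simp add: strict_mono_Suc_iff r_def)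
  moreover have "r k \<le> r (Suc k)" for k by (simp add: r_def)
  ultimately show ?thesis
    using N by (intro that[of r]) (meson less_imp_le order_trans)+
qed

theorem L2_complete:
  fixes h :: "nat \<Rightarrow> 'a \<Rightarrow> 'b::euclidean_space"
  assumes h: "\<And>n. L2 M (h n)" and Cauchy: "L2_Cauchy M h"
  shows "\<exists>f. L2 M f \<and> (\<lambda>n. sqnorm M (\<lambda>x. h n x - f x)) \<longlonglongrightarrow> 0"
proof -
  obtain r where r: "strict_mono r" "\<And>k. sqnorm M (\<lambda>x. h (r (Suc k)) x - h (r k) x) \<le> (1/8)^k"
    by (rule L2_Cauchy_geometric_subseq[OF Cauchy]) (rule that)
  have [measurable]: "h n \<in> borel_measurable M" for n using h by (rule L2_measurable)
  define f where "f x = lim (\<lambda>k. h (r k) x)" for x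
  have [measurable]: "f \<in> borel_measurable M"
    unfolding f_def by (rule borel_measurable_lim_metric) measurable
  have lim: "AE x in M. (\<lambda>k. h (r k) x) \<longlonglongrightarrow> f x"
    using L2_geometric_AE_convergent[of M "\<lambda>k. h (r k)", OF h r(2)] unfolding f_def
    by eventually_elim (simp add: convergent_LIMSEQ_iff)
  have close: "\<exists>K. \<forall>m\<ge>K. L2 M (\<lambda>x. h m x - f x) \<and> sqnorm M (\<lambda>x. h m x - f x) \<le> e" if "e > 0" for e
  proof -
    obtain K where K: "\<forall>m\<ge>K. \<forall>n\<ge>K. sqnorm M (\<lambda>x. h m x - h n x) < e"
      using Cauchy \<open>e > 0\<close> unfolding L2_Cauchy_def by blast
    have "L2 M (\<lambda>x. h m x - f x) \<and> sqnorm M (\<lambda>x. h m x - f x) \<le> e" if "m \<ge> K" for m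
    proof -
      have "AE x in M. (\<lambda>k. h m x - h (r k) x) \<longlonglongrightarrow> h m x - f x"
        using lim by eventually_elim (intro tendsto_intros)
      moreover have "\<forall>\<^sub>F k in sequentially. sqnorm M (\<lambda>x. h m x - h (r k) x) \<le> e"
        using K that seq_suble[OF r(1)] by (intro eventually_sequentiallyI[of K]) (meson less_imp_le order_trans)
      ultimately show ?thesis
        using L2_AE_limit[of M "\<lambda>k x. h m x - h (r k) x" "\<lambda>x. h m x - f x" e] L2_diff[OF h h] \<open>e > 0\<close> by simp
    qed
    then show ?thesis by blast
  qed
  obtain K where "L2 M (\<lambda>x. h K x - f x)" using close[of 1] by auto
  from L2_diff[OF h[of K] this] have "L2 M f" by simp
  moreover have "(\<lambda>n. sqnorm M (\<lambda>x. h n x - f x)) \<longlonglongrightarrow> 0"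
  proof (rule order_tendstoI)
    show "\<forall>\<^sub>F n in sequentially. a < sqnorm M (\<lambda>x. h n x - f x)" if "a < 0" for a
      using that by (intro always_eventually allI) (rule less_le_trans[OF _ sqnorm_nonneg])
    fix a :: real assume "0 < a"
    then obtain K where "\<forall>m\<ge>K. sqnorm M (\<lambda>x. h m x - f x) \<le> a / 2" using close[of "a / 2"] by auto
    with \<open>0 < a\<close> show "\<forall>\<^sub>F n in sequentially. sqnorm M (\<lambda>x. h n x - f x) < a"
      by (intro eventually_sequentiallyI[of K]) (simp add: le_less_trans[of _ "a / 2"])
  qed
  ultimately show ?thesis by blast
qed

lemma L2_inner_tendsto:
  assumes h: "\<And>n. L2 M (h n)" and g: "L2 M g" and \<phi>: "L2 M \<phi>"
    and lim: "(\<lambda>n. sqnorm M (\<lambda>x. h n x - g x)) \<longlonglongrightarrow> 0"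
  shows "(\<lambda>n. \<integral>x. \<phi> x \<bullet> h n x \<partial>M) \<longlonglongrightarrow> (\<integral>x. \<phi> x \<bullet> g x \<partial>M)"
proof (rule LIM_zero_cancel, rule Lim_null_comparison)
  have "norm ((\<integral>x. \<phi> x \<bullet> h n x \<partial>M) - (\<integral>x. \<phi> x \<bullet> g x \<partial>M))
      \<le> sqrt (sqnorm M \<phi>) * sqrt (sqnorm M (\<lambda>x. h n x - g x))" for n
    using L2_Cauchy_Schwarz[OF \<phi> L2_diff[OF h g]] L2_inner_integrable[OF \<phi> h] L2_inner_integrable[OF \<phi> g]
    by (simp add: inner_diff_right)
  then show "\<forall>\<^sub>F n in sequentially. norm ((\<integral>x. \<phi> x \<bullet> h n x \<partial>M) - (\<integral>x. \<phi> x \<bullet> g x \<partial>M))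
      \<le> sqrt (sqnorm M \<phi>) * sqrt (sqnorm M (\<lambda>x. h n x - g x))" by simp
  show "(\<lambda>n. sqrt (sqnorm M \<phi>) * sqrt (sqnorm M (\<lambda>x. h n x - g x))) \<longlonglongrightarrow> 0"
    using tendsto_mult_right_zero[OF tendsto_real_sqrt[OF lim, simplified]] .
qed

lemma sqnorm_tendsto:
  assumes h: "\<And>n. L2 M (h n)" and g: "L2 M g"
    and lim: "(\<lambda>n. sqnorm M (\<lambda>x. h n x - g x)) \<longlonglongrightarrow> 0"
  shows "(\<lambda>n. sqnorm M (h n)) \<longlonglongrightarrow> sqnorm M g"
proof -
  have "sqnorm M (h n) = sqnorm M (\<lambda>x. h n x - g x) + 2 * (\<integral>x. g x \<bullet> h n x \<partial>M) - sqnorm M g" for n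
    using sqnorm_diff[OF h g] by (simp add: inner_commute)
  moreover have "(\<lambda>n. sqnorm M (\<lambda>x. h n x - g x) + 2 * (\<integral>x. g x \<bullet> h n x \<partial>M) - sqnorm M g)
      \<longlonglongrightarrow> 0 + 2 * (\<integral>x. g x \<bullet> g x \<partial>M) - sqnorm M g"
    by (intro tendsto_intros lim L2_inner_tendsto h g)
  ultimately show ?thesis by (simp add: sqnorm_def power2_norm_eq_inner)
qed

inductive_set midpoint_tail :: "(nat \<Rightarrow> 'a \<Rightarrow> 'b::euclidean_space) \<Rightarrow> nat \<Rightarrow> ('a \<Rightarrow> 'b) set"
  for f n where
    base: "k \<ge> n \<Longrightarrow> f k \<in> midpoint_tail f n"
  | mid: "p \<in> midpoint_tail f n \<Longrightarrow> q \<in> midpoint_tail f n \<Longrightarrow> (\<lambda>x. (1/2) *\<^sub>R (p x + q x)) \<in> midpoint_tail f n"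

lemma midpoint_tail_antimono: "p \<in> midpoint_tail f n \<Longrightarrow> m \<le> n \<Longrightarrow> p \<in> midpoint_tail f m"
  by (induction rule: midpoint_tail.induct) (auto intro: midpoint_tail.intros)

lemma midpoint_tail_L2:
  assumes "\<And>n. L2 M (f n)" "p \<in> midpoint_tail f n" shows "L2 M p"
  using assms(2)
proof (induction rule: midpoint_tail.induct)
  case (mid p q)
  then show ?case by (intro L2_scaleR[OF L2_add])
qed (rule assms(1))

lemma midpoint_tail_inner_close:
  assumes f: "\<And>n. L2 M (f n)" and \<phi>: "L2 M \<phi>" and p: "p \<in> midpoint_tail f n"
    and close: "\<And>k. k \<ge> n \<Longrightarrow> \<bar>(\<integral>x. \<phi> x \<bullet> f k x \<partial>M) - l\<bar> \<le> e"
  shows "\<bar>(\<integral>x. \<phi> x \<bullet> p x \<partial>M) - l\<bar> \<le> e"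
  using p
proof (induction rule: midpoint_tail.induct)
  case (mid p q)
  have "(\<integral>x. \<phi> x \<bullet> ((1/2) *\<^sub>R (p x + q x)) \<partial>M) = (1/2) * ((\<integral>x. \<phi> x \<bullet> p x \<partial>M) + (\<integral>x. \<phi> x \<bullet> q x \<partial>M))"
    using L2_inner_integrable[OF \<phi> midpoint_tail_L2[OF f]] mid.hyps by (simp add: inner_simps)
  then show ?case using mid.IH by (simp add: abs_le_iff field_simps)
qed (rule close)

lemma midpoint_tail_L2_Cauchy:
  fixes f :: "nat \<Rightarrow> 'a \<Rightarrow> 'b::euclidean_space"
  assumes f: "\<And>n. L2 M (f n)" and C: "\<And>n. sqnorm M (f n) \<le> C"
  obtains h where "\<And>n. h n \<in> midpoint_tail f n" "\<And>n. sqnorm M (h n) \<le> C + 1 / Suc n" "L2_Cauchy M h"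
proof -
  let ?K = "midpoint_tail f"
  define d where "d n = Inf (sqnorm M ` ?K n)" for n
  have bdd: "bdd_below (sqnorm M ` ?K n)" for n
    using sqnorm_nonneg by (intro bdd_belowI[where m=0]) auto
  have f_mem: "f n \<in> ?K n" for n by (rule midpoint_tail.base) simp
  have d_le: "d n \<le> sqnorm M p" if "p \<in> ?K n" for n p
    unfolding d_def using that bdd by (intro cInf_lower) auto
  have "incseq d"
    unfolding d_def using f_mem bdd
    by (intro monoI cInf_superset_mono image_mono subsetI) (auto intro: midpoint_tail_antimono)
  moreover have d_le_C: "d n \<le> C" for n using d_le[OF f_mem] C by (rule order_trans)
  ultimately obtain D where D: "d \<longlonglongrightarrow> D" "\<And>n. d n \<le> D"
    using incseq_convergent by blast
  have "\<exists>p\<in>?K n. sqnorm M p < d n + 1 / Suc n" for n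
    using cInf_lessD[of "sqnorm M ` ?K n" "d n + 1 / Suc n"] f_mem[of n] by (auto simp: d_def)
  then obtain h where h: "\<And>n. h n \<in> ?K n" "\<And>n. sqnorm M (h n) < d n + 1 / Suc n" by metis
  have "L2_Cauchy M h"
  proof (rule L2_CauchyI)
    fix m n :: nat assume "n \<le> m"
    have h_mem: "h m \<in> ?K n" by (rule midpoint_tail_antimono[OF h(1) \<open>n \<le> m\<close>])
    have "1 / real (Suc m) \<le> 1 / real (Suc n)" using \<open>n \<le> m\<close> by (simp add: frac_le)
    then show "sqnorm M (\<lambda>x. h n x - h m x) \<le> 2 * (D - d n) + 4 * (1 / Suc n)"
      using sqnorm_parallelogram[OF midpoint_tail_L2[OF f h(1)] midpoint_tail_L2[OF f h(1)], of n m]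
        h(2)[of n] h(2)[of m] d_le[OF midpoint_tail.mid[OF h(1) h_mem]] D(2)[of m] by argo
  next
    have "(\<lambda>n. 2 * (D - d n) + 4 * (1 / Suc n)) \<longlonglongrightarrow> 2 * (D - D) + 4 * 0"
      by (intro tendsto_intros D(1) LIMSEQ_Suc[OF lim_1_over_n])
    then show "(\<lambda>n. 2 * (D - d n) + 4 * (1 / Suc n)) \<longlonglongrightarrow> 0" by simp
  qed
  moreover have "sqnorm M (h n) \<le> C + 1 / Suc n" for n using h(2)[of n] d_le_C[of n] by linarith
  ultimately show ?thesis using that h(1) by blast
qed

text \<open>A bounded sequence of \<open>L\<^sup>2\<close> has norm-convergent midpoint combinations of its tails: those of
  almost minimal norm are Cauchy by the parallelogram law. Their limit is a weak limit.\<close>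
theorem L2_weak_limit:
  fixes f :: "nat \<Rightarrow> 'a \<Rightarrow> 'b::euclidean_space"
  assumes f: "\<And>n. L2 M (f n)" and C: "\<And>n. sqnorm M (f n) \<le> C"
  shows "\<exists>g. L2 M g \<and> sqnorm M g \<le> C \<and>
    (\<forall>\<phi> l. L2 M \<phi> \<longrightarrow> (\<lambda>n. \<integral>x. \<phi> x \<bullet> f n x \<partial>M) \<longlonglongrightarrow> l \<longrightarrow> (\<integral>x. \<phi> x \<bullet> g x \<partial>M) = l)"
proof -
  obtain h where h: "\<And>n. h n \<in> midpoint_tail f n" "\<And>n. sqnorm M (h n) \<le> C + 1 / Suc n"
    and Cauchy: "L2_Cauchy M h"
    by (rule midpoint_tail_L2_Cauchy[OF f C]) (rule that)
  have h_L2: "L2 M (h n)" for n by (rule midpoint_tail_L2[OF f h(1)])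
  from L2_complete[OF this Cauchy] obtain g where g: "L2 M g" "(\<lambda>n. sqnorm M (\<lambda>x. h n x - g x)) \<longlonglongrightarrow> 0"
    by blast
  have "sqnorm M g \<le> C + 0"
    by (rule LIMSEQ_le[OF sqnorm_tendsto[OF h_L2 g] tendsto_add[OF tendsto_const LIMSEQ_Suc[OF lim_1_over_n]]])
      (use h(2) in auto)
  moreover have "(\<integral>x. \<phi> x \<bullet> g x \<partial>M) = l"
    if \<phi>: "L2 M \<phi>" and l: "(\<lambda>n. \<integral>x. \<phi> x \<bullet> f n x \<partial>M) \<longlonglongrightarrow> l" for \<phi> l
  proof (rule LIMSEQ_unique[OF L2_inner_tendsto[OF h_L2 g(1) \<phi> g(2)]], rule LIMSEQ_I)
    fix e :: real assume "e > 0"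
    with LIMSEQ_D[OF l, of "e/2"] obtain N
      where N: "\<And>n. n \<ge> N \<Longrightarrow> \<bar>(\<integral>x. \<phi> x \<bullet> f n x \<partial>M) - l\<bar> < e/2" by auto
    have "\<bar>(\<integral>x. \<phi> x \<bullet> h n x \<partial>M) - l\<bar> \<le> e/2" if "n \<ge> N" for n
      using N that by (intro midpoint_tail_inner_close[OF f \<phi> h(1)]) (auto intro: less_imp_le)
    then show "\<exists>N. \<forall>n\<ge>N. norm ((\<integral>x. \<phi> x \<bullet> h n x \<partial>M) - l) < e"
      using \<open>e > 0\<close> by (intro exI[of _ N]) force
  qed
  ultimately show ?thesis using g(1) by auto
qed

subsection \<open>Transformations preserving Lebesgue measure\<close>

lemma ball_measurable [measurable]: "ball c r \<in> sets borel"
  by simp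

definition lborel_preserving :: "('a::euclidean_space \<Rightarrow> 'a) \<Rightarrow> bool" where
  "lborel_preserving f \<longleftrightarrow> f \<in> borel_measurable borel \<and> distr lborel borel f = lborel"

lemma lborel_preserving_measurable [measurable_dest]: "lborel_preserving f \<Longrightarrow> f \<in> borel_measurable borel"
  by (simp add: lborel_preserving_def)

lemma lborel_preserving_nn_integral:
  assumes f: "lborel_preserving f" and h: "h \<in> borel_measurable borel"
  shows "(\<integral>\<^sup>+x. h (f x) \<partial>lborel) = (\<integral>\<^sup>+x. h x \<partial>lborel)"
  using nn_integral_distr[of f lborel borel h] f h by (simp add: lborel_preserving_def)

lemma lborel_preserving_integral:
  fixes h :: "'a::euclidean_space \<Rightarrow> 'b::{banach,second_countable_topology}"
  assumes f: "lborel_preserving f" and h: "h \<in> borel_measurable borel"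
  shows "(\<integral>x. h (f x) \<partial>lborel) = (\<integral>x. h x \<partial>lborel)"
    and "integrable lborel (\<lambda>x. h (f x)) \<longleftrightarrow> integrable lborel h"
  using integral_distr[of f lborel borel h] integrable_distr_eq[of f lborel borel h] f h
  by (simp_all add: lborel_preserving_def)

lemma lborel_preserving_AE:
  assumes f: "lborel_preserving f" and P: "AE x in lborel. P x"
  shows "AE x in lborel. P (f x)"
proof -
  have "distr lborel borel f = lborel" using f by (simp add: lborel_preserving_def)
  with P have "AE x in distr lborel borel f. P x" by (simp only:)
  then show ?thesis by (rule AE_distrD[rotated]) (use f in measurable)
qed

lemma lborel_preserving_compose:
  assumes "lborel_preserving f" "lborel_preserving g" shows "lborel_preserving (\<lambda>x. f (g x))"
  unfolding lborel_preserving_def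
proof
  note [measurable] = assms[THEN lborel_preserving_measurable]
  show "(\<lambda>x. f (g x)) \<in> borel_measurable borel" by measurable
  have "distr lborel borel (\<lambda>x. f (g x)) = distr (distr lborel borel g) borel f"
    by (subst distr_distr) (auto simp: comp_def)
  then show "distr lborel borel (\<lambda>x. f (g x)) = lborel"
    using assms by (simp add: lborel_preserving_def)
qed

lemma lborel_preserving_id: "lborel_preserving (\<lambda>x. x)"
  by (simp add: lborel_preserving_def distr_id2)

lemma lborel_preserving_add: "lborel_preserving (\<lambda>x. x + c)"
  using lborel_distr_plus[of c] by (simp add: lborel_preserving_def add.commute[of _ c])

lemma lborel_preserving_add_left: "lborel_preserving (\<lambda>x. c + x)"
  using lborel_preserving_add[of c] by (simp add: add.commute)

lemma lborel_preserving_orthogonal: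
  fixes f :: "real ^ 'n::{finite,wellorder} \<Rightarrow> real ^ 'n::_"
  assumes f: "orthogonal_transformation f"
  shows "lborel_preserving f"
  unfolding lborel_preserving_def
proof
  show f_measurable [measurable]: "f \<in> borel_measurable borel"
    using f by (intro borel_measurable_continuous_onI linear_continuous_on linear_conv_bounded_linear[THEN iffD1])
      (simp add: orthogonal_transformation_linear)
  show "distr lborel borel f = lborel"
  proof (rule lborel_eqI[symmetric])
    fix l u :: "real ^ 'n::_" assume corners: "\<And>b. b \<in> Basis \<Longrightarrow> l \<bullet> b \<le> u \<bullet> b"
    have g: "orthogonal_transformation (inv f)" using f by (rule orthogonal_transformation_inv)
    have preimage: "f -` box l u = inv f ` box l u"
      using orthogonal_transformation_bij[OF f] by (simp add: bij_vimage_eq_inv_image)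
    have preimage_borel: "f -` box l u \<in> sets borel"
      using measurable_sets[OF f_measurable, of "box l u"] by simp
    have image_lmeasurable: "inv f ` box l u \<in> lmeasurable" by (rule measurable_orthogonal_image[OF g]) simp
    have "emeasure (distr lborel borel f) (box l u) = emeasure lborel (f -` box l u)"
      by (subst emeasure_distr) auto
    also have "\<dots> = emeasure lebesgue (inv f ` box l u)" using preimage_borel preimage by simp
    also have "\<dots> = ennreal (measure lebesgue (inv f ` box l u))" using image_lmeasurable by (rule emeasure_eq_measure2)
    also have "\<dots> = ennreal (measure lebesgue (box l u))" by (subst measure_orthogonal_image[OF g]) auto
    also have "\<dots> = emeasure lborel (box l u)" by (simp add: emeasure_lborel_box_eq measure_def)
    also have "\<dots> = (\<Prod>b\<in>Basis. (u - l) \<bullet> b)" using corners by (simp add: emeasure_lborel_box_eq)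
    finally show "emeasure (distr lborel borel f) (box l u) = (\<Prod>b\<in>Basis. (u - l) \<bullet> b)" .
  qed simp
qed

lemma lborel_preserving_uminus: "lborel_preserving (uminus :: real ^ 'n::{finite,wellorder} \<Rightarrow> real ^ 'n::_)"
  by (rule lborel_preserving_orthogonal) (simp add: orthogonal_transformation_def linear_iff)

lemma lborel_preserving_pair_distr:
  fixes \<sigma> :: "'a::euclidean_space \<Rightarrow> 'a" and \<tau> :: "'b::euclidean_space \<Rightarrow> 'b"
  assumes "lborel_preserving \<sigma>" "lborel_preserving \<tau>"
  shows "(\<lambda>(x, y). (\<sigma> x, \<tau> y)) \<in> (lborel \<Otimes>\<^sub>M lborel) \<rightarrow>\<^sub>M (borel \<Otimes>\<^sub>M borel)"
    and "distr (lborel \<Otimes>\<^sub>M lborel) (borel \<Otimes>\<^sub>M borel) (\<lambda>(x, y). (\<sigma> x, \<tau> y)) = lborel \<Otimes>\<^sub>M lborel"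
proof -
  note [measurable] = assms[THEN lborel_preserving_measurable]
  show "(\<lambda>(x, y). (\<sigma> x, \<tau> y)) \<in> (lborel \<Otimes>\<^sub>M lborel) \<rightarrow>\<^sub>M (borel \<Otimes>\<^sub>M borel)" by measurable
  have "distr lborel borel \<sigma> \<Otimes>\<^sub>M distr lborel borel \<tau>
      = distr (lborel \<Otimes>\<^sub>M lborel) (borel \<Otimes>\<^sub>M borel) (\<lambda>(x, y). (\<sigma> x, \<tau> y))"
    using assms by (intro pair_measure_distr) (auto simp: lborel_preserving_def sigma_finite_lborel)
  then show "distr (lborel \<Otimes>\<^sub>M lborel) (borel \<Otimes>\<^sub>M borel) (\<lambda>(x, y). (\<sigma> x, \<tau> y)) = lborel \<Otimes>\<^sub>M lborel"
    using assms by (simp add: lborel_preserving_def)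
qed

lemma lborel_preserving_pair_integral:
  fixes f :: "'a::euclidean_space \<times> 'b::euclidean_space \<Rightarrow> real"
  assumes "lborel_preserving \<sigma>" "lborel_preserving \<tau>" and f: "f \<in> borel_measurable (borel \<Otimes>\<^sub>M borel)"
  shows "(\<integral>p. f (\<sigma> (fst p), \<tau> (snd p)) \<partial>(lborel \<Otimes>\<^sub>M lborel)) = (\<integral>p. f p \<partial>(lborel \<Otimes>\<^sub>M lborel))"
    and "integrable (lborel \<Otimes>\<^sub>M lborel) (\<lambda>p. f (\<sigma> (fst p), \<tau> (snd p))) \<longleftrightarrow> integrable (lborel \<Otimes>\<^sub>M lborel) f"
  using integral_distr[OF lborel_preserving_pair_distr(1)[OF assms(1,2)] f]
    integrable_distr_eq[OF lborel_preserving_pair_distr(1)[OF assms(1,2)] f]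
  unfolding lborel_preserving_pair_distr(2)[OF assms(1,2)] by (simp_all add: case_prod_unfold)

lemma lborel_preserving_pair_nn_integral:
  fixes f :: "'a::euclidean_space \<times> 'b::euclidean_space \<Rightarrow> ennreal"
  assumes "lborel_preserving \<sigma>" "lborel_preserving \<tau>" and f: "f \<in> borel_measurable (borel \<Otimes>\<^sub>M borel)"
  shows "(\<integral>\<^sup>+p. f (\<sigma> (fst p), \<tau> (snd p)) \<partial>(lborel \<Otimes>\<^sub>M lborel)) = (\<integral>\<^sup>+p. f p \<partial>(lborel \<Otimes>\<^sub>M lborel))"
  using nn_integral_distr[OF lborel_preserving_pair_distr(1)[OF assms(1,2)], of f] f
  unfolding lborel_preserving_pair_distr(2)[OF assms(1,2)] by (simp add: case_prod_unfold)

lemma pair_integrableI: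
  fixes f :: "'a::euclidean_space \<times> 'b::euclidean_space \<Rightarrow> 'c::{banach,second_countable_topology}"
  assumes f [measurable]: "f \<in> borel_measurable (lborel \<Otimes>\<^sub>M lborel)"
    and bound: "(\<integral>\<^sup>+s. \<integral>\<^sup>+x. ennreal (norm (f (s, x))) \<partial>lborel \<partial>lborel) \<le> ennreal K"
  shows "integrable (lborel \<Otimes>\<^sub>M lborel) f"
proof (rule integrableI_bounded[OF f])
  have "(\<integral>\<^sup>+p. ennreal (norm (f p)) \<partial>(lborel \<Otimes>\<^sub>M lborel)) = (\<integral>\<^sup>+s. \<integral>\<^sup>+x. ennreal (norm (f (s, x))) \<partial>lborel \<partial>lborel)"
    by (rule lborel.nn_integral_fst[symmetric]) measurable
  also note bound
  also have "ennreal K < \<infinity>" by simp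
  finally show "(\<integral>\<^sup>+p. ennreal (norm (f p)) \<partial>(lborel \<Otimes>\<^sub>M lborel)) < \<infinity>" .
qed

lemma AE_lborel_pair:
  assumes "AE x in lborel. P x"
  shows "AE p in (lborel :: 'a::euclidean_space measure) \<Otimes>\<^sub>M lborel. P (fst p) \<and> P (snd p)"
proof -
  obtain N where N: "N \<in> null_sets lborel" "\<And>x. x \<notin> N \<Longrightarrow> P x" by (rule AE_E3[OF assms]) simp
  have "N \<times> UNIV \<union> UNIV \<times> N \<in> null_sets (lborel \<Otimes>\<^sub>M lborel)"
    using N(1) by (intro null_sets.Un) (auto simp: null_sets_def lborel.emeasure_pair_measure_Times)
  then show ?thesis
  proof (rule AE_I', intro subsetI)
    fix p assume "p \<in> {p \<in> space (lborel \<Otimes>\<^sub>M lborel). \<not> (P (fst p) \<and> P (snd p))}"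
    then have "fst p \<in> N \<or> snd p \<in> N" using N(2) by blast
    then show "p \<in> N \<times> UNIV \<union> UNIV \<times> N" by (cases p) auto
  qed
qed

lemma L2_shift: "L2 lborel f \<Longrightarrow> L2 lborel (\<lambda>x. f (x + h))"
  using lborel_preserving_integral(2)[OF lborel_preserving_add[of h], of "\<lambda>x. (norm (f x))\<^sup>2"]
  by (auto simp: L2_def)

lemma sqnorm_shift: "f \<in> borel_measurable borel \<Longrightarrow> sqnorm lborel (\<lambda>x. f (x + h)) = sqnorm lborel f"
  using lborel_preserving_integral(1)[OF lborel_preserving_add[of h], of "\<lambda>x. (norm (f x))\<^sup>2"]
  by (auto simp: sqnorm_def)

lemma L2_shift_left: "L2 lborel f \<Longrightarrow> L2 lborel (\<lambda>h. f (x + h))"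
  using L2_shift[of f x] by (simp add: add.commute)

lemma sqnorm_shift_left: "f \<in> borel_measurable borel \<Longrightarrow> sqnorm lborel (\<lambda>h. f (x + h)) = sqnorm lborel f"
  using sqnorm_shift[of f x] by (simp add: add.commute)

lemma sqnorm_increment_le:
  assumes "L2 lborel v" shows "sqnorm lborel (\<lambda>x. v (x + h) - v x) \<le> 4 * sqnorm lborel v"
  using sqnorm_add_le[OF L2_shift[OF assms, of h] L2_scaleR[OF assms, of "-1"]] sqnorm_shift[of v h]
    sqnorm_scaleR[of lborel "-1" v] L2_measurable[OF assms] by simp

lemma ball_translates_integral_tendsto_0:
  fixes v :: "'a::euclidean_space \<Rightarrow> real"
  assumes v: "integrable lborel v" and b: "b \<noteq> 0"
  shows "(\<lambda>n. \<integral>x. indicator (ball 0 r) (x - real n *\<^sub>R b) * v x \<partial>lborel) \<longlonglongrightarrow> 0"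
proof -
  have [measurable]: "v \<in> borel_measurable borel" using borel_measurable_integrable[OF v] by simp
  let ?f = "\<lambda>n x. indicator (ball 0 r) (x - real n *\<^sub>R b) * v x"
  have "(\<lambda>n. \<integral>x. ?f n x \<partial>lborel) \<longlonglongrightarrow> (\<integral>x. 0 \<partial>(lborel :: 'a measure))"
  proof (rule integral_dominated_convergence)
    show "integrable lborel (\<lambda>x. \<bar>v x\<bar>)" using v by simp
    show "AE x in lborel. (\<lambda>n. ?f n x) \<longlonglongrightarrow> 0"
    proof (intro AE_I2 tendsto_eventually)
      fix x :: 'a
      obtain N :: nat where N: "(norm x + r) / norm b < N" using reals_Archimedean2 by blast
      have "?f n x = 0" if "N \<le> n" for n
      proof -
        have "norm x + r < real N * norm b" using N b by (simp add: pos_divide_less_eq)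
        also have "\<dots> \<le> norm (real n *\<^sub>R b)" using that by (simp add: mult_right_mono)
        finally have "norm x + r < norm (real n *\<^sub>R b)" .
        then show ?thesis using norm_triangle_ineq2[of "real n *\<^sub>R b" x] by (simp add: norm_minus_commute)
      qed
      then show "\<forall>\<^sub>F n in sequentially. ?f n x = 0" unfolding eventually_sequentially by blast
    qed
    show "AE x in lborel. norm (?f n x) \<le> \<bar>v x\<bar>" for n by (auto simp: indicator_def)
  qed measurable
  then show ?thesis by simp
qed

lemma AE_zero_if_AE_shift_invariant:
  fixes v :: "'a::euclidean_space \<Rightarrow> real"
  assumes v: "integrable lborel v" and nonneg: "\<And>x. 0 \<le> v x" and b: "b \<noteq> 0"
    and inv: "\<And>n::nat. AE x in lborel. v (x + real n *\<^sub>R b) = v x"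
  shows "AE x in lborel. v x = 0"
proof -
  have [measurable]: "v \<in> borel_measurable borel" using borel_measurable_integrable[OF v] by simp
  have zero: "(\<integral>x. indicator (ball 0 r) x * v x \<partial>lborel) = 0" for r :: real
  proof -
    let ?f = "\<lambda>n x. indicator (ball 0 r) (x - real n *\<^sub>R b) * v x"
    have [measurable]: "?f n \<in> borel_measurable borel" for n by measurable
    have const: "(\<integral>x. ?f n x \<partial>lborel) = (\<integral>x. indicator (ball 0 r) x * v x \<partial>lborel)" for n
    proof -
      have "(\<integral>x. ?f n x \<partial>lborel) = (\<integral>x. ?f n (x + real n *\<^sub>R b) \<partial>lborel)"
        by (rule lborel_preserving_integral(1)[OF lborel_preserving_add, symmetric]) measurable
      also have "\<dots> = (\<integral>x. indicator (ball 0 r) x * v x \<partial>lborel)"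
        by (rule integral_cong_AE; (measurable)?) (use inv[of n] in eventually_elim, simp)
      finally show ?thesis .
    qed
    show ?thesis
      using ball_translates_integral_tendsto_0[OF v b, of r] unfolding const by (simp add: LIMSEQ_const_iff)
  qed
  have "AE x in lborel. indicator (ball 0 (real n)) x * v x = 0" for n :: nat
    using integrable_real_mult_indicator[OF _ v, of "ball 0 (real n)"] zero[of "real n"] nonneg
    by (subst (asm) integral_nonneg_eq_0_iff_AE) (auto simp: mult.commute)
  then have "AE x in lborel. \<forall>n::nat. indicator (ball 0 (real n)) x * v x = 0"
    by (intro AE_all_countable[THEN iffD2]) blast
  then show ?thesis
  proof eventually_elim
    case (elim x)
    obtain n :: nat where "norm x < n" using reals_Archimedean2 by blast
    then show ?case using elim[rule_format, of n] by simp
  qed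
qed

subsection \<open>Bounded functions of bounded support and local integrability\<close>

definition bounded_supp :: "('a::euclidean_space \<Rightarrow> real) \<Rightarrow> bool" where
  "bounded_supp \<phi> \<longleftrightarrow> \<phi> \<in> borel_measurable borel \<and>
    (\<exists>R B. (\<forall>x. \<bar>\<phi> x\<bar> \<le> B) \<and> (\<forall>x. R \<le> norm x \<longrightarrow> \<phi> x = 0))"

lemma bounded_supp_measurable [measurable_dest]: "bounded_supp \<phi> \<Longrightarrow> \<phi> \<in> borel_measurable borel"
  by (simp add: bounded_supp_def)

lemma bounded_suppI:
  assumes "\<phi> \<in> borel_measurable borel" "\<And>x. \<bar>\<phi> x\<bar> \<le> B" "\<And>x. R \<le> norm x \<Longrightarrow> \<phi> x = 0"
  shows "bounded_supp \<phi>"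
  unfolding bounded_supp_def using assms by blast

lemma bounded_suppE:
  fixes \<phi> :: "'a::euclidean_space \<Rightarrow> real"
  assumes "bounded_supp \<phi>"
  obtains R B where "R > 0" "B > 0" "\<And>x. \<bar>\<phi> x\<bar> \<le> B" "\<And>x. R \<le> norm x \<Longrightarrow> \<phi> x = 0"
proof -
  from assms obtain R B where bounds: "\<And>x. \<bar>\<phi> x\<bar> \<le> B" "\<And>x. R \<le> norm x \<Longrightarrow> \<phi> x = 0"
    unfolding bounded_supp_def by blast
  show thesis
  proof (rule that)
    show "\<bar>\<phi> x\<bar> \<le> \<bar>B\<bar> + 1" for x using bounds(1)[of x] by linarith
    show "\<phi> x = 0" if "\<bar>R\<bar> + 1 \<le> norm x" for x using bounds(2)[of x] that by linarith
  qed auto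
qed

lemma continuous_bounded_supp:
  fixes \<phi> :: "'a::euclidean_space \<Rightarrow> real"
  assumes cont: "continuous_on UNIV \<phi>" and bdd: "bounded {x. \<phi> x \<noteq> 0}"
  shows "bounded_supp \<phi>"
proof -
  obtain R where R: "\<And>x. \<phi> x \<noteq> 0 \<Longrightarrow> norm x \<le> R" using bdd by (auto simp: bounded_iff)
  have "compact (\<phi> ` cball 0 R)"
    by (intro compact_continuous_image continuous_on_subset[OF cont]) auto
  then obtain B where B: "\<forall>x\<in>cball 0 R. \<bar>\<phi> x\<bar> \<le> B"
    using compact_imp_bounded[of "\<phi> ` cball 0 R"] unfolding bounded_iff by auto
  show ?thesis
  proof (rule bounded_suppI)
    show "\<bar>\<phi> x\<bar> \<le> \<bar>B\<bar>" for x using R[of x] B by (cases "\<phi> x = 0") force+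
    show "\<phi> x = 0" if "R + 1 \<le> norm x" for x using R[of x] that by linarith
  qed (rule borel_measurable_continuous_onI[OF cont])
qed

lemma bounded_supp_ball_mult:
  assumes [measurable]: "p \<in> borel_measurable borel" and bound: "\<And>h. h \<in> ball 0 r \<Longrightarrow> \<bar>p h\<bar> \<le> C"
  shows "bounded_supp (\<lambda>h. indicator (ball 0 r) h * p h)"
proof (rule bounded_suppI)
  show "\<bar>indicator (ball 0 r) h * p h\<bar> \<le> \<bar>C\<bar>" for h
    using bound[of h] by (cases "h \<in> ball 0 r") auto
  show "indicator (ball 0 r) h * p h = 0" if "r \<le> norm h" for h using that by simp
qed measurable

lemma bounded_supp_ball: "bounded_supp (indicator (ball 0 r))"
  using bounded_supp_ball_mult[of "\<lambda>_. 1" r 1] by simp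

lemma bounded_supp_box: "bounded_supp (indicator (box a b))"
proof -
  obtain R where R: "box a b \<subseteq> ball 0 R" using bounded_box bounded_subset_ballD by blast
  show ?thesis
  proof (rule bounded_suppI)
    show "indicator (box a b) x = (0::real)" if "R \<le> norm x" for x using R that by (auto simp: indicator_def)
    show "\<bar>indicator (box a b) x\<bar> \<le> (1::real)" for x by (simp add: indicator_def)
  qed simp
qed

lemma bounded_supp_shift:
  assumes "bounded_supp \<phi>" shows "bounded_supp (\<lambda>x. \<phi> (x + c))"
proof -
  obtain R B where bounds: "\<And>x. \<bar>\<phi> x\<bar> \<le> B" "\<And>x. R \<le> norm x \<Longrightarrow> \<phi> x = 0"
    by (rule bounded_suppE[OF assms]) (rule that)
  show ?thesis
  proof (rule bounded_suppI)
    show "\<phi> (x + c) = 0" if "R + norm c \<le> norm x" for x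
      using that norm_triangle_ineq4[of "x + c" c] by (intro bounds(2)) simp
  qed (use bounded_supp_measurable[OF assms] bounds(1) in auto)
qed

lemma bounded_supp_add:
  assumes "bounded_supp \<phi>" "bounded_supp \<psi>" shows "bounded_supp (\<lambda>x. \<phi> x + \<psi> x)"
proof -
  obtain R B where bounds: "\<And>x. \<bar>\<phi> x\<bar> \<le> B" "\<And>x. R \<le> norm x \<Longrightarrow> \<phi> x = 0"
    by (rule bounded_suppE[OF assms(1)]) (rule that)
  obtain R' B' where bounds': "\<And>x. \<bar>\<psi> x\<bar> \<le> B'" "\<And>x. R' \<le> norm x \<Longrightarrow> \<psi> x = 0"
    by (rule bounded_suppE[OF assms(2)]) (rule that)
  show ?thesis
  proof (rule bounded_suppI)
    show "\<bar>\<phi> x + \<psi> x\<bar> \<le> B + B'" for x using bounds(1)[of x] bounds'(1)[of x] by linarith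
    show "\<phi> x + \<psi> x = 0" if "max R R' \<le> norm x" for x using bounds(2)[of x] bounds'(2)[of x] that by simp
  qed (use assms[THEN bounded_supp_measurable] in measurable)
qed

lemma bounded_supp_cmult:
  assumes "bounded_supp \<phi>" shows "bounded_supp (\<lambda>x. c * \<phi> x)"
proof -
  obtain R B where bounds: "\<And>x. \<bar>\<phi> x\<bar> \<le> B" "\<And>x. R \<le> norm x \<Longrightarrow> \<phi> x = 0"
    by (rule bounded_suppE[OF assms]) (rule that)
  show ?thesis
  proof (rule bounded_suppI)
    show "\<bar>c * \<phi> x\<bar> \<le> \<bar>c\<bar> * B" for x using bounds(1)[of x] by (simp add: abs_mult mult_left_mono)
  qed (use bounds(2) bounded_supp_measurable[OF assms] in auto)
qed

lemma bounded_supp_integrable: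
  fixes \<phi> :: "'a::euclidean_space \<Rightarrow> real"
  assumes "bounded_supp \<phi>" shows "integrable lborel \<phi>"
proof -
  obtain R B where bounds: "\<And>x. \<bar>\<phi> x\<bar> \<le> B" "\<And>x. R \<le> norm x \<Longrightarrow> \<phi> x = 0"
    by (rule bounded_suppE[OF assms]) (rule that)
  show ?thesis
  proof (rule integrableI_bounded_set[of "ball 0 R"])
    show "emeasure lborel (ball (0 :: 'a) R) < \<infinity>" by (rule emeasure_lborel_ball_finite)
  qed (use assms bounds in auto)
qed

lemma bounded_supp_L2: assumes "bounded_supp \<phi>" shows "L2 lborel \<phi>"
proof -
  obtain R B where bounds: "\<And>x. \<bar>\<phi> x\<bar> \<le> B" "\<And>x. R \<le> norm x \<Longrightarrow> \<phi> x = 0"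
    by (rule bounded_suppE[OF assms]) (rule that)
  have "\<bar>(\<phi> x)\<^sup>2\<bar> \<le> B\<^sup>2" for x using power_mono[OF bounds(1) abs_ge_zero, of x 2] by simp
  then have "bounded_supp (\<lambda>x. (\<phi> x)\<^sup>2)"
    using assms bounds(2) by (intro bounded_suppI[where R=R and B="B\<^sup>2"]) auto
  from bounded_supp_integrable[OF this] assms show ?thesis
    by (simp add: L2_def bounded_supp_def)
qed

definition locally_integrable :: "('a::euclidean_space \<Rightarrow> 'b::{banach,second_countable_topology}) \<Rightarrow> bool" where
  "locally_integrable w \<longleftrightarrow>
    w \<in> borel_measurable borel \<and> (\<forall>a b. integrable lborel (\<lambda>x. indicator (box a b) x *\<^sub>R w x))"

lemma locally_integrable_measurable [measurable_dest]: "locally_integrable w \<Longrightarrow> w \<in> borel_measurable borel"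
  by (simp add: locally_integrable_def)

lemma locally_integrable_ball:
  fixes w :: "'a::euclidean_space \<Rightarrow> 'b::{banach,second_countable_topology}"
  assumes "locally_integrable w" shows "integrable lborel (\<lambda>x. indicator (ball 0 R) x *\<^sub>R w x)"
proof -
  obtain a where "ball (0 :: 'a) R \<subseteq> box (- a) a" using bounded_subset_box_symmetric[OF bounded_ball] by blast
  then have "(\<lambda>x. indicator (ball 0 R) x *\<^sub>R (indicator (box (- a) a) x *\<^sub>R w x)) = (\<lambda>x. indicator (ball 0 R) x *\<^sub>R w x)"
    by (auto simp: indicator_def fun_eq_iff)
  moreover have "integrable lborel (\<lambda>x. indicator (ball 0 R) x *\<^sub>R (indicator (box (- a) a) x *\<^sub>R w x))"
    using integrable_mult_indicator[of "ball 0 R" lborel "\<lambda>x. indicator (box (- a) a) x *\<^sub>R w x"] assms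
    by (simp only: locally_integrable_def) auto
  ultimately show ?thesis by simp
qed

lemma locally_integrable_scaleR_bounded_supp:
  assumes w: "locally_integrable w" and p: "bounded_supp p"
  shows "integrable lborel (\<lambda>x. p x *\<^sub>R w x)"
proof -
  obtain R B where bounds: "\<And>x. \<bar>p x\<bar> \<le> B" "\<And>x. R \<le> norm x \<Longrightarrow> p x = 0"
    by (rule bounded_suppE[OF p]) (rule that)
  show ?thesis
  proof (rule Bochner_Integration.integrable_bound)
    show "integrable lborel (\<lambda>x. B *\<^sub>R (indicator (ball 0 R) x *\<^sub>R w x))"
      by (intro integrable_scaleR_right locally_integrable_ball w)
    have "norm (p x *\<^sub>R w x) \<le> norm (B *\<^sub>R (indicator (ball 0 R) x *\<^sub>R w x))" for x
      using mult_right_mono[OF order_trans[OF bounds(1) abs_ge_self] norm_ge_zero[of "w x"]] bounds(2)[of x]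
      by (cases "norm x < R") auto
    then show "AE x in lborel. norm (p x *\<^sub>R w x) \<le> norm (B *\<^sub>R (indicator (ball 0 R) x *\<^sub>R w x))"
      by simp
  qed (use w p in measurable)
qed

lemma L2_locally_integrable:
  fixes f :: "'a::euclidean_space \<Rightarrow> 'b::euclidean_space"
  assumes f: "L2 lborel f" shows "locally_integrable f"
  unfolding locally_integrable_def
proof (intro conjI allI)
  show [measurable]: "f \<in> borel_measurable borel" using f by (simp add: L2_def)
  fix a b
  show "integrable lborel (\<lambda>x. indicator (box a b) x *\<^sub>R f x)"
  proof (rule Bochner_Integration.integrable_bound)
    show "integrable lborel (\<lambda>x. indicat_real (box a b) x * norm (f x))"
      using L2_inner_integrable[OF bounded_supp_L2[OF bounded_supp_box], of "\<lambda>x. norm (f x)" a b] f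
      by (simp add: L2_def)
  qed auto
qed

lemma locally_integrable_add:
  "locally_integrable f \<Longrightarrow> locally_integrable g \<Longrightarrow> locally_integrable (\<lambda>x. f x + g x)"
  by (auto simp: locally_integrable_def scaleR_add_right)

lemma locally_integrable_diff:
  "locally_integrable f \<Longrightarrow> locally_integrable g \<Longrightarrow> locally_integrable (\<lambda>x. f x - g x)"
  by (auto simp: locally_integrable_def scaleR_diff_right)

lemma locally_integrable_scaleR:
  assumes "locally_integrable f" shows "locally_integrable (\<lambda>x. c *\<^sub>R f x)"
proof -
  have "integrable lborel (\<lambda>x. c *\<^sub>R (indicator (box a b) x *\<^sub>R f x))" for a b
    using assms by (intro integrable_scaleR_right) (simp add: locally_integrable_def)
  then show ?thesis using assms by (auto simp: locally_integrable_def mult.commute)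
qed

lemma locally_integrable_shift:
  assumes f: "locally_integrable f" shows "locally_integrable (\<lambda>x. f (x + h))"
  unfolding locally_integrable_def
proof (intro conjI allI)
  fix a b
  have "integrable lborel (\<lambda>x. indicator (box a b) (x - h) *\<^sub>R f x)"
    using locally_integrable_scaleR_bounded_supp[OF f bounded_supp_shift[OF bounded_supp_box[of a b], of "-h"]]
    by simp
  then show "integrable lborel (\<lambda>x. indicator (box a b) x *\<^sub>R f (x + h))"
    using lborel_preserving_integral(2)[OF lborel_preserving_add, of "\<lambda>x. indicator (box a b) (x - h) *\<^sub>R f x" h] f
    by (simp add: locally_integrable_def)
qed (use locally_integrable_measurable[OF f] in measurable)

lemma set_integral_eq_0_if_box_integrals_eq_0:
  fixes f :: "'a::euclidean_space \<Rightarrow> 'b::{banach,second_countable_topology}"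
  assumes int: "integrable lborel f" and total: "(\<integral>x. f x \<partial>lborel) = 0"
    and box: "\<And>a b. set_lebesgue_integral lborel (box a b) f = 0" and A: "A \<in> sets borel"
  shows "set_lebesgue_integral lborel A f = 0"
proof -
  have sint: "set_integrable lborel A f" if "A \<in> sets borel" for A
    using integrable_mult_indicator[OF _ int] that by (simp add: set_integrable_def)
  have borel: "sets borel = sigma_sets UNIV (range (\<lambda>(a, b). box a b :: 'a set))"
    by (subst borel_eq_box) simp
  have "Int_stable (range (\<lambda>(a, b). box a b :: 'a set))"
    by (auto simp: Int_stable_def box_Int_box)
  moreover have "range (\<lambda>(a, b). box a b :: 'a set) \<subseteq> Pow UNIV" by simp
  ultimately show ?thesis using A unfolding borel
  proof (induction rule: sigma_sets_induct_disjoint)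
    case (basic A)
    then show ?case using box by auto
  next
    case empty
    then show ?case by (simp add: set_lebesgue_integral_def)
  next
    case (compl A)
    have A: "A \<in> sets borel" using compl.hyps borel by simp
    have "set_lebesgue_integral lborel (UNIV - A) f = (\<integral>x. f x - indicator A x *\<^sub>R f x \<partial>lborel)"
      unfolding set_lebesgue_integral_def
      by (intro Bochner_Integration.integral_cong) (auto simp: indicator_def)
    also have "\<dots> = (\<integral>x. f x \<partial>lborel) - set_lebesgue_integral lborel A f"
      unfolding set_lebesgue_integral_def using sint[OF A] int
      by (intro Bochner_Integration.integral_diff) (auto simp: set_integrable_def)
    finally show ?case using compl.IH total by simp
  next
    case (union A)
    have "A i \<in> sets borel" for i using union.hyps borel by auto
    then have "set_lebesgue_integral lborel (\<Union>i. A i) f = (\<Sum>i. set_lebesgue_integral lborel (A i) f)"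
      using union.hyps by (intro lebesgue_integral_countable_add sint) (auto simp: disjoint_family_on_def)
    then show ?case using union.IH by simp
  qed
qed

lemma AE_zero_if_box_integrals_zero:
  fixes w :: "'a::euclidean_space \<Rightarrow> 'b::{banach,second_countable_topology}"
  assumes w: "locally_integrable w"
    and zero: "\<And>a b. (\<integral>x. indicator (box a b) x *\<^sub>R w x \<partial>lborel) = 0"
  shows "AE x in lborel. w x = 0"
proof -
  have "AE x in lborel. indicator (box c d) x *\<^sub>R w x = 0" for c d
  proof (rule sigma_finite_measure.density_zero[OF sigma_finite_lborel])
    show int: "integrable lborel (\<lambda>x. indicator (box c d) x *\<^sub>R w x)"
      using w by (simp add: locally_integrable_def)
    fix A :: "'a set" assume A: "A \<in> sets lborel"
    show "set_lebesgue_integral lborel A (\<lambda>x. indicator (box c d) x *\<^sub>R w x) = 0"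
    proof (rule set_integral_eq_0_if_box_integrals_eq_0[OF int zero])
      fix a b
      have "set_lebesgue_integral lborel (box a b) (\<lambda>x. indicator (box c d) x *\<^sub>R w x)
          = (\<integral>x. indicator (box a b \<inter> box c d) x *\<^sub>R w x \<partial>lborel)"
        by (simp add: set_lebesgue_integral_def indicator_inter_arith mult.commute)
      then show "set_lebesgue_integral lborel (box a b) (\<lambda>x. indicator (box c d) x *\<^sub>R w x) = 0"
        unfolding box_Int_box zero .
    qed (use A in simp)
  qed
  then have "AE x in lborel. \<forall>n::nat. indicator (box (- (real n *\<^sub>R One)) (real n *\<^sub>R One)) x *\<^sub>R w x = 0"
    by (intro AE_all_countable[THEN iffD2]) blast
  then show ?thesis
  proof eventually_elim
    case (elim x)
    obtain n :: nat where "x \<in> box (- (real n *\<^sub>R One)) (real n *\<^sub>R One)"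
      using UN_box_eq_UNIV[where 'a='a] by blast
    then show ?case using elim[rule_format, of n] by simp
  qed
qed

subsection \<open>Smooth bumps and the fundamental lemma of the calculus of variations\<close>

definition flat_exp :: "real poly \<Rightarrow> real \<Rightarrow> real" where
  "flat_exp p x = (if x > 0 then poly p (1/x) * exp (- (1/x)) else 0)"

lemma poly_times_exp_tendsto_0: "((\<lambda>y::real. poly p y * exp (-y)) \<longlongrightarrow> 0) at_top"
proof -
  have "((\<lambda>y::real. \<Sum>i\<le>degree p. coeff p i * (y ^ i / exp y)) \<longlongrightarrow> (\<Sum>i\<le>degree p. coeff p i * 0)) at_top"
    by (intro tendsto_intros tendsto_power_div_exp_0)
  then show ?thesis
    by (simp add: poly_altdef sum_divide_distrib exp_minus field_simps)
qed

lemma flat_exp_over_id_tendsto_0: "((\<lambda>h. flat_exp p h / h) \<longlongrightarrow> 0) (at 0)"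
proof (rule filterlim_split_at)
  have "((\<lambda>h::real. poly (pCons 0 p) (inverse h) * exp (- inverse h)) \<longlongrightarrow> 0) (at_right 0)"
    by (rule filterlim_compose[OF poly_times_exp_tendsto_0 filterlim_inverse_at_top_right])
  moreover have "\<forall>\<^sub>F h in at_right 0. poly (pCons 0 p) (inverse h) * exp (- inverse h) = flat_exp p h / h"
    using eventually_at_right_less[of "0::real"] by eventually_elim (simp add: flat_exp_def field_simps)
  ultimately show "((\<lambda>h. flat_exp p h / h) \<longlongrightarrow> 0) (at_right 0)"
    by (rule Lim_transform_eventually)
  show "((\<lambda>h. flat_exp p h / h) \<longlongrightarrow> 0) (at_left 0)"
    by (rule tendsto_eventually, rule eventually_mono[OF eventually_at_left_field[THEN iffD2, of 0 "\<lambda>h. h < 0"]])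
      (auto simp: flat_exp_def intro!: exI[of _ "-1"])
qed

lemma DERIV_flat_exp:
  "(flat_exp p has_real_derivative flat_exp ((p - pderiv p) * [:0, 0, 1:]) x) (at x)"
proof (cases x "0::real" rule: linorder_cases)
  case less
  have "((\<lambda>x. 0) has_real_derivative 0) (at x)" by simp
  then have "(flat_exp p has_real_derivative 0) (at x)"
    by (rule has_field_derivative_transform_within_open[where S="{..<0}"]) (use less in \<open>auto simp: flat_exp_def\<close>)
  then show ?thesis using less by (simp add: flat_exp_def)
next
  case equal
  have "((\<lambda>h. (flat_exp p (0 + h) - flat_exp p 0) / h) \<longlongrightarrow> 0) (at 0)"
    using flat_exp_over_id_tendsto_0[of p] by (simp add: flat_exp_def[of p 0])
  then have "(flat_exp p has_real_derivative 0) (at 0)" by (simp only: DERIV_def)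
  then show ?thesis using equal by (simp add: flat_exp_def)
next
  case greater
  have "((\<lambda>x. poly p (1/x) * exp (- (1/x))) has_real_derivative
     poly ((p - pderiv p) * [:0, 0, 1:]) (1/x) * exp (- (1/x))) (at x)"
    using greater by (auto intro!: derivative_eq_intros simp: field_simps power2_eq_square)
  then have "(flat_exp p has_real_derivative poly ((p - pderiv p) * [:0, 0, 1:]) (1/x) * exp (- (1/x))) (at x)"
    by (rule has_field_derivative_transform_within_open[where S="{0<..}"]) (use greater in \<open>auto simp: flat_exp_def\<close>)
  then show ?thesis using greater by (simp add: flat_exp_def)
qed

lemma continuous_flat_exp: "continuous_on S (flat_exp p)"
  using DERIV_flat_exp DERIV_continuous by (intro continuous_at_imp_continuous_on) blast

lemma flat_exp_smult: "flat_exp (smult c p) x = c * flat_exp p x"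
  by (simp add: flat_exp_def)

inductive_set flat_algebra :: "(real^2 \<Rightarrow> real) set" where
  base: "(\<lambda>x. flat_exp p (c + s * x $ i)) \<in> flat_algebra"
| add: "f \<in> flat_algebra \<Longrightarrow> g \<in> flat_algebra \<Longrightarrow> (\<lambda>x. f x + g x) \<in> flat_algebra"
| mult: "f \<in> flat_algebra \<Longrightarrow> g \<in> flat_algebra \<Longrightarrow> (\<lambda>x. f x * g x) \<in> flat_algebra"

lemma flat_algebra_continuous: "g \<in> flat_algebra \<Longrightarrow> continuous_on UNIV g"
proof (induction rule: flat_algebra.induct)
  case (base p c s i)
  show ?case
    by (rule continuous_on_compose2[OF continuous_flat_exp[of UNIV]]) (auto intro!: continuous_intros)
qed (auto intro: continuous_on_add continuous_on_mult)

lemma flat_algebra_partial: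
  assumes "g \<in> flat_algebra"
  shows "\<exists>h\<in>flat_algebra. \<forall>x. ((\<lambda>t. g (x + t *\<^sub>R axis i 1)) has_real_derivative h x) (at 0)"
  using assms
proof (induction rule: flat_algebra.induct)
  case (base p c s j)
  let ?q = "smult (s * axis i 1 $ j) ((p - pderiv p) * [:0, 0, 1:])"
  have "((\<lambda>t. flat_exp p (c + s * (x + t *\<^sub>R axis i 1) $ j)) has_real_derivative flat_exp ?q (c + s * x $ j)) (at 0)"
    for x :: "real^2"
  proof -
    have "((\<lambda>t. c + s * (x + t *\<^sub>R axis i 1) $ j) has_real_derivative s * axis i 1 $ j) (at 0)"
      by (auto intro!: derivative_eq_intros)
    from DERIV_chain2[OF DERIV_flat_exp this]
    show ?thesis unfolding flat_exp_smult by (simp add: mult.commute)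
  qed
  then show ?case by (intro bexI[OF _ flat_algebra.base[of ?q c s j]] allI)
next
  case (add f g)
  then obtain f' g' where "f' \<in> flat_algebra" "g' \<in> flat_algebra"
    "\<And>x. ((\<lambda>t. f (x + t *\<^sub>R axis i 1)) has_real_derivative f' x) (at 0)"
    "\<And>x. ((\<lambda>t. g (x + t *\<^sub>R axis i 1)) has_real_derivative g' x) (at 0)"
    by blast
  then show ?case by (intro bexI[OF _ flat_algebra.add[of f' g']] allI DERIV_add)
next
  case (mult f g)
  then obtain f' g' where fg: "f' \<in> flat_algebra" "g' \<in> flat_algebra"
    "\<And>x. ((\<lambda>t. f (x + t *\<^sub>R axis i 1)) has_real_derivative f' x) (at 0)"
    "\<And>x. ((\<lambda>t. g (x + t *\<^sub>R axis i 1)) has_real_derivative g' x) (at 0)"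
    by blast
  have "(\<lambda>x. f x * g' x + f' x * g x) \<in> flat_algebra"
    by (intro flat_algebra.add flat_algebra.mult mult.hyps fg)
  moreover have "((\<lambda>t. f (x + t *\<^sub>R axis i 1) * g (x + t *\<^sub>R axis i 1))
      has_real_derivative f x * g' x + f' x * g x) (at 0)" for x
    using DERIV_mult[OF fg(3)[of x] fg(4)[of x]] by (simp add: algebra_simps)
  ultimately show ?case by (intro bexI allI)
qed

lemma flat_algebra_smooth: "g \<in> flat_algebra \<Longrightarrow> smooth_fun g"
  unfolding smooth_fun_def using flat_algebra_continuous flat_algebra_partial
  by (intro exI[of _ flat_algebra]) blast

lemma smooth_fun_continuous: "smooth_fun \<phi> \<Longrightarrow> continuous_on UNIV \<phi>"
  unfolding smooth_fun_def by blast

lemma smooth_fun_shift: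
  assumes "smooth_fun \<phi>" shows "smooth_fun (\<lambda>x. \<phi> (x + c))"
proof -
  obtain S where S: "\<phi> \<in> S" "\<And>g. g \<in> S \<Longrightarrow> continuous_on UNIV g"
    "\<And>g i. g \<in> S \<Longrightarrow> \<exists>h\<in>S. \<forall>x. ((\<lambda>t. g (x + t *\<^sub>R axis i 1)) has_real_derivative h x) (at 0)"
    using assms unfolding smooth_fun_def by blast
  let ?T = "(\<lambda>g x. g (x + c)) ` S"
  show ?thesis
    unfolding smooth_fun_def
  proof (intro exI[of _ ?T] conjI ballI allI)
    show "(\<lambda>x. \<phi> (x + c)) \<in> ?T" using S(1) by blast
    fix g' assume "g' \<in> ?T"
    then obtain g where g: "g \<in> S" "g' = (\<lambda>x. g (x + c))" by blast
    show "continuous_on UNIV g'"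
      unfolding g(2) by (rule continuous_on_compose2[OF S(2)[OF g(1)]]) (auto intro!: continuous_intros)
    fix i :: 2
    obtain h where h: "h \<in> S" "\<And>x. ((\<lambda>t. g (x + t *\<^sub>R axis i 1)) has_real_derivative h x) (at 0)"
      using S(3)[OF g(1)] by blast
    have "((\<lambda>t. g' (x + t *\<^sub>R axis i 1)) has_real_derivative h (x + c)) (at 0)" for x
      using h(2)[of "x + c"] by (simp add: g(2) add.assoc add.commute[of c])
    with h(1) show "\<exists>h\<in>?T. \<forall>x. ((\<lambda>t. g' (x + t *\<^sub>R axis i 1)) has_real_derivative h x) (at 0)"
      by (intro bexI[of _ "\<lambda>x. h (x + c)"]) blast+
  qed
qed

lemma smooth_fun_add:
  assumes "smooth_fun \<phi>" "smooth_fun \<psi>" shows "smooth_fun (\<lambda>x. \<phi> x + \<psi> x)"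
proof -
  obtain S where S: "\<phi> \<in> S" "\<And>g. g \<in> S \<Longrightarrow> continuous_on UNIV g"
    "\<And>g i. g \<in> S \<Longrightarrow> \<exists>h\<in>S. \<forall>x. ((\<lambda>t. g (x + t *\<^sub>R axis i 1)) has_real_derivative h x) (at 0)"
    using assms(1) unfolding smooth_fun_def by blast
  obtain T where T: "\<psi> \<in> T" "\<And>g. g \<in> T \<Longrightarrow> continuous_on UNIV g"
    "\<And>g i. g \<in> T \<Longrightarrow> \<exists>h\<in>T. \<forall>x. ((\<lambda>t. g (x + t *\<^sub>R axis i 1)) has_real_derivative h x) (at 0)"
    using assms(2) unfolding smooth_fun_def by blast
  let ?U = "{\<lambda>x. f x + g x |f g. f \<in> S \<and> g \<in> T}"
  show ?thesis
    unfolding smooth_fun_def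
  proof (intro exI[of _ ?U] conjI ballI allI)
    show "(\<lambda>x. \<phi> x + \<psi> x) \<in> ?U" using S(1) T(1) by blast
    fix u assume "u \<in> ?U"
    then obtain f g where fg: "f \<in> S" "g \<in> T" "u = (\<lambda>x. f x + g x)" by blast
    show "continuous_on UNIV u" unfolding fg(3) by (intro continuous_on_add S T fg)
    fix i :: 2
    obtain f' where f': "f' \<in> S" "\<And>x. ((\<lambda>t. f (x + t *\<^sub>R axis i 1)) has_real_derivative f' x) (at 0)"
      using S(3)[OF fg(1)] by blast
    obtain g' where g': "g' \<in> T" "\<And>x. ((\<lambda>t. g (x + t *\<^sub>R axis i 1)) has_real_derivative g' x) (at 0)"
      using T(3)[OF fg(2)] by blast
    have "((\<lambda>t. u (x + t *\<^sub>R axis i 1)) has_real_derivative f' x + g' x) (at 0)" for x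
      unfolding fg(3) by (rule DERIV_add[OF f'(2) g'(2)])
    with f'(1) g'(1) show "\<exists>h\<in>?U. \<forall>x. ((\<lambda>t. u (x + t *\<^sub>R axis i 1)) has_real_derivative h x) (at 0)"
      by (intro bexI[of _ "\<lambda>x. f' x + g' x"]) blast+
  qed
qed

lemma test_fun_iff: "test_fun \<phi> \<longleftrightarrow> smooth_fun \<phi> \<and> bounded {x. \<phi> x \<noteq> 0}"
  by (simp add: test_fun_def compact_closure)

lemma test_fun_bounded_supp: "test_fun \<phi> \<Longrightarrow> bounded_supp \<phi>"
  using continuous_bounded_supp smooth_fun_continuous unfolding test_fun_iff by blast

lemma test_fun_shift:
  assumes "test_fun \<phi>" shows "test_fun (\<lambda>x. \<phi> (x + c))"
proof -
  have "{x. \<phi> (x + c) \<noteq> 0} = (\<lambda>x. x - c) ` {x. \<phi> x \<noteq> 0}" by (force simp: image_iff)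
  then show ?thesis
    using assms smooth_fun_shift bounded_translation_minus unfolding test_fun_iff by metis
qed

lemma test_fun_add:
  assumes "test_fun \<phi>" "test_fun \<psi>" shows "test_fun (\<lambda>x. \<phi> x + \<psi> x)"
proof -
  have "{x. \<phi> x + \<psi> x \<noteq> 0} \<subseteq> {x. \<phi> x \<noteq> 0} \<union> {x. \<psi> x \<noteq> 0}" by auto
  then have "bounded {x. \<phi> x + \<psi> x \<noteq> 0}"
    by (rule bounded_subset[rotated]) (use assms in \<open>simp add: test_fun_iff\<close>)
  then show ?thesis using assms smooth_fun_add by (simp add: test_fun_iff)
qed

definition box_bump :: "real \<Rightarrow> real^2 \<Rightarrow> real^2 \<Rightarrow> real^2 \<Rightarrow> real" where
  "box_bump n a b x = (flat_exp 1 (n * x$1 - n * a$1) * flat_exp 1 (n * b$1 - n * x$1)) *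
                  (flat_exp 1 (n * x$2 - n * a$2) * flat_exp 1 (n * b$2 - n * x$2))"

lemma flat_exp_1: "flat_exp 1 x = (if x > 0 then exp (- (1/x)) else 0)"
  by (simp add: flat_exp_def)

lemma flat_exp_1_bounds: "0 \<le> flat_exp 1 x" "flat_exp 1 x \<le> 1"
  by (auto simp: flat_exp_1)

lemma box_bump_bounds: "0 \<le> box_bump n a b x" "box_bump n a b x \<le> 1"
  unfolding box_bump_def by (intro mult_nonneg_nonneg flat_exp_1_bounds mult_le_one)+

lemma in_box_2: "x \<in> box a b \<longleftrightarrow> a$1 < x$1 \<and> x$1 < b$1 \<and> a$2 < x$2 \<and> x$2 < (b::real^2)$2"
  by (auto simp: mem_box_cart forall_2)

lemma box_bump_outside: assumes "n > 0" "x \<notin> box a b" shows "box_bump n a b x = 0"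
proof -
  have flat: "flat_exp 1 (n * s - n * t) = 0" if "s \<le> t" for s t
    using that \<open>n > 0\<close> by (simp add: flat_exp_1)
  from assms(2) have "x$1 \<le> a$1 \<or> b$1 \<le> x$1 \<or> x$2 \<le> a$2 \<or> b$2 \<le> x$2" by (auto simp: in_box_2)
  then show ?thesis unfolding box_bump_def using flat by auto
qed

lemma box_bump_inside: assumes "n > 0" "x \<in> box a b" shows "box_bump n a b x > 0"
proof -
  have "flat_exp 1 (n * s - n * t) > 0" if "s > t" for s t
    using that \<open>n > 0\<close> by (simp add: flat_exp_1)
  then show ?thesis using assms(2) unfolding box_bump_def by (simp add: in_box_2)
qed

lemma box_bump_in_flat_algebra: "box_bump n a b \<in> flat_algebra"
proof -
  have lower: "(\<lambda>x. flat_exp 1 (n * x$i - n * a$i)) \<in> flat_algebra" for i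
    using flat_algebra.base[of 1 "- (n * a$i)" n i] by simp
  have upper: "(\<lambda>x. flat_exp 1 (n * b$i - n * x$i)) \<in> flat_algebra" for i
    using flat_algebra.base[of 1 "n * b$i" "-n" i] by simp
  have "box_bump n a b = (\<lambda>x. (flat_exp 1 (n * x$1 - n * a$1) * flat_exp 1 (n * b$1 - n * x$1)) *
                  (flat_exp 1 (n * x$2 - n * a$2) * flat_exp 1 (n * b$2 - n * x$2)))"
    by (simp add: box_bump_def fun_eq_iff)
  then show ?thesis
    using flat_algebra.mult[OF flat_algebra.mult[OF lower[of 1] upper[of 1]]
      flat_algebra.mult[OF lower[of 2] upper[of 2]]]
    by simp
qed

lemma box_bump_test_fun: assumes "n > 0" shows "test_fun (box_bump n a b)"
proof -
  have "{x. box_bump n a b x \<noteq> 0} \<subseteq> box a b" using box_bump_outside[OF assms] by blast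
  then have "bounded {x. box_bump n a b x \<noteq> 0}" using bounded_box bounded_subset by blast
  then show ?thesis by (simp add: test_fun_iff flat_algebra_smooth[OF box_bump_in_flat_algebra])
qed

lemma box_bump_measurable [measurable]: "box_bump n a b \<in> borel_measurable borel"
  by (rule borel_measurable_continuous_onI[OF flat_algebra_continuous[OF box_bump_in_flat_algebra]])

lemma flat_exp_scaled_tendsto: assumes "y > 0" shows "(\<lambda>n. flat_exp 1 (real n * y)) \<longlonglongrightarrow> 1"
proof -
  have "(\<lambda>n. exp (- ((1/y) * (1 / real n)))) \<longlonglongrightarrow> exp (- ((1/y) * 0))"
    by (intro tendsto_intros lim_1_over_n)
  moreover have "\<forall>\<^sub>F n in sequentially. exp (- ((1/y) * (1 / real n))) = flat_exp 1 (real n * y)"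
    using eventually_gt_at_top[of 0] by eventually_elim (use assms in \<open>simp add: flat_exp_1 mult.commute\<close>)
  ultimately show ?thesis by (simp add: tendsto_cong)
qed

lemma box_bump_tendsto: "(\<lambda>n. box_bump (real n) a b x) \<longlonglongrightarrow> indicator (box a b) x"
proof (cases "x \<in> box a b")
  case True
  then have "(\<lambda>n. box_bump (real n) a b x) \<longlonglongrightarrow> (1 * 1) * (1 * 1)"
    unfolding box_bump_def right_diff_distrib[symmetric]
    by (intro tendsto_mult flat_exp_scaled_tendsto) (auto simp: in_box_2)
  then show ?thesis using True by simp
next
  case False
  have "\<forall>\<^sub>F n in sequentially. box_bump (real n) a b x = 0"
    using eventually_gt_at_top[of 0] by eventually_elim (use False box_bump_outside in simp)
  then show ?thesis using False by (simp add: tendsto_eventually)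
qed

theorem fundamental_lemma_of_variations:
  fixes w :: "real^2 \<Rightarrow> 'b::{banach,second_countable_topology}"
  assumes w: "locally_integrable w" and zero: "\<And>\<phi>. test_fun \<phi> \<Longrightarrow> (\<integral>x. \<phi> x *\<^sub>R w x \<partial>lborel) = 0"
  shows "AE x in lborel. w x = 0"
proof (rule AE_zero_if_box_integrals_zero[OF w])
  fix a b
  note [measurable] = locally_integrable_measurable[OF w]
  let ?\<phi> = "\<lambda>n. box_bump (real (Suc n)) a b"
  have "(\<lambda>n. \<integral>x. ?\<phi> n x *\<^sub>R w x \<partial>lborel) \<longlonglongrightarrow> (\<integral>x. indicator (box a b) x *\<^sub>R w x \<partial>lborel)"
  proof (rule integral_dominated_convergence)
    show "integrable lborel (\<lambda>x. norm (indicator (box a b) x *\<^sub>R w x))"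
      using w by (intro integrable_norm) (simp add: locally_integrable_def)
    show "AE x in lborel. (\<lambda>n. ?\<phi> n x *\<^sub>R w x) \<longlonglongrightarrow> indicator (box a b) x *\<^sub>R w x"
      by (intro AE_I2 tendsto_scaleR tendsto_const LIMSEQ_Suc[OF box_bump_tendsto])
    show "AE x in lborel. norm (?\<phi> n x *\<^sub>R w x) \<le> norm (indicator (box a b) x *\<^sub>R w x)" for n
      using box_bump_outside[of "real (Suc n)" _ a b] box_bump_bounds[of "real (Suc n)" a b]
      by (intro AE_I2) (auto simp: indicator_def intro!: mult_left_le_one_le)
  qed auto
  then show "(\<integral>x. indicator (box a b) x *\<^sub>R w x \<partial>lborel) = 0"
    using zero[OF box_bump_test_fun] by (simp add: LIMSEQ_const_iff)
qed

subsection \<open>Increments of differentiable functions\<close>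

definition has_partials :: "(real^2 \<Rightarrow> real) \<Rightarrow> (2 \<Rightarrow> real^2 \<Rightarrow> real) \<Rightarrow> bool" where
  "has_partials \<phi> d \<longleftrightarrow>
     (\<forall>i x. ((\<lambda>t. \<phi> (x + t *\<^sub>R axis i 1)) has_real_derivative d i x) (at 0)) \<and>
     (\<forall>i. continuous_on UNIV (d i))"

definition directional :: "real ^ 'n \<Rightarrow> ('n \<Rightarrow> 'a \<Rightarrow> 'b::real_vector) \<Rightarrow> 'a \<Rightarrow> 'b" where
  "directional h g x = (\<Sum>i\<in>UNIV. h $ i *\<^sub>R g i x)"

lemma directional_2: "directional (h :: real^2) g x = h $ 1 *\<^sub>R g 1 x + h $ 2 *\<^sub>R g 2 x"
  by (simp add: directional_def sum_2)

lemma directional_minus: "directional (- h) g x = - directional h g x"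
  by (simp add: directional_def sum_negf)

lemma directional_measurable [measurable (raw)]:
  fixes g :: "'n::finite \<Rightarrow> 'a \<Rightarrow> 'b::{second_countable_topology,real_normed_vector}"
  assumes "\<And>i. g i \<in> borel_measurable M"
  shows "directional h g \<in> borel_measurable M"
  unfolding directional_def by (intro borel_measurable_sum borel_measurable_scaleR assms) simp

lemma has_partials_partial:
  "has_partials \<phi> d \<Longrightarrow> ((\<lambda>t. \<phi> (x + t *\<^sub>R axis i 1)) has_real_derivative d i x) (at 0)"
  by (simp add: has_partials_def)

lemma has_partials_continuous: "has_partials \<phi> d \<Longrightarrow> continuous_on UNIV (d i)"
  by (simp add: has_partials_def)

lemma has_partials_measurable: "has_partials \<phi> d \<Longrightarrow> d i \<in> borel_measurable borel"
  by (intro borel_measurable_continuous_onI has_partials_continuous)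

lemma smooth_fun_has_partials: assumes "smooth_fun \<phi>" obtains d where "has_partials \<phi> d"
proof -
  from assms obtain S where S: "\<phi> \<in> S" "\<And>g. g \<in> S \<Longrightarrow> continuous_on UNIV g"
    "\<And>g i. g \<in> S \<Longrightarrow> \<exists>h\<in>S. \<forall>x. ((\<lambda>t. g (x + t *\<^sub>R axis i 1)) has_real_derivative h x) (at 0)"
    unfolding smooth_fun_def by blast
  from S(3)[OF S(1)] obtain d where "\<And>i. d i \<in> S"
    "\<And>i x. ((\<lambda>t. \<phi> (x + t *\<^sub>R axis i 1)) has_real_derivative d i x) (at 0)" by metis
  with S(2) show ?thesis by (intro that[of d]) (simp add: has_partials_def)
qed

lemma has_partials_unique:
  assumes "has_partials \<phi> d" "\<And>x. ((\<lambda>t. \<phi> (x + t *\<^sub>R axis i 1)) has_real_derivative e x) (at 0)"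
  shows "e = d i"
  using DERIV_unique[OF assms(2) has_partials_partial[OF assms(1)]] by blast

lemma has_partials_shift:
  assumes "has_partials \<phi> d" shows "has_partials (\<lambda>x. \<phi> (x + c)) (\<lambda>i x. d i (x + c))"
  unfolding has_partials_def
proof (intro conjI allI)
  fix i x
  have "((\<lambda>t. \<phi> ((x + c) + t *\<^sub>R axis i 1)) has_real_derivative d i (x + c)) (at 0)"
    by (rule has_partials_partial[OF assms])
  then show "((\<lambda>t. \<phi> (x + t *\<^sub>R axis i 1 + c)) has_real_derivative d i (x + c)) (at 0)"
    by (simp add: add.assoc add.commute[of c])
  show "continuous_on UNIV (\<lambda>x. d i (x + c))"
    by (rule continuous_on_compose2[OF has_partials_continuous[OF assms]]) (auto intro!: continuous_intros)
qed

lemma axis_mvt: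
  assumes "has_partials \<phi> d"
  shows "\<exists>s. \<bar>s\<bar> \<le> \<bar>t\<bar> \<and> \<phi> (x + t *\<^sub>R axis i 1) - \<phi> x = t * d i (x + s *\<^sub>R axis i 1)"
proof -
  have deriv: "((\<lambda>t. \<phi> (x + t *\<^sub>R axis i 1)) has_real_derivative d i (x + s *\<^sub>R axis i 1)) (at s)" for s
  proof -
    have "((\<lambda>t. \<phi> ((x + s *\<^sub>R axis i 1) + t *\<^sub>R axis i 1)) has_real_derivative d i (x + s *\<^sub>R axis i 1)) (at 0)"
      by (rule has_partials_partial[OF assms])
    then have "((\<lambda>t. \<phi> (x + (t + s) *\<^sub>R axis i 1)) has_real_derivative d i (x + s *\<^sub>R axis i 1)) (at 0)"
      by (simp add: algebra_simps)
    then show ?thesis using DERIV_shift[of "\<lambda>t. \<phi> (x + t *\<^sub>R axis i 1)" "d i (x + s *\<^sub>R axis i 1)" 0 s] by simp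
  qed
  consider (zero) "t = 0" | (pos) "t > 0" | (neg) "t < 0" by linarith
  then show ?thesis
  proof cases
    case zero
    then show ?thesis by auto
  next
    case pos
    from MVT2[OF this, of "\<lambda>t. \<phi> (x + t *\<^sub>R axis i 1)" "\<lambda>s. d i (x + s *\<^sub>R axis i 1)"] deriv
    obtain s where "0 < s" "s < t" "\<phi> (x + t *\<^sub>R axis i 1) - \<phi> (x + 0 *\<^sub>R axis i 1) = (t - 0) * d i (x + s *\<^sub>R axis i 1)"
      by blast
    then show ?thesis by (intro exI[of _ s]) auto
  next
    case neg
    from MVT2[OF this, of "\<lambda>t. \<phi> (x + t *\<^sub>R axis i 1)" "\<lambda>s. d i (x + s *\<^sub>R axis i 1)"] deriv
    obtain s where "t < s" "s < 0" "\<phi> (x + 0 *\<^sub>R axis i 1) - \<phi> (x + t *\<^sub>R axis i 1) = (0 - t) * d i (x + s *\<^sub>R axis i 1)"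
      by blast
    then show ?thesis by (intro exI[of _ s]) auto
  qed
qed

lemma vec2_axis: "(h::real^2) = h$1 *\<^sub>R axis 1 1 + h$2 *\<^sub>R axis 2 1"
  by (simp add: vec_eq_iff axis_def forall_2)

lemma norm_sq_2: "(norm (h::real^2))\<^sup>2 = (h$1)\<^sup>2 + (h$2)\<^sup>2"
  by (simp add: norm_vec_def L2_set_def sum_2)

lemma norm_axis_partial: "\<bar>s\<bar> \<le> \<bar>h$2\<bar> \<Longrightarrow> norm (h$1 *\<^sub>R axis 1 1 + s *\<^sub>R axis 2 1 :: real^2) \<le> norm (h::real^2)"
  by (rule power2_le_imp_le) (simp_all add: norm_sq_2 axis_def abs_le_square_iff)

lemma increment_partials:
  assumes "has_partials \<phi> d"
  shows "\<exists>p q. norm (p - x) \<le> norm h \<and> norm (q - x) \<le> norm h \<and> \<phi> (x + h) - \<phi> x = h$1 * d 1 p + h$2 * d 2 q"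
proof -
  let ?y = "x + h$1 *\<^sub>R axis 1 1"
  obtain s where s: "\<bar>s\<bar> \<le> \<bar>h$1\<bar>" "\<phi> ?y - \<phi> x = h$1 * d 1 (x + s *\<^sub>R axis 1 1)"
    using axis_mvt[OF assms, of "h$1" x 1] by blast
  obtain r where r: "\<bar>r\<bar> \<le> \<bar>h$2\<bar>"
    "\<phi> (?y + h$2 *\<^sub>R axis 2 1) - \<phi> ?y = h$2 * d 2 (?y + r *\<^sub>R axis 2 1)"
    using axis_mvt[OF assms, of "h$2" ?y 2] by blast
  have "?y + h$2 *\<^sub>R axis 2 1 = x + h" using vec2_axis[of h] by (simp add: add.assoc)
  moreover have "norm (s *\<^sub>R axis 1 1 :: real^2) \<le> norm h"
    using s(1) component_le_norm_cart[of h 1] by simp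
  moreover have "norm (h$1 *\<^sub>R axis 1 1 + r *\<^sub>R axis 2 1 :: real^2) \<le> norm h"
    by (rule norm_axis_partial[OF r(1)])
  ultimately show ?thesis
    using s(2) r(2)
    by (intro exI[of _ "x + s *\<^sub>R axis 1 1"] exI[of _ "?y + r *\<^sub>R axis 2 1"]) (simp add: algebra_simps)
qed

lemma increment_partials_error:
  assumes "has_partials \<phi> d"
    and e: "\<And>i y. norm (y - x) \<le> norm h \<Longrightarrow> \<bar>d i y - d i x\<bar> \<le> e"
  shows "\<bar>\<phi> (x + h) - \<phi> x - directional h d x\<bar> \<le> 2 * e * norm h"
proof -
  obtain p q where pq: "norm (p - x) \<le> norm h" "norm (q - x) \<le> norm h"
      "\<phi> (x + h) - \<phi> x = h$1 * d 1 p + h$2 * d 2 q"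
    using increment_partials[OF assms(1)] by blast
  have "\<phi> (x + h) - \<phi> x - directional h d x = h$1 * (d 1 p - d 1 x) + h$2 * (d 2 q - d 2 x)"
    using pq(3) by (simp add: directional_2 algebra_simps)
  also have "\<bar>\<dots>\<bar> \<le> \<bar>h$1\<bar> * \<bar>d 1 p - d 1 x\<bar> + \<bar>h$2\<bar> * \<bar>d 2 q - d 2 x\<bar>"
    by (metis abs_mult abs_triangle_ineq)
  also have "\<dots> \<le> norm h * e + norm h * e"
    using e[OF pq(1)] e[OF pq(2)] component_le_norm_cart[of h] by (intro add_mono mult_mono) auto
  finally show ?thesis by simp
qed

lemma has_partials_has_derivative:
  assumes "has_partials \<phi> d"
  shows "(\<phi> has_derivative (\<lambda>h. directional h d x)) (at x)"
  unfolding has_derivative_at_alt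
proof (intro conjI allI impI)
  show "bounded_linear (\<lambda>h. directional h d x)"
    unfolding directional_def real_scaleR_def
    by (intro bounded_linear_sum bounded_linear_mult_const bounded_linear_vec_nth)
  fix e :: real assume "e > 0"
  have "\<exists>r>0. \<forall>y. dist y x < r \<longrightarrow> dist (d i y) (d i x) < e/2" for i
    using has_partials_continuous[OF assms] \<open>e > 0\<close> unfolding continuous_on_iff
    by (metis UNIV_I half_gt_zero)
  then obtain r where r: "\<And>i. r i > 0" "\<And>i y. dist y x < r i \<Longrightarrow> dist (d i y) (d i x) < e/2" by metis
  show "\<exists>s>0. \<forall>y. norm (y - x) < s \<longrightarrow> norm (\<phi> y - \<phi> x - directional (y - x) d x) \<le> e * norm (y - x)"
  proof (intro exI[of _ "Min (range r)"] conjI allI impI)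
    show "0 < Min (range r)" using r(1) by simp
    fix y assume y: "norm (y - x) < Min (range r)"
    have "\<bar>d i z - d i x\<bar> \<le> e/2" if "norm (z - x) \<le> norm (y - x)" for i z
    proof -
      have "Min (range r) \<le> r i" by simp
      with that y have "dist z x < r i" unfolding dist_norm by linarith
      then show ?thesis using r(2)[of z i] by (simp add: dist_real_def)
    qed
    from increment_partials_error[OF assms, of x "y - x", OF this]
    show "norm (\<phi> y - \<phi> x - directional (y - x) d x) \<le> e * norm (y - x)"
      by simp
  qed
qed

lemma increment_integral:
  assumes partials: "has_partials \<phi> d"
  shows "(\<integral>t. indicator {0..1} t *\<^sub>R directional h d (x + t *\<^sub>R h) \<partial>lborel) = \<phi> (x + h) - \<phi> x"
proof -
  let ?f = "\<lambda>t. directional h d (x + t *\<^sub>R h)"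
  have deriv: "((\<lambda>t. \<phi> (x + t *\<^sub>R h)) has_vector_derivative ?f t) (at t within S)" for t S
  proof -
    have "((\<lambda>t. x + t *\<^sub>R h) has_derivative (\<lambda>s. s *\<^sub>R h)) (at t)"
      by (auto intro!: derivative_eq_intros)
    from has_derivative_compose[OF this has_partials_has_derivative[OF partials]]
    have "((\<lambda>t. \<phi> (x + t *\<^sub>R h)) has_vector_derivative ?f t) (at t)"
      unfolding has_vector_derivative_def
      by (rule has_derivative_eq_rhs) (auto simp: directional_2 algebra_simps)
    then show ?thesis by (rule has_vector_derivative_at_within)
  qed
  have "continuous_on {0..1} ?f"
    unfolding directional_2
    by (intro continuous_intros continuous_on_compose2[OF has_partials_continuous[OF partials]]) auto
  from integral_FTC_Icc[OF zero_le_one deriv this]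
  show ?thesis by (simp add: mult.commute)
qed

lemma partial_zero_outside_support:
  assumes partials: "has_partials \<phi> d" and x: "x \<notin> closure {x. \<phi> x \<noteq> 0}"
  shows "d i x = 0"
proof -
  let ?U = "- closure {x. \<phi> x \<noteq> 0}"
  have "((\<lambda>_. 0) has_derivative (\<lambda>h. directional h d x)) (at x)"
  proof (rule has_derivative_transform_within_open[OF has_partials_has_derivative[OF partials], of ?U])
    show "\<phi> y = 0" if "y \<in> ?U" for y using that closure_subset[of "{x. \<phi> x \<noteq> 0}"] by blast
  qed (use x in auto)
  then have "(\<lambda>h. directional h d x) = (\<lambda>h. 0)"
    by (rule has_derivative_unique) simp
  from fun_cong[OF this, of "axis i 1"] show ?thesis
    by (simp add: directional_def axis_def if_distrib[of "\<lambda>t. t * _"] cong: if_cong)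
qed

lemma test_fun_partials:
  assumes "test_fun \<phi>"
  obtains d where "has_partials \<phi> d" "\<And>i. bounded_supp (d i)"
proof -
  obtain d where d: "has_partials \<phi> d"
    using assms smooth_fun_has_partials unfolding test_fun_iff by blast
  have "bounded (closure {x. \<phi> x \<noteq> 0})" using assms by (simp add: test_fun_iff bounded_closure)
  moreover have "{x. d i x \<noteq> 0} \<subseteq> closure {x. \<phi> x \<noteq> 0}" for i
    using partial_zero_outside_support[OF d] by blast
  ultimately have "bounded_supp (d i)" for i
    using continuous_bounded_supp[OF has_partials_continuous[OF d]] bounded_subset by blast
  with d show ?thesis by (rule that)
qed

lemma weak_partialD:
  assumes "weak_partial u i g" "test_fun \<phi>" "has_partials \<phi> d"
  shows "(\<integral>x. d i x *\<^sub>R u x \<partial>lborel) = - (\<integral>x. \<phi> x *\<^sub>R g x \<partial>lborel)"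
  using assms(1)[unfolded weak_partial_def, rule_format, of \<phi> "d i"] assms(2) has_partials_partial[OF assms(3)]
  by (simp add: scaleR_conv_of_real)

lemma weak_partialI:
  assumes "\<And>\<phi> d. test_fun \<phi> \<Longrightarrow> has_partials \<phi> d \<Longrightarrow>
    (\<integral>x. d i x *\<^sub>R u x \<partial>lborel) = - (\<integral>x. \<phi> x *\<^sub>R g x \<partial>lborel)"
  shows "weak_partial u i g"
  unfolding weak_partial_def scaleR_conv_of_real[symmetric]
proof (intro allI impI)
  fix \<phi> e assume *: "test_fun \<phi> \<and> (\<forall>x. ((\<lambda>t. \<phi> (x + t *\<^sub>R axis i 1)) has_real_derivative e x) (at 0))"
  then obtain d where d: "has_partials \<phi> d" using test_fun_partials by blast
  from * has_partials_unique[OF d, of i e] have "e = d i" by blast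
  with assms[OF _ d] * show "(\<integral>x. e x *\<^sub>R u x \<partial>lborel) = - (\<integral>x. \<phi> x *\<^sub>R g x \<partial>lborel)" by simp
qed

definition weak_gradient :: "(real^2 \<Rightarrow> complex) \<Rightarrow> (2 \<Rightarrow> real^2 \<Rightarrow> complex) \<Rightarrow> bool" where
  "weak_gradient u g \<longleftrightarrow> (\<forall>i. weak_partial u i (g i))"

lemma weak_gradient_2: "weak_gradient u g \<longleftrightarrow> weak_partial u 1 (g 1) \<and> weak_partial u 2 (g 2)"
  by (simp add: weak_gradient_def forall_2)

subsection \<open>Translates of functions with a weak gradient\<close>

lemma unit_interval_pair_integrable:
  fixes G :: "'a::euclidean_space \<Rightarrow> 'b::{banach,second_countable_topology}" and p :: "real \<Rightarrow> 'a \<Rightarrow> real"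
  assumes G: "locally_integrable G" and p [measurable]: "case_prod p \<in> borel_measurable (borel \<Otimes>\<^sub>M borel)"
    and B: "B \<ge> 0" "\<And>t x. t \<in> {0..1} \<Longrightarrow> \<bar>p t x\<bar> \<le> B"
    and supp: "\<And>t x. t \<in> {0..1} \<Longrightarrow> R \<le> norm x \<Longrightarrow> p t x = 0"
  shows "integrable (lborel \<Otimes>\<^sub>M lborel) (\<lambda>(t, x). (indicator {0..1} t * p t x) *\<^sub>R G (x + t *\<^sub>R h))"
proof -
  note [measurable] = locally_integrable_measurable[OF G]
  let ?G = "\<lambda>x. indicator (ball 0 (R + norm h)) x *\<^sub>R G x"
  define K where "K = (\<integral>x. norm (?G x) \<partial>lborel)"
  have K: "(\<integral>\<^sup>+x. ennreal (norm (?G x)) \<partial>lborel) = ennreal K" "K \<ge> 0"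
    unfolding K_def using nn_integral_eq_integral[OF integrable_norm[OF locally_integrable_ball[OF G]]] by auto
  have slice: "(\<integral>\<^sup>+x. ennreal (norm ((indicator {0..1} t * p t x) *\<^sub>R G (x + t *\<^sub>R h))) \<partial>lborel)
      \<le> indicator {0..1} t * ennreal (B * K)" for t :: real
  proof (cases "t \<in> {0..1}")
    case True
    have "norm ((indicator {0..1} t * p t x) *\<^sub>R G (x + t *\<^sub>R h)) \<le> B * norm (?G (x + t *\<^sub>R h))" for x
    proof (cases "norm x < R")
      case xR: True
      have "norm (t *\<^sub>R h) \<le> norm h" using True by (simp add: mult_left_le_one_le)
      then have "x + t *\<^sub>R h \<in> ball 0 (R + norm h)" using xR norm_triangle_ineq[of x "t *\<^sub>R h"] by simp
      then show ?thesis using True B(2)[OF True, of x] by (simp add: mult_right_mono)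
    qed (use True supp B(1) in simp)
    then have "(\<integral>\<^sup>+x. ennreal (norm ((indicator {0..1} t * p t x) *\<^sub>R G (x + t *\<^sub>R h))) \<partial>lborel)
       \<le> (\<integral>\<^sup>+x. ennreal B * ennreal (norm (?G (x + t *\<^sub>R h))) \<partial>lborel)"
      using B(1) by (intro nn_integral_mono) (simp flip: ennreal_mult)
    also have "\<dots> = ennreal B * (\<integral>\<^sup>+x. ennreal (norm (?G (x + t *\<^sub>R h))) \<partial>lborel)"
      by (rule nn_integral_cmult) measurable
    also have "(\<integral>\<^sup>+x. ennreal (norm (?G (x + t *\<^sub>R h))) \<partial>lborel) = ennreal K"
      unfolding K(1)[symmetric]
      by (rule lborel_preserving_nn_integral[OF lborel_preserving_add, where h="\<lambda>x. ennreal (norm (?G x))"]) measurable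
    finally show ?thesis using True B(1) K(2) by (simp add: ennreal_mult)
  qed simp
  have "(\<integral>\<^sup>+t. \<integral>\<^sup>+x. ennreal (norm ((indicator {0..1} t * p t x) *\<^sub>R G (x + t *\<^sub>R h))) \<partial>lborel \<partial>lborel)
     \<le> (\<integral>\<^sup>+t. indicator {0..1::real} t * ennreal (B * K) \<partial>lborel)"
    by (intro nn_integral_mono slice)
  also have "\<dots> = ennreal (B * K)"
    by (subst nn_integral_multc) auto
  finally show ?thesis
    by (intro pair_integrableI[where K="B * K"]) (auto simp: case_prod_unfold)
qed

definition segment_average :: "'a::euclidean_space \<Rightarrow> ('a \<Rightarrow> 'b::{banach,second_countable_topology}) \<Rightarrow> 'a \<Rightarrow> 'b" where
  "segment_average h G x = (\<integral>t. indicator {0..1::real} t *\<^sub>R G (x + t *\<^sub>R h) \<partial>lborel)"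

lemma segment_average_measurable [measurable]:
  assumes [measurable]: "G \<in> borel_measurable borel" shows "segment_average h G \<in> borel_measurable borel"
  unfolding segment_average_def by measurable

lemma bounded_supp_segment_pair_integrable:
  assumes G: "locally_integrable G" and p: "bounded_supp p"
  shows "integrable (lborel \<Otimes>\<^sub>M lborel) (\<lambda>(t, x). (indicator {0..1::real} t * p x) *\<^sub>R G (x + t *\<^sub>R h))"
proof -
  note [measurable] = bounded_supp_measurable[OF p]
  obtain R B where "B > 0" "\<And>x. \<bar>p x\<bar> \<le> B" "\<And>x. R \<le> norm x \<Longrightarrow> p x = 0"
    by (rule bounded_suppE[OF p]) (rule that)
  then show ?thesis by (intro unit_interval_pair_integrable[OF G, of "\<lambda>t. p" B R]) auto
qed

lemma locally_integrable_segment_average: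
  assumes G: "locally_integrable G" shows "locally_integrable (segment_average h G)"
  unfolding locally_integrable_def
proof (intro conjI allI)
  fix a b
  have "integrable lborel (\<lambda>x. \<integral>t. (indicator {0..1::real} t * indicator (box a b) x) *\<^sub>R G (x + t *\<^sub>R h) \<partial>lborel)"
    using bounded_supp_segment_pair_integrable[OF G bounded_supp_box] by (intro lborel_pair.integrable_snd) auto
  moreover have "(\<integral>t. (indicator {0..1::real} t * indicator (box a b) x) *\<^sub>R G (x + t *\<^sub>R h) \<partial>lborel)
      = indicator (box a b) x *\<^sub>R segment_average h G x" for x
    unfolding segment_average_def by (subst integral_scaleR_right[symmetric]) (simp add: mult.commute)
  ultimately show "integrable lborel (\<lambda>x. indicator (box a b) x *\<^sub>R segment_average h G x)" by simp
qed (use locally_integrable_measurable[OF G] in measurable)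

lemma locally_integrable_directional:
  assumes "\<And>i. locally_integrable (g i)" shows "locally_integrable (directional (h :: real^2) g)"
  using assms unfolding directional_2[abs_def] by (intro locally_integrable_add locally_integrable_scaleR)

lemma bounded_supp_directional:
  assumes "\<And>i. bounded_supp (d i)" shows "bounded_supp (directional (h :: real^2) d)"
  using assms unfolding directional_2[abs_def] real_scaleR_def by (intro bounded_supp_add bounded_supp_cmult)

lemma weak_gradient_directional:
  assumes u: "locally_integrable u" and g: "\<And>i. locally_integrable (g i)" and w: "weak_gradient u g"
    and \<phi>: "test_fun \<phi>" and d: "has_partials \<phi> d" "\<And>i. bounded_supp (d i)"
  shows "(\<integral>x. directional h d x *\<^sub>R u x \<partial>lborel) = - (\<integral>x. \<phi> x *\<^sub>R directional h g x \<partial>lborel)"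
proof -
  have integrable: "integrable lborel (\<lambda>x. h $ i *\<^sub>R (d i x *\<^sub>R u x))" for i
    by (intro integrable_scaleR_right locally_integrable_scaleR_bounded_supp u d)
  have \<phi>g: "integrable lborel (\<lambda>x. h $ i *\<^sub>R (\<phi> x *\<^sub>R g i x))" for i
    by (intro integrable_scaleR_right locally_integrable_scaleR_bounded_supp g test_fun_bounded_supp \<phi>)
  have "(\<integral>x. directional h d x *\<^sub>R u x \<partial>lborel) = (\<Sum>i\<in>UNIV. h $ i *\<^sub>R (\<integral>x. d i x *\<^sub>R u x \<partial>lborel))"
    unfolding directional_def scaleR_left.sum
    using integrable by (simp add: Bochner_Integration.integral_sum flip: integral_scaleR_right)
  also have "\<dots> = (\<Sum>i\<in>UNIV. h $ i *\<^sub>R - (\<integral>x. \<phi> x *\<^sub>R g i x \<partial>lborel))"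
    using w by (intro sum.cong refl arg_cong[where f="\<lambda>z. _ *\<^sub>R z"] weak_partialD \<phi> d) (simp add: weak_gradient_def)
  also have "\<dots> = - (\<integral>x. (\<Sum>i\<in>UNIV. h $ i *\<^sub>R (\<phi> x *\<^sub>R g i x)) \<partial>lborel)"
    using \<phi>g by (subst Bochner_Integration.integral_sum) (auto simp: sum_negf simp del: scaleR_scaleR)
  finally show ?thesis
    by (simp add: directional_def scaleR_sum_right mult.commute)
qed

lemma weak_gradient_directional_shift:
  assumes u: "locally_integrable u" and g: "\<And>i. locally_integrable (g i)" and w: "weak_gradient u g"
    and \<phi>: "test_fun \<phi>" and d: "has_partials \<phi> d" "\<And>i. bounded_supp (d i)"
  shows "(\<integral>x. directional h d (x - c) *\<^sub>R u x \<partial>lborel) = - (\<integral>x. \<phi> x *\<^sub>R directional h g (x + c) \<partial>lborel)"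
proof -
  note [measurable] = bounded_supp_measurable[OF test_fun_bounded_supp[OF \<phi>]]
    locally_integrable_measurable[OF locally_integrable_directional[OF g]]
  have "(\<integral>x. directional h (\<lambda>i x. d i (x + - c)) x *\<^sub>R u x \<partial>lborel) = - (\<integral>x. \<phi> (x + - c) *\<^sub>R directional h g x \<partial>lborel)"
    by (intro weak_gradient_directional u g w test_fun_shift \<phi> has_partials_shift d bounded_supp_shift)
  also have "(\<integral>x. \<phi> (x + - c) *\<^sub>R directional h g x \<partial>lborel) = (\<integral>x. \<phi> (x + c + - c) *\<^sub>R directional h g (x + c) \<partial>lborel)"
    by (rule lborel_preserving_integral(1)[OF lborel_preserving_add, symmetric,
          where h="\<lambda>x. \<phi> (x + - c) *\<^sub>R directional h g x"]) measurable
  finally show ?thesis by (simp add: directional_def)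
qed

lemma test_fun_increment_scaleR:
  fixes z :: "'b::{banach,second_countable_topology}"
  assumes partials: "has_partials \<phi> d"
  shows "(\<phi> (x - h) - \<phi> x) *\<^sub>R z = - (\<integral>t. (indicator {0..1::real} t * directional h d (x - t *\<^sub>R h)) *\<^sub>R z \<partial>lborel)"
proof -
  have "continuous_on {0..1} (\<lambda>t. directional h d (x - t *\<^sub>R h))"
    unfolding directional_2
    by (intro continuous_intros continuous_on_compose2[OF has_partials_continuous[OF partials]]) auto
  then have "integrable lborel (\<lambda>t. indicator {0..1} t * directional h d (x - t *\<^sub>R h))"
    using borel_integrable_atLeastAtMost'[of 0 1 "\<lambda>t. directional h d (x - t *\<^sub>R h)"]
    by (simp add: set_integrable_def)
  then have "(\<integral>t. (indicator {0..1::real} t * directional h d (x - t *\<^sub>R h)) *\<^sub>R z \<partial>lborel)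
      = (\<integral>t. indicator {0..1} t * directional h d (x - t *\<^sub>R h) \<partial>lborel) *\<^sub>R z"
    by (intro integral_scaleR_left) simp
  moreover have "\<phi> (x - h) - \<phi> x = - (\<integral>t. indicator {0..1} t * directional h d (x - t *\<^sub>R h) \<partial>lborel)"
    using increment_integral[OF partials, of "-h" x] by (simp add: directional_minus)
  ultimately show ?thesis by simp
qed

lemma weak_gradient_increment_tested:
  assumes u: "locally_integrable u" and g: "\<And>i. locally_integrable (g i)" and w: "weak_gradient u g"
    and \<phi>: "test_fun \<phi>"
  shows "(\<integral>x. \<phi> x *\<^sub>R (u (x + h) - u x) \<partial>lborel)
    = (\<integral>x. \<phi> x *\<^sub>R segment_average h (directional h g) x \<partial>lborel)"
proof -
  note G = locally_integrable_directional[OF g] and bs = test_fun_bounded_supp[OF \<phi>]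
  note [measurable] = locally_integrable_measurable[OF u] bounded_supp_measurable[OF bs]
  obtain d where d: "has_partials \<phi> d" "\<And>i. bounded_supp (d i)"
    by (rule test_fun_partials[OF \<phi>]) (rule that)
  let ?D = "\<lambda>t x. directional h d (x - t *\<^sub>R h)"
  obtain R B where bounds: "B > 0" "\<And>x. \<bar>directional h d x\<bar> \<le> B" "\<And>x. R \<le> norm x \<Longrightarrow> directional h d x = 0"
    by (rule bounded_suppE[OF bounded_supp_directional[OF d(2)]]) (rule that)
  have [measurable]: "directional h d \<in> borel_measurable borel"
    using has_partials_measurable[OF d(1)] by measurable
  have "case_prod ?D \<in> borel_measurable (borel \<Otimes>\<^sub>M borel)" by measurable
  moreover have "R \<le> norm (x - t *\<^sub>R h)" if "t \<in> {0..1}" "R + norm h \<le> norm x" for t x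
    using that norm_triangle_ineq2[of x "t *\<^sub>R h"] mult_left_le_one_le[of "norm h" t] by simp
  ultimately have int: "integrable (lborel \<Otimes>\<^sub>M lborel) (\<lambda>(t, x). (indicator {0..1::real} t * ?D t x) *\<^sub>R u (x + t *\<^sub>R 0))"
    using bounds by (intro unit_interval_pair_integrable[OF u, of ?D B "R + norm h"]) auto
  have "(\<integral>x. \<phi> x *\<^sub>R (u (x + h) - u x) \<partial>lborel) = (\<integral>x. \<phi> x *\<^sub>R u (x + h) \<partial>lborel) - (\<integral>x. \<phi> x *\<^sub>R u x \<partial>lborel)"
    unfolding scaleR_diff_right
    by (intro Bochner_Integration.integral_diff locally_integrable_scaleR_bounded_supp locally_integrable_shift u bs)
  also have "(\<integral>x. \<phi> x *\<^sub>R u (x + h) \<partial>lborel) = (\<integral>x. \<phi> (x - h) *\<^sub>R u x \<partial>lborel)"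
    using lborel_preserving_integral(1)[OF lborel_preserving_add[of h], where h="\<lambda>x. \<phi> (x - h) *\<^sub>R u x"] by simp
  also have "\<dots> - (\<integral>x. \<phi> x *\<^sub>R u x \<partial>lborel) = (\<integral>x. (\<phi> (x - h) - \<phi> x) *\<^sub>R u x \<partial>lborel)"
    using locally_integrable_scaleR_bounded_supp[OF u bs]
      locally_integrable_scaleR_bounded_supp[OF u bounded_supp_shift[OF bs, of "-h"]]
    by (simp add: scaleR_diff_left)
  also have "\<dots> = - (\<integral>x. \<integral>t. (indicator {0..1::real} t * ?D t x) *\<^sub>R u x \<partial>lborel \<partial>lborel)"
    by (simp add: test_fun_increment_scaleR[OF d(1)])
  also have "\<dots> = - (\<integral>t. indicator {0..1::real} t *\<^sub>R (\<integral>x. ?D t x *\<^sub>R u x \<partial>lborel) \<partial>lborel)"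
    using lborel_pair.Fubini_integral[OF int] by (simp flip: scaleR_scaleR)
  also have "\<dots> = (\<integral>t. \<integral>x. (indicator {0..1::real} t * \<phi> x) *\<^sub>R directional h g (x + t *\<^sub>R h) \<partial>lborel \<partial>lborel)"
    by (simp add: weak_gradient_directional_shift[OF u g w \<phi> d] flip: scaleR_scaleR)
  also have "\<dots> = (\<integral>x. \<integral>t. (indicator {0..1::real} t * \<phi> x) *\<^sub>R directional h g (x + t *\<^sub>R h) \<partial>lborel \<partial>lborel)"
    by (rule lborel_pair.Fubini_integral[OF bounded_supp_segment_pair_integrable[OF G bs], symmetric])
  also have "\<dots> = (\<integral>x. \<phi> x *\<^sub>R segment_average h (directional h g) x \<partial>lborel)"
    unfolding segment_average_def by (subst integral_scaleR_right[symmetric]) (simp add: mult.commute)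
  finally show ?thesis .
qed

theorem weak_gradient_increment:
  assumes u: "locally_integrable u" and g: "\<And>i. locally_integrable (g i)" and w: "weak_gradient u g"
  shows "AE x in lborel. u (x + h) - u x = segment_average h (directional h g) x"
proof -
  note A = locally_integrable_segment_average[OF locally_integrable_directional[OF g]]
    and du = locally_integrable_diff[OF locally_integrable_shift[OF u] u]
  have "AE x in lborel. u (x + h) - u x - segment_average h (directional h g) x = 0"
  proof (rule fundamental_lemma_of_variations)
    show "locally_integrable (\<lambda>x. u (x + h) - u x - segment_average h (directional h g) x)"
      by (intro locally_integrable_diff du A)
    fix \<phi> assume \<phi>: "test_fun \<phi>"
    show "(\<integral>x. \<phi> x *\<^sub>R (u (x + h) - u x - segment_average h (directional h g) x) \<partial>lborel) = 0"
      unfolding scaleR_diff_right[of _ _ "segment_average _ _ _"]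
      using weak_gradient_increment_tested[OF u g w \<phi>]
        locally_integrable_scaleR_bounded_supp[OF du test_fun_bounded_supp[OF \<phi>]]
        locally_integrable_scaleR_bounded_supp[OF A test_fun_bounded_supp[OF \<phi>]]
      by (subst Bochner_Integration.integral_diff) auto
  qed
  then show ?thesis by simp
qed

lemma norm_segment_average_sq_le:
  assumes [measurable]: "G \<in> borel_measurable borel"
  shows "ennreal ((norm (segment_average h G x))\<^sup>2)
     \<le> (\<integral>\<^sup>+t. indicator {0..1::real} t * ennreal ((norm (G (x + t *\<^sub>R h)))\<^sup>2) \<partial>lborel)"
proof -
  let ?i = "indicator {0..1} :: real \<Rightarrow> real"
  have "ennreal ((norm (segment_average h G x))\<^sup>2)
      \<le> (\<integral>\<^sup>+t. ennreal ((norm (?i t))\<^sup>2) \<partial>lborel) * (\<integral>\<^sup>+t. ennreal ((norm (?i t *\<^sub>R G (x + t *\<^sub>R h)))\<^sup>2) \<partial>lborel)"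
    unfolding segment_average_def by (intro norm_integral_product_sq_le) (auto simp: indicator_def)
  also have "(\<integral>\<^sup>+t. ennreal ((norm (?i t))\<^sup>2) \<partial>lborel) = (\<integral>\<^sup>+t. indicator {0..1} t \<partial>(lborel :: real measure))"
    by (intro nn_integral_cong) (simp add: indicator_def)
  also have "\<dots> = 1" by simp
  also have "(\<integral>\<^sup>+t. ennreal ((norm (?i t *\<^sub>R G (x + t *\<^sub>R h)))\<^sup>2) \<partial>lborel)
      = (\<integral>\<^sup>+t. indicator {0..1} t * ennreal ((norm (G (x + t *\<^sub>R h)))\<^sup>2) \<partial>lborel)"
    by (intro nn_integral_cong) (simp add: indicator_def)
  finally show ?thesis by simp
qed

lemma translate_sq_le:
  assumes u: "locally_integrable u" and g: "\<And>i. locally_integrable (g i)" and w: "weak_gradient u g"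
  shows "(\<integral>\<^sup>+x. ennreal ((norm (u (x + h) - u x))\<^sup>2) \<partial>lborel)
      \<le> (\<integral>\<^sup>+x. ennreal ((norm (directional h g x))\<^sup>2) \<partial>lborel)"
proof -
  let ?G = "directional h g"
  note [measurable] = locally_integrable_measurable[OF locally_integrable_directional[OF g]]
  have "(\<integral>\<^sup>+x. ennreal ((norm (u (x + h) - u x))\<^sup>2) \<partial>lborel)
     = (\<integral>\<^sup>+x. ennreal ((norm (segment_average h ?G x))\<^sup>2) \<partial>lborel)"
    by (rule nn_integral_cong_AE, use weak_gradient_increment[OF u g w, of h] in eventually_elim) simp
  also have "\<dots> \<le> (\<integral>\<^sup>+x. \<integral>\<^sup>+t. indicator {0..1::real} t * ennreal ((norm (?G (x + t *\<^sub>R h)))\<^sup>2) \<partial>lborel \<partial>lborel)"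
    by (intro nn_integral_mono norm_segment_average_sq_le) measurable
  also have "\<dots> = (\<integral>\<^sup>+t. \<integral>\<^sup>+x. indicator {0..1::real} t * ennreal ((norm (?G (x + t *\<^sub>R h)))\<^sup>2) \<partial>lborel \<partial>lborel)"
    by (rule lborel_pair.Fubini') measurable
  also have "\<dots> = (\<integral>\<^sup>+t. indicator {0..1::real} t * (\<integral>\<^sup>+x. ennreal ((norm (?G x))\<^sup>2) \<partial>lborel) \<partial>lborel)"
    by (simp add: nn_integral_cmult
        lborel_preserving_nn_integral[OF lborel_preserving_add, where h="\<lambda>x. ennreal ((norm (?G x))\<^sup>2)"])
  also have "\<dots> = (\<integral>\<^sup>+x. ennreal ((norm (?G x))\<^sup>2) \<partial>lborel)"
    by (subst nn_integral_multc) auto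
  finally show ?thesis .
qed

subsection \<open>Difference energies\<close>

definition difference_energy :: "real \<Rightarrow> ('a::euclidean_space \<Rightarrow> 'b::euclidean_space) \<Rightarrow> ennreal" where
  "difference_energy \<epsilon> v =
    (\<integral>\<^sup>+x. \<integral>\<^sup>+h. indicator (ball 0 \<epsilon>) h * ennreal ((norm (v (x + h) - v x))\<^sup>2) \<partial>lborel \<partial>lborel)"

lemma difference_energy_eq_integral_increments:
  assumes [measurable]: "v \<in> borel_measurable borel"
  shows "difference_energy \<epsilon> v
    = (\<integral>\<^sup>+h. indicator (ball 0 \<epsilon>) h * (\<integral>\<^sup>+x. ennreal ((norm (v (x + h) - v x))\<^sup>2) \<partial>lborel) \<partial>lborel)"
proof -
  have "difference_energy \<epsilon> v
      = (\<integral>\<^sup>+h. \<integral>\<^sup>+x. indicator (ball 0 \<epsilon>) h * ennreal ((norm (v (x + h) - v x))\<^sup>2) \<partial>lborel \<partial>lborel)"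
    unfolding difference_energy_def by (rule lborel_pair.Fubini') measurable
  then show ?thesis by (simp add: nn_integral_cmult)
qed

lemma difference_energy_eq_pair_integral:
  assumes [measurable]: "v \<in> borel_measurable borel"
  shows "difference_energy \<epsilon> v
    = (\<integral>\<^sup>+p. ennreal (indicator (ball 0 \<epsilon>) (fst p - snd p) * (norm (v (fst p) - v (snd p)))\<^sup>2) \<partial>(lborel \<Otimes>\<^sub>M lborel))"
proof -
  let ?F = "\<lambda>x y. ennreal (indicator (ball 0 \<epsilon>) (x - y) * (norm (v x - v y))\<^sup>2)"
  have "(\<integral>\<^sup>+h. indicator (ball 0 \<epsilon>) h * ennreal ((norm (v (x + h) - v x))\<^sup>2) \<partial>lborel) = (\<integral>\<^sup>+y. ?F x y \<partial>lborel)" for x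
  proof -
    have "(\<integral>\<^sup>+h. indicator (ball 0 \<epsilon>) h * ennreal ((norm (v (x + h) - v x))\<^sup>2) \<partial>lborel) = (\<integral>\<^sup>+h. ?F x (x + h) \<partial>lborel)"
      by (intro nn_integral_cong) (simp add: indicator_def norm_minus_commute[of "v x"])
    also have "\<dots> = (\<integral>\<^sup>+y. ?F x y \<partial>lborel)"
      by (rule lborel_preserving_nn_integral[OF lborel_preserving_add_left, of "\<lambda>y. ?F x y"]) measurable
    finally show ?thesis .
  qed
  then have "difference_energy \<epsilon> v = (\<integral>\<^sup>+x. \<integral>\<^sup>+y. ?F x y \<partial>lborel \<partial>lborel)"
    by (simp add: difference_energy_def)
  also have "\<dots> = (\<integral>\<^sup>+p. ?F (fst p) (snd p) \<partial>(lborel \<Otimes>\<^sub>M lborel))"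
    using lborel.nn_integral_fst[of "\<lambda>p. ?F (fst p) (snd p)" lborel] by simp
  finally show ?thesis .
qed

lemma difference_energy_mono:
  assumes "\<And>x h. norm (v (x + h) - v x) \<le> norm (w (x + h) - w x)"
  shows "difference_energy \<epsilon> v \<le> difference_energy \<epsilon> w"
  unfolding difference_energy_def
  by (intro nn_integral_mono mult_left_mono ennreal_leI power_mono assms) auto

lemma difference_energy_of_real: "difference_energy \<epsilon> (\<lambda>x. complex_of_real (v x)) = difference_energy \<epsilon> v"
  unfolding difference_energy_def by (simp flip: of_real_diff)

lemma difference_energy_shift:
  assumes [measurable]: "v \<in> borel_measurable borel"
  shows "difference_energy \<epsilon> (\<lambda>x. v (x + c)) = difference_energy \<epsilon> v"
  unfolding difference_energy_def
  using lborel_preserving_nn_integral[OF lborel_preserving_add[of c],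
      where h="\<lambda>x. \<integral>\<^sup>+h. indicator (ball 0 \<epsilon>) h * ennreal ((norm (v (x + h) - v x))\<^sup>2) \<partial>lborel"]
  by (simp add: add_ac)

lemma difference_energy_cmult:
  fixes v :: "'a::euclidean_space \<Rightarrow> real"
  assumes [measurable]: "v \<in> borel_measurable borel"
  shows "difference_energy \<epsilon> (\<lambda>x. s * v x) = ennreal (s\<^sup>2) * difference_energy \<epsilon> v"
proof -
  have "difference_energy \<epsilon> (\<lambda>x. s * v x)
      = (\<integral>\<^sup>+x. \<integral>\<^sup>+h. ennreal (s\<^sup>2) * (indicator (ball 0 \<epsilon>) h * ennreal ((norm (v (x + h) - v x))\<^sup>2)) \<partial>lborel \<partial>lborel)"
    unfolding difference_energy_def
    by (intro nn_integral_cong)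
      (auto simp: indicator_def ennreal_mult[symmetric] power_mult_distrib simp flip: right_diff_distrib)
  then show ?thesis by (simp add: nn_integral_cmult difference_energy_def)
qed

lemma difference_energy_cong_AE:
  assumes "AE x in lborel. w x = v x"
  shows "difference_energy \<epsilon> w = difference_energy \<epsilon> v"
  unfolding difference_energy_def
proof (rule nn_integral_cong_AE, use assms in eventually_elim)
  case (elim x)
  show ?case
    by (rule nn_integral_cong_AE, use lborel_preserving_AE[OF lborel_preserving_add_left assms, of x] in eventually_elim)
      (simp add: elim)
qed

lemma difference_energy_le_liminf:
  assumes [measurable]: "\<And>n. z n \<in> borel_measurable borel"
    and lim: "AE x in lborel. (\<lambda>n. z n x) \<longlonglongrightarrow> v x"
  shows "difference_energy \<epsilon> v \<le> liminf (\<lambda>n. difference_energy \<epsilon> (z n))"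
proof -
  let ?q = "\<lambda>u x. \<integral>\<^sup>+h. indicator (ball 0 \<epsilon>) h * ennreal ((norm (u (x + h) - u x))\<^sup>2) \<partial>lborel"
  have "difference_energy \<epsilon> v \<le> (\<integral>\<^sup>+x. liminf (\<lambda>n. ?q (z n) x) \<partial>lborel)"
    unfolding difference_energy_def
  proof (rule nn_integral_mono_AE, use lim in eventually_elim)
    case x: (elim x)
    show "?q v x \<le> liminf (\<lambda>n. ?q (z n) x)"
    proof (rule nn_integral_le_liminf_AE)
      show "AE h in lborel. (\<lambda>n. indicator (ball 0 \<epsilon>) h * ennreal ((norm (z n (x + h) - z n x))\<^sup>2))
         \<longlonglongrightarrow> indicator (ball 0 \<epsilon>) h * ennreal ((norm (v (x + h) - v x))\<^sup>2)"
        using lborel_preserving_AE[OF lborel_preserving_add_left lim, of x]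
      proof eventually_elim
        case (elim h)
        have "(\<lambda>n. ennreal ((norm (z n (x + h) - z n x))\<^sup>2)) \<longlonglongrightarrow> ennreal ((norm (v (x + h) - v x))\<^sup>2)"
          by (intro tendsto_ennrealI tendsto_intros x elim)
        then show ?case by (cases "h \<in> ball 0 \<epsilon>") auto
      qed
    qed measurable
  qed
  also have "\<dots> \<le> liminf (\<lambda>n. \<integral>\<^sup>+x. ?q (z n) x \<partial>lborel)"
    by (rule nn_integral_liminf) measurable
  finally show ?thesis by (simp add: difference_energy_def)
qed

subsection \<open>Second moments of discs\<close>

lemma vec_nth_measurable [measurable (raw)]:
  fixes f :: "'a \<Rightarrow> real ^ 'n"
  assumes "f \<in> borel_measurable M" shows "(\<lambda>x. f x $ i) \<in> borel_measurable M"
  by (rule measurable_compose[OF assms borel_measurable_continuous_onI]) (intro continuous_intros)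

lemma emeasure_ball_2: "r \<ge> 0 \<Longrightarrow> emeasure lborel (ball (c::real^2) r) = ennreal (pi * r\<^sup>2)"
  using emeasure_ball[of r c] unit_ball_vol_2 by simp

lemma not_AE_notin_ball:
  fixes c :: "real^2"
  assumes "r > 0" shows "\<not> (AE x in lborel. x \<notin> ball c r)"
proof
  assume "AE x in lborel. x \<notin> ball c r"
  then have "emeasure lborel (ball c r) = 0"
    by (subst (asm) AE_iff_measurable[OF _ refl]) (auto simp: ball_def)
  then show False using assms by (simp add: emeasure_ball_2)
qed

definition disc_moment :: "real \<Rightarrow> real" where
  "disc_moment \<epsilon> = (\<integral>h. indicator (ball 0 \<epsilon>) (h::real^2) * (h $ 1)\<^sup>2 \<partial>lborel)"

lemma bounded_supp_ball_coord: "bounded_supp (\<lambda>h. indicator (ball 0 \<epsilon>) h * (h :: real ^ 'n) $ i)"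
  by (rule bounded_supp_ball_mult[where C=\<epsilon>]) (auto intro: order_trans[OF component_le_norm_cart] less_imp_le)

lemma ball_monomial_integrable:
  "integrable lborel (\<lambda>h::real ^ 'n. indicator (ball 0 \<epsilon>) h * (h $ i * h $ j))"
proof -
  have "(\<lambda>h::real ^ 'n. indicator (ball 0 \<epsilon>) h * (h $ i * h $ j))
      = (\<lambda>h. (indicator (ball 0 \<epsilon>) h * h $ i) \<bullet> (indicator (ball 0 \<epsilon>) h * h $ j))"
    by (auto simp: indicator_def)
  then show ?thesis
    by (simp only: L2_inner_integrable[OF bounded_supp_L2[OF bounded_supp_ball_coord[of \<epsilon> i]]
        bounded_supp_L2[OF bounded_supp_ball_coord[of \<epsilon> j]]])
qed

lemma disc_second_moments:
  "(\<integral>h. indicator (ball 0 \<epsilon>) (h::real^2) * (h $ i * h $ j) \<partial>lborel) = (if i = j then disc_moment \<epsilon> else 0)"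
proof -
  let ?F = "\<lambda>i j (h::real^2). indicator (ball 0 \<epsilon>) h * (h $ i * h $ j)"
  let ?s = "\<lambda>h::real^2. (\<chi> i. if i = 1 then h $ 2 else h $ 1) :: real^2"
  let ?r = "\<lambda>h::real^2. (\<chi> i. if i = 1 then - h $ 1 else h $ 2) :: real^2"
  have norms: "norm (?s h) = norm h" "norm (?r h) = norm h" for h
    by (rule power2_eq_imp_eq; simp add: power2_norm_eq_inner inner_vec_def sum_2)+
  have preserving: "lborel_preserving ?s" "lborel_preserving ?r"
    by (rule lborel_preserving_orthogonal; simp add: orthogonal_transformation norms linear_iff vec_eq_iff)+
  have "(\<integral>h. ?F 2 2 h \<partial>lborel) = (\<integral>h. ?F 2 2 (?s h) \<partial>lborel)"
    by (rule lborel_preserving_integral(1)[OF preserving(1), symmetric]) measurable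
  also have "\<dots> = disc_moment \<epsilon>" unfolding disc_moment_def
    by (intro Bochner_Integration.integral_cong) (auto simp: indicator_def norms power2_eq_square)
  finally have square: "(\<integral>h. ?F 2 2 h \<partial>lborel) = disc_moment \<epsilon>" .
  have "(\<integral>h. ?F 1 2 h \<partial>lborel) = (\<integral>h. ?F 1 2 (?r h) \<partial>lborel)"
    by (rule lborel_preserving_integral(1)[OF preserving(2), symmetric]) measurable
  also have "\<dots> = (\<integral>h. - ?F 1 2 h \<partial>lborel)"
    by (intro Bochner_Integration.integral_cong) (auto simp: indicator_def norms)
  finally have mixed: "(\<integral>h. ?F 1 2 h \<partial>lborel) = 0" by simp
  have "(\<integral>h. ?F 1 1 h \<partial>lborel) = disc_moment \<epsilon>" by (simp add: disc_moment_def power2_eq_square)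
  with mixed square show ?thesis using exhaust_2[of i] exhaust_2[of j] by (auto simp: mult.commute)
qed

lemma disc_moment_nonneg: "0 \<le> disc_moment \<epsilon>"
  unfolding disc_moment_def by simp

lemma disc_norm_sq_integral:
  "integrable lborel (\<lambda>h::real^2. indicator (ball 0 \<epsilon>) h * (norm h)\<^sup>2)"
  "(\<integral>h. indicator (ball 0 \<epsilon>) (h::real^2) * (norm h)\<^sup>2 \<partial>lborel) = 2 * disc_moment \<epsilon>"
proof -
  have norm_sq_split: "indicator (ball 0 \<epsilon>) h * (norm h)\<^sup>2
      = indicator (ball 0 \<epsilon>) h * (h $ 1 * h $ 1) + indicator (ball 0 \<epsilon>) h * (h $ 2 * h $ 2)" for h :: "real^2"
    by (simp add: power2_norm_eq_inner inner_vec_def sum_2 distrib_left)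
  show "integrable lborel (\<lambda>h::real^2. indicator (ball 0 \<epsilon>) h * (norm h)\<^sup>2)"
    unfolding norm_sq_split by (intro Bochner_Integration.integrable_add ball_monomial_integrable)
  show "(\<integral>h. indicator (ball 0 \<epsilon>) (h::real^2) * (norm h)\<^sup>2 \<partial>lborel) = 2 * disc_moment \<epsilon>"
    unfolding norm_sq_split by (simp add: ball_monomial_integrable disc_second_moments)
qed

lemma disc_moment_pos: assumes "\<epsilon> > 0" shows "disc_moment \<epsilon> > 0"
proof -
  let ?f = "\<lambda>h::real^2. indicator (ball 0 \<epsilon>) h * (norm h)\<^sup>2"
  have "\<not> (AE h in lborel. ?f h = 0)"
  proof
    assume "AE h in lborel. ?f h = 0"
    then have "AE h in lborel. h \<notin> ball (0::real^2) \<epsilon>"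
      using AE_lborel_singleton[of 0] by eventually_elim (simp add: indicator_def split: if_splits)
    with not_AE_notin_ball[OF assms] show False by blast
  qed
  then have "(\<integral>h. ?f h \<partial>lborel) \<noteq> 0"
    using integral_nonneg_eq_0_iff_AE[OF disc_norm_sq_integral(1)[of \<epsilon>]] by simp
  then show ?thesis using disc_norm_sq_integral(2)[of \<epsilon>] disc_moment_nonneg[of \<epsilon>] by linarith
qed

lemma disc_moment_le: assumes "r \<ge> 0" shows "disc_moment r \<le> r\<^sup>2 * (pi * r\<^sup>2)"
proof -
  have "disc_moment r \<le> (\<integral>h. r\<^sup>2 * indicator (ball (0::real^2) r) h \<partial>lborel)"
    unfolding disc_moment_def
  proof (rule integral_mono)
    show "integrable lborel (\<lambda>h::real^2. indicator (ball 0 r) h * (h $ 1)\<^sup>2)"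
      using ball_monomial_integrable[of r 1 1] by (simp add: power2_eq_square)
    show "integrable lborel (\<lambda>h::real^2. r\<^sup>2 * indicator (ball 0 r) h)"
      by (intro integrable_mult_right bounded_supp_integrable bounded_supp_ball)
    fix h :: "real^2"
    have "h \<in> ball 0 r \<Longrightarrow> (h $ 1)\<^sup>2 \<le> r\<^sup>2"
      using component_le_norm_cart[of h 1] by (simp flip: abs_le_square_iff)
    then show "indicator (ball 0 r) h * (h $ 1)\<^sup>2 \<le> r\<^sup>2 * indicator (ball 0 r) h" by (simp add: indicator_def)
  qed
  also have "\<dots> = r\<^sup>2 * (pi * r\<^sup>2)" using emeasure_ball_2[OF assms, of 0] by (simp add: measure_def)
  finally show ?thesis .
qed

lemma nn_integral_disc_directional_sq:
  fixes g :: "2 \<Rightarrow> 'a \<Rightarrow> 'b::euclidean_space"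
  shows "(\<integral>\<^sup>+h. indicator (ball 0 \<epsilon>) h * ennreal ((norm (directional h g x))\<^sup>2) \<partial>lborel)
     = ennreal (disc_moment \<epsilon> * (\<Sum>i\<in>UNIV. (norm (g i x))\<^sup>2))"
proof -
  let ?F = "\<lambda>i j (h::real^2). indicator (ball 0 \<epsilon>) h * (h $ i * h $ j) :: real"
  let ?q = "\<lambda>h. ?F 1 1 h * (norm (g 1 x))\<^sup>2 + ?F 1 2 h * (2 * (g 1 x \<bullet> g 2 x)) + ?F 2 2 h * (norm (g 2 x))\<^sup>2"
  have q: "?q h = indicator (ball 0 \<epsilon>) h * (norm (directional h g x))\<^sup>2" for h
    by (simp add: directional_2 power2_norm_eq_inner inner_simps inner_commute algebra_simps)
  have int: "integrable lborel ?q"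
    by (intro Bochner_Integration.integrable_add integrable_mult_left ball_monomial_integrable)
  have "(\<integral>\<^sup>+h. indicator (ball 0 \<epsilon>) h * ennreal ((norm (directional h g x))\<^sup>2) \<partial>lborel) = (\<integral>\<^sup>+h. ennreal (?q h) \<partial>lborel)"
    unfolding q by (intro nn_integral_cong) (auto simp: indicator_def)
  also have "\<dots> = ennreal (\<integral>h. ?q h \<partial>lborel)"
    using int by (intro nn_integral_eq_integral) (auto simp: q)
  also have "(\<integral>h. ?q h \<partial>lborel) = disc_moment \<epsilon> * (norm (g 1 x))\<^sup>2 + disc_moment \<epsilon> * (norm (g 2 x))\<^sup>2"
    by (simp add: ball_monomial_integrable disc_second_moments)
  finally show ?thesis by (simp add: sum_2 distrib_left)
qed

lemma nn_integral_sum_sqnorm: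
  assumes "\<And>i::'n::finite. L2 M (g i)" "c \<ge> 0"
  shows "(\<integral>\<^sup>+x. ennreal (c * (\<Sum>i\<in>UNIV. (norm (g i x))\<^sup>2)) \<partial>M) = ennreal (c * (\<Sum>i\<in>UNIV. sqnorm M (g i)))"
proof -
  have "(\<integral>\<^sup>+x. ennreal (c * (\<Sum>i\<in>UNIV. (norm (g i x))\<^sup>2)) \<partial>M) = ennreal (\<integral>x. c * (\<Sum>i\<in>UNIV. (norm (g i x))\<^sup>2) \<partial>M)"
    using assms by (intro nn_integral_eq_integral) (auto simp: L2_def sum_nonneg)
  then show ?thesis using assms by (simp add: L2_def sqnorm_def)
qed

theorem difference_energy_le_gradient:
  assumes u: "L2 lborel u" and g: "\<And>i. L2 lborel (g i)" and w: "weak_gradient u g"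
  shows "difference_energy \<epsilon> u \<le> ennreal (disc_moment \<epsilon> * (\<Sum>i\<in>UNIV. sqnorm lborel (g i)))"
proof -
  note [measurable] = u[THEN L2_measurable, simplified] g[THEN L2_measurable, simplified]
  have [measurable]: "(\<lambda>p. directional (fst p) g (snd p)) \<in> borel_measurable (borel \<Otimes>\<^sub>M borel)"
    unfolding directional_2 by measurable
  have "difference_energy \<epsilon> u
      \<le> (\<integral>\<^sup>+h. indicator (ball 0 \<epsilon>) h * (\<integral>\<^sup>+x. ennreal ((norm (directional h g x))\<^sup>2) \<partial>lborel) \<partial>lborel)"
    unfolding difference_energy_eq_integral_increments[OF \<open>u \<in> borel_measurable borel\<close>]
    by (intro nn_integral_mono mult_left_mono translate_sq_le L2_locally_integrable u g w) auto
  also have "\<dots> = (\<integral>\<^sup>+h. \<integral>\<^sup>+x. indicator (ball 0 \<epsilon>) h * ennreal ((norm (directional h g x))\<^sup>2) \<partial>lborel \<partial>lborel)"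
    by (simp add: nn_integral_cmult)
  also have "\<dots> = (\<integral>\<^sup>+x. \<integral>\<^sup>+h. indicator (ball 0 \<epsilon>) h * ennreal ((norm (directional h g x))\<^sup>2) \<partial>lborel \<partial>lborel)"
    by (rule lborel_pair.Fubini') (simp add: case_prod_unfold directional_2)
  also have "\<dots> = ennreal (disc_moment \<epsilon> * (\<Sum>i\<in>UNIV. sqnorm lborel (g i)))"
    by (simp add: nn_integral_disc_directional_sq nn_integral_sum_sqnorm[OF g disc_moment_nonneg])
  finally show ?thesis .
qed

subsection \<open>Uniqueness of weak gradients\<close>

lemma weak_gradient_component_nonzero:
  assumes u: "L2 lborel u" "\<not> (AE x in lborel. u x = 0)"
    and g: "\<And>i. L2 lborel (g i)" and w: "weak_gradient u g"
  shows "\<not> (AE x in lborel. g i x = 0)"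
proof
  assume zero: "AE x in lborel. g i x = 0"
  have [measurable]: "u \<in> borel_measurable borel" using u(1) by (simp add: L2_def)
  let ?b = "axis i 1 :: real^2"
  have inv: "AE x in lborel. (norm (u (x + real n *\<^sub>R ?b)))\<^sup>2 = (norm (u x))\<^sup>2" for n
  proof -
    let ?h = "real n *\<^sub>R ?b"
    have "(\<integral>\<^sup>+x. ennreal ((norm (u (x + ?h) - u x))\<^sup>2) \<partial>lborel) \<le> (\<integral>\<^sup>+x. ennreal ((norm (directional ?h g x))\<^sup>2) \<partial>lborel)"
      by (intro translate_sq_le L2_locally_integrable u g w)
    also have "\<dots> = (\<integral>\<^sup>+x. 0 \<partial>(lborel :: (real^2) measure))"
      by (rule nn_integral_cong_AE, use zero in eventually_elim)
        (use exhaust_2[of i] in \<open>auto simp: directional_2 axis_def\<close>)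
    finally have "(\<integral>\<^sup>+x. ennreal ((norm (u (x + ?h) - u x))\<^sup>2) \<partial>lborel) = 0" by simp
    then have "AE x in lborel. ennreal ((norm (u (x + ?h) - u x))\<^sup>2) = 0"
      by (subst (asm) nn_integral_0_iff_AE) auto
    then show ?thesis by eventually_elim simp
  qed
  have "AE x in lborel. (norm (u x))\<^sup>2 = 0"
    by (rule AE_zero_if_AE_shift_invariant[OF L2_integrable[OF u(1)] _ _ inv]) (simp_all add: axis_eq_0_iff)
  with u(2) show False by simp
qed

lemma test_fun_bounded_below_on_cbox:
  obtains \<phi> c where "test_fun \<phi>" "c > 0" "\<And>x. x \<in> cbox a b \<Longrightarrow> c \<le> \<phi> x"
proof (cases "cbox a b = {}")
  case True
  then show ?thesis using that[OF box_bump_test_fun[of 1], of 1] by auto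
next
  case False
  let ?\<phi> = "box_bump 1 (a - (\<chi> i. 1)) (b + (\<chi> i. 1))"
  have "continuous_on (cbox a b) ?\<phi>"
    using flat_algebra_continuous[OF box_bump_in_flat_algebra] continuous_on_subset by blast
  from continuous_attains_inf[OF compact_cbox False this]
  obtain x where x: "x \<in> cbox a b" "\<And>y. y \<in> cbox a b \<Longrightarrow> ?\<phi> x \<le> ?\<phi> y" by blast
  have "x \<in> box (a - (\<chi> i. 1)) (b + (\<chi> i. 1))" using x(1) by (auto simp: in_box_2 mem_box_cart forall_2)
  then have "?\<phi> x > 0" by (intro box_bump_inside) auto
  with x(2) show ?thesis by (intro that[of ?\<phi> "?\<phi> x"] box_bump_test_fun) auto
qed

lemma not_locally_integrable_test_fun:
  assumes h [measurable]: "h \<in> borel_measurable borel" and "\<not> locally_integrable h"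
  obtains \<phi> where "test_fun \<phi>" "\<not> integrable lborel (\<lambda>x. \<phi> x *\<^sub>R h x)"
proof -
  obtain a b where ab: "\<not> integrable lborel (\<lambda>x. indicator (box a b) x *\<^sub>R h x)"
    using assms by (auto simp: locally_integrable_def)
  obtain \<phi> c where \<phi>: "test_fun \<phi>" "c > 0" "\<And>x. x \<in> cbox a b \<Longrightarrow> c \<le> \<phi> x"
    by (rule test_fun_bounded_below_on_cbox[of a b]) (rule that)
  have "\<not> integrable lborel (\<lambda>x. \<phi> x *\<^sub>R h x)"
  proof
    assume "integrable lborel (\<lambda>x. \<phi> x *\<^sub>R h x)"
    then have int: "integrable lborel (\<lambda>x. (1/c) *\<^sub>R (\<phi> x *\<^sub>R h x))" by (rule integrable_scaleR_right)
    have "norm (indicator (box a b) x *\<^sub>R h x) \<le> norm ((1/c) *\<^sub>R (\<phi> x *\<^sub>R h x))" for x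
    proof -
      have "indicator (box a b) x \<le> \<bar>\<phi> x\<bar> / c"
        using \<phi>(2) \<phi>(3)[of x] box_subset_cbox[of a b] by (auto simp: indicator_def field_simps)
      from mult_right_mono[OF this norm_ge_zero[of "h x"]] show ?thesis using \<phi>(2) by simp
    qed
    then have "integrable lborel (\<lambda>x. indicator (box a b) x *\<^sub>R h x)"
      by (intro Bochner_Integration.integrable_bound[OF int] AE_I2) auto
    with ab show False by simp
  qed
  with \<phi>(1) show ?thesis by (rule that)
qed

lemma weak_partial_integral_eq:
  assumes "weak_partial u i g" "weak_partial u i h" "test_fun \<phi>"
  shows "(\<integral>x. \<phi> x *\<^sub>R g x \<partial>lborel) = (\<integral>x. \<phi> x *\<^sub>R h x \<partial>lborel)"
proof -
  obtain d where "has_partials \<phi> d" using test_fun_partials[OF assms(3)] by metis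
  from weak_partialD[OF assms(1,3) this] weak_partialD[OF assms(2,3) this] show ?thesis by simp
qed

text \<open>If \<open>\<phi>\<^sub>0 h\<close> is not integrable, its Bochner integral has the default value 0, and so has the
  integral of \<open>(\<phi> + \<phi>\<^sub>0) h\<close> whenever \<open>\<phi> h\<close> is integrable.\<close>
lemma weak_partial_zero_if_not_locally_integrable:
  assumes w: "weak_partial u i g" "weak_partial u i h"
    and g: "locally_integrable g" and h: "h \<in> borel_measurable borel" "\<not> locally_integrable h"
  shows "AE x in lborel. g x = 0"
proof (rule fundamental_lemma_of_variations[OF g])
  obtain \<phi>0 where \<phi>0: "test_fun \<phi>0" "\<not> integrable lborel (\<lambda>x. \<phi>0 x *\<^sub>R h x)"
    by (rule not_locally_integrable_test_fun[OF h]) (rule that)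
  have zero: "(\<integral>x. \<phi> x *\<^sub>R g x \<partial>lborel) = 0"
    if "test_fun \<phi>" "\<not> integrable lborel (\<lambda>x. \<phi> x *\<^sub>R h x)" for \<phi>
    using weak_partial_integral_eq[OF w that(1)] not_integrable_integral_eq[OF that(2)] by simp
  fix \<phi> assume \<phi>: "test_fun \<phi>"
  show "(\<integral>x. \<phi> x *\<^sub>R g x \<partial>lborel) = 0"
  proof (cases "integrable lborel (\<lambda>x. \<phi> x *\<^sub>R h x)")
    case True
    have "\<not> integrable lborel (\<lambda>x. (\<phi> x + \<phi>0 x) *\<^sub>R h x)"
    proof
      assume "integrable lborel (\<lambda>x. (\<phi> x + \<phi>0 x) *\<^sub>R h x)"
      from Bochner_Integration.integrable_diff[OF this True] \<phi>0(2) show False by (simp add: scaleR_add_left)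
    qed
    from zero[OF test_fun_add[OF \<phi> \<phi>0(1)] this] zero[OF \<phi>0] show ?thesis
      using locally_integrable_scaleR_bounded_supp[OF g test_fun_bounded_supp[OF \<phi>]]
        locally_integrable_scaleR_bounded_supp[OF g test_fun_bounded_supp[OF \<phi>0(1)]]
      by (simp add: scaleR_add_left)
  qed (rule zero[OF \<phi>])
qed

lemma weak_partial_AE_unique:
  assumes w: "weak_partial u i g" "weak_partial u i h"
    and g: "locally_integrable g" "\<not> (AE x in lborel. g x = 0)" and h: "h \<in> borel_measurable borel"
  shows "AE x in lborel. h x = g x"
proof -
  have loc: "locally_integrable h"
    using weak_partial_zero_if_not_locally_integrable[OF w g(1) h] g(2) by blast
  have "AE x in lborel. h x - g x = 0"
  proof (rule fundamental_lemma_of_variations[OF locally_integrable_diff[OF loc g(1)]])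
    fix \<phi> assume \<phi>: "test_fun \<phi>"
    show "(\<integral>x. \<phi> x *\<^sub>R (h x - g x) \<partial>lborel) = 0"
      using weak_partial_integral_eq[OF w \<phi>] locally_integrable_scaleR_bounded_supp[OF loc test_fun_bounded_supp[OF \<phi>]]
        locally_integrable_scaleR_bounded_supp[OF g(1) test_fun_bounded_supp[OF \<phi>]]
      by (simp add: scaleR_diff_right)
  qed
  then show ?thesis by simp
qed

theorem dirichlet_eq:
  assumes u: "L2 lborel u" "sqnorm lborel u > 0" and g: "\<And>i. L2 lborel (g i)" and w: "weak_gradient u g"
  shows "dirichlet u = (\<Sum>i\<in>UNIV. sqnorm lborel (g i))"
proof -
  note [measurable] = g[THEN L2_measurable, simplified]
  have "\<not> (AE x in lborel. u x = 0)" using u(2) sqnorm_eq_0_iff[OF u(1)] by simp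
  note unique = weak_partial_AE_unique[OF _ _ L2_locally_integrable[OF g]
      weak_gradient_component_nonzero[OF u(1) this g w]]
  have sum: "(\<Sum>i\<in>UNIV. sqnorm lborel (g i)) = (\<integral>x. (cmod (g 1 x))\<^sup>2 + (cmod (g 2 x))\<^sup>2 \<partial>lborel)"
    using L2_integrable[OF g] by (simp add: sum_2 sqnorm_def)
  show ?thesis
    unfolding dirichlet_def
  proof (rule some_equality)
    show "\<exists>h1 h2. h1 \<in> borel_measurable lborel \<and> h2 \<in> borel_measurable lborel \<and>
        weak_partial u 1 h1 \<and> weak_partial u 2 h2 \<and>
        (\<Sum>i\<in>UNIV. sqnorm lborel (g i)) = (\<integral>x. (cmod (h1 x))\<^sup>2 + (cmod (h2 x))\<^sup>2 \<partial>lborel)"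
      using w sum unfolding weak_gradient_2 by (intro exI[of _ "g 1"] exI[of _ "g 2"]) auto
    fix D assume "\<exists>h1 h2. h1 \<in> borel_measurable lborel \<and> h2 \<in> borel_measurable lborel \<and>
        weak_partial u 1 h1 \<and> weak_partial u 2 h2 \<and> D = (\<integral>x. (cmod (h1 x))\<^sup>2 + (cmod (h2 x))\<^sup>2 \<partial>lborel)"
    then obtain h1 h2 where [measurable]: "h1 \<in> borel_measurable borel" "h2 \<in> borel_measurable borel"
      and h: "weak_partial u 1 h1" "weak_partial u 2 h2"
      and D: "D = (\<integral>x. (cmod (h1 x))\<^sup>2 + (cmod (h2 x))\<^sup>2 \<partial>lborel)" by auto
    have "AE x in lborel. h1 x = g 1 x" "AE x in lborel. h2 x = g 2 x"
      using w h by (auto simp: weak_gradient_2 intro: unique)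
    then have "D = (\<integral>x. (cmod (g 1 x))\<^sup>2 + (cmod (g 2 x))\<^sup>2 \<partial>lborel)"
      unfolding D by (intro integral_cong_AE) auto
    then show "D = (\<Sum>i\<in>UNIV. sqnorm lborel (g i))" using sum by simp
  qed
qed

subsection \<open>Weak gradients from difference energies\<close>

definition disc_gradient :: "real \<Rightarrow> (real^2 \<Rightarrow> real) \<Rightarrow> real^2 \<Rightarrow> real^2" where
  "disc_gradient \<epsilon> v x =
    (\<chi> i. (1 / disc_moment \<epsilon>) * (\<integral>h. indicator (ball 0 \<epsilon>) h * (h $ i * (v (x + h) - v x)) \<partial>lborel))"

lemma disc_gradient_measurable [measurable]:
  assumes [measurable]: "v \<in> borel_measurable borel" shows "disc_gradient \<epsilon> v \<in> borel_measurable borel"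
proof (subst borel_measurable_euclidean_space, rule ballI)
  fix b :: "real^2" assume "b \<in> Basis"
  then obtain i where b: "b = axis i 1" by (auto simp: Basis_vec_def)
  show "(\<lambda>x. disc_gradient \<epsilon> v x \<bullet> b) \<in> borel_measurable borel"
    unfolding b disc_gradient_def by (simp add: inner_axis)
qed

lemma disc_increment_integrable:
  fixes x :: "real ^ 'n"
  assumes "L2 lborel v"
  shows "integrable lborel (\<lambda>h. indicator (ball 0 \<epsilon>) h * (h $ i * (v (x + h) - v x)))"
proof -
  have "integrable lborel (\<lambda>h. (indicator (ball 0 \<epsilon>) h * h $ i) * v (x + h))"
    using L2_inner_integrable[OF bounded_supp_L2[OF bounded_supp_ball_coord] L2_shift_left[OF assms]] by simp
  moreover have "integrable lborel (\<lambda>h::real ^ 'n. (indicator (ball 0 \<epsilon>) h * h $ i) * v x)"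
    by (intro integrable_mult_left bounded_supp_integrable bounded_supp_ball_coord)
  ultimately have "integrable lborel
      (\<lambda>h. (indicator (ball 0 \<epsilon>) h * h $ i) * v (x + h) - (indicator (ball 0 \<epsilon>) h * h $ i) * v x)"
    by (rule Bochner_Integration.integrable_diff)
  then show ?thesis by (simp add: algebra_simps)
qed

text \<open>Bessel's inequality: up to the factor \<open>disc_moment \<epsilon>\<close>, the coordinates are orthonormal on the disc.\<close>
lemma disc_gradient_Bessel:
  assumes v: "L2 lborel v" and "\<epsilon> > 0"
  shows "ennreal (disc_moment \<epsilon> * (norm (disc_gradient \<epsilon> v x))\<^sup>2)
     \<le> (\<integral>\<^sup>+h. indicator (ball 0 \<epsilon>) h * ennreal ((norm (v (x + h) - v x))\<^sup>2) \<partial>lborel)" (is "_ \<le> ?R")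
proof -
  define \<alpha> where "\<alpha> = disc_gradient \<epsilon> v x"
  define a where "a = disc_moment \<epsilon> * (norm \<alpha>)\<^sup>2"
  have [measurable]: "v \<in> borel_measurable borel" using v by (simp add: L2_def)
  have moment_pos: "disc_moment \<epsilon> > 0" by (rule disc_moment_pos[OF \<open>\<epsilon> > 0\<close>])
  let ?i = "indicator (ball 0 \<epsilon>) :: real^2 \<Rightarrow> real"
  have quadratic: "(\<integral>\<^sup>+h. ennreal ((norm (?i h * (h \<bullet> \<alpha>)))\<^sup>2) \<partial>lborel) = ennreal a"
  proof -
    have "(\<integral>\<^sup>+h. ennreal ((norm (?i h * (h \<bullet> \<alpha>)))\<^sup>2) \<partial>lborel)
        = (\<integral>\<^sup>+h. indicator (ball 0 \<epsilon>) h * ennreal ((norm (directional h (\<lambda>i _. \<alpha> $ i) x))\<^sup>2) \<partial>lborel)"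
      by (intro nn_integral_cong) (auto simp: indicator_def directional_def inner_vec_def)
    also have "\<dots> = ennreal a"
      unfolding nn_integral_disc_directional_sq by (simp add: a_def norm_sq_2 sum_2)
    finally show ?thesis .
  qed
  have "a = (\<Sum>i\<in>UNIV. \<alpha> $ i * (disc_moment \<epsilon> * \<alpha> $ i))"
    unfolding a_def norm_sq_2 by (simp add: sum_2 power2_eq_square algebra_simps)
  also have "\<dots> = (\<integral>h. (\<Sum>i\<in>UNIV. \<alpha> $ i * (?i h * (h $ i * (v (x + h) - v x)))) \<partial>lborel)"
    using moment_pos by (simp add: \<alpha>_def disc_gradient_def disc_increment_integrable[OF v])
  also have "\<dots> = (\<integral>h. (?i h * (h \<bullet> \<alpha>)) * (?i h * (v (x + h) - v x)) \<partial>lborel)"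
    by (intro Bochner_Integration.integral_cong) (auto simp: indicator_def inner_vec_def sum_2 algebra_simps)
  finally have "ennreal ((norm a)\<^sup>2) \<le> (\<integral>\<^sup>+h. ennreal ((norm (?i h * (h \<bullet> \<alpha>)))\<^sup>2) \<partial>lborel)
      * (\<integral>\<^sup>+h. ennreal ((norm (?i h * (v (x + h) - v x)))\<^sup>2) \<partial>lborel)"
    by (simp only:, intro norm_integral_product_sq_le) (simp_all add: abs_mult)
  also have "(\<integral>\<^sup>+h. ennreal ((norm (?i h * (v (x + h) - v x)))\<^sup>2) \<partial>lborel) = ?R"
    by (intro nn_integral_cong) (auto simp: indicator_def)
  finally have "ennreal (a\<^sup>2) \<le> ennreal a * ?R" unfolding quadratic by simp
  moreover have "0 \<le> a" using moment_pos by (simp add: a_def)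
  ultimately have "ennreal a \<le> ?R"
    by (cases "a = 0") (auto simp: power2_eq_square ennreal_mult ennreal_mult_le_mult_iff)
  then show ?thesis by (simp add: a_def \<alpha>_def)
qed

lemma disc_gradient_L2:
  assumes v: "L2 lborel v" and "\<epsilon> > 0"
    and C: "difference_energy \<epsilon> v \<le> ennreal (disc_moment \<epsilon> * C)" "C \<ge> 0"
  shows "L2 lborel (disc_gradient \<epsilon> v)" "sqnorm lborel (disc_gradient \<epsilon> v) \<le> C"
proof -
  have [measurable]: "v \<in> borel_measurable borel" using v by (simp add: L2_def)
  have moment_pos: "disc_moment \<epsilon> > 0" by (rule disc_moment_pos[OF \<open>\<epsilon> > 0\<close>])
  have "ennreal (disc_moment \<epsilon>) * (\<integral>\<^sup>+x. ennreal ((norm (disc_gradient \<epsilon> v x))\<^sup>2) \<partial>lborel)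
     = (\<integral>\<^sup>+x. ennreal (disc_moment \<epsilon> * (norm (disc_gradient \<epsilon> v x))\<^sup>2) \<partial>lborel)"
    using moment_pos by (subst nn_integral_cmult[symmetric]) (auto simp: ennreal_mult)
  also have "\<dots> \<le> difference_energy \<epsilon> v"
    unfolding difference_energy_def by (intro nn_integral_mono disc_gradient_Bessel v \<open>\<epsilon> > 0\<close>)
  also have "\<dots> \<le> ennreal (disc_moment \<epsilon>) * ennreal C" using C moment_pos by (simp add: ennreal_mult)
  finally have "(\<integral>\<^sup>+x. ennreal ((norm (disc_gradient \<epsilon> v x))\<^sup>2) \<partial>lborel) \<le> ennreal C"
    using moment_pos by (simp add: ennreal_mult_le_mult_iff)
  with C show "L2 lborel (disc_gradient \<epsilon> v)" "sqnorm lborel (disc_gradient \<epsilon> v) \<le> C"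
    by (auto intro!: L2_nn_integralI)
qed

lemma bounded_supp_increment_pair_integrable:
  assumes p: "bounded_supp p" and \<phi>: "L2 lborel \<phi>" and v: "L2 lborel v"
  shows "integrable (lborel \<Otimes>\<^sub>M lborel) (\<lambda>(h, x). p h * (\<phi> x * (v (x + h) - v x)))"
proof (rule pair_integrableI)
  note [measurable] = bounded_supp_measurable[OF p] \<phi>[THEN L2_measurable, simplified] v[THEN L2_measurable, simplified]
  show "(\<lambda>(h, x). p h * (\<phi> x * (v (x + h) - v x))) \<in> borel_measurable (lborel \<Otimes>\<^sub>M lborel)"
    by (simp add: case_prod_unfold)
  let ?K = "sqrt (sqnorm lborel \<phi>) * sqrt (4 * sqnorm lborel v)"
  have "(\<integral>\<^sup>+h. \<integral>\<^sup>+x. ennreal (norm (p h * (\<phi> x * (v (x + h) - v x)))) \<partial>lborel \<partial>lborel)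
      \<le> (\<integral>\<^sup>+h. ennreal (\<bar>p h\<bar>) * ennreal ?K \<partial>lborel)"
  proof (intro nn_integral_mono)
    fix h
    have "(\<integral>\<^sup>+x. ennreal (norm (p h * (\<phi> x * (v (x + h) - v x)))) \<partial>lborel)
        = ennreal \<bar>p h\<bar> * (\<integral>\<^sup>+x. ennreal (norm (\<phi> x) * norm (v (x + h) - v x)) \<partial>lborel)"
      by (simp add: abs_mult ennreal_mult nn_integral_cmult)
    also have "\<dots> \<le> ennreal \<bar>p h\<bar> * ennreal (sqrt (sqnorm lborel \<phi>) * sqrt (sqnorm lborel (\<lambda>x. v (x + h) - v x)))"
      by (intro mult_left_mono L2_nn_integral_mult_le \<phi> L2_diff L2_shift v) simp
    also have "\<dots> \<le> ennreal \<bar>p h\<bar> * ennreal ?K"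
      by (intro mult_left_mono ennreal_leI real_sqrt_le_mono sqnorm_increment_le v) (auto simp: sqnorm_nonneg)
    finally show "(\<integral>\<^sup>+x. ennreal (norm (p h * (\<phi> x * (v (x + h) - v x)))) \<partial>lborel) \<le> ennreal \<bar>p h\<bar> * ennreal ?K" .
  qed
  also have "\<dots> = ennreal (\<integral>h. \<bar>p h\<bar> \<partial>lborel) * ennreal ?K"
    using bounded_supp_integrable[OF p] by (simp add: nn_integral_multc nn_integral_eq_integral)
  also have "\<dots> = ennreal ((\<integral>h. \<bar>p h\<bar> \<partial>lborel) * ?K)"
    by (intro ennreal_mult[symmetric]) (auto simp: sqnorm_nonneg)
  finally show "(\<integral>\<^sup>+h. \<integral>\<^sup>+x. ennreal (norm (case (h, x) of (h, x) \<Rightarrow> p h * (\<phi> x * (v (x + h) - v x)))) \<partial>lborel \<partial>lborel)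
      \<le> ennreal ((\<integral>h. \<bar>p h\<bar> \<partial>lborel) * ?K)"
    by simp
qed

definition increment_pairing :: "(real^2 \<Rightarrow> real) \<Rightarrow> (real^2 \<Rightarrow> real) \<Rightarrow> real^2 \<Rightarrow> real" where
  "increment_pairing \<phi> v h = (\<integral>x. \<phi> x * (v (x + h) - v x) \<partial>lborel)"

lemma disc_gradient_pairing_eq:
  assumes \<phi>: "L2 lborel \<phi>" and v: "L2 lborel v" and \<epsilon>: "\<epsilon> > 0"
  shows "(\<integral>x. \<phi> x * disc_gradient \<epsilon> v x $ i \<partial>lborel)
    = (1 / disc_moment \<epsilon>) * (\<integral>h. indicator (ball 0 \<epsilon>) h * (h $ i * increment_pairing \<phi> v h) \<partial>lborel)"
proof -
  let ?p = "\<lambda>h::real^2. indicator (ball 0 \<epsilon>) h * h $ i"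
  have moment_pos: "disc_moment \<epsilon> > 0" by (rule disc_moment_pos[OF \<epsilon>])
  have "(\<integral>h. ?p h * (\<phi> x * (v (x + h) - v x)) \<partial>lborel) = disc_moment \<epsilon> * (\<phi> x * disc_gradient \<epsilon> v x $ i)" for x
  proof -
    have "(\<integral>h. ?p h * (\<phi> x * (v (x + h) - v x)) \<partial>lborel)
        = \<phi> x * (\<integral>h. indicator (ball 0 \<epsilon>) h * (h $ i * (v (x + h) - v x)) \<partial>lborel)"
      unfolding integral_mult_right_zero[symmetric] by (simp add: mult_ac)
    then show ?thesis using moment_pos by (simp add: disc_gradient_def)
  qed
  then have "(\<integral>x. \<phi> x * disc_gradient \<epsilon> v x $ i \<partial>lborel)
      = (1 / disc_moment \<epsilon>) * (\<integral>x. \<integral>h. ?p h * (\<phi> x * (v (x + h) - v x)) \<partial>lborel \<partial>lborel)"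
    using moment_pos by simp
  also have "\<dots> = (1 / disc_moment \<epsilon>) * (\<integral>h. \<integral>x. ?p h * (\<phi> x * (v (x + h) - v x)) \<partial>lborel \<partial>lborel)"
    by (subst lborel_pair.Fubini_integral[OF bounded_supp_increment_pair_integrable[OF bounded_supp_ball_coord \<phi> v]])
      (rule refl)
  also have "\<dots> = (1 / disc_moment \<epsilon>) * (\<integral>h. ?p h * increment_pairing \<phi> v h \<partial>lborel)"
    by (simp only: integral_mult_right_zero increment_pairing_def)
  finally show ?thesis by (simp only: mult.assoc)
qed

lemma bounded_supp_uniformly_continuous:
  fixes f :: "'a::euclidean_space \<Rightarrow> real"
  assumes supp: "bounded_supp f" and cont: "continuous_on UNIV f"
  shows "uniformly_continuous_on UNIV f"
proof -
  obtain R where zero: "\<And>x. R \<le> norm x \<Longrightarrow> f x = 0" by (rule bounded_suppE[OF supp]) blast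
  have "uniformly_continuous_on (cball 0 (R + 1)) f"
    by (intro compact_uniformly_continuous continuous_on_subset[OF cont]) auto
  then have near: "\<exists>\<delta>>0. \<forall>x\<in>cball 0 (R + 1). \<forall>y\<in>cball 0 (R + 1). dist y x < \<delta> \<longrightarrow> dist (f y) (f x) < e"
    if "e > 0" for e
    using that by (auto simp: uniformly_continuous_on_def)
  show ?thesis
    unfolding uniformly_continuous_on_def
  proof (intro allI impI)
    fix e :: real assume "e > 0"
    from near[OF this] obtain \<delta> where \<delta>: "\<delta> > 0"
      "\<And>x y. norm x \<le> R + 1 \<Longrightarrow> norm y \<le> R + 1 \<Longrightarrow> dist y x < \<delta> \<Longrightarrow> dist (f y) (f x) < e" by auto
    have "dist (f y) (f x) < e" if "dist y x < min \<delta> 1" for x y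
    proof (cases "R \<le> norm x \<and> R \<le> norm y")
      case True
      then show ?thesis using zero[of x] zero[of y] \<open>e > 0\<close> by simp
    next
      case False
      then have "norm x \<le> R + 1" "norm y \<le> R + 1"
        using norm_triangle_ineq2[of x y] norm_triangle_ineq2[of y x] that by (auto simp: dist_norm norm_minus_commute)
      with \<delta>(2) that show ?thesis by simp
    qed
    with \<delta>(1) show "\<exists>\<delta>>0. \<forall>x\<in>UNIV. \<forall>y\<in>UNIV. dist y x < \<delta> \<longrightarrow> dist (f y) (f x) < e"
      by (intro exI[of _ "min \<delta> 1"]) auto
  qed
qed

lemma increment_error_uniform:
  assumes partials: "has_partials \<phi> d" and d: "\<And>i. bounded_supp (d i)" and e: "e > 0"
  shows "\<exists>\<eta>>0. \<forall>x h. norm h < \<eta> \<longrightarrow> \<bar>\<phi> (x + h) - \<phi> x - directional h d x\<bar> \<le> e * norm h"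
proof -
  have "\<exists>\<eta>>0. \<forall>x\<in>UNIV. \<forall>y\<in>UNIV. dist y x < \<eta> \<longrightarrow> dist (d i y) (d i x) < e / 2" for i
    using bounded_supp_uniformly_continuous[OF d has_partials_continuous[OF partials], of i] half_gt_zero[OF e]
    unfolding uniformly_continuous_on_def by meson
  then obtain \<eta> where \<eta>: "\<And>i. \<eta> i > 0" "\<And>i x y. dist y x < \<eta> i \<Longrightarrow> dist (d i y) (d i x) < e / 2"
    by (metis UNIV_I)
  have "\<bar>\<phi> (x + h) - \<phi> x - directional h d x\<bar> \<le> 2 * (e / 2) * norm h" if h: "norm h < min (\<eta> 1) (\<eta> 2)" for x h
  proof (rule increment_partials_error[OF partials])
    fix i :: 2 and y assume "norm (y - x) \<le> norm h"
    with h \<eta>(2)[of y x i] exhaust_2[of i] show "\<bar>d i y - d i x\<bar> \<le> e / 2"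
      by (auto simp: dist_norm)
  qed
  with \<eta>(1) show ?thesis by (intro exI[of _ "min (\<eta> 1) (\<eta> 2)"]) auto
qed

lemma increment_error_zero_outside:
  fixes \<phi> :: "real^2 \<Rightarrow> real"
  assumes \<phi>: "bounded_supp \<phi>" and d: "\<And>i. bounded_supp (d i)"
  obtains \<rho> where "\<And>x h. \<rho> \<le> norm x \<Longrightarrow> norm h \<le> 1 \<Longrightarrow> \<phi> (x + h) - \<phi> x - directional h d x = 0"
proof -
  obtain R where zero: "\<And>x. R \<le> norm x \<Longrightarrow> \<phi> x = 0"
    by (rule bounded_suppE[OF \<phi>]) blast
  have "\<exists>R. \<forall>x. R \<le> norm x \<longrightarrow> d i x = 0" for i by (rule bounded_suppE[OF d[of i]]) blast
  then obtain R' where zero_d: "\<And>i x. R' i \<le> norm x \<Longrightarrow> d i x = 0" by metis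
  show ?thesis
  proof (rule that)
    fix x h :: "real^2" assume "max (R + 1) (max (R' 1) (R' 2)) \<le> norm x" "norm h \<le> 1"
    moreover have "norm x \<le> norm (x + h) + norm h" using norm_triangle_ineq4[of "x + h" h] by simp
    ultimately show "\<phi> (x + h) - \<phi> x - directional h d x = 0" by (simp add: zero zero_d directional_2)
  qed
qed

lemma increment_pairing_eq:
  assumes \<phi>: "L2 lborel \<phi>" and v: "L2 lborel v"
  shows "increment_pairing \<phi> v h = (\<integral>x. (\<phi> (x - h) - \<phi> x) * v x \<partial>lborel)"
proof -
  note [measurable] = \<phi>[THEN L2_measurable, simplified] v[THEN L2_measurable, simplified]
  have int: "integrable lborel (\<lambda>x. \<phi> x * v x)" "integrable lborel (\<lambda>x. \<phi> x * v (x + h))"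
    "integrable lborel (\<lambda>x. \<phi> (x - h) * v x)"
    using L2_inner_integrable[OF \<phi> v] L2_inner_integrable[OF \<phi> L2_shift[OF v]]
      L2_inner_integrable[OF L2_shift[OF \<phi>, of "-h"] v] by simp_all
  have "(\<integral>x. \<phi> x * v (x + h) \<partial>lborel) = (\<integral>x. \<phi> (x - h) * v x \<partial>lborel)"
    using lborel_preserving_integral(1)[OF lborel_preserving_add[of h], where h="\<lambda>x. \<phi> (x - h) * v x"] by simp
  with int show ?thesis by (simp add: increment_pairing_def right_diff_distrib left_diff_distrib)
qed

lemma increment_pairing_remainder:
  assumes \<phi>: "bounded_supp \<phi>" and v: "L2 lborel v" and d: "\<And>i. bounded_supp (d i)"
  shows "integrable lborel (\<lambda>x. (\<phi> (x + - h) - \<phi> x - directional (- h) d x) * v x)"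
    and "increment_pairing \<phi> v h - (\<Sum>i\<in>UNIV. h $ i * - (\<integral>x. d i x * v x \<partial>lborel))
      = (\<integral>x. (\<phi> (x + - h) - \<phi> x - directional (- h) d x) * v x \<partial>lborel)"
proof -
  have L: "L2 lborel (\<lambda>x. \<phi> (x + - h) - \<phi> x)" "L2 lborel (directional (- h) d)"
    by (intro L2_diff L2_shift bounded_supp_L2 bounded_supp_directional \<phi> d)+
  note int = L2_inner_integrable[OF L(1) v] L2_inner_integrable[OF L(2) v]
  show "integrable lborel (\<lambda>x. (\<phi> (x + - h) - \<phi> x - directional (- h) d x) * v x)"
    using L2_inner_integrable[OF L2_diff[OF L] v] by simp
  have "integrable lborel (\<lambda>x. d i x * v x)" for i
    using L2_inner_integrable[OF bounded_supp_L2[OF d] v] by simp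
  then have "(\<Sum>i\<in>UNIV. h $ i * - (\<integral>x. d i x * v x \<partial>lborel)) = (\<integral>x. directional (- h) d x * v x \<partial>lborel)"
    by (simp add: directional_2 sum_2 distrib_right left_diff_distrib mult.assoc)
  with int show "increment_pairing \<phi> v h - (\<Sum>i\<in>UNIV. h $ i * - (\<integral>x. d i x * v x \<partial>lborel))
      = (\<integral>x. (\<phi> (x + - h) - \<phi> x - directional (- h) d x) * v x \<partial>lborel)"
    by (simp add: increment_pairing_eq[OF bounded_supp_L2[OF \<phi>] v] left_diff_distrib[of "_ - _"])
qed

lemma increment_pairing_has_derivative:
  assumes \<phi>: "bounded_supp \<phi>" and v: "L2 lborel v"
    and partials: "has_partials \<phi> d" and d: "\<And>i. bounded_supp (d i)"
  shows "(increment_pairing \<phi> v has_derivative (\<lambda>h. \<Sum>i\<in>UNIV. h $ i * - (\<integral>x. d i x * v x \<partial>lborel))) (at 0)"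
    (is "(_ has_derivative ?L) _")
proof -
  obtain \<rho> where zero: "\<And>x h. \<rho> \<le> norm x \<Longrightarrow> norm h \<le> 1 \<Longrightarrow> \<phi> (x + h) - \<phi> x - directional h d x = 0"
    using increment_error_zero_outside[where d=d, OF \<phi> d] by blast
  define K where "K = (\<integral>x. indicator (ball 0 \<rho>) x * \<bar>v x\<bar> \<partial>lborel)"
  have K_int: "integrable lborel (\<lambda>x. indicator (ball 0 \<rho>) x * \<bar>v x\<bar>)"
    using integrable_abs[OF locally_integrable_ball[OF L2_locally_integrable[OF v]]] by (simp add: abs_mult)
  have "K \<ge> 0" unfolding K_def by (intro integral_nonneg_AE) auto
  have "\<exists>\<eta>>0. \<forall>h. norm h < \<eta> \<longrightarrow> \<bar>increment_pairing \<phi> v h - ?L h\<bar> \<le> e * norm h" if "e > 0" for e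
  proof -
    obtain \<eta> where \<eta>: "\<eta> > 0"
      "\<And>x h. norm h < \<eta> \<Longrightarrow> \<bar>\<phi> (x + h) - \<phi> x - directional h d x\<bar> \<le> e / (K + 1) * norm h"
      using increment_error_uniform[OF partials d, of "e / (K + 1)"] \<open>e > 0\<close> \<open>K \<ge> 0\<close> by auto
    have "\<bar>increment_pairing \<phi> v h - ?L h\<bar> \<le> e * norm h" if h: "norm h < min \<eta> 1" for h
    proof -
      have "\<bar>(\<phi> (x + - h) - \<phi> x - directional (- h) d x) * v x\<bar>
          \<le> e / (K + 1) * norm h * (indicator (ball 0 \<rho>) x * \<bar>v x\<bar>)" for x
        using mult_right_mono[OF \<eta>(2)[of "- h" x] abs_ge_zero[of "v x"]] zero[of x "- h"] h
        by (cases "norm x < \<rho>") (auto simp: abs_mult)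
      then have "\<bar>increment_pairing \<phi> v h - ?L h\<bar>
          \<le> (\<integral>x. e / (K + 1) * norm h * (indicator (ball 0 \<rho>) x * \<bar>v x\<bar>) \<partial>lborel)"
        unfolding increment_pairing_remainder(2)[OF \<phi> v d]
        by (intro order_trans[OF integral_abs_bound] integral_mono integrable_abs integrable_mult_right K_int
            increment_pairing_remainder(1) \<phi> v d)
      also have "\<dots> = e * norm h * (K / (K + 1))" by (simp add: K_def)
      also have "\<dots> \<le> e * norm h" using \<open>e > 0\<close> \<open>K \<ge> 0\<close> by (intro mult_left_le) auto
      finally show ?thesis .
    qed
    with \<eta>(1) show ?thesis by (intro exI[of _ "min \<eta> 1"]) auto
  qed
  moreover have "bounded_linear ?L"
    by (intro bounded_linear_sum bounded_linear_mult_const bounded_linear_vec_nth)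
  moreover have "increment_pairing \<phi> v 0 = 0" by (simp add: increment_pairing_def)
  ultimately show ?thesis by (simp add: has_derivative_at_alt)
qed

lemma disc_moment_remainder:
  assumes [measurable]: "E \<in> borel_measurable borel"
    and small: "\<And>h. h \<in> ball 0 \<epsilon> \<Longrightarrow> \<bar>E h\<bar> \<le> e * norm h"
  shows "integrable lborel (\<lambda>h::real^2. indicator (ball 0 \<epsilon>) h * (h $ i * E h))"
    and "\<bar>\<integral>h. indicator (ball 0 \<epsilon>) h * (h $ i * E h) \<partial>lborel\<bar> \<le> 2 * e * disc_moment \<epsilon>"
proof -
  let ?g = "\<lambda>h::real^2. e * (indicator (ball 0 \<epsilon>) h * (norm h)\<^sup>2)"
  have bound: "\<bar>indicator (ball 0 \<epsilon>) h * (h $ i * E h)\<bar> \<le> ?g h" for h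
  proof (cases "h \<in> ball 0 \<epsilon>")
    case True
    have "\<bar>h $ i\<bar> * \<bar>E h\<bar> \<le> norm h * (e * norm h)"
      using small[OF True] component_le_norm_cart[of h i] by (intro mult_mono) auto
    with True show ?thesis by (simp add: abs_mult power2_eq_square mult_ac)
  qed simp
  have g: "integrable lborel ?g" by (intro integrable_mult_right disc_norm_sq_integral)
  then show int: "integrable lborel (\<lambda>h::real^2. indicator (ball 0 \<epsilon>) h * (h $ i * E h))"
    by (rule Bochner_Integration.integrable_bound) (use bound in \<open>auto intro!: AE_I2 order_trans[OF bound]\<close>)
  have "\<bar>\<integral>h. indicator (ball 0 \<epsilon>) h * (h $ i * E h) \<partial>lborel\<bar> \<le> (\<integral>h. ?g h \<partial>lborel)"
    by (intro order_trans[OF integral_abs_bound] integral_mono integrable_abs int g bound)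
  then show "\<bar>\<integral>h. indicator (ball 0 \<epsilon>) h * (h $ i * E h) \<partial>lborel\<bar> \<le> 2 * e * disc_moment \<epsilon>"
    by (simp add: disc_norm_sq_integral(2))
qed

text \<open>By isotropy of the disc, its normalised first moments recover the partial derivatives at the centre.\<close>
lemma disc_moment_tendsto_derivative:
  fixes \<Psi> :: "real^2 \<Rightarrow> real"
  assumes [measurable]: "\<Psi> \<in> borel_measurable borel" and "\<Psi> 0 = 0"
    and \<Psi>: "(\<Psi> has_derivative (\<lambda>h. \<Sum>j\<in>UNIV. h $ j * a j)) (at 0)"
  shows "((\<lambda>\<epsilon>. (1 / disc_moment \<epsilon>) * (\<integral>h. indicator (ball 0 \<epsilon>) h * (h $ i * \<Psi> h) \<partial>lborel)) \<longlongrightarrow> a i) (at_right 0)"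
proof (rule tendstoI)
  fix e :: real assume "e > 0"
  define E where "E h = \<Psi> h - (\<Sum>j\<in>UNIV. h $ j * a j)" for h
  have [measurable]: "E \<in> borel_measurable borel" unfolding E_def by measurable
  obtain \<delta> where \<delta>: "\<delta> > 0" "\<And>h. norm h < \<delta> \<Longrightarrow> \<bar>E h\<bar> \<le> e / 4 * norm h"
    using conjunct2[OF \<Psi>[unfolded has_derivative_at_alt], rule_format, of "e / 4"] \<open>e > 0\<close> \<open>\<Psi> 0 = 0\<close>
    by (auto simp: E_def)
  have "dist ((1 / disc_moment \<epsilon>) * (\<integral>h. indicator (ball 0 \<epsilon>) h * (h $ i * \<Psi> h) \<partial>lborel)) (a i) < e"
    if \<epsilon>: "0 < \<epsilon>" "\<epsilon> < \<delta>" for \<epsilon>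
  proof -
    have moment_pos: "disc_moment \<epsilon> > 0" by (rule disc_moment_pos[OF \<epsilon>(1)])
    have "\<bar>E h\<bar> \<le> e / 4 * norm h" if "h \<in> ball 0 \<epsilon>" for h using that \<delta>(2)[of h] \<epsilon> by simp
    note remainder = disc_moment_remainder[OF \<open>E \<in> borel_measurable borel\<close> this]
    have "(\<integral>h. indicator (ball 0 \<epsilon>) h * (h $ i * \<Psi> h) \<partial>lborel)
        = (\<integral>h. indicator (ball 0 \<epsilon>) h * (h $ i * E h)
            + (\<Sum>j\<in>UNIV. indicator (ball 0 \<epsilon>) h * (h $ i * h $ j) * a j) \<partial>lborel)"
      by (intro Bochner_Integration.integral_cong) (auto simp: E_def sum_2 algebra_simps)
    also have "\<dots> = (\<integral>h. indicator (ball 0 \<epsilon>) h * (h $ i * E h) \<partial>lborel)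
        + (\<Sum>j\<in>UNIV. (\<integral>h. indicator (ball 0 \<epsilon>) h * (h $ i * h $ j) \<partial>lborel) * a j)"
      by (subst Bochner_Integration.integral_add[OF remainder(1)]) (simp_all add: ball_monomial_integrable)
    also have "(\<Sum>j\<in>UNIV. (\<integral>h. indicator (ball 0 \<epsilon>) h * (h $ i * h $ j) \<partial>lborel) * a j) = disc_moment \<epsilon> * a i"
      by (simp add: disc_second_moments if_distrib[of "\<lambda>c. c * _"] cong: if_cong)
    finally have eq: "(1 / disc_moment \<epsilon>) * (\<integral>h. indicator (ball 0 \<epsilon>) h * (h $ i * \<Psi> h) \<partial>lborel) - a i
        = (1 / disc_moment \<epsilon>) * (\<integral>h. indicator (ball 0 \<epsilon>) h * (h $ i * E h) \<partial>lborel)"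
      using moment_pos by (simp add: field_simps)
    have "\<bar>(1 / disc_moment \<epsilon>) * (\<integral>h. indicator (ball 0 \<epsilon>) h * (h $ i * E h) \<partial>lborel)\<bar> \<le> e / 2"
      using remainder(2) moment_pos by (simp add: abs_mult field_simps)
    then show ?thesis unfolding dist_real_def eq using \<open>e > 0\<close> by linarith
  qed
  with \<delta>(1) show "\<forall>\<^sub>F \<epsilon> in at_right 0.
      dist ((1 / disc_moment \<epsilon>) * (\<integral>h. indicator (ball 0 \<epsilon>) h * (h $ i * \<Psi> h) \<partial>lborel)) (a i) < e"
    by (auto simp: eventually_at_right)
qed

lemma disc_gradient_pairing_tendsto:
  assumes v: "L2 lborel v" and \<phi>: "test_fun \<phi>" and d: "has_partials \<phi> d" "\<And>i. bounded_supp (d i)"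
  shows "((\<lambda>\<epsilon>. \<integral>x. \<phi> x * disc_gradient \<epsilon> v x $ i \<partial>lborel) \<longlongrightarrow> - (\<integral>x. d i x * v x \<partial>lborel)) (at_right 0)"
proof -
  note supp = test_fun_bounded_supp[OF \<phi>]
  note [measurable] = bounded_supp_measurable[OF supp] v[THEN L2_measurable, simplified]
  have "increment_pairing \<phi> v \<in> borel_measurable borel" unfolding increment_pairing_def by measurable
  from disc_moment_tendsto_derivative[OF this _ increment_pairing_has_derivative[OF supp v d], of i]
  have "((\<lambda>\<epsilon>. (1 / disc_moment \<epsilon>) * (\<integral>h. indicator (ball 0 \<epsilon>) h * (h $ i * increment_pairing \<phi> v h) \<partial>lborel))
      \<longlongrightarrow> - (\<integral>x. d i x * v x \<partial>lborel)) (at_right 0)"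
    by (simp add: increment_pairing_def)
  then show ?thesis
    by (rule Lim_transform_eventually, intro eventually_mono[OF eventually_at_right_less])
      (simp add: disc_gradient_pairing_eq[OF bounded_supp_L2[OF supp] v])
qed

definition L2_gradient :: "(real^2 \<Rightarrow> real) \<Rightarrow> (2 \<Rightarrow> real^2 \<Rightarrow> real) \<Rightarrow> bool" where
  "L2_gradient v g \<longleftrightarrow> (\<forall>i. L2 lborel (g i)) \<and>
    weak_gradient (\<lambda>x. complex_of_real (v x)) (\<lambda>i x. complex_of_real (g i x))"

lemma weak_partial_of_real:
  assumes "\<And>\<phi> d. test_fun \<phi> \<Longrightarrow> has_partials \<phi> d \<Longrightarrow>
    (\<integral>x. d i x * v x \<partial>lborel) = - (\<integral>x. \<phi> x * g x \<partial>lborel)"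
  shows "weak_partial (\<lambda>x. complex_of_real (v x)) i (\<lambda>x. complex_of_real (g x))"
proof (rule weak_partialI)
  fix \<phi> d assume "test_fun \<phi>" "has_partials \<phi> d"
  from arg_cong[OF assms[OF this], of complex_of_real]
  show "(\<integral>x. d i x *\<^sub>R complex_of_real (v x) \<partial>lborel) = - (\<integral>x. \<phi> x *\<^sub>R complex_of_real (g x) \<partial>lborel)"
    by (simp add: scaleR_conv_of_real flip: of_real_mult)
qed

theorem weak_gradient_from_difference_energy:
  assumes v: "L2 lborel v" and eps: "\<And>n. \<epsilon> n > 0" "\<epsilon> \<longlonglongrightarrow> 0"
    and C: "\<And>n. difference_energy (\<epsilon> n) v \<le> ennreal (disc_moment (\<epsilon> n) * C)" "C \<ge> 0"
  shows "\<exists>g. L2_gradient v g \<and> (\<Sum>i\<in>UNIV. sqnorm lborel (g i)) \<le> C"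
proof -
  from L2_weak_limit[of lborel "\<lambda>n. disc_gradient (\<epsilon> n) v" C, OF disc_gradient_L2[OF v eps(1) C]]
  obtain g :: "real^2 \<Rightarrow> real^2" where g: "L2 lborel g" "sqnorm lborel g \<le> C"
    and lim: "\<And>\<phi> l. L2 lborel \<phi> \<Longrightarrow> (\<lambda>n. \<integral>x. \<phi> x \<bullet> disc_gradient (\<epsilon> n) v x \<partial>lborel) \<longlonglongrightarrow> l
       \<Longrightarrow> (\<integral>x. \<phi> x \<bullet> g x \<partial>lborel) = l"
    by blast
  have at_right: "filterlim \<epsilon> (at_right 0) sequentially"
    using eps by (intro tendsto_imp_filterlim_at_right) auto
  have "weak_partial (\<lambda>x. complex_of_real (v x)) i (\<lambda>x. complex_of_real (g x $ i))" for i
  proof (rule weak_partial_of_real)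
    fix \<phi> d assume \<phi>: "test_fun \<phi>" and partials: "has_partials \<phi> d"
    obtain d' where d': "has_partials \<phi> d'" "\<And>i. bounded_supp (d' i)" by (rule test_fun_partials[OF \<phi>]) blast
    then have "d i = d' i" for i using has_partials_unique has_partials_partial[OF partials] by blast
    then have d: "bounded_supp (d i)" for i using d' by simp
    have "L2 lborel (\<lambda>x. \<phi> x *\<^sub>R (axis i 1 :: real^2))"
      using bounded_supp_L2[OF test_fun_bounded_supp[OF \<phi>]] by (auto simp: L2_def)
    from lim[OF this, of "- (\<integral>x. d i x * v x \<partial>lborel)"]
    show "(\<integral>x. d i x * v x \<partial>lborel) = - (\<integral>x. \<phi> x * g x $ i \<partial>lborel)"
      using filterlim_compose[OF disc_gradient_pairing_tendsto[OF v \<phi> partials d] at_right, of i]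
      by (simp add: inner_axis')
  qed
  then have "L2_gradient v (\<lambda>i x. g x $ i)"
    using L2_vec_nth[OF g(1)] by (auto simp: L2_gradient_def weak_gradient_def)
  then show ?thesis using g by (auto simp: sqnorm_vec_eq_sum)
qed

subsection \<open>The Dirichlet energy as a limit of difference energies\<close>

definition difference_quotient_energy :: "real \<Rightarrow> (real^2 \<Rightarrow> real) \<Rightarrow> ennreal" where
  "difference_quotient_energy \<epsilon> v = difference_energy \<epsilon> v / ennreal (disc_moment \<epsilon>)"

definition edirichlet :: "(real^2 \<Rightarrow> real) \<Rightarrow> ennreal" where
  "edirichlet v = liminf (\<lambda>n. difference_quotient_energy (1 / real (Suc n)) v)"

lemma difference_quotient_energy_le_iff:
  assumes "\<epsilon> > 0"
  shows "difference_quotient_energy \<epsilon> v \<le> D \<longleftrightarrow> difference_energy \<epsilon> v \<le> ennreal (disc_moment \<epsilon>) * D"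
    (is "?l \<longleftrightarrow> ?r")
proof
  have moment_pos: "ennreal (disc_moment \<epsilon>) > 0" using disc_moment_pos[OF assms] by simp
  show "?l" if "?r" using divide_le_posI_ennreal[OF moment_pos that] by (simp add: difference_quotient_energy_def)
  show "?r" if "?l"
  proof -
    have "difference_energy \<epsilon> v = ennreal (disc_moment \<epsilon>) * difference_quotient_energy \<epsilon> v"
      using moment_pos unfolding difference_quotient_energy_def ennreal_times_divide
      by (subst mult.commute, subst mult_divide_eq_ennreal) auto
    also have "\<dots> \<le> ennreal (disc_moment \<epsilon>) * D" by (intro mult_left_mono that) simp
    finally show ?thesis .
  qed
qed

lemma difference_quotient_energy_le_ennreal_iff:
  assumes "\<epsilon> > 0" "C \<ge> 0"
  shows "difference_quotient_energy \<epsilon> v \<le> ennreal C \<longleftrightarrow> difference_energy \<epsilon> v \<le> ennreal (disc_moment \<epsilon> * C)"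
  using disc_moment_nonneg[of \<epsilon>] assms by (simp add: difference_quotient_energy_le_iff ennreal_mult)

lemma Liminf_cmult_ennreal:
  assumes "c < top" "F \<noteq> bot" shows "Liminf F (\<lambda>n. c * f n) = c * Liminf F (f :: _ \<Rightarrow> ennreal)"
  using assms by (intro Liminf_compose_continuous_mono ennreal_continuous_on_cmult)
    (auto simp: mono_def mult_left_mono)

lemma edirichlet_le:
  assumes "\<And>n. difference_quotient_energy (1 / real (Suc n)) v \<le> D"
  shows "edirichlet v \<le> D"
  unfolding edirichlet_def using assms by (intro Liminf_le always_eventually) auto

lemma edirichlet_cong_AE: "AE x in lborel. w x = v x \<Longrightarrow> edirichlet w = edirichlet v"
  by (simp add: edirichlet_def difference_quotient_energy_def difference_energy_cong_AE)

lemma edirichlet_shift: "v \<in> borel_measurable borel \<Longrightarrow> edirichlet (\<lambda>x. v (x + c)) = edirichlet v"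
  by (simp add: edirichlet_def difference_quotient_energy_def difference_energy_shift)

lemma edirichlet_cmult:
  assumes "v \<in> borel_measurable borel"
  shows "edirichlet (\<lambda>x. s * v x) = ennreal (s\<^sup>2) * edirichlet v"
  unfolding edirichlet_def difference_quotient_energy_def difference_energy_cmult[OF assms]
  by (simp add: Liminf_cmult_ennreal flip: ennreal_times_divide)

lemma difference_quotient_energy_le_gradient:
  assumes "L2 lborel v" "L2_gradient v g" "\<epsilon> > 0"
  shows "difference_quotient_energy \<epsilon> v \<le> ennreal (\<Sum>i\<in>UNIV. sqnorm lborel (g i))"
proof -
  have "L2 lborel (\<lambda>x. complex_of_real (g i x))" for i
    using assms(2) by (intro L2_of_real) (simp add: L2_gradient_def)
  from difference_energy_le_gradient[OF L2_of_real[OF assms(1)] this] assms(2,3) show ?thesis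
    by (simp add: difference_quotient_energy_le_ennreal_iff sum_nonneg sqnorm_nonneg L2_gradient_def
        difference_energy_of_real sqnorm_of_real)
qed

lemma gradient_if_edirichlet_less:
  assumes v: "L2 lborel v" and c: "edirichlet v < ennreal c"
  shows "\<exists>g. L2_gradient v g \<and> (\<Sum>i\<in>UNIV. sqnorm lborel (g i)) \<le> c"
proof -
  have "c \<ge> 0" using c by (metis ennreal_neg linorder_not_less nle_le zero_le)
  have "\<exists>n\<ge>N. difference_quotient_energy (1 / real (Suc n)) v < ennreal c" for N
  proof (rule ccontr)
    assume "\<not> ?thesis"
    then have "\<forall>\<^sub>F n in sequentially. ennreal c \<le> difference_quotient_energy (1 / real (Suc n)) v"
      by (auto simp: eventually_sequentially not_less)
    then have "ennreal c \<le> edirichlet v" unfolding edirichlet_def by (rule Liminf_bounded)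
    with c show False by simp
  qed
  then obtain r where r: "\<And>N. r N \<ge> N" "\<And>N. difference_quotient_energy (1 / real (Suc (r N))) v < ennreal c"
    by metis
  show ?thesis
  proof (rule weak_gradient_from_difference_energy[OF v, where \<epsilon>="\<lambda>N. 1 / real (Suc (r N))"])
    show "(\<lambda>N. 1 / real (Suc (r N))) \<longlonglongrightarrow> 0"
    proof (rule tendsto_sandwich[OF _ _ tendsto_const LIMSEQ_Suc[OF lim_1_over_n]])
      show "\<forall>\<^sub>F N in sequentially. 1 / real (Suc (r N)) \<le> 1 / real (Suc N)"
        using r(1) by (intro always_eventually allI) (simp add: frac_le)
    qed auto
    show "difference_energy (1 / real (Suc (r n))) v \<le> ennreal (disc_moment (1 / real (Suc (r n))) * c)" for n
      using less_imp_le[OF r(2)[of n]] \<open>c \<ge> 0\<close> by (subst (asm) difference_quotient_energy_le_ennreal_iff) auto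
  qed (use \<open>c \<ge> 0\<close> in auto)
qed

theorem difference_quotient_energy_le_edirichlet:
  assumes v: "L2 lborel v" and "\<epsilon> > 0"
  shows "difference_quotient_energy \<epsilon> v \<le> edirichlet v"
proof (rule dense_ge)
  fix t assume t: "edirichlet v < t"
  show "difference_quotient_energy \<epsilon> v \<le> t"
  proof (cases t)
    case (real c)
    obtain g where g: "L2_gradient v g" "(\<Sum>i\<in>UNIV. sqnorm lborel (g i)) \<le> c"
      using gradient_if_edirichlet_less[OF v] t real by blast
    have "difference_quotient_energy \<epsilon> v \<le> ennreal (\<Sum>i\<in>UNIV. sqnorm lborel (g i))"
      by (rule difference_quotient_energy_le_gradient[OF v g(1) \<open>\<epsilon> > 0\<close>])
    also have "\<dots> \<le> t" unfolding real using g(2) by (rule ennreal_leI)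
    finally show ?thesis .
  qed simp
qed

lemma edirichlet_tendsto:
  assumes v: "L2 lborel v"
  shows "(\<lambda>n. difference_quotient_energy (1 / real (Suc n)) v) \<longlonglongrightarrow> edirichlet v"
proof (rule Liminf_eq_Limsup)
  have "limsup (\<lambda>n. difference_quotient_energy (1 / real (Suc n)) v) \<le> edirichlet v"
    by (intro Limsup_bounded always_eventually allI difference_quotient_energy_le_edirichlet[OF v]) simp
  then show "limsup (\<lambda>n. difference_quotient_energy (1 / real (Suc n)) v) = edirichlet v"
    unfolding edirichlet_def by (intro antisym Liminf_le_Limsup) auto
qed (simp_all add: edirichlet_def)

theorem edirichlet_le_liminf:
  assumes z: "\<And>n. L2 lborel (z n)" and lim: "AE x in lborel. (\<lambda>n. z n x) \<longlonglongrightarrow> v x"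
  shows "edirichlet v \<le> liminf (\<lambda>n. edirichlet (z n))"
proof (rule edirichlet_le, rule difference_quotient_energy_le_iff[THEN iffD2])
  fix k
  let ?\<epsilon> = "1 / real (Suc k)"
  have "difference_energy ?\<epsilon> v \<le> liminf (\<lambda>n. difference_energy ?\<epsilon> (z n))"
    using z lim by (intro difference_energy_le_liminf) (auto simp: L2_def)
  also have "\<dots> \<le> liminf (\<lambda>n. ennreal (disc_moment ?\<epsilon>) * edirichlet (z n))"
    using difference_quotient_energy_le_edirichlet[OF z, of ?\<epsilon>]
    by (intro Liminf_mono always_eventually allI) (simp add: difference_quotient_energy_le_iff)
  also have "\<dots> = ennreal (disc_moment ?\<epsilon>) * liminf (\<lambda>n. edirichlet (z n))"
    by (simp add: Liminf_cmult_ennreal)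
  finally show "difference_energy ?\<epsilon> v \<le> ennreal (disc_moment ?\<epsilon>) * liminf (\<lambda>n. edirichlet (z n))" .
qed simp

theorem edirichlet_eq_gradient:
  assumes v: "L2 lborel v" and fin: "edirichlet v < \<infinity>"
  obtains g where "L2_gradient v g" "edirichlet v = ennreal (\<Sum>i\<in>UNIV. sqnorm lborel (g i))"
proof -
  obtain D where D: "edirichlet v = ennreal D" "D \<ge> 0" using fin by (cases "edirichlet v") auto
  have "\<exists>g. L2_gradient v g \<and> (\<Sum>i\<in>UNIV. sqnorm lborel (g i)) \<le> D"
  proof (rule weak_gradient_from_difference_energy[OF v, where \<epsilon>="\<lambda>n. 1 / real (Suc n)"])
    show "(\<lambda>n. 1 / real (Suc n)) \<longlonglongrightarrow> 0" by (rule LIMSEQ_Suc[OF lim_1_over_n])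
    show "difference_energy (1 / real (Suc n)) v \<le> ennreal (disc_moment (1 / real (Suc n)) * D)" for n
      using difference_quotient_energy_le_edirichlet[OF v] D(2) unfolding D(1)
      by (intro difference_quotient_energy_le_ennreal_iff[THEN iffD1]) simp_all
  qed (use D in auto)
  then obtain g where g: "L2_gradient v g" "(\<Sum>i\<in>UNIV. sqnorm lborel (g i)) \<le> D" by blast
  have "edirichlet v \<le> ennreal (\<Sum>i\<in>UNIV. sqnorm lborel (g i))"
    by (intro edirichlet_le difference_quotient_energy_le_gradient v g) simp
  with g(2) D(1) have "edirichlet v = ennreal (\<Sum>i\<in>UNIV. sqnorm lborel (g i))"
    by (metis antisym ennreal_leI)
  with g(1) show ?thesis by (rule that)
qed

definition H1 :: "(real^2 \<Rightarrow> real) \<Rightarrow> bool" where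
  "H1 v \<longleftrightarrow> L2 lborel v \<and> edirichlet v < \<infinity>"

definition rdirichlet :: "(real^2 \<Rightarrow> real) \<Rightarrow> real" where
  "rdirichlet v = enn2real (edirichlet v)"

lemma H1_L2: "H1 v \<Longrightarrow> L2 lborel v"
  by (simp add: H1_def)

lemma rdirichlet_nonneg: "rdirichlet v \<ge> 0"
  by (simp add: rdirichlet_def)

lemma ennreal_rdirichlet: "H1 v \<Longrightarrow> ennreal (rdirichlet v) = edirichlet v"
  by (simp add: rdirichlet_def H1_def top.not_eq_extremum)

lemma rdirichlet_le: "edirichlet v \<le> ennreal D \<Longrightarrow> D \<ge> 0 \<Longrightarrow> rdirichlet v \<le> D"
  unfolding rdirichlet_def by (metis enn2real_ennreal enn2real_mono ennreal_less_top)

lemma rdirichlet_cmult: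
  assumes "v \<in> borel_measurable borel" shows "rdirichlet (\<lambda>x. s * v x) = s\<^sup>2 * rdirichlet v"
  by (simp add: rdirichlet_def edirichlet_cmult[OF assms] enn2real_mult)

lemma rdirichlet_eq_gradient:
  assumes "H1 v"
  obtains g where "L2_gradient v g" "rdirichlet v = (\<Sum>i\<in>UNIV. sqnorm lborel (g i))"
proof -
  obtain g where g: "L2_gradient v g" "edirichlet v = ennreal (\<Sum>i\<in>UNIV. sqnorm lborel (g i))"
    using edirichlet_eq_gradient assms unfolding H1_def by blast
  then have "rdirichlet v = (\<Sum>i\<in>UNIV. sqnorm lborel (g i))"
    by (simp add: rdirichlet_def sum_nonneg sqnorm_nonneg)
  with g(1) show ?thesis by (rule that)
qed

theorem sqnorm_increment_le_rdirichlet: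
  assumes v: "H1 v"
  shows "sqnorm lborel (\<lambda>x. v (x + h) - v x) \<le> (norm h)\<^sup>2 * rdirichlet v"
proof -
  obtain g where g: "L2_gradient v g" and D: "rdirichlet v = (\<Sum>i\<in>UNIV. sqnorm lborel (g i))"
    by (rule rdirichlet_eq_gradient[OF v])
  let ?u = "\<lambda>x. complex_of_real (v x)" and ?g = "\<lambda>i x. complex_of_real (g i x)"
  have loc: "locally_integrable ?u" "locally_integrable (?g i)" for i
    using H1_L2[OF v] g by (auto intro!: L2_locally_integrable L2_of_real simp: L2_gradient_def)
  have "(\<integral>\<^sup>+x. ennreal ((norm (v (x + h) - v x))\<^sup>2) \<partial>lborel) = (\<integral>\<^sup>+x. ennreal ((norm (?u (x + h) - ?u x))\<^sup>2) \<partial>lborel)"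
    by (simp flip: of_real_diff)
  also have "\<dots> \<le> (\<integral>\<^sup>+x. ennreal ((norm (directional h ?g x))\<^sup>2) \<partial>lborel)"
    using g by (intro translate_sq_le loc) (simp add: L2_gradient_def)
  also have "\<dots> \<le> (\<integral>\<^sup>+x. ennreal ((norm h)\<^sup>2 * (\<Sum>i\<in>UNIV. (norm (g i x))\<^sup>2)) \<partial>lborel)"
  proof (intro nn_integral_mono ennreal_leI)
    fix x
    have "directional h ?g x = complex_of_real (h \<bullet> (\<chi> i. g i x))"
      by (simp add: directional_def inner_vec_def scaleR_conv_of_real)
    moreover have "(norm (\<chi> i. g i x))\<^sup>2 = (\<Sum>i\<in>UNIV. (norm (g i x))\<^sup>2)"
      by (simp add: norm_sq_2 sum_2)
    ultimately show "(norm (directional h ?g x))\<^sup>2 \<le> (norm h)\<^sup>2 * (\<Sum>i\<in>UNIV. (norm (g i x))\<^sup>2)"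
      using Cauchy_Schwarz_ineq[of h "\<chi> i. g i x"] by (simp flip: power2_norm_eq_inner)
  qed
  also have "\<dots> = ennreal ((norm h)\<^sup>2 * rdirichlet v)"
    unfolding D using g by (intro nn_integral_sum_sqnorm) (auto simp: L2_gradient_def)
  finally show ?thesis
    using H1_L2[OF v] rdirichlet_nonneg[of v] by (intro L2_nn_integralI(2)) (auto simp: L2_def)
qed

lemma rdirichlet_eq_dirichlet:
  assumes v: "H1 v" and pos: "sqnorm lborel v > 0"
  shows "dirichlet (\<lambda>x. complex_of_real (v x)) = rdirichlet v"
proof -
  obtain g where g: "L2_gradient v g" and D: "rdirichlet v = (\<Sum>i\<in>UNIV. sqnorm lborel (g i))"
    by (rule rdirichlet_eq_gradient[OF v])
  then have "dirichlet (\<lambda>x. complex_of_real (v x))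
      = (\<Sum>i\<in>UNIV. sqnorm lborel (\<lambda>x. complex_of_real (g i x)))"
    using pos by (intro dirichlet_eq L2_of_real H1_L2[OF v]) (auto simp: L2_gradient_def sqnorm_of_real)
  then show ?thesis by (simp add: D sqnorm_of_real)
qed

lemma edirichlet_cmod_le:
  assumes u: "L2 lborel u" and g: "\<And>i. L2 lborel (g i)" and w: "weak_gradient u g"
  shows "edirichlet (\<lambda>x. cmod (u x)) \<le> ennreal (\<Sum>i\<in>UNIV. sqnorm lborel (g i))"
proof (rule edirichlet_le, rule difference_quotient_energy_le_ennreal_iff[THEN iffD2])
  fix n
  let ?\<epsilon> = "1 / real (Suc n)"
  have "difference_energy ?\<epsilon> (\<lambda>x. cmod (u x)) \<le> difference_energy ?\<epsilon> u"
    by (rule difference_energy_mono) (simp add: norm_triangle_ineq3)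
  also have "\<dots> \<le> ennreal (disc_moment ?\<epsilon> * (\<Sum>i\<in>UNIV. sqnorm lborel (g i)))"
    by (rule difference_energy_le_gradient[OF u g w])
  finally show "difference_energy ?\<epsilon> (\<lambda>x. cmod (u x)) \<le> ennreal (disc_moment ?\<epsilon> * (\<Sum>i\<in>UNIV. sqnorm lborel (g i)))" .
qed (simp_all add: sum_nonneg sqnorm_nonneg)

subsection \<open>Admissible profiles\<close>

definition admissible :: "(real^2 \<Rightarrow> real) \<Rightarrow> bool" where
  "admissible v \<longleftrightarrow> H1 v \<and> (\<forall>x. 0 \<le> v x) \<and> integrable lborel (\<lambda>x. ln (1 + norm x) * (v x)\<^sup>2)"

lemma admissibleD:
  assumes "admissible v"
  shows "H1 v" "L2 lborel v" "v \<in> borel_measurable borel" "\<And>x. 0 \<le> v x"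
    "integrable lborel (\<lambda>x. ln (1 + norm x) * (v x)\<^sup>2)" "integrable lborel (\<lambda>x. (v x)\<^sup>2)"
  using assms by (auto simp: admissible_def H1_def L2_def)

lemma admissible_in_X_space:
  assumes v: "admissible v" shows "(\<lambda>x. complex_of_real (v x)) \<in> X_space"
proof -
  note [measurable] = admissibleD(3)[OF v]
  obtain g where g: "L2_gradient v g" by (rule rdirichlet_eq_gradient[OF admissibleD(1)[OF v]])
  then have L: "L2 lborel (g i)" for i by (simp add: L2_gradient_def)
  have "integrable lborel (\<lambda>x. (g 1 x)\<^sup>2 + (g 2 x)\<^sup>2 + (v x)\<^sup>2 + ln (1 + norm x) * (v x)\<^sup>2)"
    using L admissibleD[OF v] by (intro Bochner_Integration.integrable_add) (auto simp: L2_def)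
  then have "(\<integral>\<^sup>+x. ennreal (norm ((g 1 x)\<^sup>2 + (g 2 x)\<^sup>2 + (v x)\<^sup>2 + ln (1 + norm x) * (v x)\<^sup>2)) \<partial>lborel) < \<infinity>"
    by (simp add: integrable_iff_bounded)
  moreover have "(\<lambda>x. complex_of_real (g i x)) \<in> borel_measurable borel" for i
    using L2_measurable[OF L] by simp
  ultimately show ?thesis
    unfolding X_space_def mem_Collect_eq using g
    by (intro conjI exI[of _ "\<lambda>x. complex_of_real (g 1 x)"] exI[of _ "\<lambda>x. complex_of_real (g 2 x)"])
      (auto simp: L2_gradient_def weak_gradient_def abs_of_nonneg)
qed

lemma X_spaceE:
  assumes "u \<in> X_space"
  obtains g where "L2 lborel u" "\<And>i. L2 lborel (g i)" "weak_gradient u g"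
    "integrable lborel (\<lambda>x. ln (1 + norm x) * (cmod (u x))\<^sup>2)"
proof -
  let ?F = "\<lambda>g1 g2 x. (cmod (g1 x))\<^sup>2 + (cmod (g2 x))\<^sup>2 + (cmod (u x))\<^sup>2 + ln (1 + norm x) * (cmod (u x))\<^sup>2"
  from assms obtain g1 g2
    where [measurable]: "u \<in> borel_measurable borel" "g1 \<in> borel_measurable borel" "g2 \<in> borel_measurable borel"
    and w: "weak_partial u 1 g1" "weak_partial u 2 g2"
    and fin: "(\<integral>\<^sup>+x. ennreal (?F g1 g2 x) \<partial>lborel) < \<infinity>"
    by (auto simp: X_space_def)
  have dominating: "integrable lborel (?F g1 g2)"
    using fin by (intro integrableI_bounded) (auto simp: abs_of_nonneg)
  have dominated: "integrable lborel f" if "f \<in> borel_measurable borel" "\<And>x. \<bar>f x\<bar> \<le> ?F g1 g2 x"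
    for f :: "real^2 \<Rightarrow> real"
    by (rule Bochner_Integration.integrable_bound[OF dominating])
      (use that in \<open>auto intro!: AE_I2 order_trans[OF that(2)]\<close>)
  have "L2 lborel u" "L2 lborel g1" "L2 lborel g2" "integrable lborel (\<lambda>x. ln (1 + norm x) * (cmod (u x))\<^sup>2)"
    unfolding L2_def by (auto intro!: dominated)
  with w show ?thesis
    by (intro that[of "\<lambda>i. if i = 1 then g1 else g2"]) (simp_all add: weak_gradient_2)
qed

lemma cmod_admissible:
  assumes u: "u \<in> X_space"
  shows "admissible (\<lambda>x. cmod (u x))" and "sqnorm lborel (\<lambda>x. cmod (u x)) = mass u"
    and "mass u > 0 \<Longrightarrow> rdirichlet (\<lambda>x. cmod (u x)) \<le> dirichlet u"
proof -
  obtain g where L: "L2 lborel u" "\<And>i. L2 lborel (g i)" and w: "weak_gradient u g"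
    and ln: "integrable lborel (\<lambda>x. ln (1 + norm x) * (cmod (u x))\<^sup>2)"
    by (rule X_spaceE[OF u]) (rule that)
  note le = edirichlet_cmod_le[OF L w]
  have "L2 lborel (\<lambda>x. cmod (u x))" using L(1) by (auto simp: L2_def)
  with le_less_trans[OF le ennreal_less_top] ln show "admissible (\<lambda>x. cmod (u x))"
    by (simp add: admissible_def H1_def)
  show mass: "sqnorm lborel (\<lambda>x. cmod (u x)) = mass u" by (simp add: sqnorm_def mass_def)
  show "rdirichlet (\<lambda>x. cmod (u x)) \<le> dirichlet u" if "mass u > 0"
    using rdirichlet_le[OF le] dirichlet_eq[OF L(1) _ L(2) w] that
    by (simp add: sum_nonneg sqnorm_nonneg sqnorm_def mass_def)
qed

subsection \<open>The logarithmic interaction\<close>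

lemma nn_integral_shifted_square_le:
  assumes v: "H1 v" and A: "A \<in> sets borel"
  shows "(\<integral>\<^sup>+x. indicator A x * ennreal ((v x)\<^sup>2) \<partial>lborel)
    \<le> 2 * (\<integral>\<^sup>+x. indicator A x * ennreal ((v (x + h))\<^sup>2) \<partial>lborel) + ennreal (2 * ((norm h)\<^sup>2 * rdirichlet v))"
proof -
  note [measurable] = A and L = H1_L2[OF v]
  note [measurable] = L2_measurable[OF L, simplified]
  let ?i = "indicator A :: _ \<Rightarrow> ennreal"
  have "(\<integral>\<^sup>+x. ?i x * ennreal ((v x)\<^sup>2) \<partial>lborel)
      \<le> (\<integral>\<^sup>+x. 2 * (?i x * ennreal ((v (x + h))\<^sup>2)) + 2 * ennreal ((norm (v (x + h) - v x))\<^sup>2) \<partial>lborel)"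
  proof (intro nn_integral_mono)
    fix x
    have "(v x)\<^sup>2 \<le> 2 * (v (x + h))\<^sup>2 + 2 * (norm (v (x + h) - v x))\<^sup>2"
      using norm_add_sq_le[of "v (x + h)" "v x - v (x + h)"] by (simp add: power2_commute)
    from ennreal_leI[OF this] show "?i x * ennreal ((v x)\<^sup>2)
        \<le> 2 * (?i x * ennreal ((v (x + h))\<^sup>2)) + 2 * ennreal ((norm (v (x + h) - v x))\<^sup>2)"
      by (auto simp: indicator_def ennreal_mult)
  qed
  also have "\<dots> = 2 * (\<integral>\<^sup>+x. ?i x * ennreal ((v (x + h))\<^sup>2) \<partial>lborel)
      + 2 * ennreal (sqnorm lborel (\<lambda>x. v (x + h) - v x))"
    using nn_integral_norm_sq[OF L2_diff[OF L2_shift[OF L] L], of h] by (simp add: nn_integral_add nn_integral_cmult)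
  also have "2 * ennreal (sqnorm lborel (\<lambda>x. v (x + h) - v x)) \<le> ennreal (2 * ((norm h)\<^sup>2 * rdirichlet v))"
    using mult_left_mono[OF ennreal_leI[OF sqnorm_increment_le_rdirichlet[OF v, of h]], of 2]
    by (simp add: ennreal_mult rdirichlet_nonneg)
  finally show ?thesis by (simp add: add_left_mono)
qed

text \<open>Average the previous estimate over the disc of radius \<open>sqrt s\<close>: its area \<open>pi * s\<close> dominates that of \<open>ball y s\<close>
  for small \<open>s\<close>, while the translations in it cost only \<open>s * rdirichlet v\<close>.\<close>
lemma ball_mass_le:
  assumes v: "H1 v" and s: "s > 0"
  shows "(\<integral>\<^sup>+x. indicator (ball y s) x * ennreal ((v x)\<^sup>2) \<partial>lborel) \<le> ennreal (2 * s * (sqnorm lborel v + rdirichlet v))"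
    (is "?A \<le> _")
proof -
  note L = H1_L2[OF v]
  note [measurable] = L2_measurable[OF L, simplified]
  let ?N = "sqnorm lborel v" and ?D = "rdirichlet v"
  let ?s = "indicator (ball y s) :: real^2 \<Rightarrow> ennreal" and ?t = "indicator (ball 0 (sqrt s)) :: real^2 \<Rightarrow> ennreal"
  have area: "emeasure lborel (ball (0::real^2) (sqrt s)) = ennreal (pi * s)" using s by (simp add: emeasure_ball_2)
  have "ennreal (pi * s) * ?A = (\<integral>\<^sup>+h. ?t h * ?A \<partial>lborel)"
    by (simp add: nn_integral_multc area)
  also have "\<dots> \<le> (\<integral>\<^sup>+h. 2 * (\<integral>\<^sup>+x. ?s x * ennreal ((v (x + h))\<^sup>2) \<partial>lborel) + ennreal (2 * (s * ?D)) * ?t h \<partial>lborel)"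
  proof (intro nn_integral_mono)
    fix h :: "real^2"
    show "?t h * ?A \<le> 2 * (\<integral>\<^sup>+x. ?s x * ennreal ((v (x + h))\<^sup>2) \<partial>lborel) + ennreal (2 * (s * ?D)) * ?t h"
    proof (cases "h \<in> ball 0 (sqrt s)")
      case True
      then have "(norm h)\<^sup>2 \<le> s" using s power_mono[of "norm h" "sqrt s" 2] by simp
      then have "ennreal (2 * ((norm h)\<^sup>2 * ?D)) \<le> ennreal (2 * (s * ?D))"
        by (intro ennreal_leI mult_left_mono mult_right_mono rdirichlet_nonneg) auto
      with nn_integral_shifted_square_le[OF v, of "ball y s" h] True show ?thesis
        by (auto intro: order_trans add_left_mono)
    qed simp
  qed
  also have "\<dots> = 2 * (\<integral>\<^sup>+h. \<integral>\<^sup>+x. ?s x * ennreal ((v (x + h))\<^sup>2) \<partial>lborel \<partial>lborel)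
      + ennreal (2 * (s * ?D)) * ennreal (pi * s)"
    by (simp add: nn_integral_add nn_integral_cmult area)
  also have "(\<integral>\<^sup>+h. \<integral>\<^sup>+x. ?s x * ennreal ((v (x + h))\<^sup>2) \<partial>lborel \<partial>lborel)
      = (\<integral>\<^sup>+x. ?s x * (\<integral>\<^sup>+h. ennreal ((norm (v (x + h)))\<^sup>2) \<partial>lborel) \<partial>lborel)"
    by (subst lborel_pair.Fubini') (simp_all add: nn_integral_cmult)
  also have "\<dots> = ennreal (pi * s\<^sup>2) * ennreal ?N"
    using s unfolding nn_integral_norm_sq[OF L2_shift_left[OF L]]
    by (simp add: sqnorm_shift_left nn_integral_multc emeasure_ball_2)
  also have "2 * (ennreal (pi * s\<^sup>2) * ennreal ?N) + ennreal (2 * (s * ?D)) * ennreal (pi * s)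
      = ennreal (2 * (pi * s\<^sup>2 * ?N) + 2 * (s * ?D) * (pi * s))"
    using s sqnorm_nonneg[of lborel v] rdirichlet_nonneg[of v] by (simp add: ennreal_mult)
  also have "2 * (pi * s\<^sup>2 * ?N) + 2 * (s * ?D) * (pi * s) = pi * s * (2 * s * (?N + ?D))"
    by (simp add: algebra_simps power2_eq_square)
  also have "ennreal \<dots> = ennreal (pi * s) * ennreal (2 * s * (?N + ?D))"
    using s sqnorm_nonneg[of lborel v] rdirichlet_nonneg[of v] by (intro ennreal_mult) auto
  finally show ?thesis using s by (simp add: ennreal_mult_le_mult_iff)
qed

lemma log_layer_cake:
  assumes "r \<ge> 0" "\<delta> \<ge> 0"
  shows "ennreal (max 0 (ln (\<delta> / r))) \<le> (\<integral>\<^sup>+s. indicator {0<..\<delta>} s * (ennreal (1 / s) * indicator {r..} s) \<partial>lborel)"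
proof (cases "0 < r \<and> r < \<delta>")
  case True
  have "(\<integral>\<^sup>+s. ennreal (1 / s) * indicator {r..\<delta>} s \<partial>lborel) = ennreal (ln \<delta> - ln r)"
    by (rule nn_integral_FTC_Icc) (use True in \<open>auto intro!: derivative_eq_intros\<close>)
  moreover have "ennreal (1 / s) * indicator {r..\<delta>} s = indicator {0<..\<delta>} s * (ennreal (1 / s) * indicator {r..} s)" for s
    using True by (auto simp: indicator_def)
  moreover have "max 0 (ln (\<delta> / r)) = ln \<delta> - ln r" using True by (simp add: ln_div)
  ultimately show ?thesis by simp
next
  case False
  then have "r = 0 \<or> \<delta> = 0 \<or> (0 < \<delta> / r \<and> \<delta> / r \<le> 1)" using assms by (auto simp: field_simps)
  then have "max 0 (ln (\<delta> / r)) = 0" by auto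
  then show ?thesis by simp
qed

lemma nn_integral_log_dist_le:
  fixes f :: "'a::euclidean_space \<Rightarrow> ennreal"
  assumes [measurable]: "f \<in> borel_measurable borel"
    and ball: "\<And>s. s > 0 \<Longrightarrow> (\<integral>\<^sup>+x. indicator (ball y s) x * f x \<partial>lborel) \<le> ennreal (C * s)"
    and "C \<ge> 0" "\<delta> \<ge> 0"
  shows "(\<integral>\<^sup>+x. ennreal (max 0 (ln (\<delta> / dist x y))) * f x \<partial>lborel) \<le> ennreal (2 * C * \<delta>)"
proof -
  let ?I = "indicator {p. dist (fst p) y \<le> snd p} :: 'a \<times> real \<Rightarrow> ennreal"
  have "(\<integral>\<^sup>+x. ennreal (max 0 (ln (\<delta> / dist x y))) * f x \<partial>lborel)
     \<le> (\<integral>\<^sup>+x. (\<integral>\<^sup>+s. indicator {0<..\<delta>} s * (ennreal (1 / s) * indicator {dist x y..} s) \<partial>lborel) * f x \<partial>lborel)"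
    by (intro nn_integral_mono mult_right_mono log_layer_cake \<open>\<delta> \<ge> 0\<close>) auto
  also have "\<dots> = (\<integral>\<^sup>+x. \<integral>\<^sup>+s. indicator {0<..\<delta>} s * (ennreal (1 / s) * ?I (x, s)) * f x \<partial>lborel \<partial>lborel)"
    by (subst nn_integral_multc[symmetric]) (auto intro!: nn_integral_cong simp: indicator_def)
  also have "\<dots> = (\<integral>\<^sup>+s. \<integral>\<^sup>+x. indicator {0<..\<delta>} s * (ennreal (1 / s) * ?I (x, s)) * f x \<partial>lborel \<partial>lborel)"
    by (rule lborel_pair.Fubini') measurable
  also have "\<dots> \<le> (\<integral>\<^sup>+s. ennreal (2 * C) * indicator {0<..\<delta>} s \<partial>lborel)"
  proof (intro nn_integral_mono)
    fix s :: real
    show "(\<integral>\<^sup>+x. indicator {0<..\<delta>} s * (ennreal (1 / s) * ?I (x, s)) * f x \<partial>lborel)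
        \<le> ennreal (2 * C) * indicator {0<..\<delta>} s"
    proof (cases "s \<in> {0<..\<delta>}")
      case True
      have "(\<integral>\<^sup>+x. indicator {0<..\<delta>} s * (ennreal (1 / s) * ?I (x, s)) * f x \<partial>lborel)
          \<le> (\<integral>\<^sup>+x. ennreal (1 / s) * (indicator (ball y (2 * s)) x * f x) \<partial>lborel)"
        using True by (intro nn_integral_mono) (auto simp: indicator_def dist_commute)
      also have "\<dots> \<le> ennreal (1 / s) * ennreal (C * (2 * s))"
        using True by (subst nn_integral_cmult) (auto intro!: mult_left_mono ball)
      also have "\<dots> = ennreal (2 * C)" using True \<open>C \<ge> 0\<close> by (subst ennreal_mult[symmetric]) auto
      finally show ?thesis using True by simp
    qed simp
  qed
  also have "\<dots> = ennreal (2 * C * \<delta>)"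
    using \<open>C \<ge> 0\<close> \<open>\<delta> \<ge> 0\<close> by (simp add: nn_integral_cmult ennreal_mult)
  finally show ?thesis .
qed

lemma log_potential_le:
  assumes v: "H1 v" and \<delta>: "\<delta> \<ge> 0"
  shows "(\<integral>\<^sup>+x. ennreal (max 0 (ln (\<delta> / dist x y)) * (v x)\<^sup>2) \<partial>lborel)
      \<le> ennreal (4 * \<delta> * (sqnorm lborel v + rdirichlet v))"
proof -
  have "(\<integral>\<^sup>+x. ennreal (max 0 (ln (\<delta> / dist x y))) * ennreal ((v x)\<^sup>2) \<partial>lborel)
      \<le> ennreal (2 * (2 * (sqnorm lborel v + rdirichlet v)) * \<delta>)"
    using ball_mass_le[OF v] H1_L2[OF v] \<delta> sqnorm_nonneg[of lborel v] rdirichlet_nonneg[of v]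
    by (intro nn_integral_log_dist_le) (auto simp: L2_def mult_ac)
  then show ?thesis by (simp add: ennreal_mult mult_ac)
qed

definition interaction_density :: "(real \<Rightarrow> real) \<Rightarrow> ('a::metric_space \<Rightarrow> real) \<Rightarrow> 'a \<times> 'a \<Rightarrow> real" where
  "interaction_density \<kappa> v p = \<kappa> (dist (fst p) (snd p)) * (v (fst p))\<^sup>2 * (v (snd p))\<^sup>2"

definition interaction :: "(real \<Rightarrow> real) \<Rightarrow> (real^2 \<Rightarrow> real) \<Rightarrow> real" where
  "interaction \<kappa> v = (\<integral>p. interaction_density \<kappa> v p \<partial>(lborel \<Otimes>\<^sub>M lborel))"

lemma interaction_density_measurable [measurable]:
  fixes v :: "'a::euclidean_space \<Rightarrow> real"
  assumes [measurable]: "v \<in> borel_measurable borel" "\<kappa> \<in> borel_measurable borel"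
  shows "interaction_density \<kappa> v \<in> borel_measurable (borel \<Otimes>\<^sub>M borel)"
  unfolding interaction_density_def by measurable

definition log_bounded :: "(real \<Rightarrow> real) \<Rightarrow> bool" where
  "log_bounded \<kappa> \<longleftrightarrow> \<kappa> \<in> borel_measurable borel \<and> (\<exists>a. \<forall>r\<ge>0. \<bar>\<kappa> r\<bar> \<le> a * (1 + \<bar>ln r\<bar>))"

lemma log_boundedI:
  assumes "\<kappa> \<in> borel_measurable borel" "\<And>r. r \<ge> 0 \<Longrightarrow> \<bar>\<kappa> r\<bar> \<le> a * (1 + \<bar>ln r\<bar>)"
  shows "log_bounded \<kappa>"
  using assms by (auto simp: log_bounded_def)

lemma log_boundedE:
  assumes "log_bounded \<kappa>"
  obtains a where "a \<ge> 0" "\<And>r. r \<ge> 0 \<Longrightarrow> \<bar>\<kappa> r\<bar> \<le> a * (1 + \<bar>ln r\<bar>)"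
proof -
  obtain a where "\<And>r. r \<ge> 0 \<Longrightarrow> \<bar>\<kappa> r\<bar> \<le> a * (1 + \<bar>ln r\<bar>)" using assms by (auto simp: log_bounded_def)
  moreover from this[of 1] have "a \<ge> 0" by simp
  ultimately show ?thesis using that by blast
qed

lemma log_bounded_measurable [measurable_dest]: "log_bounded \<kappa> \<Longrightarrow> \<kappa> \<in> borel_measurable borel"
  by (simp add: log_bounded_def)

named_theorems log_bounded_intros

lemma log_bounded_ln [log_bounded_intros]: "log_bounded ln"
  by (rule log_boundedI[where a=1]) auto

lemma log_bounded_const [log_bounded_intros]: "log_bounded (\<lambda>_. c)"
  by (rule log_boundedI[where a="\<bar>c\<bar>"]) (auto simp: distrib_left)

lemma log_bounded_add [log_bounded_intros]:
  assumes "log_bounded \<kappa>" "log_bounded \<kappa>'" shows "log_bounded (\<lambda>r. \<kappa> r + \<kappa>' r)"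
proof -
  obtain a b where a: "\<And>r. r \<ge> 0 \<Longrightarrow> \<bar>\<kappa> r\<bar> \<le> a * (1 + \<bar>ln r\<bar>)" and b: "\<And>r. r \<ge> 0 \<Longrightarrow> \<bar>\<kappa>' r\<bar> \<le> b * (1 + \<bar>ln r\<bar>)"
    using assms by (auto simp: log_bounded_def)
  have "\<bar>\<kappa> r + \<kappa>' r\<bar> \<le> (a + b) * (1 + \<bar>ln r\<bar>)" if "r \<ge> 0" for r
    using abs_triangle_ineq[of "\<kappa> r" "\<kappa>' r"] a[OF that] b[OF that] unfolding distrib_right[of a b] by linarith
  then show ?thesis using assms by (intro log_boundedI) (auto dest: log_bounded_measurable)
qed

lemma log_bounded_dominated:
  assumes "log_bounded \<kappa>" "\<kappa>' \<in> borel_measurable borel" "\<And>r. r \<ge> 0 \<Longrightarrow> \<bar>\<kappa>' r\<bar> \<le> \<bar>\<kappa> r\<bar>"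
  shows "log_bounded \<kappa>'"
  using assms by (auto simp: log_bounded_def intro: order_trans)

lemma log_bounded_cmult [log_bounded_intros]:
  assumes "log_bounded \<kappa>" shows "log_bounded (\<lambda>r. c * \<kappa> r)"
proof -
  obtain a where "\<And>r. r \<ge> 0 \<Longrightarrow> \<bar>\<kappa> r\<bar> \<le> a * (1 + \<bar>ln r\<bar>)" using assms by (auto simp: log_bounded_def)
  then have "\<bar>c * \<kappa> r\<bar> \<le> (\<bar>c\<bar> * a) * (1 + \<bar>ln r\<bar>)" if "r \<ge> 0" for r
    using mult_left_mono[of "\<bar>\<kappa> r\<bar>" "a * (1 + \<bar>ln r\<bar>)" "\<bar>c\<bar>"] that by (simp add: abs_mult mult.assoc)
  then show ?thesis using assms by (intro log_boundedI) (auto dest: log_bounded_measurable)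
qed

lemma log_bounded_diff [log_bounded_intros]:
  "log_bounded \<kappa> \<Longrightarrow> log_bounded \<kappa>' \<Longrightarrow> log_bounded (\<lambda>r. \<kappa> r - \<kappa>' r)"
  using log_bounded_add[of \<kappa> "\<lambda>r. -1 * \<kappa>' r"] log_bounded_cmult[of \<kappa>' "-1"] by simp

lemma log_bounded_positive_part [log_bounded_intros]:
  assumes "log_bounded \<kappa>" shows "log_bounded (\<lambda>r. max 0 (\<kappa> r))"
  using log_bounded_measurable[OF assms] by (intro log_bounded_dominated[OF assms]) auto

lemma log_bounded_ln_divide [log_bounded_intros]:
  assumes "\<delta> > 0" shows "log_bounded (\<lambda>r. ln (\<delta> / r))"
proof (rule log_boundedI)
  fix r :: real assume "r \<ge> 0"
  have "\<bar>ln (\<delta> / r)\<bar> \<le> \<bar>ln \<delta>\<bar> + \<bar>ln r\<bar>" using assms \<open>r \<ge> 0\<close> by (cases "r = 0") (auto simp: ln_div)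
  also have "\<dots> \<le> (1 + \<bar>ln \<delta>\<bar>) * (1 + \<bar>ln r\<bar>)" by (simp add: algebra_simps)
  finally show "\<bar>ln (\<delta> / r)\<bar> \<le> (1 + \<bar>ln \<delta>\<bar>) * (1 + \<bar>ln r\<bar>)" .
qed measurable

lemma ln_1_plus_le:
  fixes r :: real
  assumes "r \<ge> 0" shows "ln (1 + r) \<le> ln 2 + max 0 (ln r)"
proof (cases "r \<le> 1")
  case True
  then have "ln (1 + r) \<le> ln 2" using assms by (intro ln_mono) auto
  then show ?thesis by simp
next
  case False
  then have "ln (1 + r) \<le> ln (2 * r)" by (intro ln_mono) auto
  with False show ?thesis by (simp add: ln_mult_pos)
qed

lemma log_bounded_ln_1_plus [log_bounded_intros]: "log_bounded (\<lambda>r. ln (1 + r))"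
  by (rule log_bounded_dominated[of "\<lambda>r. ln 2 + max 0 (ln r)"])
    (auto intro!: log_bounded_intros simp: ln_1_plus_le)

definition log_moment :: "(real^2 \<Rightarrow> real) \<Rightarrow> real" where
  "log_moment v = (\<integral>x. ln (1 + norm x) * (v x)\<^sup>2 \<partial>lborel)"

lemma log_moment_nonneg: "log_moment v \<ge> 0"
  unfolding log_moment_def by (intro integral_nonneg_AE) auto

lemma ln_1_plus_add_le:
  fixes a b :: real
  assumes "a \<ge> 0" "b \<ge> 0" shows "ln (1 + (a + b)) \<le> ln (1 + a) + ln (1 + b)"
proof -
  have "ln (1 + (a + b)) \<le> ln ((1 + a) * (1 + b))"
    using assms by (intro ln_mono) (auto simp: algebra_simps add_pos_nonneg)
  also have "\<dots> = ln (1 + a) + ln (1 + b)" using assms by (intro ln_mult_pos) auto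
  finally show ?thesis .
qed

lemma abs_ln_dist_le:
  "\<bar>ln (dist x y)\<bar> \<le> max 0 (ln (1 / dist x y)) + (ln (1 + norm x) + ln (1 + norm y))"
proof (cases "x = y")
  case False
  have "dist x y \<le> 1 + (norm x + norm y)" using norm_triangle_ineq4[of x y] by (simp add: dist_norm)
  then have "ln (dist x y) \<le> ln (1 + (norm x + norm y))" using False by (intro ln_mono) auto
  also have "\<dots> \<le> ln (1 + norm x) + ln (1 + norm y)" by (intro ln_1_plus_add_le) auto
  finally have "ln (dist x y) \<le> ln (1 + norm x) + ln (1 + norm y)" .
  moreover have "0 \<le> ln (1 + norm x)" "0 \<le> ln (1 + norm y)" by simp_all
  moreover have "ln (1 / dist x y) = - ln (dist x y)" using False by (simp add: ln_div)
  ultimately show ?thesis by (auto simp: abs_le_iff max_def)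
qed simp

lemma log_potential_finite:
  assumes v: "admissible v"
  shows "(\<integral>\<^sup>+x. ennreal ((1 + \<bar>ln (dist x y)\<bar>) * (v x)\<^sup>2) \<partial>lborel)
     \<le> ennreal (4 * (sqnorm lborel v + rdirichlet v) + (sqnorm lborel v + log_moment v + ln (1 + norm y) * sqnorm lborel v))"
proof -
  note [measurable] = admissibleD(3)[OF v]
  let ?q = "\<lambda>x. (v x)\<^sup>2 + (ln (1 + norm x) * (v x)\<^sup>2 + ln (1 + norm y) * (v x)\<^sup>2)"
  have int: "integrable lborel ?q"
    by (intro Bochner_Integration.integrable_add integrable_mult_right admissibleD[OF v])
  have "(\<integral>\<^sup>+x. ennreal ((1 + \<bar>ln (dist x y)\<bar>) * (v x)\<^sup>2) \<partial>lborel)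
    \<le> (\<integral>\<^sup>+x. ennreal (max 0 (ln (1 / dist x y)) * (v x)\<^sup>2) + ennreal (?q x) \<partial>lborel)"
  proof (intro nn_integral_mono)
    fix x
    have "(1 + \<bar>ln (dist x y)\<bar>) * (v x)\<^sup>2
        \<le> (1 + (max 0 (ln (1 / dist x y)) + (ln (1 + norm x) + ln (1 + norm y)))) * (v x)\<^sup>2"
      by (intro mult_right_mono add_left_mono abs_ln_dist_le) simp
    also have "\<dots> = max 0 (ln (1 / dist x y)) * (v x)\<^sup>2 + ?q x" by (simp add: algebra_simps)
    finally show "ennreal ((1 + \<bar>ln (dist x y)\<bar>) * (v x)\<^sup>2)
        \<le> ennreal (max 0 (ln (1 / dist x y)) * (v x)\<^sup>2) + ennreal (?q x)"
      by (subst ennreal_plus[symmetric]) (auto simp del: ennreal_plus intro!: ennreal_leI)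
  qed
  also have "\<dots> = (\<integral>\<^sup>+x. ennreal (max 0 (ln (1 / dist x y)) * (v x)\<^sup>2) \<partial>lborel) + ennreal (\<integral>x. ?q x \<partial>lborel)"
    using nn_integral_eq_integral[OF int] by (subst nn_integral_add) (auto simp del: ennreal_plus)
  also have "(\<integral>x. ?q x \<partial>lborel) = sqnorm lborel v + log_moment v + ln (1 + norm y) * sqnorm lborel v"
    using admissibleD(5,6)[OF v] by (simp add: sqnorm_def log_moment_def)
  also have "(\<integral>\<^sup>+x. ennreal (max 0 (ln (1 / dist x y)) * (v x)\<^sup>2) \<partial>lborel)
        + ennreal (sqnorm lborel v + log_moment v + ln (1 + norm y) * sqnorm lborel v)
      \<le> ennreal (4 * (sqnorm lborel v + rdirichlet v))
        + ennreal (sqnorm lborel v + log_moment v + ln (1 + norm y) * sqnorm lborel v)"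
    using log_potential_le[OF admissibleD(1)[OF v], of 1 y] by (intro add_right_mono) simp
  also have "\<dots> = ennreal (4 * (sqnorm lborel v + rdirichlet v)
      + (sqnorm lborel v + log_moment v + ln (1 + norm y) * sqnorm lborel v))"
    using sqnorm_nonneg[of lborel v] rdirichlet_nonneg[of v] log_moment_nonneg[of v]
    by (intro ennreal_plus[symmetric]) auto
  finally show ?thesis .
qed

lemma log_interaction_density_integrable:
  assumes v: "admissible v"
  shows "integrable (lborel \<Otimes>\<^sub>M lborel) (interaction_density (\<lambda>r. 1 + \<bar>ln r\<bar>) v)"
proof (rule pair_integrableI)
  note [measurable] = admissibleD(3)[OF v]
  let ?N = "sqnorm lborel v"
  define K where "K = 4 * (?N + rdirichlet v) + (?N + log_moment v)"
  have "K \<ge> 0" using sqnorm_nonneg[of lborel v] rdirichlet_nonneg[of v] log_moment_nonneg[of v] by (simp add: K_def)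
  let ?q = "\<lambda>y. K * (v y)\<^sup>2 + ?N * (ln (1 + norm y) * (v y)\<^sup>2)"
  show "interaction_density (\<lambda>r. 1 + \<bar>ln r\<bar>) v \<in> borel_measurable (lborel \<Otimes>\<^sub>M lborel)"
    by simp
  have "(\<integral>\<^sup>+y. \<integral>\<^sup>+x. ennreal (norm (interaction_density (\<lambda>r. 1 + \<bar>ln r\<bar>) v (y, x))) \<partial>lborel \<partial>lborel)
     \<le> (\<integral>\<^sup>+y. ennreal (?q y) \<partial>lborel)"
  proof (intro nn_integral_mono)
    fix y
    have "(\<integral>\<^sup>+x. ennreal (norm (interaction_density (\<lambda>r. 1 + \<bar>ln r\<bar>) v (y, x))) \<partial>lborel)
        = (\<integral>\<^sup>+x. ennreal ((v y)\<^sup>2) * ennreal ((1 + \<bar>ln (dist x y)\<bar>) * (v x)\<^sup>2) \<partial>lborel)"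
      by (intro nn_integral_cong)
        (simp add: interaction_density_def abs_mult dist_commute mult_ac flip: ennreal_mult)
    also have "\<dots> \<le> ennreal ((v y)\<^sup>2) * ennreal (4 * (?N + rdirichlet v) + (?N + log_moment v + ln (1 + norm y) * ?N))"
      by (subst nn_integral_cmult, simp, intro mult_left_mono log_potential_finite[OF v] zero_le)
    also have "\<dots> = ennreal (?q y)"
      using \<open>K \<ge> 0\<close> sqnorm_nonneg[of lborel v] by (subst ennreal_mult'[symmetric]) (auto simp: K_def algebra_simps)
    finally show "(\<integral>\<^sup>+x. ennreal (norm (interaction_density (\<lambda>r. 1 + \<bar>ln r\<bar>) v (y, x))) \<partial>lborel) \<le> ennreal (?q y)" .
  qed
  also have "\<dots> = ennreal (\<integral>y. ?q y \<partial>lborel)"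
    using \<open>K \<ge> 0\<close> sqnorm_nonneg[of lborel v]
    by (intro nn_integral_eq_integral Bochner_Integration.integrable_add integrable_mult_right admissibleD[OF v]) auto
  finally show "(\<integral>\<^sup>+y. \<integral>\<^sup>+x. ennreal (norm (interaction_density (\<lambda>r. 1 + \<bar>ln r\<bar>) v (y, x))) \<partial>lborel \<partial>lborel)
      \<le> ennreal (\<integral>y. ?q y \<partial>lborel)" .
qed

lemma interaction_density_integrable:
  assumes v: "admissible v" and \<kappa>: "log_bounded \<kappa>"
  shows "integrable (lborel \<Otimes>\<^sub>M lborel) (interaction_density \<kappa> v)"
proof -
  note [measurable] = admissibleD(3)[OF v] log_bounded_measurable[OF \<kappa>]
  obtain a where a: "a \<ge> 0" "\<And>r. r \<ge> 0 \<Longrightarrow> \<bar>\<kappa> r\<bar> \<le> a * (1 + \<bar>ln r\<bar>)" using log_boundedE[OF \<kappa>] by blast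
  have "integrable (lborel \<Otimes>\<^sub>M lborel) (\<lambda>p. a * interaction_density (\<lambda>r. 1 + \<bar>ln r\<bar>) v p)"
    by (intro integrable_mult_right log_interaction_density_integrable[OF v])
  then show ?thesis
  proof (rule Bochner_Integration.integrable_bound)
    have "norm (interaction_density \<kappa> v p) \<le> norm (a * interaction_density (\<lambda>r. 1 + \<bar>ln r\<bar>) v p)" for p
      using mult_right_mono[OF a(2)[of "dist (fst p) (snd p)"], of "(v (fst p))\<^sup>2 * (v (snd p))\<^sup>2"] a(1)
      by (simp add: interaction_density_def abs_mult mult.assoc)
    then show "AE p in lborel \<Otimes>\<^sub>M lborel.
        norm (interaction_density \<kappa> v p) \<le> norm (a * interaction_density (\<lambda>r. 1 + \<bar>ln r\<bar>) v p)" by simp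
  qed simp
qed

lemma interaction_add:
  assumes "admissible v" "log_bounded \<kappa>" "log_bounded \<kappa>'"
  shows "interaction (\<lambda>r. \<kappa> r + \<kappa>' r) v = interaction \<kappa> v + interaction \<kappa>' v"
proof -
  have "interaction_density (\<lambda>r. \<kappa> r + \<kappa>' r) v = (\<lambda>p. interaction_density \<kappa> v p + interaction_density \<kappa>' v p)"
    by (auto simp: interaction_density_def algebra_simps)
  then show ?thesis
    unfolding interaction_def by (simp add: interaction_density_integrable assms)
qed

lemma interaction_diff:
  assumes "admissible v" "log_bounded \<kappa>" "log_bounded \<kappa>'"
  shows "interaction (\<lambda>r. \<kappa> r - \<kappa>' r) v = interaction \<kappa> v - interaction \<kappa>' v"
proof -
  have "interaction_density (\<lambda>r. \<kappa> r - \<kappa>' r) v = (\<lambda>p. interaction_density \<kappa> v p - interaction_density \<kappa>' v p)"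
    by (auto simp: interaction_density_def algebra_simps)
  then show ?thesis
    unfolding interaction_def by (simp add: interaction_density_integrable assms)
qed

lemma interaction_mono:
  assumes "admissible v" "log_bounded \<kappa>" "log_bounded \<kappa>'" "\<And>r. r \<ge> 0 \<Longrightarrow> \<kappa> r \<le> \<kappa>' r"
  shows "interaction \<kappa> v \<le> interaction \<kappa>' v"
  unfolding interaction_def
  by (intro integral_mono interaction_density_integrable assms)
    (simp add: interaction_density_def mult_right_mono assms)

lemma interaction_nonneg: "(\<And>r. r \<ge> 0 \<Longrightarrow> 0 \<le> \<kappa> r) \<Longrightarrow> 0 \<le> interaction \<kappa> v"
  unfolding interaction_def by (intro integral_nonneg_AE) (auto simp: interaction_density_def)

lemma interaction_eq_iterated:
  assumes "admissible v" "log_bounded \<kappa>"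
  shows "interaction \<kappa> v = (\<integral>y. (\<integral>x. \<kappa> (dist x y) * (v x)\<^sup>2 \<partial>lborel) * (v y)\<^sup>2 \<partial>lborel)"
    and "integrable lborel (\<lambda>y. (\<integral>x. \<kappa> (dist x y) * (v x)\<^sup>2 \<partial>lborel) * (v y)\<^sup>2)"
proof -
  have int: "integrable (lborel \<Otimes>\<^sub>M lborel) (\<lambda>(x, y). \<kappa> (dist x y) * (v x)\<^sup>2 * (v y)\<^sup>2)"
    using interaction_density_integrable[OF assms] unfolding interaction_density_def case_prod_unfold .
  show "interaction \<kappa> v = (\<integral>y. (\<integral>x. \<kappa> (dist x y) * (v x)\<^sup>2 \<partial>lborel) * (v y)\<^sup>2 \<partial>lborel)"
    using lborel_pair.integral_snd[OF int] by (simp add: interaction_def interaction_density_def case_prod_unfold)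
  show "integrable lborel (\<lambda>y. (\<integral>x. \<kappa> (dist x y) * (v x)\<^sup>2 \<partial>lborel) * (v y)\<^sup>2)"
    using lborel_pair.integrable_snd[OF int] by simp
qed

lemma interaction_const: "admissible v \<Longrightarrow> interaction (\<lambda>_. c) v = c * (sqnorm lborel v)\<^sup>2"
  by (simp add: interaction_eq_iterated log_bounded_const sqnorm_def power2_eq_square)

lemma short_range_mixed_interaction:
  fixes \<sigma> :: "real^2 \<Rightarrow> real"
  assumes v: "H1 v" and \<delta>: "\<delta> \<ge> 0" and \<sigma>: "integrable lborel \<sigma>" "\<And>x. 0 \<le> \<sigma> x"
  defines "T \<equiv> \<lambda>p. max 0 (ln (\<delta> / dist (fst p) (snd p))) * \<sigma> (fst p) * (v (snd p))\<^sup>2"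
  shows "integrable (lborel \<Otimes>\<^sub>M lborel) T"
    and "(\<integral>p. T p \<partial>(lborel \<Otimes>\<^sub>M lborel)) \<le> 4 * \<delta> * (sqnorm lborel v + rdirichlet v) * (\<integral>x. \<sigma> x \<partial>lborel)"
proof -
  note [measurable] = H1_L2[OF v, THEN L2_measurable, simplified] borel_measurable_integrable[OF \<sigma>(1), simplified]
  let ?B = "4 * \<delta> * (sqnorm lborel v + rdirichlet v)"
  have B_nonneg: "?B \<ge> 0" using \<delta> sqnorm_nonneg[of lborel v] rdirichlet_nonneg[of v] by simp
  have T_measurable: "T \<in> borel_measurable (lborel \<Otimes>\<^sub>M lborel)" unfolding T_def by measurable
  have nonneg: "0 \<le> T p" for p by (simp add: T_def \<sigma>(2))
  have "(\<integral>\<^sup>+x. \<integral>\<^sup>+y. ennreal (T (x, y)) \<partial>lborel \<partial>lborel)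
      = (\<integral>\<^sup>+x. ennreal (\<sigma> x) * (\<integral>\<^sup>+y. ennreal (max 0 (ln (\<delta> / dist y x)) * (v y)\<^sup>2) \<partial>lborel) \<partial>lborel)"
    using \<sigma>(2) by (subst nn_integral_cmult[symmetric])
      (auto simp: T_def ennreal_mult[symmetric] dist_commute mult_ac intro!: nn_integral_cong)
  also have "\<dots> \<le> (\<integral>\<^sup>+x. ennreal (\<sigma> x) * ennreal ?B \<partial>lborel)"
    by (intro nn_integral_mono mult_left_mono log_potential_le[OF v \<delta>] zero_le)
  also have "\<dots> = ennreal (?B * (\<integral>x. \<sigma> x \<partial>lborel))"
    using B_nonneg \<sigma> by (simp add: nn_integral_multc nn_integral_eq_integral ennreal_mult'[symmetric] mult.commute)
  finally have bound: "(\<integral>\<^sup>+x. \<integral>\<^sup>+y. ennreal (T (x, y)) \<partial>lborel \<partial>lborel) \<le> ennreal (?B * (\<integral>x. \<sigma> x \<partial>lborel))" .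
  then show "integrable (lborel \<Otimes>\<^sub>M lborel) T"
    using nonneg by (intro pair_integrableI[OF T_measurable]) simp
  have "(\<integral>p. T p \<partial>(lborel \<Otimes>\<^sub>M lborel)) = enn2real (\<integral>\<^sup>+x. \<integral>\<^sup>+y. ennreal (T (x, y)) \<partial>lborel \<partial>lborel)"
    using T_measurable nonneg by (subst integral_eq_nn_integral) (auto simp: lborel.nn_integral_fst[symmetric])
  also have "\<dots> \<le> ?B * (\<integral>x. \<sigma> x \<partial>lborel)"
    using enn2real_mono[OF bound ennreal_less_top] B_nonneg integral_nonneg_AE[of \<sigma> lborel] \<sigma>(2) by simp
  finally show "(\<integral>p. T p \<partial>(lborel \<Otimes>\<^sub>M lborel)) \<le> ?B * (\<integral>x. \<sigma> x \<partial>lborel)" .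
qed

lemma short_range_interaction_le:
  assumes v: "admissible v" and "\<delta> > 0"
  shows "interaction (\<lambda>r. max 0 (ln (\<delta> / r))) v \<le> 4 * \<delta> * (sqnorm lborel v + rdirichlet v) * sqnorm lborel v"
  using short_range_mixed_interaction(2)[OF admissibleD(1)[OF v] _ admissibleD(6)[OF v], of \<delta>] \<open>\<delta> > 0\<close>
  by (simp add: interaction_def interaction_density_def sqnorm_def)

lemma interaction_ln_lower:
  assumes v: "admissible v" and \<delta>: "0 < \<delta>" "\<delta> \<le> 1"
  shows "interaction ln v \<ge> interaction (\<lambda>r. max 0 (ln r)) v - ln (1 / \<delta>) * (sqnorm lborel v)\<^sup>2
    - 4 * \<delta> * (sqnorm lborel v + rdirichlet v) * sqnorm lborel v"
proof -
  have "max 0 (ln r) - ln (1 / \<delta>) - max 0 (ln (\<delta> / r)) \<le> ln r" if "r \<ge> 0" for r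
    using that \<delta> by (cases "r = 0") (auto simp: ln_div max_def ln_le_zero_iff)
  then have "interaction (\<lambda>r. max 0 (ln r) - ln (1 / \<delta>) - max 0 (ln (\<delta> / r))) v \<le> interaction ln v"
    by (intro interaction_mono v log_bounded_intros \<delta>)
  then show ?thesis
    using short_range_interaction_le[OF v \<delta>(1)]
    by (simp add: interaction_diff interaction_const v log_bounded_intros \<delta>)
qed

lemma energy_eq:
  assumes "admissible (\<lambda>x. cmod (u x))"
  shows "energy \<gamma> u = dirichlet u + \<gamma> / (4 * pi) * interaction ln (\<lambda>x. cmod (u x))"
  by (simp add: energy_def interaction_eq_iterated[OF assms log_bounded_ln])

subsection \<open>Invariances and a priori bounds\<close>

lemma interaction_shift:
  assumes [measurable]: "v \<in> borel_measurable borel" "\<kappa> \<in> borel_measurable borel"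
  shows "interaction \<kappa> (\<lambda>x. v (x + c)) = interaction \<kappa> v"
  using lborel_preserving_pair_integral(1)[OF lborel_preserving_add[of c] lborel_preserving_add[of c],
      where f="interaction_density \<kappa> v"]
  by (simp add: interaction_def interaction_density_def dist_norm)

lemma interaction_cmult: "interaction \<kappa> (\<lambda>x. s * v x) = s^4 * interaction \<kappa> v"
proof -
  have "interaction_density \<kappa> (\<lambda>x. s * v x) = (\<lambda>p. s^4 * interaction_density \<kappa> v p)"
    by (auto simp: interaction_density_def power_mult_distrib power4_eq_xxxx power2_eq_square)
  then show ?thesis by (simp add: interaction_def)
qed

lemma rdirichlet_shift: "v \<in> borel_measurable borel \<Longrightarrow> rdirichlet (\<lambda>x. v (x + c)) = rdirichlet v"
  by (simp add: rdirichlet_def edirichlet_shift)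

lemma log_weight_integrable:
  assumes v: "admissible v" and [measurable]: "w \<in> borel_measurable borel"
    and w: "\<And>x. 0 \<le> w x" "\<And>x. w x \<le> norm x + b"
  shows "integrable lborel (\<lambda>x. ln (1 + w x) * (v x)\<^sup>2)"
proof (rule Bochner_Integration.integrable_bound)
  note [measurable] = admissibleD(3)[OF v]
  have "0 \<le> b" using w[of 0] by simp
  show "integrable lborel (\<lambda>x. ln (1 + norm x) * (v x)\<^sup>2 + ln (1 + b) * (v x)\<^sup>2)"
    by (intro Bochner_Integration.integrable_add integrable_mult_right admissibleD[OF v])
  have "ln (1 + w x) * (v x)\<^sup>2 \<le> (ln (1 + norm x) + ln (1 + b)) * (v x)\<^sup>2" for x
  proof -
    have "ln (1 + w x) \<le> ln (1 + (norm x + b))" using w[of x] by (intro ln_mono) auto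
    also have "\<dots> \<le> ln (1 + norm x) + ln (1 + b)" using \<open>0 \<le> b\<close> by (intro ln_1_plus_add_le) auto
    finally show ?thesis by (rule mult_right_mono) simp
  qed
  then show "AE x in lborel. norm (ln (1 + w x) * (v x)\<^sup>2) \<le> norm (ln (1 + norm x) * (v x)\<^sup>2 + ln (1 + b) * (v x)\<^sup>2)"
    using w(1) by (intro AE_I2) (auto simp: distrib_right intro: order_trans[OF _ abs_ge_self])
  show "(\<lambda>x. ln (1 + w x) * (v x)\<^sup>2) \<in> borel_measurable lborel" by measurable
qed

lemma log_moment_shift:
  assumes v: "admissible v"
  shows "integrable lborel (\<lambda>x. ln (1 + norm x) * (v (x + c))\<^sup>2)"
    and "log_moment (\<lambda>x. v (x + c)) = (\<integral>x. ln (1 + dist x c) * (v x)\<^sup>2 \<partial>lborel)"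
proof -
  note [measurable] = admissibleD(3)[OF v]
  let ?h = "\<lambda>x. ln (1 + dist x c) * (v x)\<^sup>2"
  have "integrable lborel ?h"
    using norm_triangle_ineq4[of _ c] by (intro log_weight_integrable[where b="norm c"] v) (auto simp: dist_norm)
  then show "integrable lborel (\<lambda>x. ln (1 + norm x) * (v (x + c))\<^sup>2)"
    using lborel_preserving_integral(2)[OF lborel_preserving_add[of c], where h="?h"] by (simp add: dist_norm)
  show "log_moment (\<lambda>x. v (x + c)) = (\<integral>x. ?h x \<partial>lborel)"
    unfolding log_moment_def
    using lborel_preserving_integral(1)[OF lborel_preserving_add[of c], where h="?h"] by (simp add: dist_norm)
qed

lemma admissible_shift:
  assumes "admissible v" shows "admissible (\<lambda>x. v (x + c))"
  using assms log_moment_shift(1)[OF assms] admissibleD(3)[OF assms]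
  by (simp add: admissible_def H1_def L2_shift edirichlet_shift)

lemma admissible_cmult:
  assumes v: "admissible v" and s: "s \<ge> 0" shows "admissible (\<lambda>x. s * v x)"
proof -
  have "integrable lborel (\<lambda>x. s\<^sup>2 * (ln (1 + norm x) * (v x)\<^sup>2))"
    by (intro integrable_mult_right admissibleD[OF v])
  then have "integrable lborel (\<lambda>x. ln (1 + norm x) * (s * v x)\<^sup>2)" by (simp add: power_mult_distrib mult_ac)
  with v s L2_scaleR[OF admissibleD(2)[OF v], of s] edirichlet_cmult[OF admissibleD(3)[OF v], of s] show ?thesis
    by (simp add: admissible_def H1_def ennreal_mult_less_top)
qed

lemma difference_energy_le_Lipschitz:
  fixes v :: "real^2 \<Rightarrow> real"
  assumes Lip: "L-lipschitz_on UNIV v" and zero: "\<And>x. R \<le> norm x \<Longrightarrow> v x = 0"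
    and \<epsilon>: "0 < \<epsilon>" "\<epsilon> \<le> 1" and R: "R \<ge> 0"
  shows "difference_energy \<epsilon> v \<le> ennreal (disc_moment \<epsilon> * (2 * L\<^sup>2 * (pi * (R + 1)\<^sup>2)))"
proof -
  let ?i = "indicator (ball 0 \<epsilon>) :: real^2 \<Rightarrow> real"
  have L: "L \<ge> 0" "\<bar>v x - v y\<bar> \<le> L * norm (x - y)" for x y
    using Lip by (auto simp: lipschitz_on_def dist_norm)
  have "indicator (ball 0 \<epsilon>) h * ennreal ((norm (v (x + h) - v x))\<^sup>2)
      \<le> indicator (ball 0 (R + 1)) x * ennreal (L\<^sup>2 * (?i h * (norm h)\<^sup>2))" for x h
  proof (cases "norm h < \<epsilon>")
    case True
    have "(norm (v (x + h) - v x))\<^sup>2 \<le> (L * norm h)\<^sup>2" using L(2)[of "x + h" x] by (intro power_mono) auto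
    moreover have "R \<le> norm (x + h)" "R \<le> norm x" if "R + 1 \<le> norm x"
      using that True \<epsilon> norm_triangle_ineq4[of "x + h" h] by auto
    ultimately show ?thesis
      using True zero by (cases "norm x < R + 1") (auto simp: power_mult_distrib intro!: ennreal_leI)
  qed simp
  then have "difference_energy \<epsilon> v
      \<le> (\<integral>\<^sup>+x. \<integral>\<^sup>+h. indicator (ball (0::real^2) (R + 1)) x * ennreal (L\<^sup>2 * (?i h * (norm h)\<^sup>2)) \<partial>lborel \<partial>lborel)"
    unfolding difference_energy_def by (intro nn_integral_mono)
  also have "\<dots> = (\<integral>\<^sup>+x. indicator (ball (0::real^2) (R + 1)) x * ennreal (L\<^sup>2 * (2 * disc_moment \<epsilon>)) \<partial>lborel)"
  proof -
    have "(\<integral>\<^sup>+h. ennreal (L\<^sup>2 * (?i h * (norm h)\<^sup>2)) \<partial>lborel) = ennreal (\<integral>h. L\<^sup>2 * (?i h * (norm h)\<^sup>2) \<partial>lborel)"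
      by (intro nn_integral_eq_integral integrable_mult_right disc_norm_sq_integral) auto
    then show ?thesis by (simp add: nn_integral_cmult disc_norm_sq_integral(2))
  qed
  also have "\<dots> = ennreal (pi * (R + 1)\<^sup>2) * ennreal (L\<^sup>2 * (2 * disc_moment \<epsilon>))"
    using R by (simp add: nn_integral_multc emeasure_ball_2)
  also have "\<dots> = ennreal (disc_moment \<epsilon> * (2 * L\<^sup>2 * (pi * (R + 1)\<^sup>2)))"
    using disc_moment_nonneg[of \<epsilon>] by (simp add: mult_ac flip: ennreal_mult)
  finally show ?thesis .
qed

lemma H1_if_Lipschitz_bounded_supp:
  assumes v: "bounded_supp v" and Lip: "L-lipschitz_on UNIV v"
  shows "H1 v"
proof -
  obtain R where R: "R > 0" "\<And>x. R \<le> norm x \<Longrightarrow> v x = 0" by (rule bounded_suppE[OF v]) blast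
  have "edirichlet v \<le> ennreal (2 * L\<^sup>2 * (pi * (R + 1)\<^sup>2))"
  proof (rule edirichlet_le)
    show "difference_quotient_energy (1 / real (Suc n)) v \<le> ennreal (2 * L\<^sup>2 * (pi * (R + 1)\<^sup>2))" for n
      using difference_energy_le_Lipschitz[where R=R and \<epsilon>="1 / real (Suc n)", OF Lip R(2)] R(1)
      by (subst difference_quotient_energy_le_ennreal_iff) auto
  qed
  then show ?thesis using bounded_supp_L2[OF v] by (simp add: H1_def le_less_trans)
qed

lemma admissible_tent: "admissible (\<lambda>x. max 0 (1 - norm x))" (is "admissible ?w")
proof -
  have "bounded_supp ?w"
    by (rule bounded_suppI[where R=1 and B=1]) auto
  moreover have "1-lipschitz_on UNIV ?w"
  proof (rule lipschitz_onI)
    show "dist (?w x) (?w y) \<le> 1 * dist x y" for x y :: "real^2"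
      using norm_triangle_ineq3[of x y] by (auto simp: dist_norm max_def)
  qed simp
  moreover have "bounded_supp (\<lambda>x::real^2. ln (1 + norm x) * (?w x)\<^sup>2)"
  proof (rule bounded_suppI[where R=1 and B="ln 2"])
    show "\<bar>ln (1 + norm x) * (?w x)\<^sup>2\<bar> \<le> ln 2" for x :: "real^2"
    proof (cases "norm x < 1")
      case True
      then have "ln (1 + norm x) * (?w x)\<^sup>2 \<le> ln 2 * 1"
        by (intro mult_mono ln_mono power_le_one) (auto simp: add_pos_nonneg)
      then show ?thesis by simp
    qed simp
  qed auto
  ultimately show ?thesis
    by (auto simp: admissible_def intro: H1_if_Lipschitz_bounded_supp bounded_supp_integrable)
qed

lemma admissible_with_mass_exists:
  assumes "lam > 0" shows "\<exists>v. admissible v \<and> sqnorm lborel v = lam"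
proof -
  let ?w = "\<lambda>x::real^2. max 0 (1 - norm x)"
  have "sqnorm lborel ?w \<noteq> 0"
  proof
    assume "sqnorm lborel ?w = 0"
    then have "AE x in lborel. ?w x = 0"
      by (simp add: sqnorm_eq_0_iff[OF admissibleD(2)[OF admissible_tent]])
    then have "AE x in lborel. x \<notin> ball (0::real^2) 1" by eventually_elim (auto simp: max_def)
    with not_AE_notin_ball[of 1 0] show False by simp
  qed
  then have pos: "sqnorm lborel ?w > 0" using sqnorm_nonneg[of lborel ?w] by simp
  let ?s = "sqrt (lam / sqnorm lborel ?w)"
  have "sqnorm lborel (\<lambda>x. ?s * ?w x) = lam"
    using sqnorm_scaleR[of lborel ?s ?w] assms pos by simp
  moreover have "admissible (\<lambda>x. ?s * ?w x)"
    using assms pos by (intro admissible_cmult admissible_tent) auto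
  ultimately show ?thesis by blast
qed

definition profile_energy :: "real \<Rightarrow> (real^2 \<Rightarrow> real) \<Rightarrow> real" where
  "profile_energy c v = rdirichlet v + c * interaction ln v"

lemma profile_energy_shift:
  "v \<in> borel_measurable borel \<Longrightarrow> profile_energy c (\<lambda>x. v (x + a)) = profile_energy c v"
  by (simp add: profile_energy_def rdirichlet_shift interaction_shift)

lemma profile_energy_coercive:
  assumes "c > 0" "lam > 0"
  shows "\<exists>C\<ge>0. \<forall>v. admissible v \<longrightarrow> sqnorm lborel v = lam \<longrightarrow>
     rdirichlet v / 2 + c * interaction (\<lambda>r. max 0 (ln r)) v - C \<le> profile_energy c v"
proof -
  define \<delta> where "\<delta> = min 1 (1 / (8 * c * lam))"
  have \<delta>: "0 < \<delta>" "\<delta> \<le> 1" using assms by (auto simp: \<delta>_def)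
  have "8 * c * lam * \<delta> \<le> 8 * c * lam * (1 / (8 * c * lam))"
    using assms by (intro mult_left_mono) (auto simp: \<delta>_def)
  then have small: "8 * c * lam * \<delta> \<le> 1" using assms by simp
  define C where "C = c * (ln (1 / \<delta>) * lam\<^sup>2) + lam / 2"
  have "C \<ge> 0" using assms \<delta> unfolding C_def by (intro add_nonneg_nonneg mult_nonneg_nonneg) auto
  moreover have "rdirichlet v / 2 + c * interaction (\<lambda>r. max 0 (ln r)) v - C \<le> profile_energy c v"
    if v: "admissible v" "sqnorm lborel v = lam" for v
  proof -
    have "c * (interaction (\<lambda>r. max 0 (ln r)) v - ln (1 / \<delta>) * lam\<^sup>2 - 4 * \<delta> * (lam + rdirichlet v) * lam)
        \<le> c * interaction ln v"
      using interaction_ln_lower[OF v(1) \<delta>] v(2) assms by (intro mult_left_mono) auto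
    moreover have "c * (4 * \<delta> * (lam + rdirichlet v) * lam) \<le> (lam + rdirichlet v) / 2"
      using mult_right_mono[OF small, of "(lam + rdirichlet v) / 2"] assms rdirichlet_nonneg[of v]
      by (simp add: algebra_simps)
    ultimately show ?thesis unfolding profile_energy_def C_def by (simp add: algebra_simps add_divide_distrib)
  qed
  ultimately show ?thesis by blast
qed

lemma centre_with_small_log_moment:
  assumes v: "admissible v" and pos: "sqnorm lborel v > 0"
  shows "\<exists>y. log_moment (\<lambda>x. v (x + y))
    \<le> (ln 2 * (sqnorm lborel v)\<^sup>2 + interaction (\<lambda>r. max 0 (ln r)) v + 1) / sqnorm lborel v" (is "\<exists>y. _ \<le> ?K")
proof (rule ccontr)
  assume "\<not> ?thesis"
  then have big: "?K \<le> log_moment (\<lambda>x. v (x + y))" for y by (metis nle_le)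
  have iterated: "interaction (\<lambda>r. ln (1 + r)) v = (\<integral>y. log_moment (\<lambda>x. v (x + y)) * (v y)\<^sup>2 \<partial>lborel)"
    "integrable lborel (\<lambda>y. log_moment (\<lambda>x. v (x + y)) * (v y)\<^sup>2)"
    using interaction_eq_iterated[OF v log_bounded_ln_1_plus] by (simp_all add: log_moment_shift(2)[OF v])
  have "?K * sqnorm lborel v = (\<integral>y. ?K * (v y)\<^sup>2 \<partial>lborel)" by (simp add: sqnorm_def)
  also have "\<dots> \<le> interaction (\<lambda>r. ln (1 + r)) v"
    unfolding iterated(1)
    by (intro integral_mono iterated(2) integrable_mult_right admissibleD[OF v] mult_right_mono big) auto
  also have "\<dots> \<le> interaction (\<lambda>r. ln 2 + max 0 (ln r)) v"
    by (intro interaction_mono v log_bounded_intros ln_1_plus_le)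
  also have "\<dots> = ln 2 * (sqnorm lborel v)\<^sup>2 + interaction (\<lambda>r. max 0 (ln r)) v"
    by (simp add: interaction_add interaction_const v log_bounded_intros)
  finally show False using pos by simp
qed

subsection \<open>Disc averages and compactness\<close>

definition disc_integral :: "real \<Rightarrow> (real^2 \<Rightarrow> real) \<Rightarrow> real^2 \<Rightarrow> real" where
  "disc_integral r v x = (\<integral>h. indicator (ball 0 r) h * v (x + h) \<partial>lborel)"

definition disc_average :: "real \<Rightarrow> (real^2 \<Rightarrow> real) \<Rightarrow> real^2 \<Rightarrow> real" where
  "disc_average r v x = disc_integral r v x / (pi * r\<^sup>2)"

lemma disc_integral_measurable [measurable]:
  assumes [measurable]: "v \<in> borel_measurable borel"
  shows "disc_integral r v \<in> borel_measurable borel" "disc_average r v \<in> borel_measurable borel"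
  unfolding disc_integral_def disc_average_def by measurable

lemma disc_integrable:
  "L2 lborel v \<Longrightarrow> integrable lborel (\<lambda>h. indicator (ball 0 r) h * v (x + h))"
  for v :: "'a::euclidean_space \<Rightarrow> real"
  using L2_inner_integrable[OF bounded_supp_L2[OF bounded_supp_ball] L2_shift_left] by simp

lemma sqnorm_indicator_ball:
  assumes "r \<ge> 0" shows "sqnorm lborel (indicator (ball (0::real^2) r) :: _ \<Rightarrow> real) = pi * r\<^sup>2"
proof -
  have "(norm (indicator (ball (0::real^2) r) x :: real))\<^sup>2 = indicator (ball 0 r) x" for x
    by (simp add: indicator_def)
  then show ?thesis using emeasure_ball_2[OF assms, of 0] assms by (simp add: sqnorm_def measure_def)
qed

lemma disc_integral_bound:
  assumes v: "L2 lborel v" and r: "r \<ge> 0"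
  shows "\<bar>disc_integral r v x\<bar> \<le> sqrt pi * r * sqrt (sqnorm lborel v)"
  using L2_Cauchy_Schwarz[OF bounded_supp_L2[OF bounded_supp_ball[of r]] L2_shift_left[OF v, of x]]
    sqnorm_shift_left[of v x] v r
  by (simp add: disc_integral_def sqnorm_indicator_ball real_sqrt_mult L2_def)

lemma disc_integral_diff:
  assumes "L2 lborel v"
  shows "disc_integral r v x - disc_integral r v y = disc_integral r (\<lambda>z. v (z + (x - y)) - v z) y"
proof -
  have "disc_integral r v x - disc_integral r v y
      = (\<integral>h. indicator (ball 0 r) h * v (x + h) - indicator (ball 0 r) h * v (y + h) \<partial>lborel)"
    by (simp add: disc_integral_def disc_integrable[OF assms])
  also have "\<dots> = disc_integral r (\<lambda>z. v (z + (x - y)) - v z) y"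
    unfolding disc_integral_def by (intro Bochner_Integration.integral_cong) (simp_all add: algebra_simps)
  finally show ?thesis .
qed

lemma disc_integral_Lipschitz:
  assumes v: "H1 v" and r: "r \<ge> 0"
  shows "\<bar>disc_integral r v x - disc_integral r v y\<bar> \<le> sqrt pi * r * sqrt (rdirichlet v) * norm (x - y)"
proof -
  let ?w = "\<lambda>z. v (z + (x - y)) - v z"
  have "\<bar>disc_integral r v x - disc_integral r v y\<bar> \<le> sqrt pi * r * sqrt (sqnorm lborel ?w)"
    unfolding disc_integral_diff[OF H1_L2[OF v], of r x y]
    by (intro disc_integral_bound L2_diff L2_shift H1_L2 v r)
  also have "\<dots> \<le> sqrt pi * r * sqrt ((norm (x - y))\<^sup>2 * rdirichlet v)"
    using r by (intro mult_left_mono real_sqrt_le_mono sqnorm_increment_le_rdirichlet v) auto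
  finally show ?thesis by (simp add: real_sqrt_mult mult_ac)
qed

lemma disc_average_error_le:
  assumes v: "L2 lborel v" and r: "r > 0"
  shows "ennreal ((norm (disc_average r v x - v x))\<^sup>2)
    \<le> ennreal (1 / (pi * r\<^sup>2)) * (\<integral>\<^sup>+h. indicator (ball 0 r) h * ennreal ((norm (v (x + h) - v x))\<^sup>2) \<partial>lborel)"
proof -
  note [measurable] = L2_measurable[OF v, simplified]
  let ?i = "indicator (ball 0 r) :: real^2 \<Rightarrow> real" and ?m = "pi * r\<^sup>2"
  let ?q = "\<lambda>h. ?i h * (v (x + h) - v x)"
  have area_pos: "?m > 0" using r by simp
  have "(\<integral>h. ?q h \<partial>lborel) = (\<integral>h. ?i h * v (x + h) - ?i h * v x \<partial>lborel)"
    by (simp add: right_diff_distrib)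
  also have "\<dots> = disc_integral r v x - ?m * v x"
    using disc_integrable[OF v, of r x] bounded_supp_integrable[OF bounded_supp_ball[of r]]
      emeasure_ball_2[of r 0] r
    by (simp add: disc_integral_def measure_def)
  finally have "disc_average r v x - v x = (1 / ?m) * (\<integral>h. ?q h \<partial>lborel)"
    using r by (simp add: disc_average_def diff_divide_distrib)
  then have "ennreal ((norm (disc_average r v x - v x))\<^sup>2) = ennreal ((1 / ?m)\<^sup>2) * ennreal ((norm (\<integral>h. ?q h \<partial>lborel))\<^sup>2)"
    by (simp add: power_divide flip: ennreal_mult)
  also have "\<dots> \<le> ennreal ((1 / ?m)\<^sup>2) *
      ((\<integral>\<^sup>+h. ennreal ((norm (?i h))\<^sup>2) \<partial>lborel) * (\<integral>\<^sup>+h. ennreal ((norm (?q h))\<^sup>2) \<partial>lborel))"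
    by (intro mult_left_mono norm_integral_product_sq_le) (auto simp: indicator_def)
  also have "(\<integral>\<^sup>+h. ennreal ((norm (?i h))\<^sup>2) \<partial>lborel) = ennreal ?m"
    using nn_integral_norm_sq[OF bounded_supp_L2[OF bounded_supp_ball[where 'a="real^2" and r=r]]] r
    by (simp add: sqnorm_indicator_ball)
  also have "ennreal ((1 / ?m)\<^sup>2) * (ennreal ?m * (\<integral>\<^sup>+h. ennreal ((norm (?q h))\<^sup>2) \<partial>lborel))
      = ennreal (1 / ?m) * (\<integral>\<^sup>+h. ennreal ((norm (?q h))\<^sup>2) \<partial>lborel)"
  proof -
    have "ennreal ((1 / ?m)\<^sup>2) * ennreal ?m = ennreal (1 / ?m)"
      using area_pos by (subst ennreal_mult[symmetric]) (auto simp: power2_eq_square)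
    then show ?thesis by (simp only: mult.assoc[symmetric])
  qed
  also have "(\<integral>\<^sup>+h. ennreal ((norm (?q h))\<^sup>2) \<partial>lborel)
      = (\<integral>\<^sup>+h. indicator (ball 0 r) h * ennreal ((norm (v (x + h) - v x))\<^sup>2) \<partial>lborel)"
    by (intro nn_integral_cong) (auto simp: indicator_def)
  finally show ?thesis .
qed

lemma disc_average_approx:
  assumes v: "H1 v" and r: "r > 0"
  shows "L2 lborel (\<lambda>x. disc_average r v x - v x)" "sqnorm lborel (\<lambda>x. disc_average r v x - v x) \<le> r\<^sup>2 * rdirichlet v"
proof -
  note [measurable] = L2_measurable[OF H1_L2[OF v], simplified]
  let ?m = "pi * r\<^sup>2"
  have "(\<integral>\<^sup>+x. ennreal ((norm (disc_average r v x - v x))\<^sup>2) \<partial>lborel) \<le> ennreal (1 / ?m) * difference_energy r v"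
    unfolding difference_energy_def
    by (subst nn_integral_cmult[symmetric], measurable) (intro nn_integral_mono disc_average_error_le H1_L2 v r)
  also have "\<dots> \<le> ennreal (1 / ?m) * (ennreal (disc_moment r) * edirichlet v)"
    using difference_quotient_energy_le_edirichlet[OF H1_L2[OF v] r] r
    by (intro mult_left_mono) (auto simp: difference_quotient_energy_le_iff)
  also have "\<dots> = ennreal (disc_moment r / ?m * rdirichlet v)"
    using disc_moment_nonneg[of r] rdirichlet_nonneg[of v]
    by (simp add: ennreal_rdirichlet[OF v, symmetric] flip: ennreal_mult)
  also have "\<dots> \<le> ennreal (r\<^sup>2 * rdirichlet v)"
    using disc_moment_le[of r] r
    by (intro ennreal_leI mult_right_mono rdirichlet_nonneg) (simp add: pos_divide_le_eq)
  finally have "(\<integral>\<^sup>+x. ennreal ((norm (disc_average r v x - v x))\<^sup>2) \<partial>lborel) \<le> ennreal (r\<^sup>2 * rdirichlet v)" .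
  then show "L2 lborel (\<lambda>x. disc_average r v x - v x)" "sqnorm lborel (\<lambda>x. disc_average r v x - v x) \<le> r\<^sup>2 * rdirichlet v"
    using rdirichlet_nonneg[of v] by (auto intro!: L2_nn_integralI[where C="r\<^sup>2 * rdirichlet v"])
qed

lemma equi_Lipschitz_convergent_subsequence:
  fixes f :: "nat \<Rightarrow> 'i::countable \<Rightarrow> 'a::euclidean_space \<Rightarrow> real"
  assumes bound: "\<And>n i x. \<bar>f n i x\<bar> \<le> M" and Lip: "\<And>n i x y. \<bar>f n i x - f n i y\<bar> \<le> L * norm (x - y)"
  obtains k where "strict_mono k" "\<And>i x. convergent (\<lambda>n. f (k n) i x)"
proof -
  obtain Q :: "'a set" where Q: "countable Q" "UNIV \<subseteq> closure Q"
    using separable[of "UNIV :: 'a set"] by metis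
  obtain k where k: "strict_mono k" "\<And>p. p \<in> UNIV \<times> Q \<Longrightarrow> \<exists>l. (\<lambda>n. f (k n) (fst p) (snd p)) \<longlonglongrightarrow> l"
    using function_convergent_subsequence[of "UNIV \<times> Q" "\<lambda>n p. f n (fst p) (snd p)" M] Q bound
    by (auto simp: countable_SIGMA)
  have "convergent (\<lambda>n. f (k n) i x)" for i x
  proof (rule Cauchy_convergent, rule CauchyI)
    fix e :: real assume "e > 0"
    have "\<bar>L\<bar> + 1 > 0" by simp
    obtain q where q: "q \<in> Q" "dist q x < e / (4 * (\<bar>L\<bar> + 1))"
      using Q(2) \<open>e > 0\<close> \<open>\<bar>L\<bar> + 1 > 0\<close> closure_approachable[of x Q]
      by (meson UNIV_I divide_pos_pos mult_pos_pos subsetD zero_less_numeral)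
    have near: "\<bar>f n i x - f n i q\<bar> < e / 4" for n
    proof -
      have "\<bar>f n i x - f n i q\<bar> \<le> (\<bar>L\<bar> + 1) * norm (x - q)"
        using Lip[of n i x q] by (rule order_trans) (auto intro: mult_right_mono)
      also have "\<dots> < (\<bar>L\<bar> + 1) * (e / (4 * (\<bar>L\<bar> + 1)))"
        using q(2) by (intro mult_strict_left_mono) (auto simp: dist_norm norm_minus_commute)
      also have "\<dots> = e / 4" using \<open>\<bar>L\<bar> + 1 > 0\<close> by (simp add: field_simps)
      finally show ?thesis .
    qed
    have "Cauchy (\<lambda>n. f (k n) i q)"
      using k(2)[of "(i, q)"] q(1) by (intro convergent_Cauchy) (simp add: convergent_def)
    then obtain N where N: "\<And>m n. m \<ge> N \<Longrightarrow> n \<ge> N \<Longrightarrow> norm (f (k m) i q - f (k n) i q) < e / 2"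
      using CauchyD[of _ "e/2"] \<open>e > 0\<close> by (metis half_gt_zero)
    show "\<exists>N. \<forall>m\<ge>N. \<forall>n\<ge>N. norm (f (k m) i x - f (k n) i x) < e"
    proof (intro exI[of _ N] allI impI)
      fix m n assume "m \<ge> N" "n \<ge> N"
      from N[OF this] near[of "k m"] near[of "k n"] show "norm (f (k m) i x - f (k n) i x) < e"
        unfolding real_norm_def by linarith
    qed
  qed
  with k(1) show ?thesis by (rule that)
qed

lemma sqnorm_diff_le:
  assumes "L2 M f" "L2 M g" shows "sqnorm M (\<lambda>x. f x - g x) \<le> 2 * sqnorm M f + 2 * sqnorm M g"
  using sqnorm_add_le[OF assms(1) L2_scaleR[OF assms(2), of "-1"]] sqnorm_scaleR[of M "-1" g] by simp

lemma L2_Cauchy_if_approximable: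
  assumes u: "\<And>n. L2 M (u n)"
    and approx: "\<And>e. e > 0 \<Longrightarrow> \<exists>g. L2_Cauchy M g \<and> (\<forall>n. L2 M (g n) \<and> sqnorm M (\<lambda>x. u n x - g n x) \<le> e)"
  shows "L2_Cauchy M u"
  unfolding L2_Cauchy_def
proof (intro allI impI)
  fix e :: real assume "e > 0"
  then obtain g where Cauchy: "L2_Cauchy M g" and g: "\<And>n. L2 M (g n)"
    and close: "\<And>n. sqnorm M (\<lambda>x. u n x - g n x) \<le> e / 16"
    using approx[of "e / 16"] by auto
  obtain N where N: "\<And>m n. m \<ge> N \<Longrightarrow> n \<ge> N \<Longrightarrow> sqnorm M (\<lambda>x. g m x - g n x) < e / 4"
    using Cauchy \<open>e > 0\<close> unfolding L2_Cauchy_def by (metis divide_pos_pos zero_less_numeral)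
  have "sqnorm M (\<lambda>x. u m x - u n x) < e" if "m \<ge> N" "n \<ge> N" for m n
  proof -
    let ?d = "\<lambda>n x. u n x - g n x"
    have d_L2: "L2 M (?d n)" for n by (intro L2_diff u g)
    have "sqnorm M (\<lambda>x. u m x - u n x) = sqnorm M (\<lambda>x. (?d m x - ?d n x) + (g m x - g n x))"
      by simp
    also have "\<dots> \<le> 2 * sqnorm M (\<lambda>x. ?d m x - ?d n x) + 2 * sqnorm M (\<lambda>x. g m x - g n x)"
      by (intro sqnorm_add_le L2_diff d_L2 g)
    also have "\<dots> \<le> 2 * (2 * sqnorm M (?d m) + 2 * sqnorm M (?d n)) + 2 * sqnorm M (\<lambda>x. g m x - g n x)"
      by (intro add_right_mono mult_left_mono sqnorm_diff_le d_L2) simp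
    also have "\<dots> < 2 * (2 * (e / 16) + 2 * (e / 16)) + 2 * (e / 4)"
      using N[OF that] close[of m] close[of n] by (intro add_le_less_mono mult_left_mono add_mono) auto
    finally show ?thesis by simp
  qed
  then show "\<exists>N. \<forall>m\<ge>N. \<forall>n\<ge>N. sqnorm M (\<lambda>x. u m x - u n x) < e" by blast
qed

lemma L2_Cauchy_dominated:
  fixes f :: "nat \<Rightarrow> 'a::euclidean_space \<Rightarrow> real"
  assumes [measurable]: "\<And>n. f n \<in> borel_measurable borel"
    and bound: "\<And>n x. \<bar>f n x\<bar> \<le> \<psi> x" and \<psi>: "L2 lborel \<psi>" and conv: "\<And>x. convergent (\<lambda>n. f n x)"
  shows "L2_Cauchy lborel f"
proof -
  define a where "a x = lim (\<lambda>n. f n x)" for x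
  have lim: "(\<lambda>n. f n x) \<longlonglongrightarrow> a x" for x using conv[of x] by (simp add: a_def convergent_LIMSEQ_iff)
  have [measurable]: "a \<in> borel_measurable borel" unfolding a_def by (rule borel_measurable_lim_metric) measurable
  have a_bound: "\<bar>a x\<bar> \<le> \<psi> x" for x
    by (rule LIMSEQ_le_const2[OF tendsto_rabs[OF lim]]) (use bound in auto)
  have \<psi>_nonneg: "0 \<le> \<psi> x" for x using bound[of 0 x] by linarith
  have f: "L2 lborel (f n)" and a: "L2 lborel a" for n
    using bound a_bound \<psi>_nonneg by (auto intro!: L2_bound[OF \<psi>])
  have "(\<lambda>n. \<integral>x. (norm (f n x - a x))\<^sup>2 \<partial>lborel) \<longlonglongrightarrow> (\<integral>x. 0 \<partial>(lborel :: 'a measure))"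
  proof (rule integral_dominated_convergence)
    show "integrable lborel (\<lambda>x. 4 * (\<psi> x)\<^sup>2)" using L2_integrable[OF \<psi>] by simp
    show "AE x in lborel. norm ((norm (f n x - a x))\<^sup>2) \<le> 4 * (\<psi> x)\<^sup>2" for n
    proof (intro AE_I2)
      fix x
      have "\<bar>f n x - a x\<bar> \<le> 2 * \<psi> x" using bound[of n x] a_bound[of x] by linarith
      from power_mono[OF this abs_ge_zero, of 2] show "norm ((norm (f n x - a x))\<^sup>2) \<le> 4 * (\<psi> x)\<^sup>2"
        by (simp add: power_mult_distrib)
    qed
    show "AE x in lborel. (\<lambda>n. (norm (f n x - a x))\<^sup>2) \<longlonglongrightarrow> 0"
      using lim by (intro AE_I2 tendsto_eq_intros) (auto intro: tendsto_eq_intros)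
  qed measurable
  then have zero: "(\<lambda>n. 2 * sqnorm lborel (\<lambda>x. f n x - a x)) \<longlonglongrightarrow> 0" using tendsto_mult_right_zero by (simp add: sqnorm_def)
  show ?thesis
    unfolding L2_Cauchy_def
  proof (intro allI impI)
    fix e :: real assume "e > 0"
    then obtain N where N: "\<And>n. n \<ge> N \<Longrightarrow> 2 * sqnorm lborel (\<lambda>x. f n x - a x) < e / 2"
      using order_tendstoD(2)[OF zero, of "e / 2"] by (auto simp: eventually_sequentially)
    have "sqnorm lborel (\<lambda>x. f m x - f n x) < e" if "m \<ge> N" "n \<ge> N" for m n
      using sqnorm_diff_le[OF L2_diff[OF f a] L2_diff[OF f a], of m n] N[OF that(1)] N[OF that(2)] by simp
    then show "\<exists>N. \<forall>m\<ge>N. \<forall>n\<ge>N. sqnorm lborel (\<lambda>x. f m x - f n x) < e" by blast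
  qed
qed

lemma localised_average_L2:
  assumes v: "L2 lborel v" and r: "r > 0"
  shows "L2 lborel (\<lambda>x. indicator (ball 0 R) x * disc_average r v x)"
proof -
  note [measurable] = L2_measurable[OF v, simplified]
  have "bounded_supp (\<lambda>x. indicator (ball 0 R) x * disc_average r v x)"
    using disc_integral_bound[OF v, of r] r
    by (intro bounded_supp_ball_mult[where C="sqrt pi * r * sqrt (sqnorm lborel v) / (pi * r\<^sup>2)"])
      (auto simp: disc_average_def intro!: divide_right_mono)
  then show ?thesis by (rule bounded_supp_L2)
qed

lemma localised_average_approx:
  assumes v: "admissible v" and r: "r > 0" and R: "R > 0"
  shows "sqnorm lborel (\<lambda>x. v x - indicator (ball 0 R) x * disc_average r v x)
    \<le> r\<^sup>2 * rdirichlet v + log_moment v / ln (1 + R)"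
proof -
  note avg = disc_average_approx[OF admissibleD(1)[OF v] r]
  have "ln (1 + R) > 0" using R by simp
  let ?g = "\<lambda>x. (disc_average r v x - v x)\<^sup>2 + (1 / ln (1 + R)) * (ln (1 + norm x) * (v x)\<^sup>2)"
  have "sqnorm lborel (\<lambda>x. v x - indicator (ball 0 R) x * disc_average r v x) \<le> (\<integral>x. ?g x \<partial>lborel)"
    unfolding sqnorm_def
  proof (rule integral_mono)
    show "integrable lborel (\<lambda>x. (norm (v x - indicator (ball 0 R) x * disc_average r v x))\<^sup>2)"
      by (intro L2_integrable L2_diff localised_average_L2 admissibleD[OF v] r)
    show "integrable lborel ?g"
      using L2_integrable[OF avg(1)]
      by (intro Bochner_Integration.integrable_add integrable_mult_right admissibleD[OF v]) simp
    fix x :: "real^2"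
    show "(norm (v x - indicator (ball 0 R) x * disc_average r v x))\<^sup>2 \<le> ?g x"
    proof (cases "norm x < R")
      case True
      then show ?thesis using \<open>ln (1 + R) > 0\<close> by (simp add: power2_commute)
    next
      case False
      then have "1 \<le> ln (1 + norm x) / ln (1 + R)" using R \<open>ln (1 + R) > 0\<close> by (simp add: ln_mono)
      from mult_right_mono[OF this, of "(v x)\<^sup>2"] False show ?thesis
        by (simp add: add_increasing)
    qed
  qed
  also have "\<dots> = sqnorm lborel (\<lambda>x. disc_average r v x - v x) + log_moment v / ln (1 + R)"
    using L2_integrable[OF avg(1)] admissibleD(5)[OF v] by (simp add: sqnorm_def log_moment_def)
  finally show ?thesis using avg(2) by simp
qed

lemma arbitrarily_good_localisation:
  assumes "D \<ge> 0" "K \<ge> 0" "e > 0"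
  obtains j :: nat and R where "R > 0" "(1 / real (Suc j))\<^sup>2 * D + K / ln (1 + R) \<le> e"
proof -
  have "(\<lambda>j. (1 / real (Suc j))\<^sup>2 * D) \<longlonglongrightarrow> 0\<^sup>2 * D"
    by (intro tendsto_intros LIMSEQ_Suc[OF lim_1_over_n])
  then have "\<forall>\<^sub>F j in sequentially. (1 / real (Suc j))\<^sup>2 * D < e / 2"
    using \<open>e > 0\<close> by (intro order_tendstoD(2)) auto
  then obtain j where j: "(1 / real (Suc j))\<^sup>2 * D < e / 2" by (auto simp: eventually_sequentially)
  define R where "R = exp (2 * K / e + 1) - 1"
  have "2 * K / e + 1 > 0" using assms by (simp add: add_nonneg_pos)
  then have "R > 0" "K / ln (1 + R) \<le> e / 2" using assms by (auto simp: R_def field_simps)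
  with j show ?thesis by (intro that[of R j]) linarith+
qed

lemma disc_integrals_convergent_subsequence:
  fixes w :: "nat \<Rightarrow> real^2 \<Rightarrow> real"
  assumes w: "\<And>n. H1 (w n)" and N: "\<And>n. sqnorm lborel (w n) \<le> N" and D: "\<And>n. rdirichlet (w n) \<le> D"
  obtains k where "strict_mono k" "\<And>j x. convergent (\<lambda>n. disc_integral (1 / real (Suc j)) (w (k n)) x)"
proof -
  let ?r = "\<lambda>j::nat. 1 / real (Suc j)"
  have bound: "\<bar>disc_integral (?r j) (w n) x\<bar> \<le> sqrt pi * 1 * sqrt N" for n j x
  proof -
    have "\<bar>disc_integral (?r j) (w n) x\<bar> \<le> sqrt pi * ?r j * sqrt (sqnorm lborel (w n))"
      by (intro disc_integral_bound H1_L2 w) simp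
    also have "\<dots> \<le> sqrt pi * 1 * sqrt N"
      using N[of n] sqnorm_nonneg[of lborel "w n"] by (intro mult_mono) auto
    finally show ?thesis .
  qed
  have "\<bar>disc_integral (?r j) (w n) x - disc_integral (?r j) (w n) y\<bar> \<le> sqrt pi * 1 * sqrt D * norm (x - y)" for n j x y
  proof -
    have "\<bar>disc_integral (?r j) (w n) x - disc_integral (?r j) (w n) y\<bar>
        \<le> sqrt pi * ?r j * sqrt (rdirichlet (w n)) * norm (x - y)"
      by (intro disc_integral_Lipschitz w) simp
    also have "\<dots> \<le> sqrt pi * 1 * sqrt D * norm (x - y)"
      using D[of n] rdirichlet_nonneg[of "w n"] by (intro mult_mono) auto
    finally show ?thesis .
  qed
  from equi_Lipschitz_convergent_subsequence[of "\<lambda>n j. disc_integral (?r j) (w n)", OF bound this]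
  show ?thesis using that by blast
qed

theorem L2_precompact:
  fixes w :: "nat \<Rightarrow> real^2 \<Rightarrow> real"
  assumes w: "\<And>n. admissible (w n)" and lam: "\<And>n. sqnorm lborel (w n) = lam"
    and D: "\<And>n. rdirichlet (w n) \<le> D" and K: "\<And>n. log_moment (w n) \<le> K"
  shows "\<exists>k v. strict_mono k \<and> L2 lborel v \<and> (\<lambda>n. sqnorm lborel (\<lambda>x. w (k n) x - v x)) \<longlonglongrightarrow> 0"
proof -
  note H1 = admissibleD(1)[OF w] and L2 = admissibleD(2)[OF w] and [measurable] = admissibleD(3)[OF w]
  let ?r = "\<lambda>j::nat. 1 / real (Suc j)"
  obtain k where k: "strict_mono k" and conv: "\<And>j x. convergent (\<lambda>n. disc_integral (?r j) (w (k n)) x)"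
    using disc_integrals_convergent_subsequence[of w, OF H1 eq_refl[OF lam] D] by blast
  have "L2_Cauchy lborel (\<lambda>n. w (k n))"
  proof (rule L2_Cauchy_if_approximable[OF L2])
    fix e :: real assume "e > 0"
    have "D \<ge> 0" "K \<ge> 0" using D[of 0] rdirichlet_nonneg[of "w 0"] K[of 0] log_moment_nonneg[of "w 0"] by linarith+
    from arbitrarily_good_localisation[OF this \<open>e > 0\<close>] obtain j R
      where R: "R > 0" "(?r j)\<^sup>2 * D + K / ln (1 + R) \<le> e" by blast
    let ?g = "\<lambda>n x. indicator (ball 0 R) x * disc_average (?r j) (w (k n)) x"
    let ?B = "sqrt pi * ?r j * sqrt lam / (pi * (?r j)\<^sup>2)"
    have "convergent (\<lambda>n. ?g n x)" for x
      unfolding disc_average_def divide_inverse[of "disc_integral _ _ _"]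
      by (intro convergent_mult convergent_const conv)
    moreover have "\<bar>?g n x\<bar> \<le> indicator (ball 0 R) x * ?B" for n x
      using divide_right_mono[OF disc_integral_bound[OF L2, of "?r j" "k n" x], of "pi * (?r j)\<^sup>2"]
      by (simp add: lam disc_average_def indicator_def)
    moreover have "L2 lborel (\<lambda>x::real^2. indicator (ball 0 R) x * ?B)"
      by (intro bounded_supp_L2 bounded_supp_ball_mult) auto
    ultimately have "L2_Cauchy lborel ?g"
      by (intro L2_Cauchy_dominated[where \<psi>="\<lambda>x. indicator (ball 0 R) x * ?B"]) auto
    moreover have "sqnorm lborel (\<lambda>x. w (k n) x - ?g n x) \<le> e" for n
    proof -
      have "sqnorm lborel (\<lambda>x. w (k n) x - ?g n x) \<le> (?r j)\<^sup>2 * rdirichlet (w (k n)) + log_moment (w (k n)) / ln (1 + R)"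
        using R(1) by (intro localised_average_approx w) auto
      also have "\<dots> \<le> (?r j)\<^sup>2 * D + K / ln (1 + R)"
        using R(1) by (intro add_mono mult_left_mono divide_right_mono D K) auto
      finally show ?thesis using R(2) by simp
    qed
    ultimately show "\<exists>g. L2_Cauchy lborel g \<and> (\<forall>n. L2 lborel (g n) \<and> sqnorm lborel (\<lambda>x. w (k n) x - g n x) \<le> e)"
      using localised_average_L2[OF L2, of "?r j"] by (intro exI[of _ ?g]) auto
  qed
  from L2_complete[OF L2 this] k show ?thesis by blast
qed

lemma admissible_limit:
  assumes z: "\<And>n. admissible (z n)" and D: "\<And>n. rdirichlet (z n) \<le> D" and K: "\<And>n. log_moment (z n) \<le> K"
    and v: "L2 lborel v" "\<And>x. 0 \<le> v x" and lim: "AE x in lborel. (\<lambda>n. z n x) \<longlonglongrightarrow> v x"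
  shows "admissible v"
proof -
  note [measurable] = admissibleD(3)[OF z] L2_measurable[OF v(1), simplified]
  have "edirichlet v \<le> liminf (\<lambda>n. edirichlet (z n))"
    by (rule edirichlet_le_liminf[OF admissibleD(2)[OF z] lim])
  also have "\<dots> \<le> liminf (\<lambda>n. ennreal D)"
    using D by (intro Liminf_mono always_eventually allI)
      (simp add: ennreal_rdirichlet[OF admissibleD(1)[OF z], symmetric] ennreal_leI)
  finally have "edirichlet v < \<infinity>" by (simp add: Liminf_const le_less_trans)
  have "(\<integral>\<^sup>+x. ennreal (ln (1 + norm x) * (v x)\<^sup>2) \<partial>lborel)
      \<le> liminf (\<lambda>n. \<integral>\<^sup>+x. ennreal (ln (1 + norm x) * (z n x)\<^sup>2) \<partial>lborel)"
  proof (rule nn_integral_le_liminf_AE)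
    show "AE x in lborel. (\<lambda>n. ennreal (ln (1 + norm x) * (z n x)\<^sup>2)) \<longlonglongrightarrow> ennreal (ln (1 + norm x) * (v x)\<^sup>2)"
      using lim by eventually_elim (intro tendsto_ennrealI tendsto_intros)
  qed measurable
  also have "\<dots> = liminf (\<lambda>n. ennreal (log_moment (z n)))"
    unfolding log_moment_def using admissibleD(5)[OF z] by (subst nn_integral_eq_integral) auto
  also have "\<dots> \<le> liminf (\<lambda>n. ennreal K)" by (intro Liminf_mono always_eventually allI ennreal_leI K)
  finally have "integrable lborel (\<lambda>x. ln (1 + norm x) * (v x)\<^sup>2)"
    by (intro integrableI_nonneg) (auto simp: Liminf_const le_less_trans)
  with v \<open>edirichlet v < \<infinity>\<close> show ?thesis by (simp add: admissible_def H1_def)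
qed

theorem admissible_compactness:
  fixes z :: "nat \<Rightarrow> real^2 \<Rightarrow> real"
  assumes z: "\<And>n. admissible (z n)" and lam: "\<And>n. sqnorm lborel (z n) = lam"
    and D: "\<And>n. rdirichlet (z n) \<le> D" and K: "\<And>n. log_moment (z n) \<le> K"
  obtains k v where "strict_mono k" "admissible v" "sqnorm lborel v = lam"
    "AE x in lborel. (\<lambda>n. z (k n) x) \<longlonglongrightarrow> v x"
proof -
  obtain l w where l: "strict_mono l" and w: "L2 lborel w" "(\<lambda>n. sqnorm lborel (\<lambda>x. z (l n) x - w x)) \<longlonglongrightarrow> 0"
    using L2_precompact[of z, OF z lam D K] by blast
  have "sqnorm lborel w = lam"
    using sqnorm_tendsto[OF admissibleD(2)[OF z] w] by (simp add: lam LIMSEQ_const_iff)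
  obtain r where r: "strict_mono r" "AE x in lborel. (\<lambda>n. z (l (r n)) x) \<longlonglongrightarrow> w x"
    using L2_AE_subseq[OF admissibleD(2)[OF z] w] by blast
  have "AE x in lborel. (\<lambda>n. z (l (r n)) x) \<longlonglongrightarrow> \<bar>w x\<bar>"
    using r(2)
  proof eventually_elim
    case (elim x)
    from tendsto_rabs[OF this] show ?case by (simp add: admissibleD(4)[OF z])
  qed
  moreover have "L2 lborel (\<lambda>x. \<bar>w x\<bar>)" using w(1) by (auto simp: L2_def)
  ultimately have "admissible (\<lambda>x. \<bar>w x\<bar>)"
    by (intro admissible_limit[where z="\<lambda>n. z (l (r n))", OF z D K]) auto
  moreover have "sqnorm lborel (\<lambda>x. \<bar>w x\<bar>) = lam" using \<open>sqnorm lborel w = lam\<close> by (simp add: sqnorm_def)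
  moreover have "strict_mono (\<lambda>n. l (r n))" using strict_mono_o[OF l r(1)] by (simp add: comp_def)
  ultimately show ?thesis using \<open>AE x in lborel. (\<lambda>n. z (l (r n)) x) \<longlonglongrightarrow> \<bar>w x\<bar>\<close> by (intro that)
qed

subsection \<open>Existence of a minimiser\<close>

lemma liminf_add_ennreal_le:
  fixes f g :: "nat \<Rightarrow> ennreal"
  shows "liminf f + liminf g \<le> liminf (\<lambda>n. f n + g n)"
proof -
  have "liminf f + liminf g = (SUP n. (INF m\<in>{n..}. f m) + (INF m\<in>{n..}. g m))"
    unfolding liminf_SUP_INF
    by (rule ennreal_SUP_add[symmetric]) (auto intro!: incseq_SucI INF_superset_mono)
  also have "\<dots> \<le> liminf (\<lambda>n. f n + g n)"
    unfolding liminf_SUP_INF by (intro SUP_mono' INF_greatest add_mono INF_lower)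
  finally show ?thesis .
qed

lemma nn_integral_interaction_density:
  assumes "admissible v" "log_bounded \<kappa>" "\<And>r. r \<ge> 0 \<Longrightarrow> 0 \<le> \<kappa> r"
  shows "(\<integral>\<^sup>+p. ennreal (interaction_density \<kappa> v p) \<partial>(lborel \<Otimes>\<^sub>M lborel)) = ennreal (interaction \<kappa> v)"
  unfolding interaction_def
  by (intro nn_integral_eq_integral interaction_density_integrable assms)
    (simp add: interaction_density_def assms(3))

lemma interaction_le_liminf:
  fixes z :: "nat \<Rightarrow> real^2 \<Rightarrow> real"
  assumes z: "\<And>n. admissible (z n)" and v: "admissible v" and lim: "AE x in lborel. (\<lambda>n. z n x) \<longlonglongrightarrow> v x"
    and \<kappa>: "log_bounded \<kappa>" "\<And>r. r \<ge> 0 \<Longrightarrow> 0 \<le> \<kappa> r"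
  shows "ennreal (interaction \<kappa> v) \<le> liminf (\<lambda>n. ennreal (interaction \<kappa> (z n)))"
proof -
  note [measurable] = admissibleD(3)[OF z] admissibleD(3)[OF v] log_bounded_measurable[OF \<kappa>(1)]
  have "AE p in lborel \<Otimes>\<^sub>M lborel. (\<lambda>n. ennreal (interaction_density \<kappa> (z n) p)) \<longlonglongrightarrow> ennreal (interaction_density \<kappa> v p)"
    using AE_lborel_pair[OF lim] unfolding interaction_density_def
    by eventually_elim (intro tendsto_ennrealI tendsto_intros; simp)
  from nn_integral_le_liminf_AE[OF _ this] show ?thesis
    by (simp add: nn_integral_interaction_density z v \<kappa>)
qed

definition cut_off_ln :: "real \<Rightarrow> real \<Rightarrow> real" where
  "cut_off_ln \<delta> r = ln r + max 0 (ln (\<delta> / r)) + ln (1 / \<delta>)"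

lemma cut_off_ln_nonneg: "0 < \<delta> \<Longrightarrow> \<delta> \<le> 1 \<Longrightarrow> r \<ge> 0 \<Longrightarrow> 0 \<le> cut_off_ln \<delta> r"
  by (cases "r = 0") (auto simp: cut_off_ln_def ln_div)

lemma log_bounded_cut_off_ln: "\<delta> > 0 \<Longrightarrow> log_bounded (cut_off_ln \<delta>)"
  unfolding cut_off_ln_def[abs_def] by (intro log_bounded_intros)

lemma interaction_cut_off_ln:
  assumes v: "admissible v" and \<delta>: "\<delta> > 0"
  shows "interaction (cut_off_ln \<delta>) v
    = interaction ln v + interaction (\<lambda>r. max 0 (ln (\<delta> / r))) v + ln (1 / \<delta>) * (sqnorm lborel v)\<^sup>2"
  unfolding cut_off_ln_def[abs_def] using \<delta>
  by (simp add: interaction_add interaction_const v log_bounded_intros)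

text \<open>The logarithm is unbounded below at short distances, so Fatou's lemma is applied to a truncated kernel;
  the truncation error is uniformly of order \<open>\<delta>\<close>.\<close>
lemma profile_energy_limit_le_truncated:
  fixes z :: "nat \<Rightarrow> real^2 \<Rightarrow> real"
  assumes z: "\<And>n. admissible (z n)" "\<And>n. sqnorm lborel (z n) = lam" and D: "\<And>n. rdirichlet (z n) \<le> D"
    and v: "admissible v" "sqnorm lborel v = lam" and lim: "AE x in lborel. (\<lambda>n. z n x) \<longlonglongrightarrow> v x"
    and c_nonneg: "c \<ge> 0" and m: "(\<lambda>n. profile_energy c (z n)) \<longlonglongrightarrow> m" and \<delta>: "0 < \<delta>" "\<delta> \<le> 1"
  shows "profile_energy c v \<le> m + 4 * c * (lam + D) * lam * \<delta>"
proof -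
  let ?k = "cut_off_ln \<delta>" and ?t = "\<lambda>r. max 0 (ln (\<delta> / r))"
  let ?E = "\<lambda>u. rdirichlet u + c * interaction ?k u" and ?C = "4 * c * (lam + D) * lam * \<delta> + c * (ln (1 / \<delta>) * lam\<^sup>2)"
  note \<kappa> = log_bounded_cut_off_ln[OF \<delta>(1)] cut_off_ln_nonneg[OF \<delta>]
  have lam: "lam \<ge> 0" using v(2) sqnorm_nonneg by metis
  have E_nonneg: "0 \<le> ?E u" for u
    using c_nonneg by (intro add_nonneg_nonneg rdirichlet_nonneg mult_nonneg_nonneg interaction_nonneg \<kappa>)
  have E_eq: "ennreal (?E u) = edirichlet u + ennreal c * ennreal (interaction ?k u)" if "admissible u" for u
    using that c_nonneg \<kappa> by (simp add: ennreal_rdirichlet[OF admissibleD(1), symmetric] rdirichlet_nonneg interaction_nonneg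
        flip: ennreal_mult ennreal_plus)
  have E_le: "?E (z n) \<le> profile_energy c (z n) + ?C" for n
  proof -
    have "interaction ?t (z n) \<le> 4 * \<delta> * (lam + rdirichlet (z n)) * lam"
      using short_range_interaction_le[OF z(1) \<delta>(1), of n] by (simp add: z(2))
    also have "\<dots> \<le> 4 * \<delta> * (lam + D) * lam" using D[of n] \<delta> lam by (intro mult_right_mono mult_left_mono) auto
    finally have "c * interaction ?t (z n) \<le> 4 * c * (lam + D) * lam * \<delta>"
      using mult_left_mono[OF _ c_nonneg] by (fastforce simp: mult_ac)
    then show ?thesis by (simp add: interaction_cut_off_ln z \<delta> profile_energy_def distrib_left)
  qed
  have "ennreal (?E v) \<le> liminf (\<lambda>n. edirichlet (z n)) + ennreal c * liminf (\<lambda>n. ennreal (interaction ?k (z n)))"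
    unfolding E_eq[OF v(1)] using admissibleD(2)[OF z(1)] lim
    by (intro add_mono mult_left_mono edirichlet_le_liminf interaction_le_liminf z v \<kappa>) auto
  also have "\<dots> = liminf (\<lambda>n. edirichlet (z n)) + liminf (\<lambda>n. ennreal c * ennreal (interaction ?k (z n)))"
    by (simp add: Liminf_cmult_ennreal)
  also have "\<dots> \<le> liminf (\<lambda>n. ennreal (?E (z n)))"
    unfolding E_eq[OF z(1)] by (rule liminf_add_ennreal_le)
  also have "\<dots> \<le> liminf (\<lambda>n. ennreal (profile_energy c (z n) + ?C))"
    by (intro Liminf_mono always_eventually allI ennreal_leI E_le)
  also have "\<dots> = ennreal (m + ?C)"
    by (intro lim_imp_Liminf tendsto_ennrealI tendsto_add m tendsto_const) simp
  finally have "?E v \<le> m + ?C"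
    using LIMSEQ_le_const[OF tendsto_add[OF m tendsto_const]] order_trans[OF E_nonneg E_le]
    by (subst (asm) ennreal_le_iff) blast+
  moreover have "0 \<le> c * interaction ?t v" using c_nonneg by (intro mult_nonneg_nonneg interaction_nonneg) auto
  ultimately show ?thesis by (simp add: interaction_cut_off_ln v \<delta> profile_energy_def distrib_left)
qed

theorem profile_energy_lower_semicontinuous:
  fixes z :: "nat \<Rightarrow> real^2 \<Rightarrow> real"
  assumes "\<And>n. admissible (z n)" "\<And>n. sqnorm lborel (z n) = lam" "\<And>n. rdirichlet (z n) \<le> D"
    "admissible v" "sqnorm lborel v = lam" "AE x in lborel. (\<lambda>n. z n x) \<longlonglongrightarrow> v x"
    "c \<ge> 0" "(\<lambda>n. profile_energy c (z n)) \<longlonglongrightarrow> m"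
  shows "profile_energy c v \<le> m"
proof (rule LIMSEQ_le_const)
  show "(\<lambda>n. m + 4 * c * (lam + D) * lam * (1 / real (Suc n))) \<longlonglongrightarrow> m"
    using tendsto_add[OF tendsto_const[of m] tendsto_mult_right_zero[OF LIMSEQ_Suc[OF lim_1_over_n]]] by simp
  show "\<exists>N. \<forall>n\<ge>N. profile_energy c v \<le> m + 4 * c * (lam + D) * lam * (1 / real (Suc n))"
    using assms by (intro exI[of _ 0] allI impI profile_energy_limit_le_truncated[where z=z and D=D]) auto
qed

lemma energy_bounded_recentred:
  assumes c_pos: "c > 0" and lam_pos: "lam > 0"
  obtains D K where "\<And>v. admissible v \<Longrightarrow> sqnorm lborel v = lam \<Longrightarrow> profile_energy c v \<le> M \<Longrightarrow>
    rdirichlet v \<le> D \<and> (\<exists>y. log_moment (\<lambda>x. v (x + y)) \<le> K)"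
proof -
  obtain C where C: "\<And>v. admissible v \<Longrightarrow> sqnorm lborel v = lam \<Longrightarrow>
     rdirichlet v / 2 + c * interaction (\<lambda>r. max 0 (ln r)) v - C \<le> profile_energy c v"
    using profile_energy_coercive[OF c_pos lam_pos] by blast
  let ?K = "(ln 2 * lam\<^sup>2 + (M + C) / c + 1) / lam"
  have "rdirichlet v \<le> 2 * (M + C) \<and> (\<exists>y. log_moment (\<lambda>x. v (x + y)) \<le> ?K)"
    if v: "admissible v" "sqnorm lborel v = lam" "profile_energy c v \<le> M" for v
  proof
    let ?P = "interaction (\<lambda>r. max 0 (ln r)) v"
    have coercive: "rdirichlet v / 2 + c * ?P \<le> M + C" using C[OF v(1,2)] v(3) by linarith
    have "0 \<le> c * ?P" using c_pos by (intro mult_nonneg_nonneg interaction_nonneg) auto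
    with coercive show "rdirichlet v \<le> 2 * (M + C)" by simp
    have "c * ?P \<le> M + C" using coercive rdirichlet_nonneg[of v] by linarith
    then have "?P \<le> (M + C) / c" using c_pos by (simp add: pos_le_divide_eq mult.commute)
    then have "(ln 2 * lam\<^sup>2 + ?P + 1) / lam \<le> ?K" using lam_pos by (intro divide_right_mono) auto
    moreover obtain y where "log_moment (\<lambda>x. v (x + y)) \<le> (ln 2 * lam\<^sup>2 + ?P + 1) / lam"
      using centre_with_small_log_moment[OF v(1)] v(2) lam_pos by auto
    ultimately show "\<exists>y. log_moment (\<lambda>x. v (x + y)) \<le> ?K" by (blast intro: order_trans)
  qed
  then show ?thesis by (rule that)
qed

lemma minimising_sequence:
  fixes F :: "'a \<Rightarrow> real"
  assumes "S \<noteq> {}" "bdd_below (F ` S)"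
  obtains z where "\<And>n. z n \<in> S" "(\<lambda>n. F (z n)) \<longlonglongrightarrow> Inf (F ` S)" "\<And>n. F (z n) \<le> Inf (F ` S) + 1"
proof -
  let ?m = "Inf (F ` S)"
  have "\<exists>v\<in>S. F v < ?m + 1 / real (Suc n)" for n
    using cInf_lessD[of "F ` S" "?m + 1 / real (Suc n)"] assms(1) by auto
  then obtain z where z: "\<And>n. z n \<in> S" "\<And>n. F (z n) < ?m + 1 / real (Suc n)" by metis
  have "(\<lambda>n. F (z n)) \<longlonglongrightarrow> ?m"
  proof (rule tendsto_sandwich[OF _ _ tendsto_const])
    show "\<forall>\<^sub>F n in sequentially. ?m \<le> F (z n)"
      using z(1) assms(2) by (intro always_eventually allI cInf_lower) auto
    show "\<forall>\<^sub>F n in sequentially. F (z n) \<le> ?m + 1 / real (Suc n)"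
      using z(2) by (intro always_eventually allI less_imp_le)
    show "(\<lambda>n. ?m + 1 / real (Suc n)) \<longlonglongrightarrow> ?m"
      using tendsto_add[OF tendsto_const[of ?m] LIMSEQ_Suc[OF lim_1_over_n]] by simp
  qed
  moreover have "F (z n) \<le> ?m + 1" for n
  proof -
    have "1 / real (Suc n) \<le> 1" by simp
    with z(2)[of n] show ?thesis by linarith
  qed
  ultimately show ?thesis using z(1) by (intro that)
qed

theorem minimiser_exists:
  assumes c_pos: "c > 0" and lam_pos: "lam > 0"
  shows "\<exists>v. admissible v \<and> sqnorm lborel v = lam \<and>
    (\<forall>w. admissible w \<longrightarrow> sqnorm lborel w = lam \<longrightarrow> profile_energy c v \<le> profile_energy c w)"
proof -
  let ?S = "{v. admissible v \<and> sqnorm lborel v = lam}"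
  let ?m = "Inf (profile_energy c ` ?S)"
  obtain C where C: "\<And>v. admissible v \<Longrightarrow> sqnorm lborel v = lam \<Longrightarrow>
     rdirichlet v / 2 + c * interaction (\<lambda>r. max 0 (ln r)) v - C \<le> profile_energy c v"
    using profile_energy_coercive[OF c_pos lam_pos] by blast
  have "- C \<le> profile_energy c v" if "admissible v" "sqnorm lborel v = lam" for v
    using C[OF that] rdirichlet_nonneg[of v]
      mult_nonneg_nonneg[OF less_imp_le[OF c_pos] interaction_nonneg[of "\<lambda>r. max 0 (ln r)" v]]
    by simp
  then have bdd: "bdd_below (profile_energy c ` ?S)" by (intro bdd_belowI2[where m="- C"]) auto
  have "?S \<noteq> {}" using admissible_with_mass_exists[OF lam_pos] by blast
  from minimising_sequence[OF this bdd] obtain z where "\<And>n. z n \<in> ?S"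
      and lim: "(\<lambda>n. profile_energy c (z n)) \<longlonglongrightarrow> ?m" and near_min: "\<And>n. profile_energy c (z n) \<le> ?m + 1"
    by blast
  then have z: "admissible (z n)" "sqnorm lborel (z n) = lam" for n by auto
  obtain D K where "\<And>v. admissible v \<Longrightarrow> sqnorm lborel v = lam \<Longrightarrow> profile_energy c v \<le> ?m + 1 \<Longrightarrow>
      rdirichlet v \<le> D \<and> (\<exists>y. log_moment (\<lambda>x. v (x + y)) \<le> K)"
    by (rule energy_bounded_recentred[OF c_pos lam_pos, of "?m + 1"]) (rule that)
  then have bounds: "rdirichlet (z n) \<le> D" "\<exists>y. log_moment (\<lambda>x. z n (x + y)) \<le> K" for n using z near_min by auto
  then obtain y where y: "\<And>n. log_moment (\<lambda>x. z n (x + y n)) \<le> K" by metis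
  define w where "w n x = z n (x + y n)" for n x
  note z_meas = admissibleD(3)[OF z(1)]
  have w: "admissible (w n)" "sqnorm lborel (w n) = lam" "rdirichlet (w n) \<le> D" "log_moment (w n) \<le> K"
    "profile_energy c (w n) = profile_energy c (z n)" for n
    using admissible_shift[OF z(1)] sqnorm_shift[OF z_meas] rdirichlet_shift[OF z_meas] z(2) bounds(1) y
      profile_energy_shift[OF z_meas] unfolding w_def by auto
  obtain k v where k: "strict_mono k" and v: "admissible v" "sqnorm lborel v = lam"
    and "AE x in lborel. (\<lambda>n. w (k n) x) \<longlonglongrightarrow> v x"
    by (rule admissible_compactness[of w, OF w(1-4)]) (rule that)
  then have "profile_energy c v \<le> ?m"
    using LIMSEQ_subseq_LIMSEQ[OF lim k] c_pos
    by (intro profile_energy_lower_semicontinuous[where z="\<lambda>n. w (k n)" and D=D]) (auto simp: w comp_def)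
  also have "?m \<le> profile_energy c u" if "admissible u" "sqnorm lborel u = lam" for u
    using that bdd by (intro cInf_lower) auto
  finally show ?thesis using v by blast
qed

subsection \<open>Polarisation\<close>

definition mirror :: "'a::real_inner \<Rightarrow> real \<Rightarrow> 'a \<Rightarrow> 'a" where
  "mirror e t x = x - (2 * (x \<bullet> e - t)) *\<^sub>R e"

definition polarise :: "'a::real_inner \<Rightarrow> real \<Rightarrow> ('a \<Rightarrow> real) \<Rightarrow> 'a \<Rightarrow> real" where
  "polarise e t v x = (if x \<bullet> e < t then max (v x) (v (mirror e t x)) else min (v x) (v (mirror e t x)))"

lemma mirror_inner: "norm e = 1 \<Longrightarrow> mirror e t x \<bullet> e = 2 * t - x \<bullet> e"
  by (simp add: mirror_def inner_diff_left norm_eq_1 algebra_simps)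

lemma mirror_mirror:
  assumes "norm e = 1" shows "mirror e t (mirror e t x) = x"
proof -
  have "mirror e t (mirror e t x) = mirror e t x - (2 * (2 * t - x \<bullet> e - t)) *\<^sub>R e"
    by (subst mirror_def) (simp only: mirror_inner[OF assms])
  also have "\<dots> = x - (2 * (x \<bullet> e - t) + 2 * (2 * t - x \<bullet> e - t)) *\<^sub>R e"
    by (simp only: mirror_def scaleR_left_distrib diff_diff_eq)
  finally show ?thesis by simp
qed

lemma mirror_boundary: "x \<bullet> e = t \<Longrightarrow> mirror e t x = x"
  by (simp add: mirror_def)

lemma dist_sq_mirror:
  assumes "norm e = 1"
  shows "(dist x (mirror e t y))\<^sup>2 = (dist x y)\<^sup>2 + 4 * ((x \<bullet> e - t) * (y \<bullet> e - t))"
proof -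
  have expand: "(norm (d + s *\<^sub>R e))\<^sup>2 = (norm d)\<^sup>2 + 2 * s * (d \<bullet> e) + s\<^sup>2" for d s
    using dot_norm[of d "s *\<^sub>R e"] assms by simp
  have "x - mirror e t y = (x - y) + (2 * (y \<bullet> e - t)) *\<^sub>R e" by (simp add: mirror_def)
  then have "(dist x (mirror e t y))\<^sup>2 = (norm ((x - y) + (2 * (y \<bullet> e - t)) *\<^sub>R e))\<^sup>2" by (simp only: dist_norm)
  also have "\<dots> = (dist x y)\<^sup>2 + 4 * ((x \<bullet> e - t) * (y \<bullet> e - t))"
    unfolding expand inner_diff_left dist_norm by (simp add: power2_eq_square algebra_simps)
  finally show ?thesis .
qed

lemma dist_mirror_mirror:
  assumes "norm e = 1" shows "dist (mirror e t x) (mirror e t y) = dist x y"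
proof -
  have "(dist (mirror e t x) (mirror e t y))\<^sup>2 = (dist x y)\<^sup>2"
    using dist_sq_mirror[OF assms, of "mirror e t x" t y] dist_sq_mirror[OF assms, of y t x]
    by (simp add: dist_commute mirror_inner[OF assms] algebra_simps)
  then show ?thesis by (simp add: power2_eq_iff_nonneg)
qed

lemma dist_mirror_commute: "norm e = 1 \<Longrightarrow> dist (mirror e t x) y = dist x (mirror e t y)"
  using dist_mirror_mirror[of e t "mirror e t x" y] by (simp add: mirror_mirror)

lemma mirror_measurable [measurable]: "mirror e t \<in> borel_measurable borel" for e :: "'a::euclidean_space"
  unfolding mirror_def[abs_def] by measurable

lemma polarise_measurable [measurable]:
  fixes v :: "'a::euclidean_space \<Rightarrow> real"
  assumes [measurable]: "v \<in> borel_measurable borel" shows "polarise e t v \<in> borel_measurable borel"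
  unfolding polarise_def[abs_def] by measurable

lemma lborel_preserving_mirror:
  fixes e :: "real ^ 'n::{finite,wellorder}"
  assumes "norm e = 1" shows "lborel_preserving (mirror e t)"
proof -
  have "orthogonal_transformation (mirror e 0)"
    unfolding orthogonal_transformation_isometry
    using dist_mirror_mirror[OF assms, of 0] by (simp add: mirror_def[of e 0 0])
  from lborel_preserving_compose[OF lborel_preserving_add[of "(2 * t) *\<^sub>R e"] lborel_preserving_orthogonal[OF this]]
  have "lborel_preserving (\<lambda>x. mirror e 0 x + (2 * t) *\<^sub>R e)" .
  moreover have "mirror e 0 x + (2 * t) *\<^sub>R e = mirror e t x" for x by (simp add: mirror_def algebra_simps)
  ultimately show ?thesis by simp
qed

lemma polarise_mirror:
  assumes "norm e = 1"
  shows "polarise e t v (mirror e t x)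
      = (if x \<bullet> e < t then min (v x) (v (mirror e t x)) else max (v x) (v (mirror e t x)))"
proof -
  consider "x \<bullet> e < t" | "x \<bullet> e = t" | "t < x \<bullet> e" by linarith
  then show ?thesis
    by cases (simp_all add: polarise_def mirror_boundary mirror_inner[OF assms] mirror_mirror[OF assms]
        max.commute min.commute)
qed

lemma polarise_sum:
  fixes g :: "real \<Rightarrow> 'b::ab_semigroup_add"
  assumes "norm e = 1"
  shows "g (polarise e t v x) + g (polarise e t v (mirror e t x)) = g (v x) + g (v (mirror e t x))"
  unfolding polarise_mirror[OF assms] by (auto simp: polarise_def max_def min_def add.commute)

lemma max_min_product_diff:
  fixes a a' b b' :: real
  shows "max a a' * max b b' + min a a' * min b b' - (a * b + a' * b') = max 0 (- ((a - a') * (b - b')))"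
    and "max a a' * min b b' + min a a' * max b b' - (a * b + a' * b') = - max 0 ((a - a') * (b - b'))"
proof -
  have nonneg: "0 \<le> (a - a') * (b - b')" if "(a' \<le> a \<and> b' \<le> b) \<or> (a \<le> a' \<and> b \<le> b')"
    using that by (auto intro: mult_nonneg_nonneg mult_nonpos_nonpos)
  have nonpos: "(a - a') * (b - b') \<le> 0" if "(a' \<le> a \<and> b \<le> b') \<or> (a \<le> a' \<and> b' \<le> b)"
    using that by (auto intro: mult_nonneg_nonpos mult_nonpos_nonneg)
  consider "a' \<le> a" "b' \<le> b" | "a' \<le> a" "b \<le> b'" | "a \<le> a'" "b' \<le> b" | "a \<le> a'" "b \<le> b'" by linarith
  then have "max a a' * max b b' + min a a' * min b b' - (a * b + a' * b') = max 0 (- ((a - a') * (b - b'))) \<and>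
    max a a' * min b b' + min a a' * max b b' - (a * b + a' * b') = - max 0 ((a - a') * (b - b'))"
    by cases (use nonneg nonpos in \<open>auto simp: max_absorb1 max_absorb2 min_absorb1 min_absorb2 algebra_simps\<close>)
  then show "max a a' * max b b' + min a a' * min b b' - (a * b + a' * b') = max 0 (- ((a - a') * (b - b')))"
    "max a a' * min b b' + min a a' * max b b' - (a * b + a' * b') = - max 0 ((a - a') * (b - b'))"
    by simp_all
qed

definition polarisation_gain :: "'a::real_inner \<Rightarrow> real \<Rightarrow> ('a \<Rightarrow> real) \<Rightarrow> 'a \<Rightarrow> 'a \<Rightarrow> real" where
  "polarisation_gain e t f x y =
    polarise e t f x * polarise e t f y + polarise e t f (mirror e t x) * polarise e t f (mirror e t y)
     - (f x * f y + f (mirror e t x) * f (mirror e t y))"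

lemma polarisation_gain_eq:
  assumes "norm e = 1"
  shows "polarisation_gain e t f x y =
    (if (x \<bullet> e < t) = (y \<bullet> e < t) then max 0 (- ((f x - f (mirror e t x)) * (f y - f (mirror e t y))))
     else - max 0 ((f x - f (mirror e t x)) * (f y - f (mirror e t y))))"
  using max_min_product_diff[of "f x" "f (mirror e t x)" "f y" "f (mirror e t y)"]
  unfolding polarisation_gain_def polarise_mirror[OF assms]
  by (cases "x \<bullet> e < t"; cases "y \<bullet> e < t") (simp_all add: polarise_def add.commute)

lemma polarisation_gain_cross:
  assumes "norm e = 1"
  shows "polarise e t f x * polarise e t f (mirror e t y) + polarise e t f (mirror e t x) * polarise e t f y
     - (f x * f (mirror e t y) + f (mirror e t x) * f y) = - polarisation_gain e t f x y"
proof -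
  have "(polarise e t f x + polarise e t f (mirror e t x)) * (polarise e t f y + polarise e t f (mirror e t y))
     = (f x + f (mirror e t x)) * (f y + f (mirror e t y))"
    using polarise_sum[OF assms, of "\<lambda>r. r"] by simp
  then show ?thesis by (simp add: polarisation_gain_def algebra_simps)
qed

lemma dist_le_dist_mirror:
  assumes "norm e = 1" "(x \<bullet> e < t) = (y \<bullet> e < t)" shows "dist x y \<le> dist x (mirror e t y)"
proof (rule power2_le_imp_le)
  have "0 \<le> (x \<bullet> e - t) * (y \<bullet> e - t)"
    using assms(2) by (cases "x \<bullet> e < t") (auto intro: mult_nonpos_nonpos mult_nonneg_nonneg)
  then show "(dist x y)\<^sup>2 \<le> (dist x (mirror e t y))\<^sup>2" unfolding dist_sq_mirror[OF assms(1)] by linarith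
qed simp

lemma dist_mirror_le_dist:
  assumes "norm e = 1" "(x \<bullet> e < t) \<noteq> (y \<bullet> e < t)" shows "dist x (mirror e t y) \<le> dist x y"
proof (rule power2_le_imp_le)
  have "(x \<bullet> e - t) * (y \<bullet> e - t) \<le> 0"
    using assms(2) by (cases "x \<bullet> e < t") (auto intro: mult_nonpos_nonneg mult_nonneg_nonpos)
  then show "(dist x (mirror e t y))\<^sup>2 \<le> (dist x y)\<^sup>2" unfolding dist_sq_mirror[OF assms(1)] by linarith
qed simp

lemma polarisation_gain_sign:
  assumes unit: "norm e = 1" and mono: "mono_on {dist x y, dist x (mirror e t y)} \<kappa>"
  shows "0 \<le> (\<kappa> (dist x (mirror e t y)) - \<kappa> (dist x y)) * polarisation_gain e t f x y"
proof (cases "(x \<bullet> e < t) = (y \<bullet> e < t)")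
  case True
  then have "\<kappa> (dist x y) \<le> \<kappa> (dist x (mirror e t y))"
    using mono_onD[OF mono _ _ dist_le_dist_mirror[OF unit]] by simp
  then show ?thesis using True by (simp add: polarisation_gain_eq[OF unit])
next
  case False
  then have "\<kappa> (dist x (mirror e t y)) \<le> \<kappa> (dist x y)"
    using mono_onD[OF mono _ _ dist_mirror_le_dist[OF unit]] by simp
  then show ?thesis using False by (auto simp: polarisation_gain_eq[OF unit] intro: mult_nonpos_nonneg)
qed

definition mirror_sum :: "'a::real_inner \<Rightarrow> real \<Rightarrow> ('a \<times> 'a \<Rightarrow> 'b::plus) \<Rightarrow> 'a \<times> 'a \<Rightarrow> 'b" where
  "mirror_sum e t g p = g (fst p, snd p) + g (mirror e t (fst p), mirror e t (snd p))
    + (g (fst p, mirror e t (snd p)) + g (mirror e t (fst p), snd p))"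

lemma nn_integral_mirror_sum:
  fixes e :: "real ^ 'n::{finite,wellorder}" and g :: "_ \<Rightarrow> ennreal"
  assumes unit: "norm e = 1" and [measurable]: "g \<in> borel_measurable (borel \<Otimes>\<^sub>M borel)"
  shows "(\<integral>\<^sup>+p. mirror_sum e t g p \<partial>(lborel \<Otimes>\<^sub>M lborel)) = 4 * (\<integral>\<^sup>+p. g p \<partial>(lborel \<Otimes>\<^sub>M lborel))"
proof -
  note r = lborel_preserving_mirror[OF unit, of t]
  let ?I = "\<integral>\<^sup>+p. g p \<partial>(lborel \<Otimes>\<^sub>M lborel)"
  have "(\<integral>\<^sup>+p. mirror_sum e t g p \<partial>(lborel \<Otimes>\<^sub>M lborel)) = (?I + ?I) + (?I + ?I)"
    using lborel_preserving_pair_nn_integral[OF r r, of g]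
      lborel_preserving_pair_nn_integral[OF lborel_preserving_id r, of g]
      lborel_preserving_pair_nn_integral[OF r lborel_preserving_id, of g]
    by (simp add: mirror_sum_def nn_integral_add)
  also have "\<dots> = 4 * ?I" by (simp flip: mult_2 add: mult.assoc[symmetric])
  finally show ?thesis .
qed

lemma integral_mirror_sum:
  fixes e :: "real ^ 'n::{finite,wellorder}" and g :: "_ \<Rightarrow> real"
  assumes unit: "norm e = 1" and g: "g \<in> borel_measurable (borel \<Otimes>\<^sub>M borel)" "integrable (lborel \<Otimes>\<^sub>M lborel) g"
  shows "integrable (lborel \<Otimes>\<^sub>M lborel) (mirror_sum e t g)"
    and "(\<integral>p. mirror_sum e t g p \<partial>(lborel \<Otimes>\<^sub>M lborel)) = 4 * (\<integral>p. g p \<partial>(lborel \<Otimes>\<^sub>M lborel))"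
proof -
  note r = lborel_preserving_mirror[OF unit, of t]
  note invariant = lborel_preserving_pair_integral[OF r r g(1)]
    lborel_preserving_pair_integral[OF lborel_preserving_id r g(1)]
    lborel_preserving_pair_integral[OF r lborel_preserving_id g(1)]
  show "integrable (lborel \<Otimes>\<^sub>M lborel) (mirror_sum e t g)"
    unfolding mirror_sum_def[abs_def] by (intro Bochner_Integration.integrable_add) (simp_all add: invariant g)
  show "(\<integral>p. mirror_sum e t g p \<partial>(lborel \<Otimes>\<^sub>M lborel)) = 4 * (\<integral>p. g p \<partial>(lborel \<Otimes>\<^sub>M lborel))"
    by (simp add: mirror_sum_def invariant g)
qed

lemma mirror_sum_radial:
  fixes \<kappa> :: "real \<Rightarrow> real"
  assumes "norm e = 1"
  shows "mirror_sum e t (\<lambda>p. \<kappa> (dist (fst p) (snd p)) * q (fst p) (snd p)) (x, y)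
    = \<kappa> (dist x y) * (q x y + q (mirror e t x) (mirror e t y))
      + \<kappa> (dist x (mirror e t y)) * (q x (mirror e t y) + q (mirror e t x) y)"
  by (simp add: mirror_sum_def dist_mirror_mirror[OF assms] dist_mirror_commute[OF assms] mirror_mirror[OF assms]
    distrib_left)

lemma difference_energy_polarise_le:
  fixes e :: "real ^ 'n::{finite,wellorder}" and v :: "real ^ 'n::_ \<Rightarrow> real"
  assumes unit: "norm e = 1" and [measurable]: "v \<in> borel_measurable borel"
  shows "difference_energy \<epsilon> (polarise e t v) \<le> difference_energy \<epsilon> v"
proof -
  let ?k = "indicator {..<\<epsilon>} :: real \<Rightarrow> real" and ?p = "polarise e t v" and ?r = "mirror e t"
  let ?g = "\<lambda>u p. ?k (dist (fst p) (snd p)) * (u (fst p) - u (snd p))\<^sup>2 :: real"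
  have energy: "4 * difference_energy \<epsilon> u = (\<integral>\<^sup>+p. ennreal (mirror_sum e t (?g u) p) \<partial>(lborel \<Otimes>\<^sub>M lborel))"
    if [measurable]: "u \<in> borel_measurable borel" for u
  proof -
    have "difference_energy \<epsilon> u = (\<integral>\<^sup>+p. ennreal (?g u p) \<partial>(lborel \<Otimes>\<^sub>M lborel))"
      unfolding difference_energy_eq_pair_integral[OF that]
      by (intro nn_integral_cong) (auto simp: indicator_def dist_norm norm_minus_commute)
    moreover have "ennreal (mirror_sum e t (?g u) p) = mirror_sum e t (\<lambda>p. ennreal (?g u p)) p" for p
      by (simp add: mirror_sum_def)
    ultimately show ?thesis using nn_integral_mirror_sum[OF unit, of "\<lambda>p. ennreal (?g u p)" t] by simp
  qed
  have "mirror_sum e t (?g ?p) (x, y) \<le> mirror_sum e t (?g v) (x, y)" for x y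
  proof -
    let ?G = "polarisation_gain e t v x y"
    have squares: "(?p x)\<^sup>2 + (?p (?r x))\<^sup>2 = (v x)\<^sup>2 + (v (?r x))\<^sup>2" for x
      using polarise_sum[OF unit, of "\<lambda>r. r\<^sup>2"] .
    have same: "(?p x - ?p y)\<^sup>2 + (?p (?r x) - ?p (?r y))\<^sup>2 = (v x - v y)\<^sup>2 + (v (?r x) - v (?r y))\<^sup>2 - 2 * ?G"
      using squares[of x] squares[of y] by (simp add: polarisation_gain_def power2_diff algebra_simps)
    have cross: "(?p x - ?p (?r y))\<^sup>2 + (?p (?r x) - ?p y)\<^sup>2 = (v x - v (?r y))\<^sup>2 + (v (?r x) - v y)\<^sup>2 + 2 * ?G"
      using squares[of x] squares[of y] polarisation_gain_cross[OF unit, of t v x y]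
      by (simp add: power2_diff algebra_simps)
    have "mono_on {dist x y, dist x (?r y)} (\<lambda>s. - ?k s)" by (auto simp: mono_on_def indicator_def)
    from polarisation_gain_sign[OF unit this, of v] have gain: "0 \<le> (?k (dist x y) - ?k (dist x (?r y))) * ?G"
      by (simp add: algebra_simps)
    show ?thesis
      unfolding mirror_sum_radial[OF unit, of t ?k "\<lambda>x y. (?p x - ?p y)\<^sup>2"] same cross
        mirror_sum_radial[OF unit, of t ?k "\<lambda>x y. (v x - v y)\<^sup>2"]
      using gain by (simp add: algebra_simps)
  qed
  then have "mirror_sum e t (?g ?p) p \<le> mirror_sum e t (?g v) p" for p by (cases p) simp
  then have "4 * difference_energy \<epsilon> ?p \<le> 4 * difference_energy \<epsilon> v"
    by (simp add: energy nn_integral_mono ennreal_leI)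
  then show ?thesis by (subst (asm) ennreal_mult_le_mult_iff) auto
qed

lemma polarise_nonneg: "(\<And>x. 0 \<le> v x) \<Longrightarrow> 0 \<le> polarise e t v x"
  by (auto simp: polarise_def intro: max.coboundedI1)

lemma polarise_square:
  assumes "\<And>x. 0 \<le> v x" shows "(polarise e t v x)\<^sup>2 = polarise e t (\<lambda>x. (v x)\<^sup>2) x"
  using assms[of x] assms[of "mirror e t x"]
  by (auto simp: polarise_def max_def min_def abs_le_square_iff[symmetric] intro: power_mono)

lemma polarise_square_le: "(polarise e t v x)\<^sup>2 \<le> (v x)\<^sup>2 + (v (mirror e t x))\<^sup>2"
  by (auto simp: polarise_def max_def min_def)

lemma L2_mirror:
  fixes e :: "real ^ 'n::{finite,wellorder}" and v :: "real ^ 'n::_ \<Rightarrow> real"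
  assumes "norm e = 1" "L2 lborel v"
  shows "L2 lborel (\<lambda>x. v (mirror e t x))" "sqnorm lborel (\<lambda>x. v (mirror e t x)) = sqnorm lborel v"
  using lborel_preserving_integral[OF lborel_preserving_mirror[OF assms(1), of t], of "\<lambda>x. (v x)\<^sup>2"] assms(2)
  by (auto simp: L2_def sqnorm_def)

lemma polarise_L2:
  fixes e :: "real ^ 'n::{finite,wellorder}"
  assumes unit: "norm e = 1" and v: "L2 lborel v"
  shows "L2 lborel (polarise e t v)" "sqnorm lborel (polarise e t v) = sqnorm lborel v"
proof -
  note [measurable] = L2_measurable[OF v, simplified]
  let ?p = "polarise e t v" and ?r = "mirror e t"
  have "integrable lborel (\<lambda>x. (v x)\<^sup>2 + (v (?r x))\<^sup>2)"
    using L2_integrable[OF v] L2_integrable[OF L2_mirror(1)[OF unit v]] by simp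
  then have "integrable lborel (\<lambda>x. (?p x)\<^sup>2)"
    by (rule Bochner_Integration.integrable_bound) (use polarise_square_le in \<open>auto intro!: AE_I2\<close>)
  then show p: "L2 lborel ?p" by (simp add: L2_def)
  have "sqnorm lborel ?p + sqnorm lborel ?p = (\<integral>x. (?p x)\<^sup>2 + (?p (?r x))\<^sup>2 \<partial>lborel)"
    using L2_integrable[OF p] L2_integrable[OF L2_mirror(1)[OF unit p]] L2_mirror(2)[OF unit p, of t]
    by (simp add: sqnorm_def)
  also have "\<dots> = (\<integral>x. (v x)\<^sup>2 + (v (?r x))\<^sup>2 \<partial>lborel)" using polarise_sum[OF unit, of "\<lambda>r. r\<^sup>2"] by simp
  also have "\<dots> = sqnorm lborel v + sqnorm lborel v"
    using L2_integrable[OF v] L2_integrable[OF L2_mirror(1)[OF unit v]] L2_mirror(2)[OF unit v, of t]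
    by (simp add: sqnorm_def)
  finally show "sqnorm lborel ?p = sqnorm lborel v" by simp
qed

lemma edirichlet_mono:
  assumes "L2 lborel v" "\<And>\<epsilon>. \<epsilon> > 0 \<Longrightarrow> difference_energy \<epsilon> u \<le> difference_energy \<epsilon> v"
  shows "edirichlet u \<le> edirichlet v"
  unfolding edirichlet_def difference_quotient_energy_def
  by (intro Liminf_mono always_eventually allI divide_right_mono_ennreal assms) simp

lemma polarise_admissible:
  assumes v: "admissible v" and unit: "norm e = 1"
  shows "admissible (polarise e t v)" "rdirichlet (polarise e t v) \<le> rdirichlet v"
proof -
  note [measurable] = admissibleD(3)[OF v]
  let ?p = "polarise e t v" and ?r = "mirror e t"
  have dirichlet_le: "edirichlet ?p \<le> edirichlet v"
    by (intro edirichlet_mono difference_energy_polarise_le admissibleD[OF v] unit)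
  then show "rdirichlet ?p \<le> rdirichlet v"
    using admissibleD(1)[OF v] by (auto simp: rdirichlet_def H1_def intro: enn2real_mono)
  have "norm (?r x) \<le> norm x + norm (?r 0)" for x
    using norm_triangle_ineq[of "?r x - ?r 0" "?r 0"] dist_mirror_mirror[OF unit, of t x 0] by (simp add: dist_norm)
  then have "integrable lborel (\<lambda>x. ln (1 + norm (?r x)) * (v x)\<^sup>2)"
    by (intro log_weight_integrable[where b="norm (?r 0)"] v) auto
  then have "integrable lborel (\<lambda>x. ln (1 + norm x) * (v (?r x))\<^sup>2)"
    using lborel_preserving_integral(2)[OF lborel_preserving_mirror[OF unit, of t],
        of "\<lambda>x. ln (1 + norm (?r x)) * (v x)\<^sup>2"]
    by (simp add: mirror_mirror[OF unit])
  with admissibleD(5)[OF v]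
  have "integrable lborel (\<lambda>x. ln (1 + norm x) * (v x)\<^sup>2 + ln (1 + norm x) * (v (?r x))\<^sup>2)"
    by (rule Bochner_Integration.integrable_add)
  then have "integrable lborel (\<lambda>x. ln (1 + norm x) * (?p x)\<^sup>2)"
  proof (rule Bochner_Integration.integrable_bound)
    show "AE x in lborel. norm (ln (1 + norm x) * (?p x)\<^sup>2)
        \<le> norm (ln (1 + norm x) * (v x)\<^sup>2 + ln (1 + norm x) * (v (?r x))\<^sup>2)"
      using mult_left_mono[OF polarise_square_le, of "ln (1 + norm _)"] by (intro AE_I2) (simp add: distrib_left)
  qed measurable
  with polarise_L2(1)[OF unit admissibleD(2)[OF v]] dirichlet_le admissibleD(1)[OF v]
    polarise_nonneg[OF admissibleD(4)[OF v]]
  show "admissible ?p" by (auto simp: admissible_def H1_def)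
qed

lemma AE_pair_neq_mirror:
  fixes e :: "'a::euclidean_space"
  assumes unit: "norm e = 1"
  shows "AE p in lborel \<Otimes>\<^sub>M lborel. fst p \<noteq> snd p \<and> fst p \<noteq> mirror e t (snd p)"
proof -
  have "AE y in lborel. x \<noteq> y \<and> x \<noteq> mirror e t y" for x
    using AE_lborel_singleton[of x] AE_lborel_singleton[of "mirror e t x"]
    by eventually_elim (use mirror_mirror[OF unit] in auto)
  moreover have "{p \<in> space (lborel \<Otimes>\<^sub>M lborel). 0 < dist (fst p) (snd p) \<and> 0 < dist (fst p) (mirror e t (snd p))}
      \<in> sets ((lborel :: 'a measure) \<Otimes>\<^sub>M lborel)"
    by measurable
  ultimately show ?thesis
    using lborel_pair.AE_pair_iff[of "\<lambda>x y. x \<noteq> y \<and> x \<noteq> mirror e t y"] by (simp add: case_prod_unfold)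
qed

definition polarisation_defect :: "'a::real_inner \<Rightarrow> real \<Rightarrow> ('a \<Rightarrow> real) \<Rightarrow> 'a \<times> 'a \<Rightarrow> real" where
  "polarisation_defect e t v p = (ln (dist (fst p) (mirror e t (snd p))) - ln (dist (fst p) (snd p)))
    * polarisation_gain e t (\<lambda>x. (v x)\<^sup>2) (fst p) (snd p)"

lemma mirror_sum_interaction_density_diff:
  assumes unit: "norm e = 1" and v: "\<And>x. 0 \<le> v x"
  shows "mirror_sum e t (interaction_density ln v) p - mirror_sum e t (interaction_density ln (polarise e t v)) p
    = polarisation_defect e t v p"
proof -
  obtain x y where p: "p = (x, y)" by (cases p)
  let ?f = "\<lambda>x. (v x)\<^sup>2" and ?r = "mirror e t"
  let ?P = "polarise e t ?f" and ?G = "polarisation_gain e t ?f x y"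
  have radial: "mirror_sum e t (interaction_density ln u) (x, y)
      = ln (dist x y) * ((u x)\<^sup>2 * (u y)\<^sup>2 + (u (mirror e t x))\<^sup>2 * (u (mirror e t y))\<^sup>2)
        + ln (dist x (mirror e t y)) * ((u x)\<^sup>2 * (u (mirror e t y))\<^sup>2 + (u (mirror e t x))\<^sup>2 * (u y)\<^sup>2)" for u
    using mirror_sum_radial[OF unit, of t ln "\<lambda>x y. (u x)\<^sup>2 * (u y)\<^sup>2" x y]
    by (simp add: interaction_density_def[abs_def] mult.assoc)
  have same: "?P x * ?P y + ?P (?r x) * ?P (?r y) = ?f x * ?f y + ?f (?r x) * ?f (?r y) + ?G"
    by (simp add: polarisation_gain_def)
  have cross: "?P x * ?P (?r y) + ?P (?r x) * ?P y = ?f x * ?f (?r y) + ?f (?r x) * ?f y - ?G"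
    using polarisation_gain_cross[OF unit, of t ?f x y] by linarith
  show ?thesis
    unfolding p radial polarise_square[OF v] same cross polarisation_defect_def by (simp add: algebra_simps)
qed

lemma AE_polarisation_defect_nonneg:
  fixes e :: "'a::euclidean_space"
  assumes unit: "norm e = 1" shows "AE p in lborel \<Otimes>\<^sub>M lborel. 0 \<le> polarisation_defect e t v p"
  using AE_pair_neq_mirror[OF unit, of t]
proof eventually_elim
  case (elim p)
  then have "mono_on {dist (fst p) (snd p), dist (fst p) (mirror e t (snd p))} ln"
    by (auto simp: mono_on_def)
  then show ?case unfolding polarisation_defect_def by (rule polarisation_gain_sign[OF unit])
qed

lemma polarisation_defect_integral:
  assumes v: "admissible v" and unit: "norm e = 1"
  shows "integrable (lborel \<Otimes>\<^sub>M lborel) (polarisation_defect e t v)"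
    and "(\<integral>p. polarisation_defect e t v p \<partial>(lborel \<Otimes>\<^sub>M lborel))
        = 4 * interaction ln v - 4 * interaction ln (polarise e t v)"
proof -
  let ?p = "polarise e t v"
  note [measurable] = admissibleD(3)[OF v]
  note int = interaction_density_integrable[OF v log_bounded_ln]
    interaction_density_integrable[OF polarise_admissible(1)[OF v unit] log_bounded_ln]
  have meas: "interaction_density ln v \<in> borel_measurable (borel \<Otimes>\<^sub>M borel)"
    "interaction_density ln ?p \<in> borel_measurable (borel \<Otimes>\<^sub>M borel)" by measurable
  note sum_v = integral_mirror_sum[OF unit meas(1) int(1), of t]
    and sum_p = integral_mirror_sum[OF unit meas(2) int(2), of t]
  have defect: "polarisation_defect e t v
      = (\<lambda>p. mirror_sum e t (interaction_density ln v) p - mirror_sum e t (interaction_density ln ?p) p)"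
    using mirror_sum_interaction_density_diff[OF unit admissibleD(4)[OF v]] by auto
  show "integrable (lborel \<Otimes>\<^sub>M lborel) (polarisation_defect e t v)"
    unfolding defect by (intro Bochner_Integration.integrable_diff sum_v sum_p)
  show "(\<integral>p. polarisation_defect e t v p \<partial>(lborel \<Otimes>\<^sub>M lborel)) = 4 * interaction ln v - 4 * interaction ln ?p"
    unfolding defect by (simp add: sum_v sum_p interaction_def)
qed

lemma polarisation_defect_pos:
  assumes unit: "norm e = 1" and xy: "x \<bullet> e < t" "y \<bullet> e < t" "x \<noteq> y"
    and neg: "((v x)\<^sup>2 - (v (mirror e t x))\<^sup>2) * ((v y)\<^sup>2 - (v (mirror e t y))\<^sup>2) < 0"
  shows "0 < polarisation_defect e t v (x, y)"
proof -
  have "0 < (x \<bullet> e - t) * (y \<bullet> e - t)" using xy by (intro mult_neg_neg) auto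
  then have "(dist x y)\<^sup>2 < (dist x (mirror e t y))\<^sup>2" using dist_sq_mirror[OF unit, of x t y] by simp
  then have "dist x y < dist x (mirror e t y)" by (rule power2_less_imp_less) simp
  then have "ln (dist x y) < ln (dist x (mirror e t y))"
    using xy(3) by (intro ln_less_cancel_iff[THEN iffD2]) (auto intro: le_less_trans[OF zero_le_dist])
  moreover have "0 < polarisation_gain e t (\<lambda>x. (v x)\<^sup>2) x y"
    using xy neg by (simp add: polarisation_gain_eq[OF unit])
  ultimately show ?thesis by (simp add: polarisation_defect_def)
qed

lemma AE_notin_or_AE_notin:
  fixes P N :: "'a::euclidean_space set"
  assumes [measurable]: "P \<in> sets borel" "N \<in> sets borel" and prod: "AE p in lborel \<Otimes>\<^sub>M lborel. p \<notin> P \<times> N"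
  shows "(AE x in lborel. x \<notin> P) \<or> (AE x in lborel. x \<notin> N)"
proof -
  have "emeasure (lborel \<Otimes>\<^sub>M lborel) (P \<times> N) = 0"
    using prod by (subst (asm) AE_iff_measurable[OF _ refl]) (auto simp: space_pair_measure)
  then have "emeasure lborel P = 0 \<or> emeasure lborel N = 0" by (simp add: lborel.emeasure_pair_measure_Times)
  then show ?thesis by (auto intro!: AE_not_in simp: null_sets_def)
qed

locale ground_state =
  fixes c lam :: real and v :: "real^2 \<Rightarrow> real"
  assumes c_pos: "c > 0" and lam_pos: "lam > 0" and adm: "admissible v" and mass: "sqnorm lborel v = lam"
    and min: "\<And>w. admissible w \<Longrightarrow> sqnorm lborel w = lam \<Longrightarrow> profile_energy c v \<le> profile_energy c w"
begin

lemma AE_polarisation_defect_zero: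
  assumes unit: "norm e = 1" shows "AE p in lborel \<Otimes>\<^sub>M lborel. polarisation_defect e t v p = 0"
proof -
  note p = polarise_admissible[OF adm unit, of t]
  have "profile_energy c v \<le> profile_energy c (polarise e t v)"
    by (rule min[OF p(1)]) (simp add: polarise_L2(2)[OF unit admissibleD(2)[OF adm]] mass)
  then have "c * interaction ln v \<le> c * interaction ln (polarise e t v)" using p(2) by (simp add: profile_energy_def)
  then have "(\<integral>p. polarisation_defect e t v p \<partial>(lborel \<Otimes>\<^sub>M lborel)) \<le> 0"
    using c_pos by (simp add: polarisation_defect_integral(2)[OF adm unit])
  then have "(\<integral>p. polarisation_defect e t v p \<partial>(lborel \<Otimes>\<^sub>M lborel)) = 0"
    using integral_nonneg_AE[OF AE_polarisation_defect_nonneg[OF unit, of t v]] by linarith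
  then show ?thesis
    using integral_nonneg_eq_0_iff_AE[OF polarisation_defect_integral(1)[OF adm unit]
        AE_polarisation_defect_nonneg[OF unit]]
    by blast
qed

theorem polarisation_dichotomy:
  assumes unit: "norm e = 1"
  shows "(AE x in lborel. x \<bullet> e < t \<longrightarrow> v (mirror e t x) \<le> v x) \<or> (AE x in lborel. x \<bullet> e < t \<longrightarrow> v x \<le> v (mirror e t x))"
proof -
  note [measurable] = admissibleD(3)[OF adm]
  have sq_less: "(v x)\<^sup>2 < (v y)\<^sup>2" if "v x < v y" for x y
    using that admissibleD(4)[OF adm] by (intro power_strict_mono) auto
  define P where "P = {x. x \<bullet> e < t \<and> v (mirror e t x) < v x}"
  define N where "N = {x. x \<bullet> e < t \<and> v x < v (mirror e t x)}"
  have "AE p in lborel \<Otimes>\<^sub>M lborel. p \<notin> P \<times> N"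
    using AE_polarisation_defect_zero[OF unit, of t] AE_pair_neq_mirror[OF unit, of t]
  proof eventually_elim
    case (elim p)
    show ?case
    proof
      assume "p \<in> P \<times> N"
      then obtain x y where p: "p = (x, y)" and xy: "x \<in> P" "y \<in> N" by auto
      then have "((v x)\<^sup>2 - (v (mirror e t x))\<^sup>2) * ((v y)\<^sup>2 - (v (mirror e t y))\<^sup>2) < 0"
        by (intro mult_pos_neg) (auto simp: P_def N_def sq_less)
      with polarisation_defect_pos[OF unit, of x t y v] xy elim p show False by (auto simp: P_def N_def)
    qed
  qed
  then have "(AE x in lborel. x \<notin> P) \<or> (AE x in lborel. x \<notin> N)"
    by (intro AE_notin_or_AE_notin) (auto simp: P_def N_def)
  then show ?thesis
  proof
    assume "AE x in lborel. x \<notin> P"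
    then have "AE x in lborel. x \<bullet> e < t \<longrightarrow> v x \<le> v (mirror e t x)"
      by eventually_elim (auto simp: P_def not_less)
    then show ?thesis ..
  next
    assume "AE x in lborel. x \<notin> N"
    then have "AE x in lborel. x \<bullet> e < t \<longrightarrow> v (mirror e t x) \<le> v x"
      by eventually_elim (auto simp: N_def not_less)
    then show ?thesis ..
  qed
qed

end

subsection \<open>Radial symmetry of minimisers\<close>

lemma AE_not_hyperplane:
  fixes e :: "'a::euclidean_space"
  assumes "e \<noteq> 0" shows "AE x in lborel. x \<bullet> e \<noteq> t"
proof -
  have closed: "{x. e \<bullet> x = t} \<in> sets borel" using closed_hyperplane by (rule borel_closed)
  have "negligible {x. e \<bullet> x = t}" using assms by (intro negligible_hyperplane) simp
  then have "{x. e \<bullet> x = t} \<in> null_sets lborel"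
    using closed by (simp add: negligible_iff_null_sets null_sets_def emeasure_completion)
  then show ?thesis by (rule AE_I') (auto simp: inner_commute)
qed

definition half_mass :: "('a::euclidean_space \<Rightarrow> real) \<Rightarrow> 'a \<Rightarrow> real \<Rightarrow> real" where
  "half_mass v e t = (\<integral>x. indicator {x. x \<bullet> e < t} x * (v x)\<^sup>2 \<partial>lborel)"

lemma indicator_square_integrable:
  fixes v :: "'a::euclidean_space \<Rightarrow> real"
  assumes "L2 lborel v" "A \<in> sets borel" shows "integrable lborel (\<lambda>x. indicator A x * (v x)\<^sup>2)"
  using integrable_mult_indicator[OF _ L2_integrable[OF assms(1)], of A] assms(2) by simp

lemma half_mass_mono:
  assumes "L2 lborel v" "s \<le> t" shows "half_mass v e s \<le> half_mass v e t"
  unfolding half_mass_def using assms(2)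
  by (intro integral_mono indicator_square_integrable assms(1) mult_right_mono) (auto simp: indicator_def)

lemma integral_above_half_mass:
  assumes v: "L2 lborel v" and "e \<noteq> 0"
  shows "(\<integral>x. indicator {x. t < x \<bullet> e} x * (v x)\<^sup>2 \<partial>lborel) = sqnorm lborel v - half_mass v e t"
proof -
  note [measurable] = L2_measurable[OF v, simplified]
  have "sqnorm lborel v = (\<integral>x. indicator {x. x \<bullet> e < t} x * (v x)\<^sup>2 + indicator {x. t < x \<bullet> e} x * (v x)\<^sup>2 \<partial>lborel)"
    unfolding sqnorm_def
    by (rule integral_cong_AE; (measurable)?)
      (use AE_not_hyperplane[OF \<open>e \<noteq> 0\<close>, of t] in eventually_elim, auto simp: indicator_def)
  also have "\<dots> = half_mass v e t + (\<integral>x. indicator {x. t < x \<bullet> e} x * (v x)\<^sup>2 \<partial>lborel)"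
    unfolding half_mass_def by (intro Bochner_Integration.integral_add indicator_square_integrable v) measurable
  finally show ?thesis by simp
qed

lemma half_mass_mirror:
  fixes e :: "real ^ 'n::{finite,wellorder}"
  assumes v: "L2 lborel v" and unit: "norm e = 1"
  shows "half_mass (\<lambda>x. v (mirror e t x)) e t = sqnorm lborel v - half_mass v e t"
proof -
  note [measurable] = L2_measurable[OF v, simplified]
  have "half_mass (\<lambda>x. v (mirror e t x)) e t
      = (\<integral>x. indicator {x. t < x \<bullet> e} (mirror e t x) * (v (mirror e t x))\<^sup>2 \<partial>lborel)"
    unfolding half_mass_def by (intro Bochner_Integration.integral_cong) (auto simp: indicator_def mirror_inner[OF unit])
  also have "\<dots> = (\<integral>x. indicator {x. t < x \<bullet> e} x * (v x)\<^sup>2 \<partial>lborel)"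
    by (rule lborel_preserving_integral(1)[OF lborel_preserving_mirror[OF unit]]) measurable
  also have "\<dots> = sqnorm lborel v - half_mass v e t" using unit by (intro integral_above_half_mass v) auto
  finally show ?thesis .
qed

lemma AE_eq_on_half_space:
  assumes u: "L2 lborel u" "\<And>x. 0 \<le> u x" and w: "L2 lborel w" "\<And>x. 0 \<le> w x"
    and dominated: "AE x in lborel. x \<bullet> e < t \<longrightarrow> u x \<le> w x" and mass: "half_mass w e t \<le> half_mass u e t"
  shows "AE x in lborel. x \<bullet> e < t \<longrightarrow> u x = w x"
proof -
  let ?i = "indicator {x. x \<bullet> e < t} :: _ \<Rightarrow> real"
  have int: "integrable lborel (\<lambda>x. ?i x * (u x)\<^sup>2)" "integrable lborel (\<lambda>x. ?i x * (w x)\<^sup>2)"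
    by (intro indicator_square_integrable u w; measurable)+
  have AE_le: "AE x in lborel. ?i x * (u x)\<^sup>2 \<le> ?i x * (w x)\<^sup>2"
    using dominated by eventually_elim (simp add: indicator_def power_mono u(2))
  with mass integral_mono_AE[OF int this] have "(\<integral>x. ?i x * (u x)\<^sup>2 \<partial>lborel) = (\<integral>x. ?i x * (w x)\<^sup>2 \<partial>lborel)"
    by (simp add: half_mass_def)
  from integral_ineq_eq_0_then_AE[OF AE_le int this] show ?thesis
    by eventually_elim (simp add: indicator_def power2_eq_iff_nonneg u(2) w(2))
qed

lemma half_mass_tendsto:
  assumes v: "L2 lborel v" and [measurable]: "i \<in> borel_measurable borel"
    and lim: "AE x in lborel. (\<lambda>n. indicator {x. x \<bullet> e < T n} x :: real) \<longlonglongrightarrow> i x"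
  shows "(\<lambda>n. half_mass v e (T n)) \<longlonglongrightarrow> (\<integral>x. i x * (v x)\<^sup>2 \<partial>lborel)"
  unfolding half_mass_def
proof (rule integral_dominated_convergence)
  note [measurable] = L2_measurable[OF v, simplified]
  show "(\<lambda>x. i x * (v x)\<^sup>2) \<in> borel_measurable lborel" by measurable
  show "(\<lambda>x. indicator {x. x \<bullet> e < T n} x * (v x)\<^sup>2) \<in> borel_measurable lborel" for n by measurable
  show "integrable lborel (\<lambda>x. (v x)\<^sup>2)" using L2_integrable[OF v] by simp
  show "AE x in lborel. (\<lambda>n. indicator {x. x \<bullet> e < T n} x * (v x)\<^sup>2) \<longlonglongrightarrow> i x * (v x)\<^sup>2"
    using lim by eventually_elim (intro tendsto_mult tendsto_const)
  show "AE x in lborel. norm (indicator {x. x \<bullet> e < T n} x * (v x)\<^sup>2) \<le> (v x)\<^sup>2" for n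
    by (auto simp: indicator_def)
qed

lemma half_mass_continuous:
  assumes v: "L2 lborel v" and "e \<noteq> 0" shows "continuous_on UNIV (half_mass v e)"
proof (rule continuous_on_sequentiallyI)
  fix T :: "nat \<Rightarrow> real" and t :: real assume T: "T \<longlonglongrightarrow> t"
  have "(\<lambda>n. half_mass v e (T n)) \<longlonglongrightarrow> (\<integral>x. indicator {x. x \<bullet> e < t} x * (v x)\<^sup>2 \<partial>lborel)"
  proof (rule half_mass_tendsto[OF v])
    show "AE x in lborel. (\<lambda>n. indicator {x. x \<bullet> e < T n} x :: real) \<longlonglongrightarrow> indicator {x. x \<bullet> e < t} x"
      using AE_not_hyperplane[OF \<open>e \<noteq> 0\<close>, of t]
    proof eventually_elim
      case (elim x)
      then consider (below) "x \<bullet> e < t" | (above) "t < x \<bullet> e" by linarith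
      then have "\<forall>\<^sub>F n in sequentially. x \<bullet> e < T n \<longleftrightarrow> x \<bullet> e < t"
      proof cases
        case below
        with order_tendstoD(1)[OF T below] show ?thesis by (simp add: eventually_mono)
      next
        case above
        from order_tendstoD(2)[OF T above] show ?thesis by eventually_elim (use above in auto)
      qed
      then show ?case by (intro tendsto_eventually) (auto simp: indicator_def elim: eventually_mono)
    qed
  qed measurable
  then show "(\<lambda>n. half_mass v e (T n)) \<longlonglongrightarrow> half_mass v e t" by (simp add: half_mass_def)
qed

lemma half_mass_at_infinity:
  assumes v: "L2 lborel v"
  shows "(\<lambda>n. half_mass v e (- real n)) \<longlonglongrightarrow> 0" and "(\<lambda>n. half_mass v e (real n)) \<longlonglongrightarrow> sqnorm lborel v"
proof -
  have "(\<lambda>n. half_mass v e (- real n)) \<longlonglongrightarrow> (\<integral>x. 0 * (v x)\<^sup>2 \<partial>lborel)"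
  proof (rule half_mass_tendsto[OF v], simp, intro AE_I2 tendsto_eventually)
    fix x
    obtain N :: nat where "- (x \<bullet> e) < N" using reals_Archimedean2 by blast
    then show "\<forall>\<^sub>F n in sequentially. indicator {x. x \<bullet> e < - real n} x = (0::real)"
      by (intro eventually_sequentiallyI[of N]) (auto simp: indicator_def)
  qed
  then show "(\<lambda>n. half_mass v e (- real n)) \<longlonglongrightarrow> 0" by simp
  have "(\<lambda>n. half_mass v e (real n)) \<longlonglongrightarrow> (\<integral>x. 1 * (v x)\<^sup>2 \<partial>lborel)"
  proof (rule half_mass_tendsto[OF v], simp, intro AE_I2 tendsto_eventually)
    fix x
    obtain N :: nat where "x \<bullet> e < N" using reals_Archimedean2 by blast
    then show "\<forall>\<^sub>F n in sequentially. indicator {x. x \<bullet> e < real n} x = (1::real)"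
      by (intro eventually_sequentiallyI[of N]) (auto simp: indicator_def)
  qed
  then show "(\<lambda>n. half_mass v e (real n)) \<longlonglongrightarrow> sqnorm lborel v" by (simp add: sqnorm_def)
qed

lemma bisecting_hyperplane_exists:
  assumes v: "L2 lborel v" and pos: "sqnorm lborel v > 0" and "e \<noteq> 0"
  obtains t where "2 * half_mass v e t = sqnorm lborel v"
proof -
  let ?h = "sqnorm lborel v / 2"
  have "\<forall>\<^sub>F n in sequentially. half_mass v e (- real n) < ?h"
    using pos by (intro order_tendstoD(2)[OF half_mass_at_infinity(1)[OF v]]) simp
  then obtain m where m: "half_mass v e (- real m) < ?h" by (auto simp: eventually_sequentially)
  have "\<forall>\<^sub>F n in sequentially. ?h < half_mass v e (real n)"
    using pos by (intro order_tendstoD(1)[OF half_mass_at_infinity(2)[OF v]]) simp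
  then obtain n where n: "?h < half_mass v e (real n)" by (auto simp: eventually_sequentially)
  have "- real m \<le> real n" by simp
  from IVT'[of "half_mass v e" "- real m" ?h "real n", OF _ _ this
      continuous_on_subset[OF half_mass_continuous[OF v \<open>e \<noteq> 0\<close>]]] m n
  obtain t where "half_mass v e t = ?h" by auto
  then show ?thesis by (intro that[of t]) simp
qed

context ground_state
begin

lemma dominates_mirror_image:
  assumes unit: "norm e = 1" and half: "lam \<le> 2 * half_mass v e t"
  shows "AE x in lborel. x \<bullet> e < t \<longrightarrow> v (mirror e t x) \<le> v x"
  using polarisation_dichotomy[OF unit, of t]
proof
  assume dominated: "AE x in lborel. x \<bullet> e < t \<longrightarrow> v x \<le> v (mirror e t x)"
  have "half_mass (\<lambda>x. v (mirror e t x)) e t \<le> half_mass v e t"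
    using half by (simp add: half_mass_mirror[OF admissibleD(2)[OF adm] unit] mass)
  from AE_eq_on_half_space[OF _ _ _ _ dominated this] show ?thesis
    by (auto simp: admissibleD[OF adm] L2_mirror[OF unit] elim: eventually_mono)
qed

lemma AE_mirror_symmetric:
  assumes unit: "norm e = 1" and half: "2 * half_mass v e t = lam"
  shows "AE x in lborel. v (mirror e t x) = v x"
proof -
  have "half_mass v e t \<le> half_mass (\<lambda>x. v (mirror e t x)) e t"
    using half by (simp add: half_mass_mirror[OF admissibleD(2)[OF adm] unit] mass)
  from AE_eq_on_half_space[OF _ _ _ _ dominates_mirror_image[OF unit] this] half
  have below: "AE x in lborel. x \<bullet> e < t \<longrightarrow> v (mirror e t x) = v x"
    by (simp add: admissibleD[OF adm] L2_mirror[OF unit])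
  show ?thesis
    using below lborel_preserving_AE[OF lborel_preserving_mirror[OF unit, of t] below]
  proof eventually_elim
    case (elim x)
    consider "x \<bullet> e < t" | "x \<bullet> e = t" | "t < x \<bullet> e" by linarith
    then show ?case using elim by cases (auto simp: mirror_boundary mirror_inner[OF unit] mirror_mirror[OF unit])
  qed
qed

lemma symmetric_about_point: "\<exists>p. AE x in lborel. v (p - x) = v (p + x)"
proof -
  let ?b = "\<lambda>i::2. axis i 1 :: real^2"
  have "\<exists>t. 2 * half_mass v (?b i) t = lam" for i
    using bisecting_hyperplane_exists[OF admissibleD(2)[OF adm], of "?b i"] mass lam_pos by (auto simp: axis_eq_0_iff)
  then obtain t where t: "\<And>i. 2 * half_mass v (?b i) (t i) = lam" by metis
  have sym: "AE x in lborel. v (mirror (?b i) (t i) x) = v x" for i by (rule AE_mirror_symmetric[OF _ t]) simp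
  let ?p = "\<chi> i. t i"
  have "AE y in lborel. v (mirror (?b 1) (t 1) (mirror (?b 2) (t 2) y)) = v y"
    using sym[of 2] lborel_preserving_AE[OF lborel_preserving_mirror sym[of 1], of "?b 2" "t 2"] by auto
  from lborel_preserving_AE[OF lborel_preserving_add_left this, of ?p]
  have "AE x in lborel. v (mirror (?b 1) (t 1) (mirror (?b 2) (t 2) (?p + x))) = v (?p + x)" .
  moreover have "axis (1::2) (1::real) $ 1 = 1" "axis (1::2) (1::real) $ 2 = 0"
    "axis (2::2) (1::real) $ 1 = 0" "axis (2::2) (1::real) $ 2 = 1"
    by (simp_all add: axis_def)
  then have "mirror (?b 1) (t 1) (mirror (?b 2) (t 2) (?p + x)) = ?p - x" for x
    by (simp add: vec_eq_iff forall_2 mirror_def inner_axis)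
  ultimately show ?thesis by auto
qed

lemma ground_state_shift: "ground_state c lam (\<lambda>x. v (x + p))"
  using c_pos lam_pos admissible_shift[OF adm] sqnorm_shift[OF admissibleD(3)[OF adm]] mass min
    profile_energy_shift[OF admissibleD(3)[OF adm]]
  by unfold_locales auto

lemma even_dominates_mirror_image:
  assumes even: "AE x in lborel. v (- x) = v x" and unit: "norm e = 1" and t_nonneg: "t \<ge> 0"
  shows "AE x in lborel. x \<bullet> e < t \<longrightarrow> v (mirror e t x) \<le> v x"
proof (rule dominates_mirror_image[OF unit])
  note L2 = admissibleD(2)[OF adm] and [measurable] = admissibleD(3)[OF adm]
  have "half_mass v e 0 = (\<integral>x. indicator {x. x \<bullet> e < 0} (- x) * (v (- x))\<^sup>2 \<partial>lborel)"
    unfolding half_mass_def by (rule lborel_preserving_integral(1)[OF lborel_preserving_uminus, symmetric]) measurable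
  also have "\<dots> = (\<integral>x. indicator {x. 0 < x \<bullet> e} x * (v x)\<^sup>2 \<partial>lborel)"
    by (rule integral_cong_AE; (measurable)?) (use even in eventually_elim, simp add: indicator_def)
  also have "\<dots> = lam - half_mass v e 0"
    using unit mass by (subst integral_above_half_mass[OF L2]) auto
  finally show "lam \<le> 2 * half_mass v e t" using half_mass_mono[OF L2 t_nonneg, of e] by simp
qed

end

lemma disc_integral_eq_ball:
  assumes [measurable]: "v \<in> borel_measurable borel"
  shows "disc_integral r v x = (\<integral>w. indicator (ball x r) w * v w \<partial>lborel)"
proof -
  have "(\<integral>w. indicator (ball x r) w * v w \<partial>lborel) = (\<integral>h. indicator (ball x r) (x + h) * v (x + h) \<partial>lborel)"
    by (rule lborel_preserving_integral(1)[OF lborel_preserving_add_left, symmetric]) measurable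
  also have "\<dots> = disc_integral r v x"
    unfolding disc_integral_def by (intro Bochner_Integration.integral_cong) (auto simp: indicator_def dist_norm)
  finally show ?thesis by simp
qed

lemma mirror_exchanging:
  fixes x y :: "'a::real_inner"
  assumes "x \<noteq> y" "norm x \<le> norm y"
  obtains e t where "norm e = 1" "t \<ge> 0" "mirror e t x = y" "\<And>w. norm (w - x) < norm (y - x) / 2 \<Longrightarrow> w \<bullet> e < t"
proof -
  define l where "l = norm (y - x)"
  have l_pos: "l > 0" using assms(1) by (simp add: l_def)
  define e where "e = (1 / l) *\<^sub>R (y - x)"
  define t where "t = ((norm y)\<^sup>2 - (norm x)\<^sup>2) / (2 * l)"
  have unit: "norm e = 1" using l_pos by (simp add: e_def l_def)
  have x_offset: "x \<bullet> e - t = - l / 2"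
  proof -
    have "l\<^sup>2 = (norm y)\<^sup>2 - 2 * (x \<bullet> y) + (norm x)\<^sup>2"
      unfolding l_def power2_norm_eq_inner by (simp add: inner_diff_left inner_diff_right inner_commute)
    moreover have "x \<bullet> e = (x \<bullet> y - (norm x)\<^sup>2) / l"
      by (simp add: e_def inner_diff_right power2_norm_eq_inner)
    ultimately show ?thesis using l_pos by (simp add: t_def field_simps power2_eq_square)
  qed
  show ?thesis
  proof (rule that[OF unit])
    show "t \<ge> 0" using assms(2) l_pos by (simp add: t_def power_mono)
    have "mirror e t x = x + l *\<^sub>R e" unfolding mirror_def x_offset by simp
    then show "mirror e t x = y" using l_pos by (simp add: e_def)
    fix w assume "norm (w - x) < norm (y - x) / 2"
    moreover have "(w - x) \<bullet> e \<le> norm (w - x) * norm e" by (rule norm_cauchy_schwarz)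
    ultimately show "w \<bullet> e < t" using x_offset unit by (simp add: inner_diff_left l_def)
  qed
qed

lemma (in ground_state) disc_integral_decreasing:
  assumes even: "AE x in lborel. v (- x) = v x" and xy: "x \<noteq> y" "norm x \<le> norm y" and r: "r \<le> norm (y - x) / 2"
  shows "disc_integral r v y \<le> disc_integral r v x"
proof -
  note [measurable] = admissibleD(3)[OF adm]
  obtain e t where unit: "norm e = 1" and t_nonneg: "t \<ge> 0" and mirror: "mirror e t x = y"
    and below: "\<And>w. norm (w - x) < norm (y - x) / 2 \<Longrightarrow> w \<bullet> e < t"
    using mirror_exchanging[OF xy] by blast
  note preserving = lborel_preserving_mirror[OF unit, of t]
  have ball: "indicator (ball y r) (mirror e t w) = (indicator (ball x r) w :: real)" for w
    using dist_mirror_mirror[OF unit, of t x w] by (simp add: mirror indicator_def)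
  have int: "integrable lborel (\<lambda>w. indicator (ball z r) w * v w)" for z
    using locally_integrable_scaleR_bounded_supp[OF L2_locally_integrable[OF admissibleD(2)[OF adm]]
        bounded_supp_shift[OF bounded_supp_ball[of r], of "- z"]]
    by (rule Bochner_Integration.integrable_cong[THEN iffD1, rotated 2])
      (auto simp: indicator_def dist_norm norm_minus_commute)
  have "disc_integral r v y = (\<integral>w. indicator (ball x r) w * v (mirror e t w) \<partial>lborel)"
    unfolding disc_integral_eq_ball[OF \<open>v \<in> borel_measurable borel\<close>] ball[symmetric]
    by (rule lborel_preserving_integral(1)[OF preserving, symmetric]) measurable
  also have "\<dots> \<le> (\<integral>w. indicator (ball x r) w * v w \<partial>lborel)"
  proof (rule integral_mono_AE)
    show "integrable lborel (\<lambda>w. indicator (ball x r) w * v (mirror e t w))"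
      using lborel_preserving_integral(2)[OF preserving, of "\<lambda>w. indicator (ball y r) w * v w"] int[of y]
      by (simp add: ball)
    show "integrable lborel (\<lambda>w. indicator (ball x r) w * v w)" by (rule int)
    show "AE w in lborel. indicator (ball x r) w * v (mirror e t w) \<le> indicator (ball x r) w * v w"
      using even_dominates_mirror_image[OF even unit t_nonneg]
    proof eventually_elim
      case (elim w)
      then show ?case using below[of w] r by (auto simp: indicator_def dist_norm norm_minus_commute)
    qed
  qed
  also have "\<dots> = disc_integral r v x" by (simp add: disc_integral_eq_ball)
  finally show ?thesis .
qed

lemma disc_average_AE_subsequence:
  assumes v: "H1 v"
  obtains k where "strict_mono k" "AE x in lborel. (\<lambda>n. disc_average (1 / real (Suc (k n))) v x) \<longlonglongrightarrow> v x"
proof -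
  let ?a = "\<lambda>n. disc_average (1 / real (Suc n)) v"
  have "L2 lborel (?a n)" for n
    using L2_add[OF disc_average_approx(1)[OF v, of "1 / real (Suc n)"] H1_L2[OF v]] by simp
  moreover have "(\<lambda>n. sqnorm lborel (\<lambda>x. ?a n x - v x)) \<longlonglongrightarrow> 0"
  proof (rule tendsto_sandwich[OF _ _ tendsto_const])
    show "\<forall>\<^sub>F n in sequentially. sqnorm lborel (\<lambda>x. ?a n x - v x) \<le> (1 / real (Suc n))\<^sup>2 * rdirichlet v"
      by (intro always_eventually allI disc_average_approx(2)[OF v]) simp
    have "(\<lambda>n. (1 / real (Suc n))\<^sup>2 * rdirichlet v) \<longlonglongrightarrow> 0\<^sup>2 * rdirichlet v"
      by (intro tendsto_intros LIMSEQ_Suc[OF lim_1_over_n])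
    then show "(\<lambda>n. (1 / real (Suc n))\<^sup>2 * rdirichlet v) \<longlonglongrightarrow> 0" by simp
  qed (simp add: sqnorm_nonneg)
  ultimately obtain k where "strict_mono k" "AE x in lborel. (\<lambda>n. ?a (k n) x) \<longlonglongrightarrow> v x"
    using L2_AE_subseq[of lborel ?a v] H1_L2[OF v] by blast
  then show ?thesis by (rule that)
qed

lemma radial_profile_of_decreasing:
  fixes L :: "real^2 \<Rightarrow> ereal"
  assumes nonneg: "\<And>x. 0 \<le> L x" and dec: "\<And>x y. norm x \<le> norm y \<Longrightarrow> L y \<le> L x"
    and finite: "AE x in lborel. L x < \<infinity>"
  obtains g where "\<And>x. x \<noteq> 0 \<Longrightarrow> L x = ereal (g (norm x))" "\<And>s. s > 0 \<Longrightarrow> 0 \<le> g s"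
    "\<And>r s. 0 < r \<Longrightarrow> r \<le> s \<Longrightarrow> g s \<le> g r"
proof -
  define g where "g s = real_of_ereal (L (s *\<^sub>R axis 1 1))" for s
  have g: "L x = ereal (g (norm x))" if "x \<noteq> 0" for x
  proof -
    have "\<exists>y\<in>ball 0 (norm x). L y < \<infinity>"
    proof (rule ccontr)
      assume none: "\<not> ?thesis"
      from finite have "AE y in lborel. y \<notin> ball (0::real^2) (norm x)" by eventually_elim (use none in auto)
      with not_AE_notin_ball[of "norm x" 0] that show False by simp
    qed
    then obtain y where "norm y < norm x" "L y < \<infinity>" by auto
    then have "L x < \<infinity>" using dec[of y x] by (auto intro: le_less_trans)
    have "L (norm x *\<^sub>R axis 1 1) = L x"
      using dec[of x "norm x *\<^sub>R axis 1 1"] dec[of "norm x *\<^sub>R axis 1 1" x] by (intro antisym) auto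
    then show ?thesis using \<open>L x < \<infinity>\<close> nonneg[of x] by (cases "L x") (auto simp: g_def)
  qed
  have axis: "L (s *\<^sub>R axis 1 1) = ereal (g s)" if "s > 0" for s
    using g[of "s *\<^sub>R axis 1 1"] that by simp
  show ?thesis
  proof (rule that[OF g])
    show "0 \<le> g s" if "s > 0" for s using nonneg[of "s *\<^sub>R axis 1 1"] axis[OF that] by simp
    show "g s \<le> g r" if "0 < r" "r \<le> s" for r s
      using dec[of "r *\<^sub>R axis 1 1" "s *\<^sub>R axis 1 1"] axis[of r] axis[of s] that by simp
  qed
qed

lemma (in ground_state) radial_representative:
  assumes even: "AE x in lborel. v (- x) = v x"
  obtains g where "\<And>s. s > 0 \<Longrightarrow> 0 \<le> g s" "\<And>r s. 0 < r \<Longrightarrow> r \<le> s \<Longrightarrow> g s \<le> g r"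
    "AE x in lborel. v x = g (norm x)"
proof -
  obtain k where k: "strict_mono k" and lim: "AE x in lborel. (\<lambda>n. disc_average (1 / real (Suc (k n))) v x) \<longlonglongrightarrow> v x"
    using disc_average_AE_subsequence[OF admissibleD(1)[OF adm]] by blast
  let ?a = "\<lambda>n. disc_average (1 / real (Suc (k n))) v"
  define L where "L x = liminf (\<lambda>n. ereal (?a n x))" for x
  have dec: "L y \<le> L x" if xy: "norm x \<le> norm y" for x y
  proof (cases "x = y")
    case False
    have "\<forall>\<^sub>F n in sequentially. 1 / real (Suc n) < norm (y - x) / 2"
      using order_tendstoD(2)[OF LIMSEQ_Suc[OF lim_1_over_n], of "norm (y - x) / 2"] False by simp
    then have "\<forall>\<^sub>F n in sequentially. 1 / real (Suc (k n)) < norm (y - x) / 2"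
      using filterlim_subseq[OF k] by (rule eventually_compose_filterlim)
    then have "\<forall>\<^sub>F n in sequentially. ereal (?a n y) \<le> ereal (?a n x)"
      by eventually_elim
        (auto simp: disc_average_def intro!: divide_right_mono disc_integral_decreasing[OF even False xy])
    then show ?thesis unfolding L_def by (rule Liminf_mono)
  qed simp
  have "0 \<le> ?a n x" for n x
    unfolding disc_average_def disc_integral_def using admissibleD(4)[OF adm]
    by (intro divide_nonneg_nonneg integral_nonneg_AE AE_I2) auto
  then have nonneg: "0 \<le> L x" for x unfolding L_def by (intro Liminf_bounded always_eventually) simp
  have L: "AE x in lborel. L x = ereal (v x)"
    using lim
  proof eventually_elim
    case (elim x)
    then have "(\<lambda>n. ereal (?a n x)) \<longlonglongrightarrow> ereal (v x)" by simp
    then show ?case unfolding L_def by (rule lim_imp_Liminf[OF sequentially_bot])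
  qed
  then have "AE x in lborel. L x < \<infinity>" by eventually_elim simp
  from radial_profile_of_decreasing[of L, OF nonneg dec this] obtain g
    where g: "\<And>x. x \<noteq> 0 \<Longrightarrow> L x = ereal (g (norm x))" "\<And>s. s > 0 \<Longrightarrow> 0 \<le> g s"
      "\<And>r s. 0 < r \<Longrightarrow> r \<le> s \<Longrightarrow> g s \<le> g r" by blast
  have "AE x in lborel. v x = g (norm x)"
    using L AE_lborel_singleton[of 0] by eventually_elim (simp add: g(1))
  with g show ?thesis by (intro that)
qed

subsection \<open>Boundedness of radial minimisers\<close>

lemma edirichlet_superadditive:
  assumes "L2 lborel a" "L2 lborel b" "L2 lborel v"
    and difference_energies: "\<And>\<epsilon>. difference_energy \<epsilon> a + difference_energy \<epsilon> b \<le> difference_energy \<epsilon> v"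
  shows "edirichlet a + edirichlet b \<le> edirichlet v"
proof (rule LIMSEQ_le[OF tendsto_add edirichlet_tendsto])
  show "\<exists>N. \<forall>n\<ge>N. difference_quotient_energy (1 / real (Suc n)) a + difference_quotient_energy (1 / real (Suc n)) b
      \<le> difference_quotient_energy (1 / real (Suc n)) v"
    unfolding difference_quotient_energy_def
    by (simp add: divide_right_mono_ennreal[OF difference_energies] flip: add_divide_distrib_ennreal)
qed (intro edirichlet_tendsto assms)+

lemma truncation_sq_le:
  "(min a M - min b M)\<^sup>2 + (max 0 (a - M) - max 0 (b - M))\<^sup>2 \<le> (a - b)\<^sup>2" for a b M :: real
proof -
  define p where "p = min a M - min b M"
  define q where "q = max 0 (a - M) - max 0 (b - M)"
  have "a - b = p + q" by (auto simp: p_def q_def min_def max_def)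
  moreover have "0 \<le> p * q"
    by (cases "a \<le> b") (auto simp: p_def q_def min_def max_def intro!: mult_nonneg_nonneg mult_nonpos_nonpos)
  ultimately show ?thesis unfolding p_def[symmetric] q_def[symmetric] by (simp add: power2_eq_square algebra_simps)
qed

lemma difference_energy_truncation_le:
  fixes v :: "'a::euclidean_space \<Rightarrow> real"
  assumes [measurable]: "v \<in> borel_measurable borel"
  shows "difference_energy \<epsilon> (\<lambda>x. min (v x) M) + difference_energy \<epsilon> (\<lambda>x. max 0 (v x - M)) \<le> difference_energy \<epsilon> v"
proof -
  let ?q = "\<lambda>u x h. indicator (ball 0 \<epsilon>) h * ennreal ((norm (u (x + h) - u x :: real))\<^sup>2)"
  let ?a = "\<lambda>x. min (v x) M" and ?w = "\<lambda>x. max 0 (v x - M)"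
  have "difference_energy \<epsilon> ?a + difference_energy \<epsilon> ?w = (\<integral>\<^sup>+x. \<integral>\<^sup>+h. ?q ?a x h + ?q ?w x h \<partial>lborel \<partial>lborel)"
    unfolding difference_energy_def by (simp add: nn_integral_add)
  also have "\<dots> \<le> difference_energy \<epsilon> v"
    unfolding difference_energy_def
  proof (intro nn_integral_mono)
    fix x h
    have "ennreal ((norm (?a (x + h) - ?a x))\<^sup>2) + ennreal ((norm (?w (x + h) - ?w x))\<^sup>2)
        \<le> ennreal ((norm (v (x + h) - v x))\<^sup>2)"
      using truncation_sq_le[of "v (x + h)" M "v x"] by (simp flip: ennreal_plus)
    then show "?q ?a x h + ?q ?w x h \<le> ?q v x h" by (simp add: indicator_def)
  qed
  finally show ?thesis .
qed

lemma admissible_dominated: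
  assumes v: "admissible v" and [measurable]: "u \<in> borel_measurable borel"
    and u: "\<And>x. 0 \<le> u x" "\<And>x. u x \<le> v x" and D: "edirichlet u \<le> edirichlet v"
  shows "admissible u"
proof -
  note [measurable] = admissibleD(3)[OF v]
  have "L2 lborel u"
    using u admissibleD(4)[OF v] by (intro L2_bound[OF admissibleD(2)[OF v]]) auto
  moreover have "integrable lborel (\<lambda>x. ln (1 + norm x) * (u x)\<^sup>2)"
  proof (rule Bochner_Integration.integrable_bound[OF admissibleD(5)[OF v]])
    show "AE x in lborel. norm (ln (1 + norm x) * (u x)\<^sup>2) \<le> norm (ln (1 + norm x) * (v x)\<^sup>2)"
      using power_mono[OF u(2,1)] by (intro AE_I2) (simp add: mult_left_mono)
  qed measurable
  ultimately show ?thesis using u(1) D admissibleD(1)[OF v] by (auto simp: admissible_def H1_def)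
qed

lemma truncation_admissible:
  assumes v: "admissible v" and M_nonneg: "M \<ge> 0"
  shows "admissible (\<lambda>x. min (v x) M)" "admissible (\<lambda>x. max 0 (v x - M))"
    "rdirichlet (\<lambda>x. min (v x) M) + rdirichlet (\<lambda>x. max 0 (v x - M)) \<le> rdirichlet v"
proof -
  note [measurable] = admissibleD(3)[OF v]
  note nonneg = admissibleD(4)[OF v]
  let ?a = "\<lambda>x. min (v x) M" and ?w = "\<lambda>x. max 0 (v x - M)"
  note le = difference_energy_truncation_le[OF admissibleD(3)[OF v], of _ M]
  have "edirichlet ?a \<le> edirichlet v" "edirichlet ?w \<le> edirichlet v"
    by (intro edirichlet_mono[OF admissibleD(2)[OF v]] order_trans[OF _ le]; simp)+
  then show a: "admissible ?a" and w: "admissible ?w"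
    using nonneg M_nonneg by (auto intro!: admissible_dominated[OF v])
  have "edirichlet ?a + edirichlet ?w \<le> edirichlet v"
    by (rule edirichlet_superadditive[OF _ _ _ le]) (intro admissibleD(2) a w v)+
  then show "rdirichlet ?a + rdirichlet ?w \<le> rdirichlet v"
    by (simp add: a w v admissibleD(1) rdirichlet_nonneg flip: ennreal_rdirichlet ennreal_plus)
qed

lemma ln_mult_increment_le:
  fixes r a p b q :: real
  assumes "r \<ge> 0" and a: "0 \<le> a" "a \<le> p" and b: "0 \<le> b" "b \<le> q"
  shows "ln r * (a * b) - ln r * (p * q) \<le> max 0 (ln (1 / r)) * ((p - a) * q + p * (q - b))"
proof -
  have "- ln r \<le> max 0 (ln (1 / r))" using \<open>r \<ge> 0\<close> by (cases "r = 0") (auto simp: ln_div)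
  moreover have "0 \<le> p * q - a * b" using mult_mono[OF a(2) b(2)] a b by simp
  moreover have "p * q - a * b \<le> (p - a) * q + p * (q - b)"
    using mult_nonneg_nonneg[of "p - a" "q - b"] a b by (simp add: algebra_simps)
  ultimately have "- ln r * (p * q - a * b) \<le> max 0 (ln (1 / r)) * ((p - a) * q + p * (q - b))"
    by (intro mult_mono) auto
  then show ?thesis by (simp add: algebra_simps)
qed

lemma square_diff_integrable:
  assumes "admissible a" "admissible v"
  shows "integrable lborel (\<lambda>x. (v x)\<^sup>2 - (a x)\<^sup>2)"
    and "(\<integral>x. (v x)\<^sup>2 - (a x)\<^sup>2 \<partial>lborel) = sqnorm lborel v - sqnorm lborel a"
  using assms[THEN admissibleD(6)] by (simp_all add: sqnorm_def)

lemma interaction_ln_le_if_dominated: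
  assumes v: "admissible v" and a: "admissible a" and dominated: "\<And>x. a x \<le> v x"
  shows "interaction ln a \<le> interaction ln v + 8 * (sqnorm lborel v + rdirichlet v) * (sqnorm lborel v - sqnorm lborel a)"
proof -
  note [measurable] = admissibleD(3)[OF v] admissibleD(3)[OF a]
  define \<sigma> where "\<sigma> = (\<lambda>x. (v x)\<^sup>2 - (a x)\<^sup>2)"
  have [measurable]: "\<sigma> \<in> borel_measurable borel" unfolding \<sigma>_def by measurable
  have square_le: "(a x)\<^sup>2 \<le> (v x)\<^sup>2" for x using dominated admissibleD(4)[OF a] by (intro power_mono)
  define T where "T = (\<lambda>p. max 0 (ln (1 / dist (fst p) (snd p))) * \<sigma> (fst p) * (v (snd p))\<^sup>2)"
  let ?B = "4 * (sqnorm lborel v + rdirichlet v) * (sqnorm lborel v - sqnorm lborel a)"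
  have "integrable lborel \<sigma>" "\<And>x. 0 \<le> \<sigma> x"
    using square_diff_integrable(1)[OF a v] square_le by (auto simp: \<sigma>_def)
  from short_range_mixed_interaction[OF admissibleD(1)[OF v] _ this, of 1]
  have T: "integrable (lborel \<Otimes>\<^sub>M lborel) T" "(\<integral>p. T p \<partial>(lborel \<Otimes>\<^sub>M lborel)) \<le> ?B"
    using square_diff_integrable(2)[OF a v, folded \<sigma>_def] by (simp_all add: T_def)
  have swapped: "integrable (lborel \<Otimes>\<^sub>M lborel) (\<lambda>p. T (snd p, fst p))"
      "(\<integral>p. T (snd p, fst p) \<partial>(lborel \<Otimes>\<^sub>M lborel)) = (\<integral>p. T p \<partial>(lborel \<Otimes>\<^sub>M lborel))"
    using lborel_pair.integrable_product_swap[OF T(1)] lborel_pair.integral_product_swap[of T] T(1)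
    by (auto simp: case_prod_unfold borel_measurable_integrable)
  note int = interaction_density_integrable[OF a log_bounded_ln] interaction_density_integrable[OF v log_bounded_ln]
  have "interaction ln a - interaction ln v
      = (\<integral>p. interaction_density ln a p - interaction_density ln v p \<partial>(lborel \<Otimes>\<^sub>M lborel))"
    unfolding interaction_def by (rule Bochner_Integration.integral_diff[OF int, symmetric])
  also have "\<dots> \<le> (\<integral>p. T p + T (snd p, fst p) \<partial>(lborel \<Otimes>\<^sub>M lborel))"
  proof (rule integral_mono)
    fix p :: "(real^2) \<times> (real^2)"
    show "interaction_density ln a p - interaction_density ln v p \<le> T p + T (snd p, fst p)"
      using ln_mult_increment_le[of "dist (fst p) (snd p)", OF _ _ square_le[of "fst p"] _ square_le[of "snd p"]]
      by (simp add: interaction_density_def T_def \<sigma>_def dist_commute algebra_simps)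
  qed (intro Bochner_Integration.integrable_diff Bochner_Integration.integrable_add int T swapped)+
  also have "\<dots> = 2 * (\<integral>p. T p \<partial>(lborel \<Otimes>\<^sub>M lborel))" using T(1) swapped by simp
  also have "\<dots> \<le> 2 * ?B" using T(2) by (rule mult_left_mono) simp
  finally show ?thesis by (simp add: algebra_simps)
qed

lemma interaction_mono_profile:
  assumes v: "admissible v" and a: "admissible a" and dominated: "\<And>x. a x \<le> v x"
    and \<kappa>: "log_bounded \<kappa>" "\<And>r. r \<ge> 0 \<Longrightarrow> 0 \<le> \<kappa> r"
  shows "interaction \<kappa> a \<le> interaction \<kappa> v"
  unfolding interaction_def
proof (rule integral_mono)
  have square_le: "(a x)\<^sup>2 \<le> (v x)\<^sup>2" for x using dominated admissibleD(4)[OF a] by (intro power_mono)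
  show "interaction_density \<kappa> a p \<le> interaction_density \<kappa> v p" for p
    unfolding interaction_density_def by (intro mult_mono square_le mult_nonneg_nonneg \<kappa>) auto
qed (intro interaction_density_integrable v a \<kappa>)+

lemma renormalisation_factor_bounds:
  fixes \<delta> m :: real
  assumes "m > 0" "0 \<le> \<delta>" "\<delta> \<le> m / 2"
  defines "q \<equiv> m / (m - \<delta>)"
  shows "1 \<le> q" "q \<le> 1 + 2 * \<delta> / m" "q\<^sup>2 \<le> 1 + 6 * \<delta> / m"
proof -
  have pos: "m / 2 \<le> m - \<delta>" "m - \<delta> > 0" using assms(1-3) by (auto simp: field_simps)
  have "q - 1 = \<delta> / (m - \<delta>)" using pos by (simp add: q_def field_simps)
  moreover have "\<dots> \<le> \<delta> / (m / 2)" using pos assms(1,2) by (intro divide_left_mono) auto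
  ultimately show q_le: "q \<le> 1 + 2 * \<delta> / m" by (simp add: mult.commute)
  show "1 \<le> q" using pos assms(2) by (simp add: q_def)
  moreover have "2 * \<delta> / m \<le> 1" using assms(1,3) by (simp add: field_simps)
  with q_le have "q + 1 \<le> 3" by linarith
  ultimately have "(q - 1) * (q + 1) \<le> (2 * \<delta> / m) * 3" using q_le assms(1,2) by (intro mult_mono) auto
  then show "q\<^sup>2 \<le> 1 + 6 * \<delta> / m" by (simp add: power2_eq_square algebra_simps)
qed

context ground_state
begin

lemma profile_energy_le_rescaled:
  assumes a: "admissible a" and pos: "sqnorm lborel a > 0"
  defines "q \<equiv> lam / sqnorm lborel a"
  shows "profile_energy c v \<le> q * rdirichlet a + c * (q\<^sup>2 * interaction ln a)"
proof -
  have q_nonneg: "q \<ge> 0" using pos lam_pos by (simp add: q_def)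
  then have "sqrt q ^ 4 = q\<^sup>2" by (simp add: power4_eq_xxxx power2_eq_square)
  moreover have "sqnorm lborel (\<lambda>x. sqrt q * a x) = lam"
    using sqnorm_scaleR[of lborel "sqrt q" a] q_nonneg pos by (simp add: q_def)
  ultimately show ?thesis
    using min[OF admissible_cmult[OF a, of "sqrt q"]] q_nonneg
    by (simp add: profile_energy_def rdirichlet_cmult[OF admissibleD(3)[OF a]] interaction_cmult)
qed

definition truncation_const :: real where
  "truncation_const = 2 * rdirichlet v / lam
      + c * (8 * (lam + rdirichlet v) + 6 * interaction (\<lambda>r. max 0 (ln r)) v / lam)"

lemma truncation_const_nonneg: "truncation_const \<ge> 0"
  unfolding truncation_const_def using lam_pos c_pos rdirichlet_nonneg[of v] interaction_nonneg[of "\<lambda>r. max 0 (ln r)" v]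
  by (intro add_nonneg_nonneg mult_nonneg_nonneg divide_nonneg_nonneg) auto

lemma rdirichlet_excess_le:
  assumes M_nonneg: "M \<ge> 0"
  defines "\<delta> \<equiv> lam - sqnorm lborel (\<lambda>x. min (v x) M)"
  assumes small: "\<delta> \<le> lam / 2"
  shows "rdirichlet (\<lambda>x. max 0 (v x - M)) \<le> truncation_const * \<delta>"
proof -
  let ?a = "\<lambda>x. min (v x) M" and ?w = "\<lambda>x. max 0 (v x - M)"
  define P where "P = interaction (\<lambda>r. max 0 (ln r)) v"
  note tr = truncation_admissible[OF adm M_nonneg]
  define q where "q = lam / sqnorm lborel ?a"
  have mass_a: "sqnorm lborel ?a = lam - \<delta>" by (simp add: \<delta>_def)
  have "(\<integral>x. (v x)\<^sup>2 - (?a x)\<^sup>2 \<partial>lborel) \<ge> 0"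
    using admissibleD(4)[OF tr(1)] by (intro integral_nonneg_AE AE_I2) (simp add: power_mono)
  then have \<delta>: "\<delta> \<ge> 0" by (simp add: square_diff_integrable[OF tr(1) adm] \<delta>_def mass)
  note q = renormalisation_factor_bounds[OF lam_pos \<delta> small, folded mass_a, folded q_def]
  have dirichlet: "q * rdirichlet ?a \<le> rdirichlet ?a + (2 * \<delta> / lam) * rdirichlet v"
  proof -
    have "(q - 1) * rdirichlet ?a \<le> (2 * \<delta> / lam) * rdirichlet v"
      using q tr(3) rdirichlet_nonneg[of ?w] rdirichlet_nonneg[of ?a] \<delta> lam_pos by (intro mult_mono) auto
    then show ?thesis by (simp add: algebra_simps)
  qed
  have interaction: "q\<^sup>2 * interaction ln ?a \<le> interaction ln v + (8 * (lam + rdirichlet v) * \<delta> + (6 * \<delta> / lam) * P)"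
  proof -
    have "interaction ln ?a \<le> interaction (\<lambda>r. max 0 (ln r)) ?a"
      by (intro interaction_mono[OF tr(1)] log_bounded_intros) auto
    also have "\<dots> \<le> P" unfolding P_def by (intro interaction_mono_profile[OF adm tr(1)] log_bounded_intros) auto
    finally have "(q\<^sup>2 - 1) * interaction ln ?a \<le> (q\<^sup>2 - 1) * P" using q(1) by (intro mult_left_mono) auto
    also have "\<dots> \<le> (6 * \<delta> / lam) * P"
      using q(3) interaction_nonneg[of "\<lambda>r. max 0 (ln r)" v] by (intro mult_right_mono) (auto simp: P_def)
    finally have "q\<^sup>2 * interaction ln ?a \<le> interaction ln ?a + (6 * \<delta> / lam) * P" by (simp add: algebra_simps)
    then show ?thesis using interaction_ln_le_if_dominated[OF adm tr(1)] by (simp add: mass \<delta>_def)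
  qed
  have "sqnorm lborel ?a > 0" using small lam_pos by (simp add: mass_a field_simps)
  from profile_energy_le_rescaled[OF tr(1) this, folded q_def] dirichlet tr(3)
    mult_left_mono[OF interaction less_imp_le[OF c_pos]]
  have "rdirichlet ?w \<le> (2 * \<delta> / lam) * rdirichlet v + c * (8 * (lam + rdirichlet v) * \<delta> + (6 * \<delta> / lam) * P)"
    by (simp add: profile_energy_def distrib_left)
  also have "\<dots> = truncation_const * \<delta>" by (simp add: truncation_const_def P_def algebra_simps)
  finally show ?thesis .
qed

end

text \<open>A translate by the diameter of the support is orthogonal to the function.\<close>
lemma Poincare_ball:
  assumes w: "H1 w" and R: "R > 0" and supp: "AE x in lborel. R \<le> norm x \<longrightarrow> w x = 0"
  shows "sqnorm lborel w \<le> 2 * R\<^sup>2 * rdirichlet w"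
proof -
  note L = H1_L2[OF w]
  let ?h = "(2 * R) *\<^sub>R axis 1 1 :: real^2"
  have norm_h: "norm ?h = 2 * R" using R by simp
  have "AE x in lborel. w (x + ?h) \<bullet> w x = 0"
    using supp lborel_preserving_AE[OF lborel_preserving_add supp, of ?h]
  proof eventually_elim
    case (elim x)
    have "R \<le> norm (x + ?h) \<or> R \<le> norm x" using norm_triangle_ineq4[of "x + ?h" x] norm_h by auto
    then show ?case using elim by auto
  qed
  then have "(\<integral>x. w (x + ?h) \<bullet> w x \<partial>lborel) = 0" by (rule integral_eq_zero_AE)
  then have "2 * sqnorm lborel w = sqnorm lborel (\<lambda>x. w (x + ?h) - w x)"
    using sqnorm_diff[OF L2_shift[OF L] L, of ?h] sqnorm_shift[of w ?h] L by (simp add: L2_def)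
  also have "\<dots> \<le> (norm ?h)\<^sup>2 * rdirichlet w" by (rule sqnorm_increment_le_rdirichlet[OF w])
  finally show ?thesis unfolding norm_h by (simp add: power2_eq_square)
qed

lemma norm_ge_if_ge_on_ball:
  fixes w :: "real^2 \<Rightarrow> real"
  assumes w: "L2 lborel w" and "r \<ge> 0" "k \<ge> 0" and ge: "AE x in lborel. norm x < r \<longrightarrow> k \<le> w x"
  shows "sqrt pi * r * k \<le> sqrt (sqnorm lborel w)"
proof -
  let ?i = "\<lambda>x::real^2. k *\<^sub>R indicator (ball 0 r) x :: real"
  have "sqnorm lborel ?i \<le> sqnorm lborel w"
    unfolding sqnorm_def
  proof (rule integral_mono_AE)
    show "integrable lborel (\<lambda>x. (norm (?i x))\<^sup>2)"
      by (intro L2_integrable L2_scaleR bounded_supp_L2 bounded_supp_ball)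
    show "AE x in lborel. (norm (?i x))\<^sup>2 \<le> (norm (w x))\<^sup>2"
      using ge by eventually_elim (use \<open>k \<ge> 0\<close> in \<open>auto simp: indicator_def intro!: power_mono\<close>)
  qed (rule L2_integrable[OF w])
  then have "sqrt (k\<^sup>2 * (pi * r\<^sup>2)) \<le> sqrt (sqnorm lborel w)"
    using sqnorm_scaleR[of lborel k "indicator (ball 0 r) :: real^2 \<Rightarrow> real"] \<open>r \<ge> 0\<close>
    by (simp add: sqnorm_indicator_ball)
  then show ?thesis using assms(2,3) by (simp add: real_sqrt_mult mult_ac)
qed

context ground_state
begin

lemma truncation_mass_defect:
  assumes M_nonneg: "M \<ge> 0" and supp: "AE x in lborel. R \<le> norm x \<longrightarrow> v x \<le> M"
  defines "w \<equiv> \<lambda>x. max 0 (v x - M)"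
  shows "lam - sqnorm lborel (\<lambda>x. min (v x) M) = sqnorm lborel w + 2 * M * disc_integral R w 0"
proof -
  note [measurable] = admissibleD(3)[OF adm]
  note tr = truncation_admissible[OF adm M_nonneg]
  have w: "admissible w" unfolding w_def by (rule tr)
  let ?i = "indicator (ball 0 R) :: real^2 \<Rightarrow> real"
  have excess_integrable: "integrable lborel (\<lambda>x. ?i x * w x)"
    using L2_inner_integrable[OF bounded_supp_L2[OF bounded_supp_ball] admissibleD(2)[OF w]] by simp
  have "lam - sqnorm lborel (\<lambda>x. min (v x) M) = (\<integral>x. (v x)\<^sup>2 - (min (v x) M)\<^sup>2 \<partial>lborel)"
    by (simp add: square_diff_integrable[OF tr(1) adm] mass)
  also have "\<dots> = (\<integral>x. (w x)\<^sup>2 + 2 * M * (?i x * w x) \<partial>lborel)"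
  proof (rule integral_cong_AE)
    show "AE x in lborel. (v x)\<^sup>2 - (min (v x) M)\<^sup>2 = (w x)\<^sup>2 + 2 * M * (?i x * w x)"
      using supp by eventually_elim
        (auto simp: w_def indicator_def min_def max_def power2_eq_square algebra_simps not_less)
  qed (unfold w_def, measurable)
  also have "\<dots> = sqnorm lborel w + 2 * M * disc_integral R w 0"
    using admissibleD(6)[OF w] excess_integrable by (simp add: sqnorm_def disc_integral_def)
  finally show ?thesis .
qed

lemma truncation_mass_defect_le:
  assumes M_nonneg: "M \<ge> 0" and "R > 0" and supp: "AE x in lborel. R \<le> norm x \<longrightarrow> v x \<le> M"
  shows "lam - sqnorm lborel (\<lambda>x. min (v x) M) \<le> 2 * R * (lam + rdirichlet v)"
proof -
  note tr = truncation_admissible(1)[OF adm M_nonneg]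
  let ?b = "\<lambda>x. indicator (ball 0 R) x * (v x)\<^sup>2"
  have ball_integrable: "integrable lborel ?b" by (intro indicator_square_integrable admissibleD(2)[OF adm]) simp
  have "lam - sqnorm lborel (\<lambda>x. min (v x) M) = (\<integral>x. (v x)\<^sup>2 - (min (v x) M)\<^sup>2 \<partial>lborel)"
    by (simp add: square_diff_integrable[OF tr adm] mass)
  also have "\<dots> \<le> (\<integral>x. ?b x \<partial>lborel)"
  proof (rule integral_mono_AE[OF square_diff_integrable(1)[OF tr adm] ball_integrable])
    show "AE x in lborel. (v x)\<^sup>2 - (min (v x) M)\<^sup>2 \<le> ?b x"
      using supp by eventually_elim (auto simp: indicator_def min_def)
  qed
  also have "\<dots> \<le> 2 * R * (lam + rdirichlet v)"
  proof -
    have "ennreal (\<integral>x. ?b x \<partial>lborel) = (\<integral>\<^sup>+x. indicator (ball 0 R) x * ennreal ((v x)\<^sup>2) \<partial>lborel)"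
      using nn_integral_eq_integral[OF ball_integrable] by (simp add: ennreal_mult' ennreal_indicator)
    also have "\<dots> \<le> ennreal (2 * R * (lam + rdirichlet v))"
      using ball_mass_le[OF admissibleD(1)[OF adm] \<open>R > 0\<close>] by (simp add: mass)
    finally show ?thesis
      using \<open>R > 0\<close> lam_pos rdirichlet_nonneg[of v] by (subst (asm) ennreal_le_iff) auto
  qed
  finally show ?thesis .
qed

lemma excess_norm_le:
  assumes M_nonneg: "M \<ge> 0" and supp: "AE x in lborel. R \<le> norm x \<longrightarrow> v x \<le> M"
    and R: "R > 0" "4 * R\<^sup>2 * truncation_const \<le> 1" "4 * R * (lam + rdirichlet v) \<le> lam"
  shows "sqrt (sqnorm lborel (\<lambda>x. max 0 (v x - M))) \<le> 8 * truncation_const * M * sqrt pi * R ^ 3"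
proof -
  let ?K = truncation_const and ?w = "\<lambda>x. max 0 (v x - M)"
  note w = truncation_admissible(2)[OF adm M_nonneg]
  define n where "n = sqrt (sqnorm lborel ?w)"
  have n: "n \<ge> 0" "n\<^sup>2 = sqnorm lborel ?w" using sqnorm_nonneg[of lborel ?w] by (auto simp: n_def)
  define \<delta> where "\<delta> = lam - sqnorm lborel (\<lambda>x. min (v x) M)"
  have "AE x in lborel. R \<le> norm x \<longrightarrow> ?w x = 0" using supp by eventually_elim auto
  from Poincare_ball[OF admissibleD(1)[OF w] R(1) this] have "n\<^sup>2 \<le> 2 * R\<^sup>2 * rdirichlet ?w" by (simp add: n)
  also have "\<dots> \<le> 2 * R\<^sup>2 * (?K * \<delta>)"
  proof (intro mult_left_mono)
    have "\<delta> \<le> lam / 2"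
      using truncation_mass_defect_le[OF M_nonneg R(1) supp] R(3) by (simp add: \<delta>_def algebra_simps)
    then show "rdirichlet ?w \<le> ?K * \<delta>" unfolding \<delta>_def by (rule rdirichlet_excess_le[OF M_nonneg])
  qed simp
  also have "\<dots> \<le> 2 * R\<^sup>2 * (?K * (n\<^sup>2 + 2 * M * (sqrt pi * R * n)))"
  proof (intro mult_left_mono)
    have "disc_integral R ?w 0 \<le> sqrt pi * R * n"
      using disc_integral_bound[OF admissibleD(2)[OF w], of R 0] R(1) by (simp add: n_def)
    then show "\<delta> \<le> n\<^sup>2 + 2 * M * (sqrt pi * R * n)"
      using M_nonneg by (simp add: \<delta>_def truncation_mass_defect[OF M_nonneg supp] n mult_left_mono)
  qed (simp_all add: truncation_const_nonneg)
  also have "\<dots> = (4 * R\<^sup>2 * ?K) * (n\<^sup>2 / 2) + 4 * ?K * M * sqrt pi * R ^ 3 * n"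
    by (simp add: algebra_simps power3_eq_cube power2_eq_square)
  also have "(4 * R\<^sup>2 * ?K) * (n\<^sup>2 / 2) \<le> 1 * (n\<^sup>2 / 2)" using R(2) by (intro mult_right_mono) auto
  finally have "n * n \<le> 8 * ?K * M * sqrt pi * R ^ 3 * n" by (simp add: power2_eq_square)
  then have "n \<le> 8 * ?K * M * sqrt pi * R ^ 3"
    using n(1) truncation_const_nonneg M_nonneg R(1) by (cases "n = 0") auto
  then show ?thesis by (simp add: n_def)
qed

lemma excess_on_half_ball_le:
  assumes M_nonneg: "M \<ge> 0" and supp: "AE x in lborel. R \<le> norm x \<longrightarrow> v x \<le> M"
    and k: "k \<ge> 0" "AE x in lborel. norm x < R / 2 \<longrightarrow> M + k \<le> v x"
    and R: "R > 0" "4 * R\<^sup>2 * truncation_const \<le> 1" "4 * R * (lam + rdirichlet v) \<le> lam"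
  shows "k \<le> 16 * truncation_const * R\<^sup>2 * M"
proof -
  have "AE x in lborel. norm x < R / 2 \<longrightarrow> k \<le> max 0 (v x - M)"
    using k(2) by eventually_elim auto
  then have "sqrt pi * (R / 2) * k \<le> sqrt (sqnorm lborel (\<lambda>x. max 0 (v x - M)))"
    using R(1) k(1) by (intro norm_ge_if_ge_on_ball admissibleD(2)[OF truncation_admissible(2)[OF adm M_nonneg]]) auto
  also have "\<dots> \<le> 8 * truncation_const * M * sqrt pi * R ^ 3" by (rule excess_norm_le[OF M_nonneg supp R])
  finally have "(sqrt pi * (R / 2)) * k \<le> (sqrt pi * (R / 2)) * (16 * truncation_const * R\<^sup>2 * M)"
    by (simp add: power3_eq_cube power2_eq_square mult_ac)
  then show ?thesis using R(1) by (subst (asm) mult_le_cancel_left_pos) auto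
qed

end

lemma bounded_if_halving_growth:
  fixes g :: "real \<Rightarrow> real"
  assumes g: "\<And>s. s > 0 \<Longrightarrow> 0 \<le> g s" "\<And>r s. 0 < r \<Longrightarrow> r \<le> s \<Longrightarrow> g s \<le> g r"
    and "R > 0" "C \<ge> 0" and step: "\<And>r. 0 < r \<Longrightarrow> r \<le> R \<Longrightarrow> g (r / 2) \<le> (1 + C * r\<^sup>2) * g r"
  obtains B where "\<And>s. s > 0 \<Longrightarrow> g s \<le> B"
proof -
  define K where "K = C * R\<^sup>2"
  have K_nonneg: "K \<ge> 0" using \<open>C \<ge> 0\<close> by (simp add: K_def)
  have iterated: "g (R / 2 ^ n) \<le> exp (K * (2 - 2 * (1/2) ^ n)) * g R" for n
  proof (induction n)
    case (Suc n)
    let ?r = "R / 2 ^ n"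
    have r: "0 < ?r" "?r \<le> R" using \<open>R > 0\<close> by (auto simp: field_simps)
    have "C * ?r\<^sup>2 = K * ((1/2) ^ n * (1/2) ^ n)" by (simp add: K_def power2_eq_square power_divide)
    also have "\<dots> \<le> K * (1/2) ^ n" using K_nonneg by (intro mult_left_mono mult_left_le) (auto intro: power_le_one)
    finally have factor: "1 + C * ?r\<^sup>2 \<le> exp (K * (1/2) ^ n)"
      using exp_ge_add_one_self[of "K * (1/2) ^ n"] by linarith
    have "g (R / 2 ^ Suc n) \<le> (1 + C * ?r\<^sup>2) * g ?r" using step[OF r] by (simp add: mult.commute)
    also have "\<dots> \<le> exp (K * (1/2) ^ n) * (exp (K * (2 - 2 * (1/2) ^ n)) * g R)"
      using g(1)[OF r(1)] by (intro mult_mono[OF factor Suc.IH]) auto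
    also have "\<dots> = exp (K * (1/2) ^ n + K * (2 - 2 * (1/2) ^ n)) * g R" by (simp add: exp_add)
    also have "K * (1/2) ^ n + K * (2 - 2 * (1/2) ^ n) = K * (2 - 2 * (1/2) ^ Suc n)" by (simp add: algebra_simps)
    finally show ?case .
  qed simp
  show ?thesis
  proof (rule that)
    fix s :: real assume s: "s > 0"
    obtain n :: nat where "R / s < 2 ^ n" using real_arch_pow[of 2 "R / s"] by auto
    then have "g s \<le> g (R / 2 ^ n)" using g(2)[of "R / 2 ^ n" s] s \<open>R > 0\<close> by (simp add: field_simps)
    also have "\<dots> \<le> exp (K * (2 - 2 * (1/2) ^ n)) * g R" by (rule iterated)
    also have "\<dots> \<le> exp (K * 2) * g R"
      using K_nonneg g(1)[OF \<open>R > 0\<close>] by (intro mult_right_mono) (auto intro!: mult_left_mono)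
    finally show "g s \<le> exp (K * 2) * g R" .
  qed
qed

lemma (in ground_state) radial_bounded:
  assumes g: "\<And>s. s > 0 \<Longrightarrow> 0 \<le> g s" "\<And>r s. 0 < r \<Longrightarrow> r \<le> s \<Longrightarrow> g s \<le> g r"
    and radial: "AE x in lborel. v x = g (norm x)"
  obtains B where "\<And>s. s > 0 \<Longrightarrow> g s \<le> B"
proof -
  let ?K = truncation_const and ?D = "lam + rdirichlet v"
  define R where "R = min 1 (min (1 / (4 * ?K + 1)) (lam / (4 * ?D)))"
  note K = truncation_const_nonneg
  have D_pos: "?D > 0" using lam_pos rdirichlet_nonneg[of v] by simp
  have R: "R > 0" using K lam_pos D_pos by (simp add: R_def)
  have growth: "g (r / 2) \<le> (1 + 16 * ?K * r\<^sup>2) * g r" if r: "0 < r" "r \<le> R" for r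
  proof -
    have bounds: "r \<le> 1" "r * (4 * ?K + 1) \<le> 1" "r * (4 * ?D) \<le> lam"
      using r K D_pos by (auto simp: R_def pos_le_divide_eq)
    have "r\<^sup>2 * (4 * ?K) \<le> r * (4 * ?K)"
      using r bounds(1) K by (intro mult_right_mono) (auto simp: power2_eq_square mult_left_le)
    then have "4 * r\<^sup>2 * ?K \<le> 1" using bounds(2) r(1) by (simp add: algebra_simps)
    moreover have "AE x in lborel. r \<le> norm x \<longrightarrow> v x \<le> g r"
      using radial by eventually_elim (use g(2)[OF r(1)] in auto)
    moreover have "AE x in lborel. norm x < r / 2 \<longrightarrow> g r + (g (r / 2) - g r) \<le> v x"
      using radial AE_lborel_singleton[of 0] by eventually_elim (auto intro: g(2))
    ultimately have "g (r / 2) - g r \<le> 16 * ?K * r\<^sup>2 * g r"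
      using g(1)[OF r(1)] g(2)[of "r / 2" r] r(1) bounds(3) by (intro excess_on_half_ball_le) (auto simp: mult_ac)
    then show ?thesis by (simp add: algebra_simps)
  qed
  show ?thesis by (rule bounded_if_halving_growth[OF g R _ growth that]) (simp_all add: K)
qed

lemma (in ground_state) ground_state_cong_AE:
  assumes w [measurable]: "w \<in> borel_measurable borel" and nonneg: "\<And>x. 0 \<le> w x" and AE_eq: "AE x in lborel. w x = v x"
  shows "ground_state c lam w"
proof -
  note [measurable] = admissibleD(3)[OF adm]
  note edirichlet = edirichlet_cong_AE[OF AE_eq]
  have "L2 lborel w" using AE_eq by (intro L2_bound[OF admissibleD(2)[OF adm]]) auto
  moreover have "integrable lborel (\<lambda>x. ln (1 + norm x) * (w x)\<^sup>2)"
    by (rule integrable_cong_AE[THEN iffD1, OF _ _ _ admissibleD(5)[OF adm]]) (use AE_eq in auto)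
  ultimately have "admissible w"
    using admissibleD(1)[OF adm] nonneg by (simp add: admissible_def H1_def edirichlet)
  moreover have "sqnorm lborel w = lam" using sqnorm_cong_AE[of w lborel v] AE_eq by (simp add: mass)
  moreover have "interaction ln w = interaction ln v"
    unfolding interaction_def interaction_density_def
    by (rule integral_cong_AE; (measurable)?) (use AE_lborel_pair[OF AE_eq] in eventually_elim, simp)
  then have "profile_energy c w = profile_energy c v" by (simp add: profile_energy_def rdirichlet_def edirichlet)
  ultimately show ?thesis using c_pos lam_pos min by unfold_locales auto
qed

theorem radial_ground_state_exists:
  assumes c_pos: "c > 0" and lam_pos: "lam > 0"
  obtains f where "antimono f" "ground_state c lam (\<lambda>x. f (norm x))"
proof -
  obtain v where "admissible v" "sqnorm lborel v = lam"
    "\<And>w. admissible w \<Longrightarrow> sqnorm lborel w = lam \<Longrightarrow> profile_energy c v \<le> profile_energy c w"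
    using minimiser_exists[OF c_pos lam_pos] by blast
  with c_pos lam_pos have v: "ground_state c lam v" by unfold_locales auto
  obtain p where "AE x in lborel. v (p - x) = v (p + x)" using ground_state.symmetric_about_point[OF v] by blast
  then have even: "AE x in lborel. v (- x + p) = v (x + p)" by (simp add: add.commute)
  interpret centred: ground_state c lam "\<lambda>x. v (x + p)" by (rule ground_state.ground_state_shift[OF v])
  obtain g where g: "\<And>s. s > 0 \<Longrightarrow> 0 \<le> g s" "\<And>r s. 0 < r \<Longrightarrow> r \<le> s \<Longrightarrow> g s \<le> g r"
    and vg: "AE x in lborel. v (x + p) = g (norm x)"
    using centred.radial_representative[OF even] by blast
  obtain B where B: "\<And>s. s > 0 \<Longrightarrow> g s \<le> B" using centred.radial_bounded[OF g vg] by blast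
  define f where "f s = (if s > 0 then g s else max 0 B)" for s
  have "f s \<le> f r" if "r \<le> s" for r s
    using that g(2)[of r s] B[of s] by (auto simp: f_def le_max_iff_disj)
  then have antimono: "antimono f" by (rule antimonoI)
  then have "(\<lambda>s. - f s) \<in> borel_measurable borel" by (intro borel_measurable_mono) (auto simp: mono_def antimono_def)
  from borel_measurable_uminus[OF this] have [measurable]: "f \<in> borel_measurable borel" by simp
  have "ground_state c lam (\<lambda>x. f (norm x))"
  proof (rule centred.ground_state_cong_AE)
    show "AE x in lborel. f (norm x) = v (x + p)"
      using vg AE_lborel_singleton[of 0] by eventually_elim (simp add: f_def)
    show "0 \<le> f (norm x)" for x using g(1) by (simp add: f_def)
  qed measurable
  with antimono show ?thesis by (rule that)
qed

lemma energy_of_real: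
  assumes v: "admissible v" and pos: "sqnorm lborel v > 0"
  shows "energy \<gamma> (\<lambda>x. complex_of_real (v x)) = profile_energy (\<gamma> / (4 * pi)) v"
  using energy_eq[of "\<lambda>x. complex_of_real (v x)" \<gamma>] v
  by (simp add: admissibleD(4) profile_energy_def rdirichlet_eq_dirichlet[OF admissibleD(1)[OF v] pos])

lemma profile_energy_cmod_le:
  assumes u: "u \<in> X_space" and pos: "mass u > 0"
  shows "profile_energy (\<gamma> / (4 * pi)) (\<lambda>x. cmod (u x)) \<le> energy \<gamma> u"
  using cmod_admissible(3)[OF u pos] by (simp add: profile_energy_def energy_eq[OF cmod_admissible(1)[OF u]])

lemma ground_state_energy_eq_e0:
  assumes "ground_state (\<gamma> / (4 * pi)) lam v"
  shows "ereal (energy \<gamma> (\<lambda>x. complex_of_real (v x))) = e0 \<gamma> lam"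
proof -
  interpret ground_state "\<gamma> / (4 * pi)" lam v by fact
  let ?u = "\<lambda>x. complex_of_real (v x)"
  have energy: "energy \<gamma> ?u = profile_energy (\<gamma> / (4 * pi)) v" by (rule energy_of_real[OF adm]) (simp add: mass lam_pos)
  have u: "?u \<in> X_space" "mass ?u = lam"
    using admissible_in_X_space[OF adm] mass by (simp_all add: mass_def sqnorm_def)
  show ?thesis
    unfolding e0_def
  proof (rule antisym)
    show "ereal (energy \<gamma> ?u) \<le> (INF u\<in>{u \<in> X_space. mass u = lam}. ereal (energy \<gamma> u))"
    proof (rule INF_greatest)
      fix w assume "w \<in> {u \<in> X_space. mass u = lam}"
      then have w: "w \<in> X_space" "mass w = lam" by auto
      have "energy \<gamma> ?u \<le> profile_energy (\<gamma> / (4 * pi)) (\<lambda>x. cmod (w x))"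
        unfolding energy by (rule min) (simp_all add: cmod_admissible[OF w(1)] w(2))
      also have "\<dots> \<le> energy \<gamma> w" using w lam_pos by (intro profile_energy_cmod_le) auto
      finally show "ereal (energy \<gamma> ?u) \<le> ereal (energy \<gamma> w)" by simp
    qed
    show "(INF u\<in>{u \<in> X_space. mass u = lam}. ereal (energy \<gamma> u)) \<le> ereal (energy \<gamma> ?u)"
      by (rule INF_lower) (use u in auto)
  qed
qed

theorem theorem3p1:
  fixes \<gamma> lam :: real
  assumes "\<gamma> > 0" and "lam > 0"
  shows "\<exists>u \<in> X_space. sym_decreasing u \<and> mass u = lam \<and> ereal (energy \<gamma> u) = e0 \<gamma> lam"
proof -
  have "\<gamma> / (4 * pi) > 0" using assms(1) by simp
  then obtain f where f: "antimono f" and ground: "ground_state (\<gamma> / (4 * pi)) lam (\<lambda>x. f (norm x))"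
    using radial_ground_state_exists assms(2) by blast
  let ?u = "\<lambda>x. complex_of_real (f (norm x))"
  have "?u \<in> X_space" using admissible_in_X_space ground_state.adm[OF ground] by blast
  moreover have "mass ?u = lam" using ground_state.mass[OF ground] by (simp add: mass_def sqnorm_def)
  moreover have "sym_decreasing ?u" unfolding sym_decreasing_def using f by (auto simp: antimono_def)
  moreover have "ereal (energy \<gamma> ?u) = e0 \<gamma> lam" by (rule ground_state_energy_eq_e0[OF ground])
  ultimately show ?thesis by blast
qed

end
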